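(* Let $2<p<N$. Then the Dirichlet eigenvalue problem $$-(x_1x_2)^{-p}\,\mathrm{div}_{\mathbb{M}}\big(|\nabla_{\mathbb{M}}u|^{p-2}\nabla_{\mathbb{M}}u\big)=\lambda|u|^{p-2}u\ \text{ in } \mathrm{int}\,\mathbb{M},\qquad u=0\ \text{ on } \partial\mathbb{M},$$ possesses a sequence of infinitely many non-trivial weak solutions $(u_k,\lambda_k)\in E\times\mathbb{R}_+$. That is, $u_k\ne0$ and for every $\varphi\in C_0^\infty(\mathrm{int}\,\mathbb{M})$ $$\int_{\mathbb{M}}x_1|\nabla_{\mathbb{M}}u_k|^{p-2}\nabla_{\mathbb{M}}u_k\cdot\nabla_{\mathbb{M}}\varphi\,d\sigma=\lambda_k\int_{\mathbb{M}}x_1(x_1x_2)^p|u_k|^{p-2}u_k\,\varphi\,d\sigma .$$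
   Context: Setting. $n\ge 1$ is an integer, $N=n+2$, $\delta>0$ is a fixed small constant, $X$ is a bounded open set with coordinates $x'=(x_1',\dots,x_n')$, and $\mathbb{M}=(0,\delta)\times(0,\delta)\times X$ with points $(x_1,x_2,x')$ and boundary part $\partial\mathbb{M}=\{0\}\times\{0\}\times X$. Put $\nabla_{\mathbb{M}}=(x_1\partial_{x_1},\,x_1x_2\partial_{x_2},\,\partial_{x_1'},\dots,\partial_{x_n'})$, $\mathrm{div}_{\mathbb{M}}=\nabla_{\mathbb{M}}\cdot$, $d\sigma=\frac{dx_1}{x_1}\frac{dx_2}{x_1x_2}dx'$, and $\mathbb{R}_+=(0,\infty)$. All functions are real-valued. Weighted spaces. For $1\le p<\infty$ and $\gamma_1,\gamma_2\in\mathbb{R}$, $L_p^{\gamma_1,\gamma_2}(\mathbb{M})$ has norm $\|u\|_{L_p^{\gamma_1,\gamma_2}(\mathbb{M})}=\big(\int_{\mathbb{M}}|x_1^{\frac Np-\gamma_1}x_2^{\frac Np-\gamma_2}u|^p\,d\sigma\big)^{1/p}$. $\mathcal{H}_p^{1,(\gamma_1,\gamma_2)}(\mathbb{M})$ is the space of $u\in W^{1,p}_{\mathrm{loc}}(\mathrm{int}\,\mathbb{M})$ such that $u$ and all components of $\nabla_{\mathbb{M}}u$ lie in $L_p^{\gamma_1,\gamma_2}(\mathbb{M})$, with the natural norm, and $\mathcal{H}_{p,0}^{1,(\gamma_1,\gamma_2)}(\mathbb{M})$ is the closure of $C_0^\infty(\mathrm{int}\,\mathbb{M})$ in it. Write $E=\mathcal{H}_{p,0}^{1,(\frac{N-1}{p},\frac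 Np)}(\mathbb{M})$. The Dirichlet boundary condition is encoded in $u\in E$. *)

theory Defs
  imports "HOL-Analysis.Analysis"
begin

section \<open>Test functions and weak gradients on an open set\<close>

text \<open>All partial derivatives of order at most \<open>k\<close> exist and are continuous on the whole space
  (total differentiability at each stage is automatic when the next-order partials are continuous).\<close>

fun Ck :: "nat \<Rightarrow> ('a::euclidean_space \<Rightarrow> real) \<Rightarrow> bool" where
  "Ck 0 f \<longleftrightarrow> continuous_on UNIV f"
| "Ck (Suc k) f \<longleftrightarrow>
     (\<forall>x. f differentiable (at x)) \<and> (\<forall>i\<in>Basis. Ck k (\<lambda>x. frechet_derivative f (at x) i))"

definition test_functions :: "'a::euclidean_space set \<Rightarrow> ('a \<Rightarrow> real) set" where
  "test_functions U =
     {\<phi>. (\<forall>k. Ck k \<phi>) \<and> compact (closure {x. \<phi> x \<noteq> 0}) \<and> closure {x. \<phi> x \<noteq> 0} \<subseteq> U}"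

definition classical_gradient :: "('a::euclidean_space \<Rightarrow> real) \<Rightarrow> 'a \<Rightarrow> 'a" where
  "classical_gradient f x = (\<Sum>i\<in>Basis. frechet_derivative f (at x) i *\<^sub>R i)"

definition Lp_loc :: "'a::euclidean_space set \<Rightarrow> real \<Rightarrow> ('a \<Rightarrow> 'b::euclidean_space) set" where
  "Lp_loc U p = {f. f \<in> borel_measurable (lebesgue_on U) \<and>
     (\<forall>K. compact K \<longrightarrow> K \<subseteq> U \<longrightarrow> integrable (lebesgue_on K) (\<lambda>x. norm (f x) powr p))}"

definition is_weak_gradient ::
  "'a::euclidean_space set \<Rightarrow> ('a \<Rightarrow> real) \<Rightarrow> ('a \<Rightarrow> 'a) \<Rightarrow> bool" where
  "is_weak_gradient U u g \<longleftrightarrow> u \<in> Lp_loc U 1 \<and> g \<in> Lp_loc U 1 \<and>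
     (\<forall>\<phi>\<in>test_functions U. \<forall>i\<in>Basis.
        (\<integral>x. u x * frechet_derivative \<phi> (at x) i \<partial>lebesgue_on U) =
        - (\<integral>x. (g x \<bullet> i) * \<phi> x \<partial>lebesgue_on U))"

text \<open>A weak gradient is unique up to null sets, so the choice of representative is immaterial.
  The value is meaningful only for functions that possess a weak gradient on \<open>U\<close>.\<close>

definition weak_gradient :: "'a::euclidean_space set \<Rightarrow> ('a \<Rightarrow> real) \<Rightarrow> 'a \<Rightarrow> 'a" where
  "weak_gradient U u = (SOME g. is_weak_gradient U u g)"

definition W1p_loc :: "'a::euclidean_space set \<Rightarrow> real \<Rightarrow> ('a \<Rightarrow> real) set" where
  "W1p_loc U p = {u. u \<in> Lp_loc U p \<and> (\<exists>g. is_weak_gradient U u g \<and> g \<in> Lp_loc U p)}"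


section \<open>The stretched corner manifold and its weighted Sobolev spaces\<close>

text \<open>Points are triples \<open>(x1, x2, x')\<close>; the number \<open>n\<close> is \<open>CARD('n)\<close> and \<open>N = n + 2\<close>.
  For open \<open>X\<close> the set below is open, hence equal to its own interior: the boundary part
  \<open>{0} \<times> {0} \<times> X\<close> does not belong to it.  Elements of the function spaces are represented by
  total functions, of which only the values on this set, up to null sets, matter.\<close>

type_synonym 'n pt = "real \<times> real \<times> (real ^ 'n)"

definition MM :: "real \<Rightarrow> (real ^ 'n) set \<Rightarrow> 'n::finite pt set" where
  "MM \<delta> X = {0<..<\<delta>} \<times> {0<..<\<delta>} \<times> X"

definition dimN :: "(real ^ 'n::finite) set \<Rightarrow> real" where
  "dimN X = real CARD('n) + 2"

definition sigma_M :: "real \<Rightarrow> (real ^ 'n) set \<Rightarrow> 'n::finite pt measure" where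
  "sigma_M \<delta> X =
     density (lebesgue_on (MM \<delta> X)) (\<lambda>(x1, x2, x'). ennreal (1 / x1 * (1 / (x1 * x2))))"

definition corner_scale :: "'n::finite pt \<Rightarrow> 'n pt \<Rightarrow> 'n pt" where
  "corner_scale = (\<lambda>(x1, x2, x') (g1, g2, g'). (x1 * g1, x1 * x2 * g2, g'))"

definition nabla_M :: "real \<Rightarrow> (real ^ 'n) set \<Rightarrow> ('n::finite pt \<Rightarrow> real) \<Rightarrow> 'n pt \<Rightarrow> 'n pt" where
  "nabla_M \<delta> X u x = corner_scale x (weak_gradient (MM \<delta> X) u x)"

definition nabla_M_classical :: "('n::finite pt \<Rightarrow> real) \<Rightarrow> 'n pt \<Rightarrow> 'n pt" where
  "nabla_M_classical \<phi> x = corner_scale x (classical_gradient \<phi> x)"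

definition weighted_pow ::
  "(real ^ 'n) set \<Rightarrow> real \<Rightarrow> real \<Rightarrow> real \<Rightarrow> ('n::finite pt \<Rightarrow> real) \<Rightarrow> 'n pt \<Rightarrow> real" where
  "weighted_pow X p \<gamma>1 \<gamma>2 f = (\<lambda>(x1, x2, x').
     \<bar>x1 powr (dimN X / p - \<gamma>1) * x2 powr (dimN X / p - \<gamma>2) * f (x1, x2, x')\<bar> powr p)"

definition Lp_M ::
  "real \<Rightarrow> (real ^ 'n) set \<Rightarrow> real \<Rightarrow> real \<Rightarrow> real \<Rightarrow> ('n::finite pt \<Rightarrow> real) set" where
  "Lp_M \<delta> X p \<gamma>1 \<gamma>2 = {f. f \<in> borel_measurable (lebesgue_on (MM \<delta> X)) \<and>
     integrable (sigma_M \<delta> X) (weighted_pow X p \<gamma>1 \<gamma>2 f)}"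

definition Lp_M_norm ::
  "real \<Rightarrow> (real ^ 'n) set \<Rightarrow> real \<Rightarrow> real \<Rightarrow> real \<Rightarrow> ('n::finite pt \<Rightarrow> real) \<Rightarrow> real" where
  "Lp_M_norm \<delta> X p \<gamma>1 \<gamma>2 f = (\<integral>x. weighted_pow X p \<gamma>1 \<gamma>2 f x \<partial>sigma_M \<delta> X) powr (1 / p)"

definition H1_M ::
  "real \<Rightarrow> (real ^ 'n) set \<Rightarrow> real \<Rightarrow> real \<Rightarrow> real \<Rightarrow> ('n::finite pt \<Rightarrow> real) set" where
  "H1_M \<delta> X p \<gamma>1 \<gamma>2 = {u. u \<in> W1p_loc (MM \<delta> X) p \<and> u \<in> Lp_M \<delta> X p \<gamma>1 \<gamma>2 \<and>
     (\<forall>i\<in>Basis. (\<lambda>x. nabla_M \<delta> X u x \<bullet> i) \<in> Lp_M \<delta> X p \<gamma>1 \<gamma>2)}"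

definition H1_M_norm ::
  "real \<Rightarrow> (real ^ 'n) set \<Rightarrow> real \<Rightarrow> real \<Rightarrow> real \<Rightarrow> ('n::finite pt \<Rightarrow> real) \<Rightarrow> real" where
  "H1_M_norm \<delta> X p \<gamma>1 \<gamma>2 u =
     (Lp_M_norm \<delta> X p \<gamma>1 \<gamma>2 u powr p +
      (\<Sum>i\<in>Basis. Lp_M_norm \<delta> X p \<gamma>1 \<gamma>2 (\<lambda>x. nabla_M \<delta> X u x \<bullet> i) powr p)) powr (1 / p)"

definition H10_M ::
  "real \<Rightarrow> (real ^ 'n) set \<Rightarrow> real \<Rightarrow> real \<Rightarrow> real \<Rightarrow> ('n::finite pt \<Rightarrow> real) set" where
  "H10_M \<delta> X p \<gamma>1 \<gamma>2 = {u \<in> H1_M \<delta> X p \<gamma>1 \<gamma>2.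
     \<forall>\<epsilon>>0. \<exists>\<phi>\<in>test_functions (MM \<delta> X). H1_M_norm \<delta> X p \<gamma>1 \<gamma>2 (\<lambda>x. u x - \<phi> x) < \<epsilon>}"

text \<open>The factor \<open>x1\<close> is the \<open>p\<close>-th power of the weight of the space with indices
  \<open>((N - 1) / p, N / p)\<close>.  For \<open>u\<close> in that space both integrals converge absolutely.\<close>

definition weak_eigensolution ::
  "real \<Rightarrow> (real ^ 'n) set \<Rightarrow> real \<Rightarrow> ('n::finite pt \<Rightarrow> real) \<Rightarrow> real \<Rightarrow> bool" where
  "weak_eigensolution \<delta> X p u lam \<longleftrightarrow>
     (\<forall>\<phi>\<in>test_functions (MM \<delta> X).
        (\<integral>x. fst x * norm (nabla_M \<delta> X u x) powr (p - 2) *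
              (nabla_M \<delta> X u x \<bullet> nabla_M_classical \<phi> x) \<partial>sigma_M \<delta> X) =
        lam * (\<integral>x. fst x * (fst x * fst (snd x)) powr p * \<bar>u x\<bar> powr (p - 2) * u x * \<phi> x
                 \<partial>sigma_M \<delta> X))"

end

theory Submission
  imports Defs "HOL-Homology.Invariance_of_Domain"
begin

text \<open>With \<open>\<nu> = x\<^sub>1 d\<sigma>\<close> and \<open>\<mu> = (x\<^sub>1 x\<^sub>2)\<^sup>p \<nu>\<close> the problem asks for critical points of the quotient of
  \<open>\<integral>\<bar>\<nabla>u\<bar>\<^sup>p d\<nu>\<close> by \<open>\<integral>\<bar>u\<bar>\<^sup>p d\<mu>\<close>. Translation in \<open>x'\<close> yields a Poincare inequality in \<open>L\<^sup>p(\<nu>)\<close>. The embedding of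
  the energy space into \<open>L\<^sup>p(\<mu>)\<close> is compact: near the corner \<open>\<mu>\<close> has a small density with respect to \<open>\<nu>\<close>, and
  away from it the means over the cells of a fine grid control the norm by the local Poincare inequality.

  Eigenfunctions arise as limits of the inverse iteration \<open>-\<Delta>\<^sub>p u\<^sub>k\<^sub>+\<^sub>1 = \<bar>u\<^sub>k\<bar>\<^sup>p\<^sup>-\<^sup>2 u\<^sub>k\<close>, whose ratios
  \<open>\<parallel>u\<^sub>k\<^sub>+\<^sub>1\<parallel> / \<parallel>u\<^sub>k\<parallel>\<close> increase. If no eigenvalue were at least \<open>1 / \<epsilon>\<close>, then for every starting point on the unit
  sphere of a space of dimension \<open>d + 1\<close> these ratios would eventually exceed \<open>\<theta>\<^sub>0 = \<epsilon>\<^sup>1\<^sup>/\<^sup>(\<^sup>p\<^sup>-\<^sup>1\<^sup>)\<close>; by monotonicity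
  and compactness this happens at one step \<open>n\<close> for all of them. The iterates are odd and continuous, so by the
  Borsuk-Ulam theorem one of them is annihilated by the \<open>d\<close> functionals that control the embedding up to
  \<open>\<epsilon>\<^sup>1\<^sup>/\<^sup>p\<close>, and its ratio is at most \<open>\<theta>\<^sub>0\<close>. Hence the eigenvalues are unbounded, and eigenfunctions with
  distinct eigenvalues are not proportional.\<close>

section \<open>The Borsuk-Ulam theorem\<close>

text \<open>The ratios increase by Hoelder's inequality combined with testing each equation by its
  own solution. In the limit equality holds, and Clarkson's inequality turns it into
  proportionality: a limit ratio \<open>\<theta>\<close> gives the eigenvalue
  \<open>\<theta> powr (1 - p)\<close>. Large eigenvalues thus require starting points whose ratios
  stay small. No deformation lemma is needed, because the compact sphere of starting points passes
  the threshold at one common step. Clarkson's inequality also replaces weak compactness: minimizing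
  sequences are Cauchy. The energy space consists of pairs of a function and a limit of gradients;
  only on the corner domain is the second component identified with the weak gradient. Borsuk-Ulam
  rests on the oddness of the degree of odd maps, by induction on the dimension. The obstacle is
  that an odd map need not preserve the equator, and that the continuous image of the equator may
  fill the whole sphere. A Lipschitz approximation cannot do so; a direction that it misses allows a
  shear that brings the equator back to itself.\<close>

definition Sph :: "nat \<Rightarrow> (nat \<Rightarrow> real) set" where
  "Sph n = {x. (\<Sum>i\<le>n. (x i)\<^sup>2) = 1 \<and> (\<forall>i>n. x i = 0)}"

definition nrml :: "nat \<Rightarrow> (nat \<Rightarrow> real) \<Rightarrow> nat \<Rightarrow> real" where
  "nrml n v = (\<lambda>i. if i \<le> n then v i / sqrt (\<Sum>j\<le>n. (v j)\<^sup>2) else 0)"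

lemma nsphere_eq_Sph: "nsphere n = top_of_set (Sph n)"
  by (simp add: nsphere Sph_def euclidean_product_topology)

lemma Sph_uminus: "x \<in> Sph n \<Longrightarrow> (\<lambda>i. - x i) \<in> Sph n"
  by (simp add: Sph_def)

lemma Sph_mono: "m \<le> n \<Longrightarrow> Sph m \<subseteq> Sph n"
proof
  fix x assume mn: "m \<le> n" and x: "x \<in> Sph m"
  have "(\<Sum>i\<le>n. (x i)\<^sup>2) = (\<Sum>i\<le>m. (x i)\<^sup>2)"
    using mn x by (intro sum.mono_neutral_right) (auto simp: Sph_def)
  with x mn show "x \<in> Sph n" by (auto simp: Sph_def)
qed

text \<open>Padding points with zeros makes the equator literally the sphere of one dimension less,
  which is what the degree step for odd maps expects.\<close>

lemma Sph_Suc_iff: "x \<in> Sph n \<longleftrightarrow> x \<in> Sph (Suc n) \<and> x (Suc n) = 0"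
proof
  assume "x \<in> Sph n" then show "x \<in> Sph (Suc n) \<and> x (Suc n) = 0"
    using Sph_mono[of n "Suc n"] by (auto simp: Sph_def)
next
  assume "x \<in> Sph (Suc n) \<and> x (Suc n) = 0" then show "x \<in> Sph n"
    by (auto simp: Sph_def intro: Suc_lessI)
qed

lemma Sph_coord_le_1: "x \<in> Sph n \<Longrightarrow> \<bar>x i\<bar> \<le> 1"
proof (cases "i \<le> n")
  case True
  assume "x \<in> Sph n"
  then have s: "(\<Sum>i\<le>n. (x i)\<^sup>2) = 1" by (simp add: Sph_def)
  have "(x i)\<^sup>2 \<le> (\<Sum>i\<le>n. (x i)\<^sup>2)" using True by (intro member_le_sum) auto
  then have "(x i)\<^sup>2 \<le> 1\<^sup>2" using s by simp
  then show ?thesis using abs_le_square_iff[of "x i" 1] by simp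
qed (auto simp: Sph_def)

lemma Sph_coord_ge: "x \<in> Sph n \<Longrightarrow> \<exists>i\<le>n. (x i)\<^sup>2 \<ge> 1 / (Suc n)"
proof (rule ccontr)
  assume x: "x \<in> Sph n" and *: "\<not> (\<exists>i\<le>n. (x i)\<^sup>2 \<ge> 1 / (Suc n))"
  have "(\<Sum>i\<le>n. (x i)\<^sup>2) < (\<Sum>i\<le>n. 1 / (Suc n))"
    using * by (intro sum_strict_mono) (auto simp: not_le simp del: of_nat_Suc dest: leD)
  also have "\<dots> = 1" by simp
  finally show False using x by (simp add: Sph_def)
qed

text \<open>The ambient sequence space carries the product topology, where closed and bounded does
  not imply compact; Tychonoff's theorem for a product of intervals does the work.\<close>

lemma compact_Sph: "compact (Sph n)"
proof -
  have "compactin (product_topology (\<lambda>i. euclidean) UNIV) (PiE UNIV (\<lambda>i. {-1..1::real}))"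
    by (simp add: compactin_PiE)
  then have 1: "compact (PiE UNIV (\<lambda>i::nat. {-1..1::real}))"
    by (simp add: euclidean_product_topology)
  have 2: "closed (Sph n)" unfolding Sph_def Collect_conj_eq
    by (intro closed_Int closed_Collect_eq closed_Collect_all closed_Collect_imp continuous_intros) auto
  have "Sph n \<subseteq> PiE UNIV (\<lambda>i. {-1..1})"
    using Sph_coord_le_1 by (force simp: abs_le_iff minus_le_iff)
  then have "Sph n = PiE UNIV (\<lambda>i. {-1..1}) \<inter> Sph n" by blast
  then show ?thesis using compact_Int_closed[OF 1 2] by simp
qed

lemma nrml_pos: fixes n :: nat shows "\<exists>i\<le>n. v i \<noteq> 0 \<Longrightarrow> (\<Sum>j\<le>n. (v j)\<^sup>2) > (0::real)"
  using sum_pos2[OF finite_atMost[of n], of _ "\<lambda>j. (v j)\<^sup>2"] by auto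

lemma nrml_in_Sph: "\<exists>i\<le>n. v i \<noteq> 0 \<Longrightarrow> nrml n v \<in> Sph n"
proof -
  assume "\<exists>i\<le>n. v i \<noteq> 0"
  note p = nrml_pos[OF this]
  have "(\<Sum>i\<le>n. (nrml n v i)\<^sup>2) = (\<Sum>i\<le>n. (v i)\<^sup>2 / (\<Sum>j\<le>n. (v j)\<^sup>2))"
    using p by (intro sum.cong) (auto simp: nrml_def power_divide)
  also have "\<dots> = 1" using p by (simp flip: sum_divide_distrib)
  finally show ?thesis by (auto simp: Sph_def nrml_def)
qed

lemma nrml_id: "x \<in> Sph n \<Longrightarrow> nrml n x = x"
  by (auto simp: nrml_def Sph_def fun_eq_iff)

lemma nrml_uminus: "nrml n (\<lambda>i. - v i) = (\<lambda>i. - nrml n v i)"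
  by (auto simp: nrml_def)

lemma continuous_on_nrml:
  fixes F :: "'a::topological_space \<Rightarrow> nat \<Rightarrow> real"
  assumes "\<And>i. i \<le> n \<Longrightarrow> continuous_on S (\<lambda>x. F x i)"
    and "\<And>x. x \<in> S \<Longrightarrow> \<exists>i\<le>n. F x i \<noteq> 0"
  shows "continuous_on S (\<lambda>x. nrml n (F x))"
proof (rule continuous_on_coordinatewise_then_product)
  fix i
  have "continuous_on S (\<lambda>x. F x i / sqrt (\<Sum>j\<le>n. (F x j)\<^sup>2))" if "i \<le> n"
  proof (intro continuous_intros ballI)
    fix x assume "x \<in> S"
    show "sqrt (\<Sum>j\<le>n. (F x j)\<^sup>2) \<noteq> 0" using nrml_pos[OF assms(2)[OF \<open>x \<in> S\<close>]] by simp
  qed (use assms(1) that in auto)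
  then show "continuous_on S (\<lambda>x. nrml n (F x) i)"
    by (cases "i \<le> n") (auto simp: nrml_def)
qed

text \<open>Homotopies may be written by linear formulas in the ambient space: they only have to
  avoid the origin, and the radial projection \<open>nrml\<close> brings them back to the
  sphere.\<close>

lemma Brouwer_degree2_nrml_homotopy:
  assumes cont: "\<And>i. i \<le> n \<Longrightarrow> continuous_on ({0..1} \<times> Sph n) (\<lambda>z. H z i)"
    and nz: "\<And>t x. t \<in> {0..1::real} \<Longrightarrow> x \<in> Sph n \<Longrightarrow> \<exists>i\<le>n. H (t, x) i \<noteq> 0"
  shows "Brouwer_degree2 n (\<lambda>x. nrml n (H (0, x))) = Brouwer_degree2 n (\<lambda>x. nrml n (H (1, x)))"
proof (rule Brouwer_degree2_homotopic)
  have c: "continuous_on ({0..1} \<times> Sph n) (\<lambda>z. nrml n (H z))"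
    using nz by (intro continuous_on_nrml cont) auto
  have "continuous_map (prod_topology (top_of_set {0..1}) (nsphere n)) (nsphere n) (\<lambda>z. nrml n (H z))"
    using c nz nrml_in_Sph
    by (auto simp: nsphere_eq_Sph prod_topology_subtopology_eu image_subset_iff)
  then show "homotopic_with (\<lambda>x. True) (nsphere n) (nsphere n) (\<lambda>x. nrml n (H (0, x))) (\<lambda>x. nrml n (H (1, x)))"
    by (auto simp: homotopic_with intro!: exI[of _ "\<lambda>z. nrml n (H z)"])
qed

text \<open>The bound is part of the notion because products of Lipschitz functions are Lipschitz
  only when the factors are bounded; with it the class is a function ring for
  Stone-Weierstrass.\<close>

definition l1lip :: "nat \<Rightarrow> (nat \<Rightarrow> real) set \<Rightarrow> ((nat \<Rightarrow> real) \<Rightarrow> real) \<Rightarrow> bool" where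
  "l1lip n S f \<longleftrightarrow> (\<exists>L B. L \<ge> 0 \<and> (\<forall>x\<in>S. \<bar>f x\<bar> \<le> B) \<and>
     (\<forall>x\<in>S. \<forall>y\<in>S. \<bar>f x - f y\<bar> \<le> L * (\<Sum>j\<le>n. \<bar>x j - y j\<bar>)))"

lemma l1lipE:
  assumes "l1lip n S f"
  obtains L B where "L \<ge> 0" "\<forall>x\<in>S. \<bar>f x\<bar> \<le> B"
    "\<forall>x\<in>S. \<forall>y\<in>S. \<bar>f x - f y\<bar> \<le> L * (\<Sum>j\<le>n. \<bar>x j - y j\<bar>)"
  using assms[unfolded l1lip_def] by (elim exE conjE) (rule that)

lemma l1lip_add: "l1lip n S f \<Longrightarrow> l1lip n S g \<Longrightarrow> l1lip n S (\<lambda>x. f x + g x)"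
proof -
  assume "l1lip n S f" "l1lip n S g"
  obtain L B where 1: "L \<ge> 0" "\<forall>x\<in>S. \<bar>f x\<bar> \<le> B"
    "\<forall>x\<in>S. \<forall>y\<in>S. \<bar>f x - f y\<bar> \<le> L * (\<Sum>j\<le>n. \<bar>x j - y j\<bar>)"
    by (rule l1lipE[OF \<open>l1lip n S f\<close>])
  obtain L' B' where 2: "L' \<ge> 0" "\<forall>x\<in>S. \<bar>g x\<bar> \<le> B'"
    "\<forall>x\<in>S. \<forall>y\<in>S. \<bar>g x - g y\<bar> \<le> L' * (\<Sum>j\<le>n. \<bar>x j - y j\<bar>)"
    by (rule l1lipE[OF \<open>l1lip n S g\<close>])
  note * = 1(1) 2(1) 1(2)[rule_format] 2(2)[rule_format] 1(3)[rule_format] 2(3)[rule_format]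
  show ?thesis unfolding l1lip_def
  proof (rule exI[of _ "L + L'"], rule exI[of _ "B + B'"], intro conjI ballI)
    show "0 \<le> L + L'" using * by simp
    show "\<bar>f x + g x\<bar> \<le> B + B'" if "x \<in> S" for x using *(3,4)[OF that] by linarith
    show "\<bar>f x + g x - (f y + g y)\<bar> \<le> (L + L') * (\<Sum>j\<le>n. \<bar>x j - y j\<bar>)" if "x \<in> S" "y \<in> S" for x y
      using *(5,6)[OF that] unfolding distrib_right by linarith
  qed
qed

lemma l1lip_mult: "l1lip n S f \<Longrightarrow> l1lip n S g \<Longrightarrow> l1lip n S (\<lambda>x. f x * g x)"
proof -
  assume "l1lip n S f" "l1lip n S g"
  obtain L B where 1: "L \<ge> 0" "\<forall>x\<in>S. \<bar>f x\<bar> \<le> B"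
    "\<forall>x\<in>S. \<forall>y\<in>S. \<bar>f x - f y\<bar> \<le> L * (\<Sum>j\<le>n. \<bar>x j - y j\<bar>)"
    by (rule l1lipE[OF \<open>l1lip n S f\<close>])
  obtain L' B' where 2: "L' \<ge> 0" "\<forall>x\<in>S. \<bar>g x\<bar> \<le> B'"
    "\<forall>x\<in>S. \<forall>y\<in>S. \<bar>g x - g y\<bar> \<le> L' * (\<Sum>j\<le>n. \<bar>x j - y j\<bar>)"
    by (rule l1lipE[OF \<open>l1lip n S g\<close>])
  note * = 1(1) 2(1) 1(2)[rule_format] 2(2)[rule_format] 1(3)[rule_format] 2(3)[rule_format]
  show ?thesis unfolding l1lip_def
  proof (rule exI[of _ "\<bar>B\<bar> * L' + \<bar>B'\<bar> * L"], rule exI[of _ "\<bar>B\<bar> * \<bar>B'\<bar>"], intro conjI ballI)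
    show "0 \<le> \<bar>B\<bar> * L' + \<bar>B'\<bar> * L" using * by simp
    show "\<bar>f x * g x\<bar> \<le> \<bar>B\<bar> * \<bar>B'\<bar>" if "x \<in> S" for x
      using *(3,4)[OF that] by (auto simp: abs_mult intro!: mult_mono)
    show "\<bar>f x * g x - f y * g y\<bar> \<le> (\<bar>B\<bar> * L' + \<bar>B'\<bar> * L) * (\<Sum>j\<le>n. \<bar>x j - y j\<bar>)" (is "_ \<le> _ * ?d") if "x \<in> S" "y \<in> S" for x y
    proof -
      have "\<bar>f x * g x - f y * g y\<bar> = \<bar>f x * (g x - g y) + g y * (f x - f y)\<bar>" by (simp add: algebra_simps)
      also have "\<dots> \<le> \<bar>f x\<bar> * \<bar>g x - g y\<bar> + \<bar>g y\<bar> * \<bar>f x - f y\<bar>" by (metis abs_mult abs_triangle_ineq)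
      also have "\<dots> \<le> \<bar>B\<bar> * (L' * ?d) + \<bar>B'\<bar> * (L * ?d)"
        using *(3)[OF that(1)] *(4)[OF that(2)] *(5,6)[OF that] by (intro add_mono mult_mono) auto
      finally show ?thesis by (simp add: algebra_simps)
    qed
  qed
qed

lemma l1lip_cont: assumes "l1lip n S f" shows "continuous_on S f"
proof -
  obtain L B where L: "L \<ge> 0" "\<And>x y. x\<in>S \<Longrightarrow> y\<in>S \<Longrightarrow> \<bar>f x - f y\<bar> \<le> L * (\<Sum>j\<le>n. \<bar>x j - y j\<bar>)"
    using l1lipE[OF assms] by metis
  show ?thesis unfolding continuous_on_def
  proof
    fix a assume a: "a \<in> S"
    have "((\<lambda>x. x j) \<longlongrightarrow> a j) (at a within S)" for j
      using continuous_on_product_then_coordinatewise[OF continuous_on_id, where S=S and i=j] a by (auto simp: continuous_on_def)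
    then have "((\<lambda>x. L * (\<Sum>j\<le>n. \<bar>x j - a j\<bar>)) \<longlongrightarrow> L * (\<Sum>j\<le>n. \<bar>a j - a j\<bar>)) (at a within S)"
      by (intro tendsto_intros)
    then have "((\<lambda>x. L * (\<Sum>j\<le>n. \<bar>x j - a j\<bar>)) \<longlongrightarrow> 0) (at a within S)" by simp
    then have "((\<lambda>x. f x - f a) \<longlongrightarrow> 0) (at a within S)"
    proof (rule Lim_null_comparison[rotated])
      show "\<forall>\<^sub>F x in at a within S. norm (f x - f a) \<le> L * (\<Sum>j\<le>n. \<bar>x j - a j\<bar>)"
        using L(2) a by (auto simp: eventually_at_filter)
    qed
    then show "(f \<longlongrightarrow> f a) (at a within S)" by (simp add: LIM_zero_iff)
  qed
qed

text \<open>Stone-Weierstrass applies since the coordinates are Lipschitz and separate points. The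
  counting argument below fails for merely continuous maps, which may fill space.\<close>

lemma l1lip_approx:
  assumes f: "continuous_on (Sph n) f" and e: "e > 0"
  shows "\<exists>g. l1lip n (Sph n) g \<and> (\<forall>x\<in>Sph n. \<bar>f x - g x\<bar> < e)"
proof -
  interpret function_ring_on "Collect (l1lip n (Sph n))" "Sph n"
  proof
    show "compact (Sph n)" by (rule compact_Sph)
    show "(\<lambda>_. c) \<in> Collect (l1lip n (Sph n))" for c
      unfolding l1lip_def mem_Collect_eq by (intro exI[of _ 0] exI[of _ "\<bar>c\<bar>"]) auto
    show "\<exists>f\<in>Collect (l1lip n (Sph n)). f x \<noteq> f y" if xy: "x \<in> Sph n" "y \<in> Sph n" "x \<noteq> y" for x y
    proof -
      from xy obtain i where i: "x i \<noteq> y i" by blast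
      then have "i \<le> n" using xy by (auto simp: Sph_def not_le)
      have "\<bar>u i - v i\<bar> \<le> (\<Sum>j\<le>n. \<bar>u j - v j\<bar>)" for u v :: "nat \<Rightarrow> real"
        using \<open>i \<le> n\<close> by (intro member_le_sum[of i _ "\<lambda>j. \<bar>u j - v j\<bar>"]) auto
      then have "l1lip n (Sph n) (\<lambda>x. x i)"
        unfolding l1lip_def using Sph_coord_le_1 by (intro exI[of _ 1]) auto
      with i show ?thesis by (intro bexI[of _ "\<lambda>x. x i"]) auto
    qed
  qed (auto intro: l1lip_cont l1lip_add l1lip_mult)
  show ?thesis using Stone_Weierstrass_basic[OF f e] by auto
qed

text \<open>The coordinate \<open>x i\<close> is recovered from the others through
  \<open>\<Sum>(x j)\<^sup>2 = 1\<close> up to sign. Subtracting the two equations and dividing by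
  \<open>\<bar>x i + y i\<bar>\<close>, which is at least \<open>2 / Suc k\<close> as both entries
  are large and of equal sign, bounds the remaining difference. Hence \<open>k\<close> rounded
  numbers locate a point of the \<open>k\<close>-sphere, and the count below has exponent
  \<open>k\<close>.\<close>

lemma Sph_code_close:
  fixes e :: real
  assumes x: "x \<in> Sph k" and y: "y \<in> Sph k" and i: "i \<le> k"
    and big: "(x i)\<^sup>2 \<ge> 1 / Suc k" "(y i)\<^sup>2 \<ge> 1 / Suc k" and sgn: "x i > 0 \<longleftrightarrow> y i > 0"
    and close: "\<And>j. j \<in> {..k} - {i} \<Longrightarrow> \<bar>x j - y j\<bar> \<le> e"
  shows "(\<Sum>j\<le>k. \<bar>x j - y j\<bar>) \<le> (real k + 2) * real k * e"
proof -
  have split: "(\<Sum>j\<le>k. g j) = g i + (\<Sum>j\<in>{..k}-{i}. g j)" for g :: "nat \<Rightarrow> real"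
    using i by (subst sum.remove[of _ i]) auto
  have card: "card ({..k}-{i}) = k" using i by simp
  have d: "(\<Sum>j\<in>{..k}-{i}. \<bar>x j - y j\<bar>) \<le> k * e"
    using sum_bounded_above[of "{..k}-{i}" "\<lambda>j. \<bar>x j - y j\<bar>" e] close card by simp
  have s: "sqrt (1 / Suc k) \<ge> 1 / Suc k"
    by (rule real_le_rsqrt) (simp add: power2_eq_square divide_simps del: of_nat_Suc)
  have b: "\<bar>x i\<bar> \<ge> 1 / Suc k" "\<bar>y i\<bar> \<ge> 1 / Suc k"
    using order_trans[OF s real_sqrt_le_mono[OF big(1)]] order_trans[OF s real_sqrt_le_mono[OF big(2)]]
    by (simp_all only: real_sqrt_abs)
  then have "x i \<noteq> 0" "y i \<noteq> 0" by auto
  then have "\<bar>x i + y i\<bar> = \<bar>x i\<bar> + \<bar>y i\<bar>" using sgn by auto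
  then have b2: "\<bar>x i + y i\<bar> \<ge> 2 / Suc k" using b by simp
  have "(x i)\<^sup>2 - (y i)\<^sup>2 = (\<Sum>j\<in>{..k}-{i}. (y j)\<^sup>2 - (x j)\<^sup>2)"
    using x y split[of "\<lambda>j. (x j)\<^sup>2"] split[of "\<lambda>j. (y j)\<^sup>2"] by (simp add: Sph_def sum_subtractf)
  moreover have "\<bar>x i - y i\<bar> * \<bar>x i + y i\<bar> = \<bar>(x i)\<^sup>2 - (y i)\<^sup>2\<bar>"
    by (simp add: power2_eq_square square_diff_square_factored abs_mult)
  ultimately have "\<bar>x i - y i\<bar> * \<bar>x i + y i\<bar> \<le> (\<Sum>j\<in>{..k}-{i}. \<bar>(y j)\<^sup>2 - (x j)\<^sup>2\<bar>)"
    using sum_abs by simp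
  also have "\<dots> \<le> (\<Sum>j\<in>{..k}-{i}. 2 * \<bar>x j - y j\<bar>)"
  proof (rule sum_mono)
    fix j
    have "\<bar>(y j)\<^sup>2 - (x j)\<^sup>2\<bar> = \<bar>x j + y j\<bar> * \<bar>x j - y j\<bar>"
      by (simp add: power2_eq_square square_diff_square_factored abs_mult abs_minus_commute add.commute)
    also have "\<dots> \<le> 2 * \<bar>x j - y j\<bar>"
      using Sph_coord_le_1[OF x, of j] Sph_coord_le_1[OF y, of j] by (intro mult_right_mono) auto
    finally show "\<bar>(y j)\<^sup>2 - (x j)\<^sup>2\<bar> \<le> 2 * \<bar>x j - y j\<bar>" .
  qed
  also have "\<dots> \<le> 2 * (k * e)" using d by (simp flip: sum_distrib_left)
  finally have "\<bar>x i - y i\<bar> * (2 / Suc k) \<le> 2 * (k * e)"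
    using mult_left_mono[OF b2 abs_ge_zero[of "x i - y i"]] by linarith
  then have "\<bar>x i - y i\<bar> \<le> Suc k * (k * e)" by (simp add: field_simps)
  then have "(\<Sum>j\<le>k. \<bar>x j - y j\<bar>) \<le> Suc k * (k * e) + k * e"
    using d split[of "\<lambda>j. \<bar>x j - y j\<bar>"] by simp
  also have "\<dots> = (real k + 2) * real k * e" by (simp add: algebra_simps)
  finally show ?thesis .
qed

text \<open>A Lipschitz image of the \<open>k\<close>-sphere meets only \<open>O(K\<^sup>k)\<close> of the \<open>M ^ (k + 1)\<close> lines through
  the grid points \<open>(m\<^sub>0 / M, \<dots>, m\<^sub>k / M, 1)\<close>, where the ratio \<open>K / M\<close> is fixed.\<close>

lemma lipschitz_misses_line:
  fixes f :: "(nat \<Rightarrow> real) \<Rightarrow> nat \<Rightarrow> real"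
  assumes L: "L \<ge> 0" and lip: "\<And>i x y. i \<le> Suc k \<Longrightarrow> x \<in> Sph k \<Longrightarrow> y \<in> Sph k \<Longrightarrow>
      \<bar>f x i - f y i\<bar> \<le> L * (\<Sum>j\<le>k. \<bar>x j - y j\<bar>)"
    and c: "c > 0" and low: "\<And>x. x \<in> Sph k \<Longrightarrow> \<exists>i\<le>Suc k. \<bar>f x i\<bar> \<ge> c"
  shows "\<exists>a. \<forall>x\<in>Sph k. \<exists>i\<le>k. f x i \<noteq> a i * f x (Suc k)"
proof (rule ccontr)
  assume neg: "\<not> ?thesis"
  \<comment> \<open>Points with equal codes differ by at most \<open>(k + 2) * k / K\<close> in the
    sum norm. With \<open>K = M * Q\<close> and this bound on \<open>Q\<close>, the slopes of the
    grid lines through their images differ by less than the spacing \<open>1 / M\<close>.\<close>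
  obtain Q :: nat where Q: "real Q > 2 * L * ((real k + 2) * real k) / c" "Q > 0"
  proof -
    obtain q :: nat where "real q > 2 * L * ((real k + 2) * real k) / c" using reals_Archimedean2 by blast
    then show ?thesis using that[of "Suc q"] by simp
  qed
  \<comment> \<open>There are at most \<open>2 * Suc k * (3 * Q) ^ k * M ^ k\<close> codes but
    \<open>M ^ Suc k\<close> grid points; the summand 1 makes the two counts incompatible.\<close>
  define M where "M = 2 * Suc k * (3 * Q) ^ k + 1"
  define K where "K = M * Q"
  have M: "M > 0" and K: "K > 0" using Q by (auto simp: M_def K_def)
  define grid where "grid = PiE {..k} (\<lambda>_. {0..<M})"
  have neg': "\<exists>x. x \<in> Sph k \<and> (\<forall>i\<le>k. f x i = a i * f x (Suc k))" for a :: "nat \<Rightarrow> real"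
    using neg by blast
  have "\<forall>m. \<exists>x. x \<in> Sph k \<and> (\<forall>i\<le>k. f x i = real (m i) / M * f x (Suc k))"
    by (intro allI neg')
  from choice[OF this] obtain X where X': "\<forall>m. X m \<in> Sph k \<and> (\<forall>i\<le>k. f (X m) i = real (m i) / M * f (X m) (Suc k))" ..
  have X: "\<And>m. X m \<in> Sph k" "\<And>m i. i \<le> k \<Longrightarrow> f (X m) i = real (m i) / M * f (X m) (Suc k)"
    using X' by simp_all
  have "\<forall>m. \<exists>i. i \<le> k \<and> (X m i)\<^sup>2 \<ge> 1 / Suc k" using Sph_coord_ge[OF X(1)] by blast
  from choice[OF this] obtain I where I': "\<forall>m. I m \<le> k \<and> (X m (I m))\<^sup>2 \<ge> 1 / Suc k" ..
  have I: "\<And>m. I m \<le> k" "\<And>m. (X m (I m))\<^sup>2 \<ge> 1 / Suc k" using I' by simp_all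
  \<comment> \<open>A code records the index of a large coordinate, its sign, and the remaining
    coordinates rounded to multiples of \<open>1 / K\<close>.\<close>
  define code where "code m = (I m, X m (I m) > 0, restrict (\<lambda>j. \<lfloor>K * X m j\<rfloor>) ({..k} - {I m}))" for m
  define Codes where "Codes = (SIGMA i:{..k}. (UNIV::bool set) \<times> PiE ({..k} - {i}) (\<lambda>_. {- int K..int K}))"
  \<comment> \<open>On a grid line all slopes lie in \<open>[0, 1)\<close>, so the last coordinate
    dominates and inherits the lower bound \<open>c\<close>.\<close>
  have low': "\<bar>f (X m) (Suc k)\<bar> \<ge> c" if "m \<in> grid" for m
  proof -
    obtain i where i: "i \<le> Suc k" "\<bar>f (X m) i\<bar> \<ge> c" using low[OF X(1)] by blast
    show ?thesis
    proof (cases "i = Suc k")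
      case False
      then have "i \<le> k" using i by simp
      then have "m i < M" using that by (auto simp: grid_def)
      then have "real (m i) / M \<le> 1" by simp
      then have "\<bar>f (X m) i\<bar> \<le> 1 * \<bar>f (X m) (Suc k)\<bar>"
        unfolding X(2)[OF \<open>i \<le> k\<close>] abs_mult by (intro mult_right_mono) auto
      then show ?thesis using i by simp
    qed (use i in simp)
  qed
  have inj: "inj_on code grid"
  proof (rule inj_onI)
    fix m m' assume m: "m \<in> grid" "m' \<in> grid" and eq: "code m = code m'"
    let ?x = "X m" and ?y = "X m'"
    have Ieq: "I m' = I m" using eq by (simp add: code_def)
    have d: "(\<Sum>j\<le>k. \<bar>?x j - ?y j\<bar>) \<le> (real k + 2) * real k * (1 / real K)"
    proof (rule Sph_code_close[OF X(1) X(1) I(1)[of m]])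
      show "1 / Suc k \<le> (?x (I m))\<^sup>2" "1 / Suc k \<le> (?y (I m))\<^sup>2" using I(2)[of m] I(2)[of m'] Ieq by auto
      show "(0 < ?x (I m)) = (0 < ?y (I m))" using eq Ieq by (simp add: code_def)
      fix j assume j: "j \<in> {..k} - {I m}"
      have "\<lfloor>K * ?x j\<rfloor> = \<lfloor>K * ?y j\<rfloor>"
        using eq j Ieq by (simp add: code_def) (metis (no_types, lifting) restrict_apply' j)
      then have "\<bar>K * ?x j - K * ?y j\<bar> \<le> 1" by linarith
      then have "K * \<bar>?x j - ?y j\<bar> \<le> 1" by (simp add: abs_mult flip: right_diff_distrib)
      then show "\<bar>?x j - ?y j\<bar> \<le> 1 / K" using K by (simp add: field_simps)
    qed
    show "m = m'"
    proof (rule PiE_ext[of _ "{..k}" "\<lambda>_. {0..<M}"])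
      fix i assume "i \<in> {..k}"
      then have i: "i \<le> k" by simp
      let ?a = "real (m i) / M" and ?b = "real (m' i) / M" and ?d = "\<Sum>j\<le>k. \<bar>?x j - ?y j\<bar>"
      have "m i < M" using PiE_mem[OF m(1)[unfolded grid_def], of i] i by simp
      then have a: "\<bar>?a\<bar> \<le> 1" by simp
      \<comment> \<open>The difference of slopes, multiplied by a last coordinate of size at least
        \<open>c\<close>, is expressed by increments of \<open>f\<close>, to which the Lipschitz
        bound applies.\<close>
      have "(?b - ?a) * f ?y (Suc k) = (f ?y i - f ?x i) + ?a * (f ?x (Suc k) - f ?y (Suc k))"
        using X(2)[OF i, of m] X(2)[OF i, of m'] by (simp add: algebra_simps)
      then have "\<bar>?b - ?a\<bar> * \<bar>f ?y (Suc k)\<bar> \<le> \<bar>f ?y i - f ?x i\<bar> + \<bar>?a\<bar> * \<bar>f ?x (Suc k) - f ?y (Suc k)\<bar>"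
        by (metis abs_mult abs_triangle_ineq)
      also have "\<dots> \<le> L * ?d + 1 * (L * ?d)"
        using lip[of i ?x ?y] lip[of "Suc k" ?x ?y] X(1) i a
        by (intro add_mono mult_mono) (auto simp: abs_minus_commute)
      also have "\<dots> \<le> 2 * L * ((real k + 2) * real k * (1 / K))"
        using mult_left_mono[OF d L] by (simp only: mult_1 mult.assoc)
      finally have "\<bar>?b - ?a\<bar> * c \<le> 2 * L * ((real k + 2) * real k * (1 / K))"
        using mult_left_mono[OF low'[OF m(2)] abs_ge_zero[of "?b - ?a"]] by linarith
      then have "\<bar>?b - ?a\<bar> \<le> 2 * L * ((real k + 2) * real k * (1 / K)) / c" by (rule iffD2[OF pos_le_divide_eq[OF c]])
      also have "\<dots> = (2 * L * ((real k + 2) * real k) / c) * (1 / K)" by simp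
      also have "\<dots> < Q * (1 / K)" using Q K by (intro mult_strict_right_mono) auto
      also have "\<dots> = 1 / M" using Q by (simp add: K_def)
      finally have lt: "\<bar>?b - ?a\<bar> < 1 / M" .
      have "\<bar>?b - ?a\<bar> = \<bar>real (m' i) - real (m i)\<bar> / M" by (simp add: abs_divide flip: diff_divide_distrib)
      with lt M have "\<bar>real (m' i) - real (m i)\<bar> < 1" by (simp add: divide_less_cancel)
      then show "m i = m' i" by linarith
    qed (use m in \<open>auto simp: grid_def\<close>)
  qed
  have "code ` grid \<subseteq> Codes"
  proof
    fix z assume "z \<in> code ` grid"
    then obtain m where m: "z = code m" by blast
    have "\<lfloor>K * X m j\<rfloor> \<in> {- int K..int K}" for j
    proof -
      have "\<bar>real K * X m j\<bar> \<le> real K * 1"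
        unfolding abs_mult using Sph_coord_le_1[OF X(1), of m j] by (intro mult_mono) auto
      then have "- real K \<le> real K * X m j" "real K * X m j \<le> real K" by (auto simp: abs_le_iff)
      then show ?thesis by (auto simp: le_floor_iff floor_le_iff)
    qed
    then show "z \<in> Codes" using I(1) unfolding m code_def Codes_def by (auto simp: PiE_iff)
  qed
  moreover have fin: "finite Codes" unfolding Codes_def by (intro finite_SigmaI finite_cartesian_product finite_PiE) auto
  ultimately have "card grid \<le> card Codes" using inj card_inj_on_le by blast
  moreover have "card grid = M ^ Suc k" by (simp add: grid_def card_PiE)
  moreover have "card Codes = (\<Sum>i\<le>k. 2 * (2 * K + 1) ^ k)"
  proof -
    have "nat (int K + 1 + int K) = 2 * K + 1" by linarith
    then show ?thesis unfolding Codes_def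
      by (subst card_SigmaI) (auto simp: card_cartesian_product card_PiE prod_constant
        intro!: finite_cartesian_product finite_PiE sum.cong)
  qed
  moreover have "\<dots> = Suc k * 2 * (2 * K + 1) ^ k" by simp
  moreover have "(2 * K + 1) ^ k \<le> (3 * Q) ^ k * M ^ k"
  proof -
    have "2 * K + 1 \<le> 3 * Q * M" using K by (simp add: K_def mult.commute)
    then have "(2 * K + 1) ^ k \<le> (3 * Q * M) ^ k" by (rule power_mono) simp
    then show ?thesis by (simp only: power_mult_distrib)
  qed
  ultimately have "M ^ Suc k \<le> Suc k * 2 * ((3 * Q) ^ k * M ^ k)"
    by (metis le_trans mult_le_mono2)
  then have "M * M ^ k \<le> (2 * Suc k * (3 * Q) ^ k) * M ^ k" by (simp only: power_Suc mult_ac)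
  then have "M \<le> 2 * Suc k * (3 * Q) ^ k" using M by (simp only: mult_le_cancel2) simp
  then show False by (simp add: M_def)
qed

text \<open>The map is deformed through nowhere vanishing maps into an odd map that sends the
  equator to itself. For such maps the degree has the same parity as the degree of the restriction
  to the equator, where the induction hypothesis applies.\<close>

theorem odd_map_odd_degree:
  assumes "continuous_on (Sph n) f" and "\<And>x. x \<in> Sph n \<Longrightarrow> f x \<in> Sph n"
    and "\<And>x. x \<in> Sph n \<Longrightarrow> f (\<lambda>i. - x i) = (\<lambda>i. - f x i)"
  shows "odd (Brouwer_degree2 n f)"
  using assms
proof (induction n arbitrary: f)
  case 0
  \<comment> \<open>The 0-sphere has two points, so an odd self-map is the identity, of degree 1, or
    the reflection, of degree -1.\<close>
  define e :: "nat \<Rightarrow> real" where "e = (\<lambda>i. if i = 0 then 1 else 0)"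
  have S0: "x = e \<or> x = (\<lambda>i. - e i)" if "x \<in> Sph 0" for x
  proof -
    have "x 0 = 1 \<or> x 0 = -1" "\<forall>i>0. x i = 0" using that by (auto simp: Sph_def power2_eq_1_iff)
    then show ?thesis by (auto simp: e_def fun_eq_iff)
  qed
  have e: "e \<in> Sph 0" by (auto simp: Sph_def e_def)
  consider "f e = e" | "f e = (\<lambda>i. - e i)" using S0[OF 0(2)[OF e]] by blast
  then show ?case
  proof cases
    case 1
    then have "f x = id x" if "x \<in> Sph 0" for x using S0[OF that] 0(3)[OF e] by auto
    then have "Brouwer_degree2 0 f = Brouwer_degree2 0 id"
      by (intro Brouwer_degree2_eq) (simp add: nsphere_eq_Sph)
    then show ?thesis by simp
  next
    case 2
    then have "f x = (\<lambda>i. if i = 0 then - x i else x i)" if "x \<in> Sph 0" for x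
      using S0[OF that] 0(3)[OF e] by (auto simp: e_def)
    then have "Brouwer_degree2 0 f = Brouwer_degree2 0 (\<lambda>x i. if i = 0 then - x i else x i)"
      by (intro Brouwer_degree2_eq) (simp add: nsphere_eq_Sph)
    then show ?thesis by (simp add: Brouwer_degree2_reflection)
  qed
next
  case (Suc k)
  let ?n = "Suc k"
  \<comment> \<open>Some coordinate of \<open>f x\<close> has square at least
    \<open>1 / Suc ?n\<close>, hence absolute value at least \<open>2 * c\<close>; an approximation
    within \<open>c\<close> therefore stays away from the origin.\<close>
  define c :: real where "c = 1 / (2 * Suc ?n)"
  have c: "c > 0" by (simp add: c_def)
  have fi: "continuous_on (Sph ?n) (\<lambda>x. f x i)" for i
    using Suc.prems(1) by (rule continuous_on_product_then_coordinatewise)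
  obtain g where g: "\<And>i. l1lip ?n (Sph ?n) (g i)" "\<And>i x. x \<in> Sph ?n \<Longrightarrow> \<bar>f x i - g i x\<bar> < c"
    using l1lip_approx[OF fi c] by metis
  have "\<exists>L\<ge>0. \<forall>x\<in>Sph ?n. \<forall>y\<in>Sph ?n. \<bar>g i x - g i y\<bar> \<le> L * (\<Sum>j\<le>?n. \<bar>x j - y j\<bar>)" for i
    using g(1)[of i] unfolding l1lip_def by blast
  then obtain Li where Li: "\<And>i. Li i \<ge> 0"
    "\<And>i x y. x \<in> Sph ?n \<Longrightarrow> y \<in> Sph ?n \<Longrightarrow> \<bar>g i x - g i y\<bar> \<le> Li i * (\<Sum>j\<le>?n. \<bar>x j - y j\<bar>)"
    by metis
  define L where "L = (\<Sum>i\<le>?n. Li i)"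
  have L: "L \<ge> 0" "\<And>i. i \<le> ?n \<Longrightarrow> Li i \<le> L"
    unfolding L_def using Li(1) by (simp_all add: sum_nonneg member_le_sum del: sum.atMost_Suc)
  \<comment> \<open>The odd part of the Lipschitz approximation: since \<open>f\<close> is odd,
    taking it does not worsen the error.\<close>
  define h where "h x i = (g i x - g i (\<lambda>j. - x j)) / 2" for x i
  have hodd: "h (\<lambda>j. - x j) i = - h x i" for x i by (simp add: h_def field_simps)
  have gcont: "continuous_on (Sph ?n) (g i)" for i using g(1) by (rule l1lip_cont)
  have ncont: "continuous_on (Sph ?n) (\<lambda>x j. - x j)"
    by (intro continuous_on_coordinatewise_then_product continuous_intros
      continuous_on_product_then_coordinatewise[OF continuous_on_id])
  have hcont: "continuous_on (Sph ?n) (\<lambda>x. h x i)" for i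
    unfolding h_def
    by (intro continuous_intros gcont continuous_on_compose2[OF gcont ncont]) (auto simp: Sph_uminus)
  have avg: "\<bar>(a - b) / 2\<bar> < d" if "\<bar>a\<bar> < d" "\<bar>b\<bar> < d" for a b d :: real using that by (auto simp: abs_less_iff)
  have avg': "\<bar>(a - b) / 2\<bar> \<le> d" if "\<bar>a\<bar> \<le> d" "\<bar>b\<bar> \<le> d" for a b d :: real using that by (auto simp: abs_le_iff)
  have fh: "\<bar>f x i - h x i\<bar> < c" if x: "x \<in> Sph ?n" for x i
  proof -
    have "f x i - h x i = ((f x i - g i x) - (f (\<lambda>j. - x j) i - g i (\<lambda>j. - x j))) / 2"
      using Suc.prems(3)[OF x] by (simp add: h_def field_simps)
    then show ?thesis using avg[OF g(2)[OF x, of i] g(2)[OF Sph_uminus[OF x], of i]] by simp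
  qed
  have fbig: "\<exists>i\<le>?n. \<bar>f x i\<bar> \<ge> 2 * c" if x: "x \<in> Sph ?n" for x
  proof -
    obtain i where i: "i \<le> ?n" "(f x i)\<^sup>2 \<ge> 1 / Suc ?n" using Sph_coord_ge[OF Suc.prems(2)[OF x]] by blast
    have "2 * c = 1 / Suc ?n" by (simp add: c_def field_simps)
    then have "(2 * c)\<^sup>2 \<le> 1 / Suc ?n" unfolding \<open>2 * c = _\<close> by (simp add: power2_eq_square divide_simps del: of_nat_Suc)
    then have "(2 * c)\<^sup>2 \<le> (f x i)\<^sup>2" using i by linarith
    then have "\<bar>2 * c\<bar> \<le> \<bar>f x i\<bar>" by (simp only: abs_le_square_iff)
    then show ?thesis using i c by auto
  qed
  have hbig: "\<exists>i\<le>?n. \<bar>h x i\<bar> \<ge> c" if x: "x \<in> Sph ?n" for x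
  proof -
    obtain i where i: "i \<le> ?n" "\<bar>f x i\<bar> \<ge> 2 * c" using fbig[OF x] by blast
    then show ?thesis using fh[OF x, of i] by (intro exI[of _ i] conjI) linarith+
  qed
  have hlip: "\<bar>h x i - h y i\<bar> \<le> L * (\<Sum>j\<le>k. \<bar>x j - y j\<bar>)"
    if "i \<le> ?n" "x \<in> Sph k" "y \<in> Sph k" for i x y
  proof -
    have x: "x \<in> Sph ?n" "x ?n = 0" and y: "y \<in> Sph ?n" "y ?n = 0" using that Sph_Suc_iff by blast+
    have "h x i - h y i = ((g i x - g i y) - (g i (\<lambda>j. - x j) - g i (\<lambda>j. - y j))) / 2"
      by (simp add: h_def field_simps)
    moreover have "\<bar>g i x - g i y\<bar> \<le> Li i * (\<Sum>j\<le>k. \<bar>x j - y j\<bar>)"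
      using Li(2)[OF x(1) y(1), of i] x y by simp
    moreover have "\<bar>g i (\<lambda>j. - x j) - g i (\<lambda>j. - y j)\<bar> \<le> Li i * (\<Sum>j\<le>k. \<bar>x j - y j\<bar>)"
      using Li(2)[OF Sph_uminus[OF x(1)] Sph_uminus[OF y(1)], of i] x y
      by (simp add: abs_minus_commute)
    ultimately have "\<bar>h x i - h y i\<bar> \<le> Li i * (\<Sum>j\<le>k. \<bar>x j - y j\<bar>)" using avg' by simp
    also have "\<dots> \<le> L * (\<Sum>j\<le>k. \<bar>x j - y j\<bar>)" using L(2)[OF that(1)] by (intro mult_right_mono sum_nonneg) auto
    finally show ?thesis .
  qed
  \<comment> \<open>The equator has dimension \<open>k\<close>, so its Lipschitz image misses some
    line through the origin; \<open>(a, 1)\<close> spans it.\<close>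
  obtain a where a: "\<And>x. x \<in> Sph k \<Longrightarrow> \<exists>i\<le>k. h x i \<noteq> a i * h x ?n"
  proof -
    have "\<exists>i\<le>Suc k. c \<le> \<bar>h x i\<bar>" if "x \<in> Sph k" for x
      using hbig Sph_mono[of k ?n] that by auto
    from lipschitz_misses_line[OF L(1) hlip c this] show ?thesis using that by blast
  qed
  define H1 where "H1 = (\<lambda>(t::real, x) i. (1 - t) * f x i + t * h x i)"
  \<comment> \<open>The shear turns the missed direction \<open>(a, 1)\<close> into the last axis,
    so on the equator the first \<open>Suc k\<close> coordinates cannot all vanish at
    \<open>t = 1\<close>. The even factor then suppresses the last coordinate exactly on the equator
    and keeps the map odd.\<close>
  define H2 where "H2 = (\<lambda>(t::real, x) i. if i \<le> k then h x i - t * a i * h x ?n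
      else (1 - t + t * (x ?n)\<^sup>2) * h x ?n)"
  have snd: "continuous_on ({0..1} \<times> Sph ?n) (\<lambda>z. F (snd z))" if "continuous_on (Sph ?n) F"
    for F :: "_ \<Rightarrow> real"
    by (rule continuous_on_compose2[OF that]) (auto intro: continuous_intros)
  have coord: "continuous_on (Sph ?n) (\<lambda>x. x j)" for j
    by (rule continuous_on_product_then_coordinatewise[OF continuous_on_id])
  have H1c: "continuous_on ({0..1} \<times> Sph ?n) (\<lambda>z. H1 z i)" for i
    unfolding H1_def case_prod_beta by (intro continuous_intros snd fi hcont)
  have H2c: "continuous_on ({0..1} \<times> Sph ?n) (\<lambda>z. H2 z i)" for i
  proof (cases "i \<le> k")
    case True
    show ?thesis unfolding H2_def case_prod_beta using True
      by (simp only: if_True) (intro continuous_intros snd hcont)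
  next
    case False
    show ?thesis unfolding H2_def case_prod_beta using False
      by (simp only: if_False) (intro continuous_intros snd hcont coord)
  qed
  have H1n: "\<exists>i\<le>?n. H1 (t, x) i \<noteq> 0" if t: "t \<in> {0..1}" and x: "x \<in> Sph ?n" for t x
  proof -
    obtain i where i: "i \<le> ?n" "\<bar>f x i\<bar> \<ge> 2 * c" using fbig[OF x] by blast
    have "H1 (t, x) i = f x i - t * (f x i - h x i)" by (simp add: H1_def algebra_simps)
    moreover have "\<bar>t * (f x i - h x i)\<bar> \<le> 1 * c"
      unfolding abs_mult using t fh[OF x, of i] by (intro mult_mono) auto
    ultimately show ?thesis using i c by (intro exI[of _ i]) auto
  qed
  have H2n: "\<exists>i\<le>?n. H2 (t, x) i \<noteq> 0" if t: "t \<in> {0..1}" and x: "x \<in> Sph ?n" for t x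
  proof (rule ccontr)
    assume "\<not> ?thesis"
    then have z: "H2 (t, x) i = 0" if "i \<le> ?n" for i using that by auto
    have z1: "h x i = t * a i * h x ?n" if "i \<le> k" for i using z[of i] that by (simp add: H2_def)
    have z2: "(1 - t + t * (x ?n)\<^sup>2) * h x ?n = 0" using z[of ?n] by (simp add: H2_def)
    have "h x ?n \<noteq> 0"
    proof
      assume "h x ?n = 0"
      then have "h x i = 0" if "i \<le> ?n" for i using z1[of i] that by (cases "i = ?n") auto
      moreover obtain i where "i \<le> ?n" "\<bar>h x i\<bar> \<ge> c" using hbig[OF x] by blast
      ultimately show False using c by force
    qed
    then have "1 - t + t * (x ?n)\<^sup>2 = 0" using z2 by simp
    moreover have "0 \<le> t * (x ?n)\<^sup>2" using t by simp
    ultimately have "t = 1" using t by simp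
    then have "(x ?n)\<^sup>2 = 0" using \<open>1 - t + t * (x ?n)\<^sup>2 = 0\<close> by simp
    then have "x \<in> Sph k" using x Sph_Suc_iff[of x k] by simp
    then obtain i where i: "i \<le> k" "h x i \<noteq> a i * h x ?n" using a by blast
    show False using z1[OF i(1)] i(2) \<open>t = 1\<close> by simp
  qed
  define F where "F x = nrml ?n (H2 (1, x))" for x
  have "Brouwer_degree2 ?n f = Brouwer_degree2 ?n (\<lambda>x. nrml ?n (H1 (0, x)))"
    using Suc.prems(2) by (intro Brouwer_degree2_eq) (simp add: nsphere_eq_Sph H1_def nrml_id)
  also have "\<dots> = Brouwer_degree2 ?n (\<lambda>x. nrml ?n (H1 (1, x)))"
    by (intro Brouwer_degree2_nrml_homotopy H1c H1n)
  also have "\<dots> = Brouwer_degree2 ?n (\<lambda>x. nrml ?n (H2 (0, x)))"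
    by (intro Brouwer_degree2_eq) (auto simp: H1_def H2_def nrml_def le_Suc_eq fun_eq_iff)
  also have "\<dots> = Brouwer_degree2 ?n F"
    unfolding F_def by (intro Brouwer_degree2_nrml_homotopy H2c H2n)
  finally have deg: "Brouwer_degree2 ?n f = Brouwer_degree2 ?n F" .
  have "continuous_on (Sph ?n) (\<lambda>x. H2 (1, x) i)" for i
    by (rule continuous_on_compose2[OF H2c]) (auto intro!: continuous_intros)
  then have Fc: "continuous_on (Sph ?n) F" unfolding F_def
    by (intro continuous_on_nrml H2n) auto
  have FS: "F x \<in> Sph ?n" if "x \<in> Sph ?n" for x
    unfolding F_def by (intro nrml_in_Sph H2n that) auto
  have "H2 (1, (\<lambda>i. - x i)) = (\<lambda>i. - H2 (1, x) i)" for x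
    by (auto simp: H2_def hodd fun_eq_iff)
  then have Fodd: "F (\<lambda>i. - x i) = (\<lambda>i. - F x i)" for x
    by (simp add: F_def nrml_uminus)
  have Fk: "F x \<in> Sph k" if "x \<in> Sph k" for x
  proof -
    have "x \<in> Sph ?n" "x ?n = 0" using that Sph_Suc_iff by blast+
    then have "F x ?n = 0" by (simp add: F_def nrml_def H2_def)
    then show ?thesis using FS[OF \<open>x \<in> Sph ?n\<close>] iffD2[OF Sph_Suc_iff[of "F x" k]] by blast
  qed
  \<comment> \<open>The parity comparison between an odd map and its restriction to the equator is
    available once both spheres are preserved.\<close>
  have "even (Brouwer_degree2 ?n F - Brouwer_degree2 (?n - Suc 0) F)"
  proof (rule Borsuk_odd_mapping_degree_step)
    show "continuous_map (nsphere ?n) (nsphere ?n) F"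
      using Fc FS by (auto simp: nsphere_eq_Sph)
    show "F \<in> topspace (nsphere (?n - Suc 0)) \<rightarrow> topspace (nsphere (?n - Suc 0))"
      using Fk by (auto simp: nsphere_eq_Sph)
  qed (simp add: Fodd)
  moreover have "odd (Brouwer_degree2 k F)"
    using Sph_mono[of k ?n] by (intro Suc.IH continuous_on_subset[OF Fc] Fk Fodd) auto
  ultimately show ?case unfolding deg by simp
qed

text \<open>Without a common zero, normalizing \<open>f\<close> gives an odd self-map of the
  \<open>d\<close>-sphere whose last coordinate is identically zero. Oddness makes its degree odd,
  while a map that is not onto has degree zero.\<close>

theorem Borsuk_Ulam:
  assumes cont: "\<And>i. i < d \<Longrightarrow> continuous_on (Sph d) (\<lambda>x. f x i)"
    and odd: "\<And>x i. x \<in> Sph d \<Longrightarrow> i < d \<Longrightarrow> f (\<lambda>j. - x j) i = - f x i"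
  shows "\<exists>x\<in>Sph d. \<forall>i<d. f x i = (0::real)"
proof (rule ccontr)
  assume neg: "\<not> ?thesis"
  define F where "F x = nrml d (\<lambda>i. if i < d then f x i else 0)" for x
  have nz: "\<exists>i\<le>d. (if i < d then f x i else 0) \<noteq> 0" if "x \<in> Sph d" for x
    using neg that by (metis less_imp_le)
  have Fc: "continuous_on (Sph d) F"
    unfolding F_def
  proof (intro continuous_on_nrml nz)
    show "continuous_on (Sph d) (\<lambda>x. if i < d then f x i else 0)" for i by (cases "i < d") (auto intro: cont)
  qed
  have FS: "F x \<in> Sph d" if "x \<in> Sph d" for x unfolding F_def by (intro nrml_in_Sph nz that)
  have Fodd: "F (\<lambda>i. - x i) = (\<lambda>i. - F x i)" if "x \<in> Sph d" for x
  proof -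
    have "(\<lambda>i. if i < d then f (\<lambda>j. - x j) i else 0) = (\<lambda>i. - (if i < d then f x i else 0))"
      using odd[OF that] by fastforce
    then show ?thesis unfolding F_def nrml_uminus[symmetric] by simp
  qed
  have "odd (Brouwer_degree2 d F)" by (intro odd_map_odd_degree Fc FS Fodd)
  moreover have "Brouwer_degree2 d F = 0"
  proof (rule Brouwer_degree2_nonsurjective)
    show "continuous_map (nsphere d) (nsphere d) F" using Fc FS by (auto simp: nsphere_eq_Sph)
    have "(\<lambda>i. if i = d then 1 else 0) \<in> Sph d" by (auto simp: Sph_def if_distrib[of "\<lambda>x. x\<^sup>2"] cong: if_cong)
    moreover have "F x d = 0" for x by (simp add: F_def nrml_def)
    ultimately have "F ` Sph d \<noteq> Sph d" using zero_neq_one imageE by (smt (verit))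
    then show "F ` topspace (nsphere d) \<noteq> topspace (nsphere d)" by (simp add: nsphere_eq_Sph)
  qed
  ultimately show False by simp
qed

section \<open>The spaces \<open>L\<^sup>p\<close> and their duality map\<close>

lemma powr_Young:
  fixes x y :: real
  assumes "0 < q" "q < p" "0 \<le> x" "0 \<le> y"
  shows "x powr (p - q) * y powr q \<le> ((p - q) * x powr p + q * y powr p) / p"
proof (cases "x = 0 \<or> y = 0")
  case True
  then show ?thesis using assms by auto
next
  case False
  then have "x > 0" "y > 0" using assms by auto
  then have "(x powr p) powr ((p - q) / p) * (y powr p) powr (q / p) \<le> (p - q) / p * x powr p + q / p * y powr p"
    using assms by (intro Youngs_inequality_0) (auto simp: field_simps)
  then show ?thesis using assms by (simp add: powr_powr add_divide_distrib)
qed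

text \<open>Young's inequality with \<open>q = 1\<close>, rearranged. Avoiding derivatives keeps the
  boundary case \<open>x = 0\<close> inside the statement.\<close>

lemma powr_tangent:
  fixes x y :: real
  assumes "1 < s" "0 \<le> x" "0 \<le> y"
  shows "y powr s \<ge> x powr s + s * x powr (s - 1) * (y - x)"
proof -
  have "x powr (s - 1) * y powr 1 \<le> ((s - 1) * x powr s + 1 * y powr s) / s"
    using assms by (intro powr_Young) auto
  then have "s * (x powr (s - 1) * y) \<le> (s - 1) * x powr s + y powr s"
    using assms by (simp add: field_simps)
  moreover have "x powr (s - 1) * x = x powr s"
    using assms powr_mult_base[of x "s - 1"] by (simp add: mult.commute)
  ultimately show ?thesis by (simp add: algebra_simps)
qed

text \<open>Average the tangent inequalities at the mean \<open>a * x + b * y\<close>; the linear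
  terms cancel.\<close>

lemma powr_convex_combination:
  fixes x y :: real
  assumes "1 < s" "0 \<le> x" "0 \<le> y" "0 \<le> a" "0 \<le> b" "a + b = 1"
  shows "(a * x + b * y) powr s \<le> a * x powr s + b * y powr s"
proof -
  define m where "m = a * x + b * y"
  have m: "m \<ge> 0" using assms by (simp add: m_def)
  have "a * (m powr s + s * m powr (s - 1) * (x - m)) + b * (m powr s + s * m powr (s - 1) * (y - m))
     \<le> a * x powr s + b * y powr s"
    using assms m by (intro add_mono mult_left_mono powr_tangent) auto
  also have "a * (m powr s + s * m powr (s - 1) * (x - m)) + b * (m powr s + s * m powr (s - 1) * (y - m))
     = (a + b) * m powr s + s * m powr (s - 1) * (a * x + b * y - (a + b) * m)" by (simp add: algebra_simps)
  also have "\<dots> = m powr s" using assms by (simp add: m_def)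
  finally show ?thesis by (simp add: m_def)
qed

lemma powr_superadditive:
  fixes x y :: real
  assumes "1 \<le> s" "0 \<le> x" "0 \<le> y"
  shows "x powr s + y powr s \<le> (x + y) powr s"
proof (cases "x + y = 0")
  case False
  then have pos: "x + y > 0" using assms by simp
  have *: "z powr s \<le> z * (x + y) powr (s - 1)" if "0 \<le> z" "z \<le> x + y" for z
  proof (cases "z = 0")
    case False
    then have "z powr s = z * z powr (s - 1)" using that by (simp add: powr_mult_base)
    also have "\<dots> \<le> z * (x + y) powr (s - 1)" using that assms by (intro mult_left_mono powr_mono2) auto
    finally show ?thesis .
  qed simp
  have "x powr s + y powr s \<le> x * (x + y) powr (s - 1) + y * (x + y) powr (s - 1)"
    using assms by (intro add_mono *) auto
  also have "\<dots> = (x + y) * (x + y) powr (s - 1)" by (simp add: algebra_simps)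
  also have "\<dots> = (x + y) powr s" using pos by (simp add: powr_mult_base)
  finally show ?thesis .
next
  case True
  then have "x = 0" "y = 0" using assms by auto
  then show ?thesis by simp
qed

lemma norm_add_powr_le:
  assumes "0 \<le> p"
  shows "norm (a + b) powr p \<le> 2 powr p * (norm a powr p + norm b powr p)"
proof -
  have "norm (a + b) \<le> 2 * max (norm a) (norm b)" using norm_triangle_ineq[of a b] by linarith
  then have "norm (a + b) powr p \<le> (2 * max (norm a) (norm b)) powr p"
    using assms by (intro powr_mono2) auto
  also have "\<dots> = 2 powr p * max (norm a) (norm b) powr p" by (simp add: powr_mult)
  also have "\<dots> \<le> 2 powr p * (norm a powr p + norm b powr p)" by (auto simp: max_def)
  finally show ?thesis .
qed

text \<open>Superadditivity of \<open>t powr (p / 2)\<close> joins the two squares on the left, the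
  parallelogram law evaluates their sum, and convexity of the same power splits it again. At
  \<open>p = 2\<close> the parallelogram law alone is the claim.\<close>

lemma Clarkson_pointwise:
  fixes a b :: "'a::real_inner"
  assumes "2 \<le> p"
  shows "norm ((1/2) *\<^sub>R (a + b)) powr p + norm ((1/2) *\<^sub>R (a - b)) powr p \<le> (norm a powr p + norm b powr p) / 2"
proof (cases "p = 2")
  case True
  show ?thesis unfolding True by (simp add: power2_norm_eq_inner inner_add inner_diff algebra_simps)
next
  case False
  let ?m = "(1/2) *\<^sub>R (a + b)" and ?d = "(1/2) *\<^sub>R (a - b)"
  have sq: "norm x powr p = ((norm x)\<^sup>2) powr (p / 2)" for x :: 'a
    by (simp add: powr_powr flip: powr_numeral)
  have "norm ?m powr p + norm ?d powr p \<le> ((norm ?m)\<^sup>2 + (norm ?d)\<^sup>2) powr (p / 2)"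
    unfolding sq using assms by (intro powr_superadditive) auto
  also have "(norm ?m)\<^sup>2 + (norm ?d)\<^sup>2 = 1/2 * (norm a)\<^sup>2 + 1/2 * (norm b)\<^sup>2"
    by (simp add: power_mult_distrib power2_norm_eq_inner inner_add inner_diff inner_commute field_simps)
  also have "(\<dots>) powr (p / 2) \<le> 1/2 * ((norm a)\<^sup>2) powr (p / 2) + 1/2 * ((norm b)\<^sup>2) powr (p / 2)"
    using assms False by (intro powr_convex_combination) auto
  finally show ?thesis by (simp add: sq)
qed

text \<open>The gradient of \<open>norm a powr p / p\<close>; on gradients it is the flux of the
  p-Laplacian, on functions the nonlinearity of the right-hand side.\<close>

definition dual_vec :: "real \<Rightarrow> 'a::real_inner \<Rightarrow> 'a" where
  "dual_vec p a = norm a powr (p - 2) *\<^sub>R a"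

lemma dual_vec_inner_self: "dual_vec p a \<bullet> a = norm a powr p"
proof (cases "a = 0")
  case False
  then have "norm a powr (p - 2) * (norm a)\<^sup>2 = norm a powr (p - 2) * norm a powr 2" by simp
  also have "\<dots> = norm a powr p" by (simp only: powr_add[symmetric]) simp
  finally show ?thesis by (simp add: dual_vec_def power2_norm_eq_inner)
qed (simp add: dual_vec_def)

lemma norm_dual_vec: "norm (dual_vec p a) = norm a powr (p - 1)"
proof (cases "a = 0")
  case False
  then show ?thesis using powr_mult_base[of "norm a" "p - 2"] by (simp add: dual_vec_def mult.commute)
qed (simp add: dual_vec_def)

lemma dual_vec_scale: "dual_vec p (c *\<^sub>R a) = (\<bar>c\<bar> powr (p - 2) * c) *\<^sub>R dual_vec p a"
  by (simp add: dual_vec_def powr_mult)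

lemma dual_vec_tangent:
  assumes "1 < p"
  shows "norm b powr p \<ge> norm a powr p + p * (dual_vec p a \<bullet> (b - a))"
proof -
  have "dual_vec p a \<bullet> b \<le> norm a powr (p - 1) * norm b"
    using norm_cauchy_schwarz[of "dual_vec p a" b] by (simp add: norm_dual_vec)
  moreover have "norm b powr p \<ge> norm a powr p + p * norm a powr (p - 1) * (norm b - norm a)"
    using assms by (intro powr_tangent) auto
  moreover have "norm a powr (p - 1) * norm a = norm a powr p"
    using powr_mult_base[of "norm a" "p - 1"] by (simp add: mult.commute)
  ultimately show ?thesis using assms
    by (simp add: inner_diff dual_vec_inner_self right_diff_distrib mult.assoc)
     (smt (verit, best) mult_left_mono)
qed

text \<open>The product splits into the symmetric part
  \<open>(A + B) / 2 * (norm (a - b))\<^sup>2\<close> and a part that is nonnegative because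
  \<open>t powr (p - 2)\<close> is increasing. The longer vector has norm at least
  \<open>norm (a - b) / 2\<close>, which yields the constant
  \<open>2 powr (2 - p) / 2\<close>.\<close>

lemma dual_vec_monotone:
  assumes p: "2 < p"
  shows "(dual_vec p a - dual_vec p b) \<bullet> (a - b) \<ge> 2 powr (1 - p) * norm (a - b) powr p"
proof -
  let ?A = "norm a powr (p - 2)" and ?B = "norm b powr (p - 2)"
  have 1: "(dual_vec p a - dual_vec p b) \<bullet> (a - b) =
      (?A + ?B) / 2 * (norm (a - b))\<^sup>2 + (?A - ?B) * ((norm a)\<^sup>2 - (norm b)\<^sup>2) / 2"
    by (simp add: dual_vec_def power2_norm_eq_inner inner_diff inner_commute field_simps)
  have 2: "(?A - ?B) * ((norm a)\<^sup>2 - (norm b)\<^sup>2) \<ge> 0"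
  proof (cases "norm a \<le> norm b")
    case True
    then have "?A \<le> ?B" "(norm a)\<^sup>2 \<le> (norm b)\<^sup>2" using p by (auto intro!: powr_mono2 power_mono)
    then show ?thesis by (intro mult_nonpos_nonpos) auto
  next
    case False
    then have "?B \<le> ?A" "(norm b)\<^sup>2 \<le> (norm a)\<^sup>2" using p by (auto intro!: powr_mono2 power_mono)
    then show ?thesis by (intro mult_nonneg_nonneg) auto
  qed
  have "norm (a - b) / 2 \<le> max (norm a) (norm b)" using norm_triangle_ineq4[of a b] by linarith
  then have "(norm (a - b) / 2) powr (p - 2) \<le> max (norm a) (norm b) powr (p - 2)"
    using p by (intro powr_mono2) auto
  also have "\<dots> \<le> ?A + ?B" by (auto simp: max_def)
  finally have "(norm (a - b) / 2) powr (p - 2) / 2 * (norm (a - b))\<^sup>2 \<le> (?A + ?B) / 2 * (norm (a - b))\<^sup>2"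
    by (intro mult_right_mono) auto
  moreover have "(norm (a - b) / 2) powr (p - 2) / 2 * (norm (a - b))\<^sup>2 = 2 powr (1 - p) * norm (a - b) powr p"
  proof (cases "a = b")
    case False
    then have n: "norm (a - b) > 0" by simp
    have "2 powr (1 - p) = inverse (2 powr (p - 2)) / (2::real)"
      by (simp add: powr_diff powr_minus field_simps)
    moreover have "norm (a - b) powr p = norm (a - b) powr (p - 2) * (norm (a - b))\<^sup>2"
      using n by (simp add: powr_diff)
    ultimately show ?thesis using n by (simp add: powr_divide field_simps)
  qed simp
  ultimately show ?thesis using 1 2 by linarith
qed

text \<open>For the longer vector \<open>a\<close> the difference is
  \<open>A *\<^sub>R (a - b) + (A - B) *\<^sub>R b\<close>. The second part is controlled by the
  tangent inequality for the power \<open>p - 1\<close>, giving the constant \<open>p - 1\<close>,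
  and the first adds 1.\<close>

lemma dual_vec_diff_le:
  assumes p: "2 < p"
  shows "norm (dual_vec p a - dual_vec p b) \<le> p * (norm a + norm b) powr (p - 2) * norm (a - b)"
proof -
  have *: "norm (dual_vec p a - dual_vec p b) \<le> p * norm a powr (p - 2) * norm (a - b)"
    if ba: "norm b \<le> norm a" for a b :: 'a
  proof -
    let ?A = "norm a powr (p - 2)" and ?B = "norm b powr (p - 2)"
    have m: "?B \<le> ?A" using ba p by (intro powr_mono2) auto
    have "dual_vec p a - dual_vec p b = ?A *\<^sub>R (a - b) + (?A - ?B) *\<^sub>R b"
      by (simp add: dual_vec_def algebra_simps)
    then have 1: "norm (dual_vec p a - dual_vec p b) \<le> ?A * norm (a - b) + (?A - ?B) * norm b"
      using m norm_triangle_ineq[of "?A *\<^sub>R (a - b)" "(?A - ?B) *\<^sub>R b"] by simp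
    have "(?A - ?B) * norm b \<le> ?A * norm a - ?B * norm b"
      using ba by (simp add: left_diff_distrib mult_left_mono)
    also have "\<dots> = norm a powr (p - 1) - norm b powr (p - 1)"
      using powr_mult_base[of "norm a" "p - 2"] powr_mult_base[of "norm b" "p - 2"] by (simp add: mult.commute)
    also have "\<dots> \<le> (p - 1) * ?A * (norm a - norm b)"
      using powr_tangent[of "p - 1" "norm a" "norm b"] p by (simp add: algebra_simps)
    also have "\<dots> \<le> (p - 1) * ?A * norm (a - b)"
      using p by (intro mult_left_mono norm_triangle_ineq2) auto
    finally show ?thesis using 1 by (simp add: algebra_simps)
  qed
  have A: "norm a powr (p - 2) \<le> (norm a + norm b) powr (p - 2)" "norm b powr (p - 2) \<le> (norm a + norm b) powr (p - 2)"
    using p by (auto intro!: powr_mono2)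
  show ?thesis
  proof (cases "norm b \<le> norm a")
    case True
    have "p * norm a powr (p - 2) * norm (a - b) \<le> p * (norm a + norm b) powr (p - 2) * norm (a - b)"
      using A p by (intro mult_right_mono mult_left_mono) auto
    then show ?thesis using *[OF True] by linarith
  next
    case False
    have "p * norm b powr (p - 2) * norm (a - b) \<le> p * (norm a + norm b) powr (p - 2) * norm (a - b)"
      using A p by (intro mult_right_mono mult_left_mono) auto
    then show ?thesis using *[of a b] False by (simp add: norm_minus_commute)
  qed
qed

text \<open>Young's inequality for three factors with weights \<open>(p - 2) / p\<close>,
  \<open>1 / p\<close>, \<open>1 / p\<close>: replace \<open>y * z\<close> by squares and use the
  two-factor case with \<open>q = 2\<close> for each.\<close>

lemma powr_Young3:
  fixes x y z :: real
  assumes p: "2 < p" and nn: "0 \<le> x" "0 \<le> y" "0 \<le> z"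
  shows "x powr (p - 2) * y * z \<le> ((p - 2) * x powr p + y powr p + z powr p) / p"
proof -
  let ?X = "x powr (p - 2)"
  have *: "p * (?X * t\<^sup>2) \<le> (p - 2) * x powr p + 2 * t powr p" if "0 \<le> t" for t
    using powr_Young[of 2 p x t] p nn that by (simp add: le_divide_eq mult.commute)
  have "y * z \<le> (y\<^sup>2 + z\<^sup>2) / 2" using sum_squares_bound[of y z] by simp
  from mult_left_mono[OF this, of "p * ?X"] have "p * (?X * y * z) \<le> (p * (?X * y\<^sup>2) + p * (?X * z\<^sup>2)) / 2"
    using p by (simp add: algebra_simps)
  moreover have "k \<le> c + Y + Z" if "a \<le> c + 2 * Y" "b \<le> c + 2 * Z" "k \<le> (a + b) / 2" for a b c k Y Z :: real
  proof -
    have "2 * k \<le> a + b" using that(3) by simp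
    then show ?thesis using that(1,2) by argo
  qed
  ultimately have "p * (?X * y * z) \<le> (p - 2) * x powr p + y powr p + z powr p"
    using *[OF nn(2)] *[OF nn(3)] by blast
  then show ?thesis using p by (simp add: le_divide_eq mult.commute)
qed

text \<open>Functions instead of equivalence classes, with values in an arbitrary Euclidean space,
  so that scalar functions and gradient fields share one calculus.\<close>

definition LpS :: "'a measure \<Rightarrow> real \<Rightarrow> ('a \<Rightarrow> 'b::euclidean_space) set" where
  "LpS M p = {f. f \<in> borel_measurable M \<and> integrable M (\<lambda>x. norm (f x) powr p)}"

definition Lpint :: "'a measure \<Rightarrow> real \<Rightarrow> ('a \<Rightarrow> 'b::euclidean_space) \<Rightarrow> real" where
  "Lpint M p f = (\<integral>x. norm (f x) powr p \<partial>M)"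

definition Lpn :: "'a measure \<Rightarrow> real \<Rightarrow> ('a \<Rightarrow> 'b::euclidean_space) \<Rightarrow> real" where
  "Lpn M p f = Lpint M p f powr (1 / p)"

lemma LpS_measurable: "f \<in> LpS M p \<Longrightarrow> f \<in> borel_measurable M" by (simp add: LpS_def)

lemma LpS_integrable: "f \<in> LpS M p \<Longrightarrow> integrable M (\<lambda>x. norm (f x) powr p)" by (simp add: LpS_def)

lemma Lpint_nonneg: "Lpint M p f \<ge> 0" by (simp add: Lpint_def)

lemma Lpn_nonneg [simp]: "Lpn M p f \<ge> 0" by (simp add: Lpn_def)

lemma LpS_bound:
  assumes f: "f \<in> LpS M p" and p: "0 \<le> p" and g: "g \<in> borel_measurable M"
    and le: "AE x in M. norm (g x) \<le> c * norm (f x)"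
  shows "g \<in> LpS M p"
proof -
  have "AE x in M. norm (norm (g x) powr p) \<le> norm (\<bar>c\<bar> powr p * norm (f x) powr p)"
    using le
  proof eventually_elim
    case (elim x)
    then have "norm (g x) \<le> \<bar>c\<bar> * norm (f x)" by (smt (verit) mult_right_mono norm_ge_zero)
    then have "norm (g x) powr p \<le> (\<bar>c\<bar> * norm (f x)) powr p" using p by (intro powr_mono2) auto
    then show ?case by (simp add: powr_mult)
  qed
  then have "integrable M (\<lambda>x. norm (g x) powr p)"
    by (rule Bochner_Integration.integrable_bound[rotated 2]) (use LpS_integrable[OF f] g in auto)
  with g show ?thesis by (simp add: LpS_def)
qed

lemma LpS_cong_AE:
  assumes "f \<in> LpS M p" "g \<in> borel_measurable M" "AE x in M. f x = g x"
  shows "g \<in> LpS M p"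
proof -
  have "integrable M (\<lambda>x. norm (g x) powr p)"
    by (rule integrable_cong_AE_imp[OF LpS_integrable[OF assms(1)]]) (use assms in auto)
  with assms show ?thesis by (simp add: LpS_def)
qed

lemma Lpint_cong_AE:
  assumes "f \<in> borel_measurable M" "g \<in> borel_measurable M" "AE x in M. f x = g x"
  shows "Lpint M p f = Lpint M p g"
  unfolding Lpint_def by (rule integral_cong_AE) (use assms in auto)

lemma LpS_0: "(\<lambda>x. 0) \<in> LpS M p" by (simp add: LpS_def)

section \<open>Norm inequalities and completeness\<close>

context
  fixes p :: real assumes p: "2 < p"
begin

lemma Lpn_powr: "Lpn M p f powr p = Lpint M p f"
  using p Lpint_nonneg[of M p f] by (simp add: Lpn_def powr_powr)

lemma LpS_add: assumes "f \<in> LpS M p" "g \<in> LpS M p" shows "(\<lambda>x. f x + g x) \<in> LpS M p"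
proof -
  have "integrable M (\<lambda>x. norm (f x + g x) powr p)"
  proof (rule Bochner_Integration.integrable_bound)
    show "integrable M (\<lambda>x. 2 powr p * (norm (f x) powr p + norm (g x) powr p))"
      using assms by (auto simp: LpS_def)
    show "AE x in M. norm (norm (f x + g x) powr p) \<le> norm (2 powr p * (norm (f x) powr p + norm (g x) powr p))"
      using p norm_add_powr_le[of p] by auto
  qed (use assms in \<open>auto simp: LpS_def\<close>)
  then show ?thesis using assms by (auto simp: LpS_def)
qed

lemma LpS_scaleR: assumes "f \<in> LpS M p" shows "(\<lambda>x. c *\<^sub>R f x) \<in> LpS M p"
  by (rule LpS_bound[OF assms, of _ "\<bar>c\<bar>"]) (use assms p in \<open>auto simp: LpS_def\<close>)

lemma LpS_mult: fixes f :: "'a \<Rightarrow> real" assumes "f \<in> LpS M p" shows "(\<lambda>x. c * f x) \<in> LpS M p"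
  using LpS_scaleR[OF assms, of c] by simp

lemma LpS_diff: assumes "f \<in> LpS M p" "g \<in> LpS M p" shows "(\<lambda>x. f x - g x) \<in> LpS M p"
  using LpS_add[OF assms(1) LpS_scaleR[OF assms(2), of "-1"]] by simp

lemma Lpint_scaleR: "Lpint M p (\<lambda>x. c *\<^sub>R f x) = \<bar>c\<bar> powr p * Lpint M p f"
  by (simp add: Lpint_def powr_mult)

lemma Lpn_scaleR: "Lpn M p (\<lambda>x. c *\<^sub>R f x) = \<bar>c\<bar> * Lpn M p f"
  using p Lpint_nonneg[of M p f] by (simp add: Lpn_def Lpint_scaleR powr_mult powr_powr)

lemma Lpn_minus_commute: "Lpn M p (\<lambda>x. f x - g x) = Lpn M p (\<lambda>x. g x - f x)"
  by (simp add: Lpn_def Lpint_def norm_minus_commute)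

lemma Lpint_le_iff: "0 \<le> c \<Longrightarrow> Lpint M p f \<le> c powr p \<longleftrightarrow> Lpn M p f \<le> c"
proof -
  assume c: "0 \<le> c"
  have "Lpn M p f powr p \<le> c powr p \<longleftrightarrow> Lpn M p f \<le> c"
  proof
    assume "Lpn M p f powr p \<le> c powr p"
    then show "Lpn M p f \<le> c" using powr_less_mono2[of p c "Lpn M p f"] p c by force
  qed (use p Lpn_nonneg[of M p f] in \<open>auto intro: powr_mono2\<close>)
  then show ?thesis by (simp add: Lpn_powr)
qed

lemma Lpn_eq_0_iff: assumes "f \<in> LpS M p" shows "Lpn M p f = 0 \<longleftrightarrow> (AE x in M. f x = 0)"
proof -
  have "Lpn M p f = 0 \<longleftrightarrow> Lpint M p f = 0" by (simp add: Lpn_def)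
  also have "\<dots> \<longleftrightarrow> (AE x in M. norm (f x) powr p = 0)"
    unfolding Lpint_def by (rule integral_nonneg_eq_0_iff_AE) (use assms in \<open>auto simp: LpS_def\<close>)
  finally show ?thesis by simp
qed

text \<open>Convexity with weights \<open>S / (S + T)\<close> and \<open>T / (S + T)\<close> after
  dividing by upper bounds of the norms. Positive bounds instead of the norms themselves avoid a
  case distinction when a norm is zero.\<close>

lemma Minkowski_aux:
  assumes f: "f \<in> LpS M p" and g: "g \<in> LpS M p" and S: "S > 0" "Lpn M p f \<le> S" and T: "T > 0" "Lpn M p g \<le> T"
  shows "Lpn M p (\<lambda>x. f x + g x) \<le> S + T"
proof -
  define a where "a = S / (S + T)"
  define b where "b = T / (S + T)"
  have ab: "0 \<le> a" "0 \<le> b" "a + b = 1" using S T by (auto simp: a_def b_def simp flip: add_divide_distrib)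
  have aS: "(S + T) * a / S = 1" "(S + T) * b / T = 1" using S T by (auto simp: a_def b_def)
  have pt: "norm (f x + g x) powr p \<le> (S + T) powr p * (a * (norm (f x) powr p / S powr p) + b * (norm (g x) powr p / T powr p))" for x
  proof -
    have "norm (f x + g x) \<le> norm (f x) + norm (g x)" by (rule norm_triangle_ineq)
    also have "\<dots> = (S + T) * (a * (norm (f x) / S) + b * (norm (g x) / T))"
    proof -
      have "(S + T) * (a * (u / S) + b * (v / T)) = ((S + T) * a / S) * u + ((S + T) * b / T) * v" for u v
        by (simp add: algebra_simps)
      then show ?thesis using aS by simp
    qed
    finally have "norm (f x + g x) powr p \<le> ((S + T) * (a * (norm (f x) / S) + b * (norm (g x) / T))) powr p"
      using p by (intro powr_mono2) auto
    also have "\<dots> = (S + T) powr p * (a * (norm (f x) / S) + b * (norm (g x) / T)) powr p"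
      using S T ab by (intro powr_mult)
    also have "\<dots> \<le> (S + T) powr p * (a * (norm (f x) / S) powr p + b * (norm (g x) / T) powr p)"
      using S T ab p by (intro mult_left_mono powr_convex_combination) auto
    finally show ?thesis using S T by (simp add: powr_divide)
  qed
  have "Lpint M p (\<lambda>x. f x + g x) \<le> (\<integral>x. (S + T) powr p * (a * (norm (f x) powr p / S powr p) + b * (norm (g x) powr p / T powr p)) \<partial>M)"
    unfolding Lpint_def using LpS_integrable[OF LpS_add[OF f g]] LpS_integrable[OF f] LpS_integrable[OF g]
    by (intro integral_mono pt) auto
  also have "\<dots> = (S + T) powr p * (a * (Lpint M p f / S powr p) + b * (Lpint M p g / T powr p))"
    using LpS_integrable[OF f] LpS_integrable[OF g] by (simp add: Lpint_def)
  also have "\<dots> \<le> (S + T) powr p * (a * 1 + b * 1)"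
  proof (intro mult_left_mono add_mono)
    have "Lpint M p f \<le> S powr p" "Lpint M p g \<le> T powr p" using S T by (auto simp: Lpint_le_iff)
    then show "Lpint M p f / S powr p \<le> 1" "Lpint M p g / T powr p \<le> 1" using S T by auto
  qed (use ab in auto)
  finally have "Lpint M p (\<lambda>x. f x + g x) \<le> (S + T) powr p" using ab by simp
  then show ?thesis using S T by (simp add: Lpint_le_iff)
qed

lemma Minkowski:
  assumes f: "f \<in> LpS M p" and g: "g \<in> LpS M p"
  shows "Lpn M p (\<lambda>x. f x + g x) \<le> Lpn M p f + Lpn M p g"
proof (rule field_le_epsilon)
  fix e :: real assume e: "e > 0"
  have "Lpn M p (\<lambda>x. f x + g x) \<le> (Lpn M p f + e/2) + (Lpn M p g + e/2)"
    using e by (intro Minkowski_aux f g) (auto intro: add_nonneg_pos)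
  then show "Lpn M p (\<lambda>x. f x + g x) \<le> Lpn M p f + Lpn M p g + e" by simp
qed

lemma Minkowski_diff:
  assumes f: "f \<in> LpS M p" and g: "g \<in> LpS M p"
  shows "\<bar>Lpn M p f - Lpn M p g\<bar> \<le> Lpn M p (\<lambda>x. f x - g x)"
  using Minkowski[OF LpS_diff[OF f g] g] Minkowski[OF LpS_diff[OF g f] f]
  by (simp add: Lpn_minus_commute[of _ g f] abs_le_iff)

lemma Minkowski_dist:
  assumes "f \<in> LpS M p" "g \<in> LpS M p" "h \<in> LpS M p"
  shows "Lpn M p (\<lambda>x. f x - h x) \<le> Lpn M p (\<lambda>x. f x - g x) + Lpn M p (\<lambda>x. g x - h x)"
  using Minkowski[OF LpS_diff[OF assms(1,2)] LpS_diff[OF assms(2,3)]] by simp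

text \<open>The exponents are \<open>p / (p - 2)\<close>, \<open>p\<close>, \<open>p\<close>: the
  form in which differences of \<open>dual_vec\<close> are estimated.\<close>

lemma Hoelder3:
  fixes f :: "'a \<Rightarrow> 'b::euclidean_space" and g :: "'a \<Rightarrow> 'c::euclidean_space" and h :: "'a \<Rightarrow> 'd::euclidean_space"
  assumes f: "f \<in> LpS M p" and g: "g \<in> LpS M p" and h: "h \<in> LpS M p"
  shows "integrable M (\<lambda>x. norm (f x) powr (p - 2) * norm (g x) * norm (h x))" (is "integrable M ?k")
    and "(\<integral>x. norm (f x) powr (p - 2) * norm (g x) * norm (h x) \<partial>M) \<le> Lpn M p f powr (p - 2) * Lpn M p g * Lpn M p h"
proof -
  note [measurable] = LpS_measurable[OF f] LpS_measurable[OF g] LpS_measurable[OF h]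
  note int[simp] = LpS_integrable[OF f] LpS_integrable[OF g] LpS_integrable[OF h]
  show I: "integrable M ?k"
  proof (rule Bochner_Integration.integrable_bound)
    show "integrable M (\<lambda>x. ((p - 2) * norm (f x) powr p + norm (g x) powr p + norm (h x) powr p) / p)" by simp
    show "AE x in M. norm (?k x) \<le> norm (((p - 2) * norm (f x) powr p + norm (g x) powr p + norm (h x) powr p) / p)"
      using p by (auto simp: abs_mult intro!: AE_I2 order_trans[OF powr_Young3])
  qed measurable
  \<comment> \<open>Dividing by positive upper bounds \<open>A\<close>, \<open>B\<close>,
    \<open>C\<close> of the norms reduces the claim to integrating \<open>powr_Young3\<close>, whose
    weights add up to 1.\<close>
  have aux: "integral\<^sup>L M ?k \<le> A powr (p - 2) * B * C"
    if A: "A > 0" "Lpn M p f \<le> A" and B: "B > 0" "Lpn M p g \<le> B" and C: "C > 0" "Lpn M p h \<le> C" for A B C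
  proof -
    let ?D = "A powr (p - 2) * B * C"
    have D: "?D > 0" using A B C by simp
    have "integral\<^sup>L M ?k / ?D = (\<integral>x. (norm (f x) / A) powr (p - 2) * (norm (g x) / B) * (norm (h x) / C) \<partial>M)"
      using A B C by (subst integral_divide_zero[symmetric]) (simp add: powr_divide)
    also have "\<dots> \<le> (\<integral>x. ((p - 2) * (norm (f x) powr p / A powr p) + norm (g x) powr p / B powr p + norm (h x) powr p / C powr p) / p \<partial>M)"
    proof (rule integral_mono)
      show "integrable M (\<lambda>x. (norm (f x) / A) powr (p - 2) * (norm (g x) / B) * (norm (h x) / C))"
        using integrable_divide[OF I, of ?D] A B C by (simp add: powr_divide)
      show "(norm (f x) / A) powr (p - 2) * (norm (g x) / B) * (norm (h x) / C)
        \<le> ((p - 2) * (norm (f x) powr p / A powr p) + norm (g x) powr p / B powr p + norm (h x) powr p / C powr p) / p" for x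
        using powr_Young3[OF p, of "norm (f x) / A" "norm (g x) / B" "norm (h x) / C"] A B C by (simp add: powr_divide)
    qed simp
    also have "\<dots> = ((p - 2) * (Lpint M p f / A powr p) + Lpint M p g / B powr p + Lpint M p h / C powr p) / p"
      by (simp add: Lpint_def)
    also have "\<dots> \<le> ((p - 2) * 1 + 1 + 1) / p"
    proof (intro divide_right_mono add_mono mult_left_mono)
      have "Lpint M p f \<le> A powr p" "Lpint M p g \<le> B powr p" "Lpint M p h \<le> C powr p" using A B C by (auto simp: Lpint_le_iff)
      then show "Lpint M p f / A powr p \<le> 1" "Lpint M p g / B powr p \<le> 1" "Lpint M p h / C powr p \<le> 1" using A B C by auto
    qed (use p in auto)
    also have "\<dots> = 1" using p by simp
    finally show ?thesis using D by (simp add: divide_le_eq)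
  qed
  \<comment> \<open>Norms may be zero, so the bounds are taken as norm plus \<open>e\<close> and
    \<open>e\<close> tends to 0 from the right.\<close>
  let ?F = "\<lambda>e. (Lpn M p f + e) powr (p - 2) * (Lpn M p g + e) * (Lpn M p h + e)"
  have "(?F \<longlongrightarrow> (Lpn M p f + 0) powr (p - 2) * (Lpn M p g + 0) * (Lpn M p h + 0)) (at_right 0)"
    using p Lpn_nonneg[of M p f] eventually_at_right_less[of "0::real"]
    by (intro tendsto_intros tendsto_powr') (auto elim: eventually_mono)
  moreover have "\<forall>\<^sub>F e in at_right 0. integral\<^sup>L M ?k \<le> ?F e"
    using eventually_at_right_less[of "0::real"]
  proof eventually_elim
    case (elim e)
    then show ?case by (intro aux) (auto intro: add_nonneg_pos)
  qed
  ultimately show "integral\<^sup>L M ?k \<le> Lpn M p f powr (p - 2) * Lpn M p g * Lpn M p h"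
    by (intro tendsto_lowerbound[where F="at_right (0::real)" and f="?F"]) auto
qed

lemma Hoelder_dual:
  assumes f: "f \<in> LpS M p" and h: "h \<in> LpS M p"
  shows "integrable M (\<lambda>x. dual_vec p (f x) \<bullet> h x)"
    and "\<bar>\<integral>x. dual_vec p (f x) \<bullet> h x \<partial>M\<bar> \<le> Lpn M p f powr (p - 1) * Lpn M p h"
proof -
  note [measurable] = LpS_measurable[OF f] LpS_measurable[OF h]
  have le: "\<bar>dual_vec p (f x) \<bullet> h x\<bar> \<le> norm (f x) powr (p - 2) * norm (f x) * norm (h x)" for x
    using Cauchy_Schwarz_ineq2[of "dual_vec p (f x)" "h x"] by (simp add: dual_vec_def)
  show I: "integrable M (\<lambda>x. dual_vec p (f x) \<bullet> h x)"
    by (rule Bochner_Integration.integrable_bound[OF Hoelder3(1)[OF f f h]]) (use le in \<open>auto simp: dual_vec_def abs_mult\<close>)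
  have "\<bar>\<integral>x. dual_vec p (f x) \<bullet> h x \<partial>M\<bar> \<le> (\<integral>x. \<bar>dual_vec p (f x) \<bullet> h x\<bar> \<partial>M)" by (rule integral_abs_bound)
  also have "\<dots> \<le> (\<integral>x. norm (f x) powr (p - 2) * norm (f x) * norm (h x) \<partial>M)"
    using I Hoelder3(1)[OF f f h] le by (intro integral_mono) auto
  also have "\<dots> \<le> Lpn M p f powr (p - 2) * Lpn M p f * Lpn M p h" by (rule Hoelder3(2)[OF f f h])
  also have "Lpn M p f powr (p - 2) * Lpn M p f = Lpn M p f powr (p - 1)"
    using powr_mult_base[OF Lpn_nonneg, of M p f "p - 2"] by (simp add: mult.commute)
  finally show "\<bar>\<integral>x. dual_vec p (f x) \<bullet> h x \<partial>M\<bar> \<le> Lpn M p f powr (p - 1) * Lpn M p h" .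
qed

text \<open>Apply the three-factor inequality to \<open>norm f + norm g\<close>, the difference, and
  the test function.\<close>

lemma dual_diff_bound:
  assumes f: "f \<in> LpS M p" and g: "g \<in> LpS M p" and h: "h \<in> LpS M p"
  shows "\<bar>(\<integral>x. dual_vec p (f x) \<bullet> h x \<partial>M) - (\<integral>x. dual_vec p (g x) \<bullet> h x \<partial>M)\<bar>
    \<le> p * (Lpn M p f + Lpn M p g) powr (p - 2) * Lpn M p (\<lambda>x. f x - g x) * Lpn M p h"
proof -
  let ?s = "\<lambda>x. norm (f x) + norm (g x)"
  have nf: "(\<lambda>x. norm (f x)) \<in> LpS M p" "(\<lambda>x. norm (g x)) \<in> LpS M p"
    using f g by (auto simp: LpS_def)
  have s: "?s \<in> LpS M p" by (rule LpS_add[OF nf])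
  have d: "(\<lambda>x. f x - g x) \<in> LpS M p" by (rule LpS_diff[OF f g])
  let ?k = "\<lambda>x. norm (?s x) powr (p - 2) * norm (f x - g x) * norm (h x)"
  have "(\<integral>x. dual_vec p (f x) \<bullet> h x \<partial>M) - (\<integral>x. dual_vec p (g x) \<bullet> h x \<partial>M) = (\<integral>x. (dual_vec p (f x) - dual_vec p (g x)) \<bullet> h x \<partial>M)"
    using Hoelder_dual(1)[OF f h] Hoelder_dual(1)[OF g h] by (simp add: inner_diff_left)
  also have "\<bar>\<dots>\<bar> \<le> (\<integral>x. \<bar>(dual_vec p (f x) - dual_vec p (g x)) \<bullet> h x\<bar> \<partial>M)" by (rule integral_abs_bound)
  also have "\<dots> \<le> (\<integral>x. p * ?k x \<partial>M)"
  proof (rule integral_mono)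
    show "integrable M (\<lambda>x. \<bar>(dual_vec p (f x) - dual_vec p (g x)) \<bullet> h x\<bar>)"
      using Hoelder_dual(1)[OF f h] Hoelder_dual(1)[OF g h] by (simp add: inner_diff_left)
    show "integrable M (\<lambda>x. p * ?k x)" using Hoelder3(1)[OF s d h] by simp
    show "\<bar>(dual_vec p (f x) - dual_vec p (g x)) \<bullet> h x\<bar> \<le> p * ?k x" for x
    proof -
      have "\<bar>(dual_vec p (f x) - dual_vec p (g x)) \<bullet> h x\<bar> \<le> norm (dual_vec p (f x) - dual_vec p (g x)) * norm (h x)"
        by (rule Cauchy_Schwarz_ineq2)
      also have "\<dots> \<le> (p * (norm (f x) + norm (g x)) powr (p - 2) * norm (f x - g x)) * norm (h x)"
        by (intro mult_right_mono dual_vec_diff_le p) simp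
      finally show ?thesis by (simp add: mult.assoc)
    qed
  qed
  also have "\<dots> \<le> p * (Lpn M p ?s powr (p - 2) * Lpn M p (\<lambda>x. f x - g x) * Lpn M p h)"
    using Hoelder3[OF s d h] p by simp
  also have "\<dots> \<le> p * ((Lpn M p f + Lpn M p g) powr (p - 2) * Lpn M p (\<lambda>x. f x - g x) * Lpn M p h)"
  proof -
    have "Lpn M p ?s \<le> Lpn M p f + Lpn M p g"
      using Minkowski[OF nf] by (simp add: Lpn_def Lpint_def)
    then have "Lpn M p ?s powr (p - 2) \<le> (Lpn M p f + Lpn M p g) powr (p - 2)"
      using p Lpn_nonneg by (intro powr_mono2) auto
    then show ?thesis using p Lpn_nonneg by (intro mult_left_mono mult_right_mono) auto
  qed
  finally show ?thesis by (simp add: mult.assoc)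
qed

lemma Clarkson:
  assumes f: "f \<in> LpS M p" and g: "g \<in> LpS M p"
  shows "Lpint M p (\<lambda>x. (1/2) *\<^sub>R (f x + g x)) + Lpint M p (\<lambda>x. (1/2) *\<^sub>R (f x - g x)) \<le> (Lpint M p f + Lpint M p g) / 2"
proof -
  note i = LpS_integrable[OF LpS_scaleR[OF LpS_add[OF f g]], of "1/2"] LpS_integrable[OF LpS_scaleR[OF LpS_diff[OF f g]], of "1/2"]
    LpS_integrable[OF f] LpS_integrable[OF g]
  have "Lpint M p (\<lambda>x. (1/2) *\<^sub>R (f x + g x)) + Lpint M p (\<lambda>x. (1/2) *\<^sub>R (f x - g x)) =
    (\<integral>x. norm ((1/2) *\<^sub>R (f x + g x)) powr p + norm ((1/2) *\<^sub>R (f x - g x)) powr p \<partial>M)"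
    unfolding Lpint_def by (rule Bochner_Integration.integral_add[symmetric, OF i(1,2)])
  also have "\<dots> \<le> (\<integral>x. (norm (f x) powr p + norm (g x) powr p) / 2 \<partial>M)"
    using p by (intro integral_mono Bochner_Integration.integrable_add i Clarkson_pointwise integrable_divide) auto
  also have "\<dots> = (Lpint M p f + Lpint M p g) / 2"
    using i by (simp add: Lpint_def)
  finally show ?thesis .
qed

lemma dual_monotone:
  assumes f: "f \<in> LpS M p" and g: "g \<in> LpS M p"
  shows "2 powr (1 - p) * Lpint M p (\<lambda>x. f x - g x) \<le>
    (\<integral>x. dual_vec p (f x) \<bullet> (f x - g x) \<partial>M) - (\<integral>x. dual_vec p (g x) \<bullet> (f x - g x) \<partial>M)"
proof -
  have d: "(\<lambda>x. f x - g x) \<in> LpS M p" by (rule LpS_diff[OF f g])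
  have "2 powr (1 - p) * Lpint M p (\<lambda>x. f x - g x) = (\<integral>x. 2 powr (1 - p) * norm (f x - g x) powr p \<partial>M)"
    by (simp add: Lpint_def)
  also have "\<dots> \<le> (\<integral>x. dual_vec p (f x) \<bullet> (f x - g x) - dual_vec p (g x) \<bullet> (f x - g x) \<partial>M)"
    using LpS_integrable[OF d] Hoelder_dual(1)[OF f d] Hoelder_dual(1)[OF g d] dual_vec_monotone[OF p]
    by (intro integral_mono) (auto simp: inner_diff_left)
  finally show ?thesis using Hoelder_dual(1)[OF f d] Hoelder_dual(1)[OF g d] by simp
qed

lemma Lpint_tangent:
  assumes f: "f \<in> LpS M p" and g: "g \<in> LpS M p"
  shows "Lpint M p g \<ge> Lpint M p f + p * (\<integral>x. dual_vec p (f x) \<bullet> (g x - f x) \<partial>M)"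
proof -
  have d: "(\<lambda>x. g x - f x) \<in> LpS M p" by (rule LpS_diff[OF g f])
  have "(\<integral>x. norm (f x) powr p + p * (dual_vec p (f x) \<bullet> (g x - f x)) \<partial>M) \<le> Lpint M p g"
    unfolding Lpint_def using LpS_integrable[OF f] LpS_integrable[OF g] Hoelder_dual(1)[OF f d] dual_vec_tangent[of p] p
    by (intro integral_mono) auto
  then show ?thesis using LpS_integrable[OF f] Hoelder_dual(1)[OF f d] by (simp add: Lpint_def)
qed

text \<open>Riesz-Fischer: a fast subsequence converges almost everywhere, and Fatou's lemma
  compares the whole sequence with its limit.\<close>

lemma Lpn_complete:
  fixes f :: "nat \<Rightarrow> 'a \<Rightarrow> 'b::euclidean_space"
  assumes f: "\<And>n. f n \<in> LpS M p"
    and Cauchy: "\<And>e. e > 0 \<Longrightarrow> \<exists>N. \<forall>m\<ge>N. \<forall>n\<ge>N. Lpn M p (\<lambda>x. f m x - f n x) < e"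
  shows "\<exists>g. g \<in> LpS M p \<and> (\<lambda>n. Lpn M p (\<lambda>x. f n x - g x)) \<longlonglongrightarrow> 0"
proof -
  note [measurable] = LpS_measurable[OF f]
  have nn: "(\<integral>\<^sup>+x. ennreal (norm (f m x - f n x) powr p) \<partial>M) = ennreal (Lpint M p (\<lambda>x. f m x - f n x))" for m n
    unfolding Lpint_def by (rule nn_integral_eq_integral[OF LpS_integrable[OF LpS_diff[OF f f]]]) auto
  have "\<exists>N. \<forall>k. (\<forall>m\<ge>N k. \<forall>n\<ge>N k. Lpn M p (\<lambda>x. f m x - f n x) < (1/4) ^ k)"
    by (intro choice allI Cauchy) auto
  then obtain N where N: "\<And>k m n. m \<ge> N k \<Longrightarrow> n \<ge> N k \<Longrightarrow> Lpn M p (\<lambda>x. f m x - f n x) < (1/4) ^ k" by blast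
  \<comment> \<open>The sum exceeds each of \<open>N 0\<close>, ..., \<open>N k\<close>, so the
    indices \<open>r k\<close> and \<open>r (Suc k)\<close> both lie beyond \<open>N k\<close>; the
    summand \<open>k\<close> makes \<open>r\<close> unbounded.\<close>
  define r where "r k = (\<Sum>j\<le>k. N j) + k" for k
  have r1: "r k \<ge> N k" for k unfolding r_def by (rule trans_le_add1) (rule member_le_sum, auto)
  have r2: "r k \<ge> k" and r3: "r (Suc k) \<ge> N k" for k using r1[of k] by (auto simp: r_def)
  let ?d = "\<lambda>k x. norm (f (r (Suc k)) x - f (r k) x)"
  \<comment> \<open>The differences decay like \<open>4 ^ (- k)\<close>. The inserted weight
    \<open>2 ^ k\<close> leaves a summable bound, and finiteness of the weighted series at a point
    forces the differences there below a multiple of \<open>2 ^ (- k)\<close>.\<close>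
  have dk: "(\<integral>\<^sup>+x. ennreal ((2 ^ k * ?d k x) powr p) \<partial>M) \<le> ennreal ((1/2) ^ k)" for k
  proof -
    have "(\<integral>\<^sup>+x. ennreal ((2 ^ k * ?d k x) powr p) \<partial>M) = ennreal ((2 ^ k) powr p) * (\<integral>\<^sup>+x. ennreal (?d k x powr p) \<partial>M)"
      by (subst nn_integral_cmult[symmetric]) (auto simp: powr_mult ennreal_mult)
    also have "\<dots> = ennreal ((2 ^ k) powr p * Lpint M p (\<lambda>x. f (r (Suc k)) x - f (r k) x))"
      by (simp add: nn ennreal_mult Lpint_nonneg)
    also have "\<dots> \<le> ennreal ((2 ^ k) powr p * ((1/4) ^ k) powr p)"
      using N[OF r3 r1, of k] by (intro ennreal_leI mult_left_mono) (auto simp: Lpint_le_iff)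
    also have "(2 ^ k) powr p * ((1/4::real) ^ k) powr p = ((1/2) ^ k) powr p"
      by (simp flip: powr_mult power_mult_distrib)
    also have "ennreal (((1/2) ^ k) powr p) \<le> ennreal (((1/2) ^ k) powr 1)"
      using p by (intro ennreal_leI powr_mono') (auto simp: power_le_one)
    finally show ?thesis by simp
  qed
  have "(\<integral>\<^sup>+x. suminf (\<lambda>k. ennreal ((2 ^ k * ?d k x) powr p)) \<partial>M) = suminf (\<lambda>k. \<integral>\<^sup>+x. ennreal ((2 ^ k * ?d k x) powr p) \<partial>M)"
    by (rule nn_integral_suminf) auto
  also have "\<dots> \<le> suminf (\<lambda>k. ennreal ((1/2) ^ k))" by (intro suminf_le dk) auto
  also have "\<dots> = ennreal (suminf (\<lambda>k. (1/2) ^ k))" by (rule suminf_ennreal2) auto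
  finally have "(\<integral>\<^sup>+x. suminf (\<lambda>k. ennreal ((2 ^ k * ?d k x) powr p)) \<partial>M) \<noteq> \<infinity>"
    by (auto simp: top_unique)
  then have "AE x in M. suminf (\<lambda>k. ennreal ((2 ^ k * ?d k x) powr p)) \<noteq> \<infinity>"
    by (rule nn_integral_PInf_AE[rotated]) measurable
  then have conv: "AE x in M. convergent (\<lambda>k. f (r k) x)"
  proof eventually_elim
    case (elim x)
    let ?s = "suminf (\<lambda>k. ennreal ((2 ^ k * ?d k x) powr p))"
    define C where "C = enn2real ?s"
    have "?s < top_class.top" using elim by (simp only: infinity_ennreal_def less_top)
    then have C: "?s = ennreal C" "C \<ge> 0" unfolding C_def by (simp_all only: ennreal_enn2real enn2real_nonneg)
    have "(2 ^ k * ?d k x) powr p \<le> C" for k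
    proof -
      have "ennreal ((2 ^ k * ?d k x) powr p) \<le> ?s"
        by (rule order_trans[OF _ sum_le_suminf[of "\<lambda>k. ennreal ((2 ^ k * ?d k x) powr p)" "{k}"]]) auto
      then show ?thesis unfolding C(1) ennreal_le_iff[OF C(2)] .
    qed
    then have "2 ^ k * ?d k x \<le> C powr (1/p)" for k
      using powr_mono2[of "1/p" "(2 ^ k * ?d k x) powr p" C] p by (simp add: powr_powr)
    then have dle: "norm (f (r (Suc k)) x - f (r k) x) \<le> C powr (1/p) * (1/2) ^ k" for k
      by (simp add: power_divide field_simps)
    have "summable (\<lambda>k. f (r (Suc k)) x - f (r k) x)"
      by (rule summable_comparison_test'[of "\<lambda>k. C powr (1/p) * (1/2) ^ k" 0]) (use dle in \<open>auto intro: summable_mult summable_geometric\<close>)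
    then have "convergent (\<lambda>n. (\<Sum>k<n. f (r (Suc k)) x - f (r k) x) + f (r 0) x)"
      by (intro convergent_add convergent_const) (simp add: summable_iff_convergent)
    then show ?case using sum_lessThan_telescope[of "\<lambda>k. f (r k) x"] by simp
  qed
  define g where "g x = lim (\<lambda>k. f (r k) x)" for x
  have [measurable]: "g \<in> borel_measurable M" unfolding g_def by measurable
  \<comment> \<open>Only the second index passes to the limit, along the subsequence; the first may
    be any index beyond \<open>N K\<close>, so the full sequence converges.\<close>
  have fatou: "(\<integral>\<^sup>+x. ennreal (norm (f m x - g x) powr p) \<partial>M) \<le> ennreal (((1/4) ^ K) powr p)" if m: "m \<ge> N K" for m K
  proof -
    have "(\<integral>\<^sup>+x. ennreal (norm (f m x - g x) powr p) \<partial>M) = (\<integral>\<^sup>+x. liminf (\<lambda>k. ennreal (norm (f m x - f (r k) x) powr p)) \<partial>M)"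
    proof (rule nn_integral_cong_AE, use conv in eventually_elim)
      case (elim x)
      then have "(\<lambda>k. f (r k) x) \<longlonglongrightarrow> g x" by (simp add: g_def convergent_LIMSEQ_iff)
      then have "(\<lambda>k. ennreal (norm (f m x - f (r k) x) powr p)) \<longlonglongrightarrow> ennreal (norm (f m x - g x) powr p)"
        using p by (intro tendsto_ennrealI tendsto_powr' tendsto_intros) auto
      then show ?case by (rule lim_imp_Liminf[OF sequentially_bot, symmetric])
    qed
    also have "\<dots> \<le> liminf (\<lambda>k. \<integral>\<^sup>+x. ennreal (norm (f m x - f (r k) x) powr p) \<partial>M)"
      by (rule nn_integral_liminf) auto
    also have "\<dots> \<le> liminf (\<lambda>k. ennreal (((1/4) ^ K) powr p))"
    proof (rule Liminf_mono, rule eventually_sequentiallyI[of "N K"])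
      fix k assume "N K \<le> k"
      then have "Lpn M p (\<lambda>x. f m x - f (r k) x) < (1/4) ^ K" using r2[of k] by (intro N m) auto
      then show "(\<integral>\<^sup>+x. ennreal (norm (f m x - f (r k) x) powr p) \<partial>M) \<le> ennreal (((1/4) ^ K) powr p)"
        unfolding nn by (intro ennreal_leI) (simp add: Lpint_le_iff)
    qed
    also have "\<dots> = ennreal (((1/4) ^ K) powr p)" by (simp add: Liminf_const)
    finally show ?thesis .
  qed
  have fg: "(\<lambda>x. f m x - g x) \<in> LpS M p" if m: "m \<ge> N K" for m K
  proof -
    have "integrable M (\<lambda>x. norm (f m x - g x) powr p)"
    proof (rule integrableI_bounded)
      show "(\<integral>\<^sup>+x. ennreal (norm (norm (f m x - g x) powr p)) \<partial>M) < \<infinity>"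
        using fatou[OF m] by (simp add: order_le_less_trans)
    qed measurable
    then show ?thesis by (simp add: LpS_def)
  qed
  have fgn: "Lpn M p (\<lambda>x. f m x - g x) \<le> (1/4) ^ K" if m: "m \<ge> N K" for m K
  proof -
    have "ennreal (Lpint M p (\<lambda>x. f m x - g x)) \<le> ennreal (((1/4) ^ K) powr p)"
      using fatou[OF m] LpS_integrable[OF fg[OF m]] unfolding Lpint_def by (subst (asm) nn_integral_eq_integral) auto
    then show ?thesis by (simp add: ennreal_le_iff Lpint_le_iff)
  qed
  have "g \<in> LpS M p" using LpS_diff[OF f fg[OF order_refl], of "N 0" 0] by simp
  moreover have "(\<lambda>n. Lpn M p (\<lambda>x. f n x - g x)) \<longlonglongrightarrow> 0"
  proof (rule LIMSEQ_I)
    fix e :: real assume "e > 0"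
    then obtain K where K: "(1/4) ^ K < e" using real_arch_pow_inv[of e "1/4"] by auto
    have "norm (Lpn M p (\<lambda>x. f n x - g x) - 0) < e" if "n \<ge> N K" for n
      using order_le_less_trans[OF fgn[OF that] K] Lpn_nonneg[of M p "\<lambda>x. f n x - g x"] by simp
    then show "\<exists>no. \<forall>n\<ge>no. norm (Lpn M p (\<lambda>x. f n x - g x) - 0) < e" by blast
  qed
  ultimately show ?thesis by blast
qed

end

section \<open>Eigenpairs by inverse iteration\<close>

lemma Lpn_sum_le:
  fixes f :: "'i \<Rightarrow> 'a \<Rightarrow> 'b::euclidean_space"
  assumes p: "2 < p" and "finite I" and "\<And>i. i \<in> I \<Longrightarrow> f i \<in> LpS M p"
  shows "(\<lambda>x. \<Sum>i\<in>I. c i *\<^sub>R f i x) \<in> LpS M p \<and> Lpn M p (\<lambda>x. \<Sum>i\<in>I. c i *\<^sub>R f i x) \<le> (\<Sum>i\<in>I. \<bar>c i\<bar> * Lpn M p (f i))"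
  using assms(2,3)
proof (induction I)
  case empty
  have "Lpn M p (\<lambda>x. 0::'b) = 0" using p by (simp add: Lpn_def Lpint_def)
  then show ?case by (simp add: LpS_0)
next
  case (insert i I)
  then have IH: "(\<lambda>x. \<Sum>i\<in>I. c i *\<^sub>R f i x) \<in> LpS M p"
     "Lpn M p (\<lambda>x. \<Sum>i\<in>I. c i *\<^sub>R f i x) \<le> (\<Sum>i\<in>I. \<bar>c i\<bar> * Lpn M p (f i))" by auto
  have s: "(\<lambda>x. c i *\<^sub>R f i x) \<in> LpS M p" using insert by (intro LpS_scaleR p) auto
  show ?case using insert.hyps Minkowski[OF p s IH(1)] LpS_add[OF p s IH(1)] IH(2) p
    by (simp add: Lpn_scaleR)
qed

text \<open>The assumption \<open>finite_rank\<close> is the compactness of the embedding of the energy space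
  into \<open>L\<^sup>p(\<mu>)\<close>, in the form in which it meets the Borsuk-Ulam theorem.\<close>

locale lp_variational =
  fixes p :: real and \<nu> \<mu> :: "'a measure" and V :: "('a \<Rightarrow> real) set"
    and D :: "('a \<Rightarrow> real) \<Rightarrow> 'a \<Rightarrow> 'b::euclidean_space" and CP Cm :: real
  assumes p: "2 < p"
    and V_lin: "\<And>\<phi> \<psi> a b. \<phi> \<in> V \<Longrightarrow> \<psi> \<in> V \<Longrightarrow> (\<lambda>x. a * \<phi> x + b * \<psi> x) \<in> V"
    and D_lin: "\<And>\<phi> \<psi> a b x. \<phi> \<in> V \<Longrightarrow> \<psi> \<in> V \<Longrightarrow> D (\<lambda>x. a * \<phi> x + b * \<psi> x) x = a *\<^sub>R D \<phi> x + b *\<^sub>R D \<psi> x"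
    and V_LpS: "\<And>\<phi>. \<phi> \<in> V \<Longrightarrow> \<phi> \<in> LpS \<nu> p"
    and D_LpS: "\<And>\<phi>. \<phi> \<in> V \<Longrightarrow> D \<phi> \<in> LpS \<nu> p"
    and CP: "CP > 0"
    and poincare: "\<And>\<phi>. \<phi> \<in> V \<Longrightarrow> Lpn \<nu> p \<phi> \<le> CP * Lpn \<nu> p (D \<phi>)"
    and Cm: "Cm > 0"
    and mu_LpS: "\<And>f :: 'a \<Rightarrow> real. f \<in> LpS \<nu> p \<Longrightarrow> f \<in> LpS \<mu> p"
    and mu_le: "\<And>f :: 'a \<Rightarrow> real. f \<in> LpS \<nu> p \<Longrightarrow> Lpn \<mu> p f \<le> Cm * Lpn \<nu> p f"
    and finite_rank: "\<And>e. e > 0 \<Longrightarrow> \<exists>(d::nat) K (l :: nat \<Rightarrow> ('a \<Rightarrow> real) \<Rightarrow> real). K \<ge> 0 \<and>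
        (\<forall>i f g a b. f \<in> LpS \<nu> p \<longrightarrow> g \<in> LpS \<nu> p \<longrightarrow> l i (\<lambda>x. a * f x + b * g x) = a * l i f + b * l i g) \<and>
        (\<forall>i f. f \<in> LpS \<nu> p \<longrightarrow> \<bar>l i f\<bar> \<le> K * Lpn \<nu> p f) \<and>
        (\<forall>\<phi>\<in>V. Lpn \<mu> p \<phi> \<le> e * Lpn \<nu> p (D \<phi>) + K * (\<Sum>i<d. \<bar>l i \<phi>\<bar>))"
    and infinite_dim: "\<And>d. \<exists>\<psi> :: nat \<Rightarrow> 'a \<Rightarrow> real. (\<forall>i. \<psi> i \<in> V) \<and>
        (\<forall>c. (\<exists>i\<le>d. c i \<noteq> 0) \<longrightarrow> Lpn \<mu> p (\<lambda>x. \<Sum>i\<le>d. c i *\<^sub>R \<psi> i x) > 0)"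
begin

text \<open>The closure of the graph of \<open>D\<close> in two copies of \<open>L^p(\<nu>)\<close>.
  Keeping the limit gradient as a separate component dispenses with showing that \<open>D\<close> is
  closable.\<close>

definition E :: "(('a \<Rightarrow> real) \<times> ('a \<Rightarrow> 'b)) set" where
  "E = {(u, g). u \<in> LpS \<nu> p \<and> g \<in> LpS \<nu> p \<and>
     (\<forall>e>0. \<exists>\<phi>\<in>V. Lpn \<nu> p (\<lambda>x. u x - \<phi> x) < e \<and> Lpn \<nu> p (\<lambda>x. g x - D \<phi> x) < e)}"

text \<open>Together with \<open>B\<close>, the derivatives of the functionals
  \<open>Lpint \<nu> p g / p\<close> and \<open>Lpint \<mu> p f / p\<close>: linear in the second
  argument, homogeneous of degree \<open>p - 1\<close> in the first.\<close>

definition A :: "('a \<Rightarrow> 'b) \<Rightarrow> ('a \<Rightarrow> 'b) \<Rightarrow> real" where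
  "A g h = (\<integral>x. dual_vec p (g x) \<bullet> h x \<partial>\<nu>)"

definition B :: "('a \<Rightarrow> real) \<Rightarrow> ('a \<Rightarrow> real) \<Rightarrow> real" where
  "B f h = (\<integral>x. dual_vec p (f x) \<bullet> h x \<partial>\<mu>)"

abbreviation "nu_n \<equiv> Lpn \<nu> p"
abbreviation "mu_n \<equiv> Lpn \<mu> p"

section \<open>The energy space: linearity, Poincare inequality, completeness, compactness\<close>

lemma E_D: "(u, g) \<in> E \<Longrightarrow> u \<in> LpS \<nu> p" "(u, g) \<in> E \<Longrightarrow> g \<in> LpS \<nu> p" "(u, g) \<in> E \<Longrightarrow> u \<in> LpS \<mu> p"
  by (auto simp: E_def mu_LpS)

lemma E_approx:
  assumes "(u, g) \<in> E" "e > 0"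
  obtains \<phi> where "\<phi> \<in> V" "nu_n (\<lambda>x. u x - \<phi> x) < e" "nu_n (\<lambda>x. g x - D \<phi> x) < e"
  using assms by (auto simp: E_def)

lemma V_in_E: "\<phi> \<in> V \<Longrightarrow> (\<phi>, D \<phi>) \<in> E"
  unfolding E_def using V_LpS D_LpS by (auto simp: Lpn_def Lpint_def intro!: bexI[of _ \<phi>])

lemma Lpn_lincomb_le:
  fixes f g :: "'a \<Rightarrow> 'c::euclidean_space"
  assumes "f \<in> LpS M p" "g \<in> LpS M p"
  shows "Lpn M p (\<lambda>x. a *\<^sub>R f x + b *\<^sub>R g x) \<le> \<bar>a\<bar> * Lpn M p f + \<bar>b\<bar> * Lpn M p g"
  using Minkowski[OF p LpS_scaleR[OF p assms(1), of a] LpS_scaleR[OF p assms(2), of b]] p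
  by (simp add: Lpn_scaleR)

lemma E_lin:
  assumes z: "(u, g) \<in> E" and w: "(v, h) \<in> E"
  shows "((\<lambda>x. a * u x + b * v x), (\<lambda>x. a *\<^sub>R g x + b *\<^sub>R h x)) \<in> E"
proof -
  note L = E_D[OF z] E_D[OF w]
  have "(\<lambda>x. a * u x + b * v x) \<in> LpS \<nu> p" "(\<lambda>x. a *\<^sub>R g x + b *\<^sub>R h x) \<in> LpS \<nu> p"
    using L by (auto intro!: LpS_add LpS_scaleR LpS_mult p)
  moreover have "\<exists>\<phi>\<in>V. nu_n (\<lambda>x. a * u x + b * v x - \<phi> x) < e \<and> nu_n (\<lambda>x. a *\<^sub>R g x + b *\<^sub>R h x - D \<phi> x) < e" if e: "e > 0" for e
  proof -
    define c where "c = e / (\<bar>a\<bar> + \<bar>b\<bar> + 1)"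
    have c: "c > 0" using e by (simp add: c_def)
    have "c * (\<bar>a\<bar> + \<bar>b\<bar> + 1) = e" by (simp add: c_def)
    then have ce: "\<bar>a\<bar> * c + \<bar>b\<bar> * c < e" using c by (simp add: algebra_simps)
    obtain \<phi> where \<phi>: "\<phi> \<in> V" "nu_n (\<lambda>x. u x - \<phi> x) < c" "nu_n (\<lambda>x. g x - D \<phi> x) < c" by (rule E_approx[OF z c])
    obtain \<psi> where \<psi>: "\<psi> \<in> V" "nu_n (\<lambda>x. v x - \<psi> x) < c" "nu_n (\<lambda>x. h x - D \<psi> x) < c" by (rule E_approx[OF w c])
    have "nu_n (\<lambda>x. a * u x + b * v x - (a * \<phi> x + b * \<psi> x)) = nu_n (\<lambda>x. a *\<^sub>R (u x - \<phi> x) + b *\<^sub>R (v x - \<psi> x))"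
      by (simp add: algebra_simps)
    also have "\<dots> \<le> \<bar>a\<bar> * nu_n (\<lambda>x. u x - \<phi> x) + \<bar>b\<bar> * nu_n (\<lambda>x. v x - \<psi> x)"
      by (intro Lpn_lincomb_le LpS_diff[OF p]) (use L \<phi> \<psi> V_LpS in auto)
    also have "\<dots> \<le> \<bar>a\<bar> * c + \<bar>b\<bar> * c" using \<phi> \<psi> by (intro add_mono mult_left_mono) auto
    finally have 1: "nu_n (\<lambda>x. a * u x + b * v x - (a * \<phi> x + b * \<psi> x)) < e" using ce by simp
    have "nu_n (\<lambda>x. a *\<^sub>R g x + b *\<^sub>R h x - D (\<lambda>x. a * \<phi> x + b * \<psi> x) x) = nu_n (\<lambda>x. a *\<^sub>R (g x - D \<phi> x) + b *\<^sub>R (h x - D \<psi> x))"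
      using \<phi> \<psi> by (simp add: D_lin algebra_simps)
    also have "\<dots> \<le> \<bar>a\<bar> * nu_n (\<lambda>x. g x - D \<phi> x) + \<bar>b\<bar> * nu_n (\<lambda>x. h x - D \<psi> x)"
      by (intro Lpn_lincomb_le LpS_diff[OF p]) (use L \<phi> \<psi> D_LpS in auto)
    also have "\<dots> \<le> \<bar>a\<bar> * c + \<bar>b\<bar> * c" using \<phi> \<psi> by (intro add_mono mult_left_mono) auto
    finally have 2: "nu_n (\<lambda>x. a *\<^sub>R g x + b *\<^sub>R h x - D (\<lambda>x. a * \<phi> x + b * \<psi> x) x) < e" using ce by simp
    show ?thesis using 1 2 by (intro bexI[of _ "\<lambda>x. a * \<phi> x + b * \<psi> x"] conjI V_lin \<phi>(1) \<psi>(1))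
  qed
  ultimately show ?thesis by (simp add: E_def)
qed

lemma E_diff: "(u, g) \<in> E \<Longrightarrow> (v, h) \<in> E \<Longrightarrow> ((\<lambda>x. u x - v x), (\<lambda>x. g x - h x)) \<in> E"
  using E_lin[of u g v h 1 "-1"] by simp

lemma E_scale: "(u, g) \<in> E \<Longrightarrow> ((\<lambda>x. a * u x), (\<lambda>x. a *\<^sub>R g x)) \<in> E"
  using E_lin[of u g u g a 0] by simp

lemma Lpn_diff_le2:
  fixes f g :: "'a \<Rightarrow> 'c::euclidean_space"
  assumes "f \<in> LpS M p" "g \<in> LpS M p"
  shows "Lpn M p f \<le> Lpn M p g + Lpn M p (\<lambda>x. f x - g x)"
  using Minkowski_diff[OF p assms] by linarith

lemma E_poincare:
  assumes z: "(u, g) \<in> E"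
  shows "nu_n u \<le> CP * nu_n g"
proof (rule field_le_epsilon)
  fix e :: real assume e: "e > 0"
  define c where "c = e / (1 + CP)"
  have "c * (1 + CP) = e" using CP by (simp add: c_def)
  then have "c + CP * c = e" by (simp add: algebra_simps)
  moreover have "c > 0" using e CP by (simp add: c_def)
  ultimately have c: "c > 0" "c + CP * c = e" by auto
  obtain \<phi> where \<phi>: "\<phi> \<in> V" "nu_n (\<lambda>x. u x - \<phi> x) < c" "nu_n (\<lambda>x. g x - D \<phi> x) < c" by (rule E_approx[OF z c(1)])
  have "nu_n u \<le> nu_n \<phi> + c" using Lpn_diff_le2[OF E_D(1)[OF z] V_LpS[OF \<phi>(1)]] \<phi> by simp
  also have "nu_n \<phi> \<le> CP * nu_n (D \<phi>)" by (rule poincare[OF \<phi>(1)])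
  also have "nu_n (D \<phi>) \<le> nu_n g + c"
    using Lpn_diff_le2[OF D_LpS[OF \<phi>(1)] E_D(2)[OF z]] \<phi> by (simp add: Lpn_minus_commute[of _ _ "D \<phi>"] p)
  finally show "nu_n u \<le> CP * nu_n g + e" using c CP by (simp add: algebra_simps)
qed

lemma E_mu_le: "(u, g) \<in> E \<Longrightarrow> mu_n u \<le> Cm * CP * nu_n g"
proof -
  assume z: "(u, g) \<in> E"
  have "mu_n u \<le> Cm * nu_n u" by (rule mu_le[OF E_D(1)[OF z]])
  also have "\<dots> \<le> Cm * (CP * nu_n g)" using E_poincare[OF z] Cm by simp
  finally show ?thesis by (simp add: mult.assoc)
qed

text \<open>The inequality passes from \<open>V\<close> to its closure because the functionals are
  bounded on all of \<open>L^p(\<nu>)\<close>.\<close>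

lemma E_finite_rank:
  assumes e: "e > 0"
  shows "\<exists>(d::nat) K (l :: nat \<Rightarrow> ('a \<Rightarrow> real) \<Rightarrow> real). K \<ge> 0 \<and>
        (\<forall>i f g a b. f \<in> LpS \<nu> p \<longrightarrow> g \<in> LpS \<nu> p \<longrightarrow> l i (\<lambda>x. a * f x + b * g x) = a * l i f + b * l i g) \<and>
        (\<forall>i f. f \<in> LpS \<nu> p \<longrightarrow> \<bar>l i f\<bar> \<le> K * nu_n f) \<and>
        (\<forall>(u, g)\<in>E. mu_n u \<le> e * nu_n g + K * (\<Sum>i<d. \<bar>l i u\<bar>))"
proof -
  obtain d K and l :: "nat \<Rightarrow> ('a \<Rightarrow> real) \<Rightarrow> real" where K: "K \<ge> 0"
    and lin: "\<forall>i f g a b. f \<in> LpS \<nu> p \<longrightarrow> g \<in> LpS \<nu> p \<longrightarrow> l i (\<lambda>x. a * f x + b * g x) = a * l i f + b * l i g"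
    and bd: "\<forall>i f. f \<in> LpS \<nu> p \<longrightarrow> \<bar>l i f\<bar> \<le> K * nu_n f"
    and fr: "\<forall>\<phi>\<in>V. mu_n \<phi> \<le> e * nu_n (D \<phi>) + K * (\<Sum>i<d. \<bar>l i \<phi>\<bar>)"
    using finite_rank[OF e] by (elim exE conjE) (rule that)
  have "mu_n u \<le> e * nu_n g + K * (\<Sum>i<d. \<bar>l i u\<bar>)" if z: "(u, g) \<in> E" for u g
  proof (rule field_le_epsilon)
    fix s :: real assume s: "s > 0"
    \<comment> \<open>Replacing \<open>u\<close> by a close test function costs
      \<open>Cm * c\<close> in \<open>\<mu>\<close>, \<open>e * c\<close> in the gradient and
      \<open>K * c\<close> in each of the \<open>d\<close> functionals; the denominator makes the
      total equal to \<open>s\<close>.\<close>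
    define c where "c = s / (Cm + e + K * d * K)"
    have dn: "Cm + e + K * d * K > 0" using Cm e K by (simp add: add_pos_nonneg)
    have "c * (Cm + e + K * d * K) = s" using dn by (simp add: c_def)
    then have "Cm * c + e * c + K * d * (K * c) = s" by (simp add: algebra_simps)
    moreover have "c > 0" using s dn by (simp add: c_def)
    ultimately have c: "c > 0" "Cm * c + e * c + K * d * (K * c) = s" by auto
    obtain \<phi> where \<phi>: "\<phi> \<in> V" "nu_n (\<lambda>x. u x - \<phi> x) < c" "nu_n (\<lambda>x. g x - D \<phi> x) < c" by (rule E_approx[OF z c(1)])
    note L = E_D[OF z] V_LpS[OF \<phi>(1)] D_LpS[OF \<phi>(1)]
    have 1: "mu_n u \<le> mu_n \<phi> + Cm * c"
    proof -
      have "mu_n u \<le> mu_n \<phi> + mu_n (\<lambda>x. u x - \<phi> x)" by (rule Lpn_diff_le2) (use L mu_LpS in auto)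
      also have "mu_n (\<lambda>x. u x - \<phi> x) \<le> Cm * nu_n (\<lambda>x. u x - \<phi> x)" by (intro mu_le LpS_diff p L)
      also have "\<dots> \<le> Cm * c" using \<phi> Cm by (intro mult_left_mono) auto
      finally show ?thesis by simp
    qed
    have 2: "nu_n (D \<phi>) \<le> nu_n g + c"
      using Lpn_diff_le2[OF L(5) L(2)] \<phi> by (simp add: Lpn_minus_commute[of _ _ "D \<phi>"] p)
    have 3: "\<bar>l i \<phi>\<bar> \<le> \<bar>l i u\<bar> + K * c" for i
    proof -
      have "l i \<phi> = l i (\<lambda>x. 1 * u x + (-1) * (u x - \<phi> x))" by simp
      also have "\<dots> = 1 * l i u + (-1) * l i (\<lambda>x. u x - \<phi> x)"
        using lin L(1) LpS_diff[OF p L(1) L(4)] by blast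
      finally have "\<bar>l i \<phi>\<bar> \<le> \<bar>l i u\<bar> + \<bar>l i (\<lambda>x. u x - \<phi> x)\<bar>" by simp
      also have "\<bar>l i (\<lambda>x. u x - \<phi> x)\<bar> \<le> K * nu_n (\<lambda>x. u x - \<phi> x)" using bd LpS_diff[OF p L(1) L(4)] by blast
      also have "\<dots> \<le> K * c" using \<phi> K by (intro mult_left_mono) auto
      finally show ?thesis by simp
    qed
    have "mu_n u \<le> e * nu_n (D \<phi>) + K * (\<Sum>i<d. \<bar>l i \<phi>\<bar>) + Cm * c" using fr \<phi>(1) 1 by force
    also have "\<dots> \<le> e * (nu_n g + c) + K * (\<Sum>i<d. \<bar>l i u\<bar> + K * c) + Cm * c"
      using e K Cm 2 3 by (intro add_mono mult_left_mono sum_mono) auto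
    also have "\<dots> = e * nu_n g + K * (\<Sum>i<d. \<bar>l i u\<bar>) + (Cm * c + e * c + K * d * (K * c))"
      by (simp add: sum.distrib algebra_simps)
    finally show "mu_n u \<le> e * nu_n g + K * (\<Sum>i<d. \<bar>l i u\<bar>) + s" using c by simp
  qed
  with K lin bd show ?thesis by (intro exI[of _ d] exI[of _ K] exI[of _ l]) auto
qed

text \<open>By the Poincare inequality the functions follow their gradients, so only the gradients
  need to be Cauchy.\<close>

lemma E_complete:
  assumes z: "\<And>n::nat. (u n, g n) \<in> E"
    and Cauchy: "\<And>e. e > 0 \<Longrightarrow> \<exists>N. \<forall>m\<ge>N. \<forall>n\<ge>N. nu_n (\<lambda>x. g m x - g n x) < e"
  shows "\<exists>v h. (v, h) \<in> E \<and> (\<lambda>n. nu_n (\<lambda>x. u n x - v x)) \<longlonglongrightarrow> 0 \<and> (\<lambda>n. nu_n (\<lambda>x. g n x - h x)) \<longlonglongrightarrow> 0"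
proof -
  have "\<exists>h. h \<in> LpS \<nu> p \<and> (\<lambda>n. nu_n (\<lambda>x. g n x - h x)) \<longlonglongrightarrow> 0"
    by (rule Lpn_complete[OF p], rule E_D(2)[OF z], rule Cauchy)
  then obtain h where h: "h \<in> LpS \<nu> p" "(\<lambda>n. nu_n (\<lambda>x. g n x - h x)) \<longlonglongrightarrow> 0" by (elim exE conjE)
  have "\<exists>N. \<forall>m\<ge>N. \<forall>n\<ge>N. nu_n (\<lambda>x. u m x - u n x) < e" if e: "e > 0" for e
  proof -
    have "e / CP > 0" using e CP by simp
    from Cauchy[OF this] obtain N where N: "\<forall>m\<ge>N. \<forall>n\<ge>N. nu_n (\<lambda>x. g m x - g n x) < e / CP" ..
    have "nu_n (\<lambda>x. u m x - u n x) < e" if "m \<ge> N" "n \<ge> N" for m n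
    proof -
      have "nu_n (\<lambda>x. u m x - u n x) \<le> CP * nu_n (\<lambda>x. g m x - g n x)"
        by (rule E_poincare[OF E_diff[OF z[of m] z[of n]]])
      also have "\<dots> < CP * (e / CP)" using N that CP by (intro mult_strict_left_mono) auto
      finally show ?thesis using CP by simp
    qed
    then show ?thesis by blast
  qed
  note Cu = this
  have "\<exists>v. v \<in> LpS \<nu> p \<and> (\<lambda>n. nu_n (\<lambda>x. u n x - v x)) \<longlonglongrightarrow> 0"
    by (rule Lpn_complete[OF p], rule E_D(1)[OF z], rule Cu)
  then obtain v where v: "v \<in> LpS \<nu> p" "(\<lambda>n. nu_n (\<lambda>x. u n x - v x)) \<longlonglongrightarrow> 0" by (elim exE conjE)
  have "\<exists>\<phi>\<in>V. nu_n (\<lambda>x. v x - \<phi> x) < e \<and> nu_n (\<lambda>x. h x - D \<phi> x) < e" if e: "e > 0" for e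
  proof -
    have e2: "e / 2 > 0" using e by simp
    have "\<forall>\<^sub>F n in sequentially. nu_n (\<lambda>x. u n x - v x) < e/2 \<and> nu_n (\<lambda>x. g n x - h x) < e/2"
      by (intro eventually_conj order_tendstoD(2)[OF v(2) e2] order_tendstoD(2)[OF h(2) e2])
    then obtain n where n: "nu_n (\<lambda>x. u n x - v x) < e/2" "nu_n (\<lambda>x. g n x - h x) < e/2"
      by (auto simp: eventually_sequentially)
    obtain \<phi> where \<phi>: "\<phi> \<in> V" "nu_n (\<lambda>x. u n x - \<phi> x) < e/2" "nu_n (\<lambda>x. g n x - D \<phi> x) < e/2" by (rule E_approx[OF z[of n] e2])
    have "nu_n (\<lambda>x. v x - \<phi> x) < e"
      using Minkowski_dist[OF p v(1) E_D(1)[OF z[of n]] V_LpS[OF \<phi>(1)]] n \<phi> by (simp add: Lpn_minus_commute[of _ _ v] p)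
    moreover have "nu_n (\<lambda>x. h x - D \<phi> x) < e"
      using Minkowski_dist[OF p h(1) E_D(2)[OF z[of n]] D_LpS[OF \<phi>(1)]] n \<phi> by (simp add: Lpn_minus_commute[of _ _ h] p)
    ultimately show ?thesis using \<phi>(1) by blast
  qed
  then have "(v, h) \<in> E" using v h by (simp add: E_def)
  then show ?thesis using v h by blast
qed

text \<open>For each accuracy \<open>1 / Suc m\<close> finitely many functionals control the
  \<open>\<mu>\<close>-norm. A subsequence along which all these countably many values converge is
  Cauchy in \<open>L^p(\<mu>)\<close>.\<close>

lemma E_compact:
  assumes z: "\<And>n::nat. (u n, g n) \<in> E" and R: "\<And>n. nu_n (g n) \<le> R"
  shows "\<exists>r v. strict_mono r \<and> v \<in> LpS \<mu> p \<and> (\<lambda>n. mu_n (\<lambda>x. u (r n) x - v x)) \<longlonglongrightarrow> 0"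
proof -
  have "\<forall>m::nat. \<exists>(d::nat) K (l :: nat \<Rightarrow> ('a \<Rightarrow> real) \<Rightarrow> real). K \<ge> 0 \<and>
        (\<forall>i f g a b. f \<in> LpS \<nu> p \<longrightarrow> g \<in> LpS \<nu> p \<longrightarrow> l i (\<lambda>x. a * f x + b * g x) = a * l i f + b * l i g) \<and>
        (\<forall>i f. f \<in> LpS \<nu> p \<longrightarrow> \<bar>l i f\<bar> \<le> K * nu_n f) \<and>
        (\<forall>(u, g)\<in>E. mu_n u \<le> (1 / Suc m) * nu_n g + K * (\<Sum>i<d. \<bar>l i u\<bar>))"
    by (intro allI E_finite_rank) simp
  then obtain d :: "nat \<Rightarrow> nat" and K :: "nat \<Rightarrow> real" and l :: "nat \<Rightarrow> nat \<Rightarrow> ('a \<Rightarrow> real) \<Rightarrow> real" where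
    dKl: "\<forall>m. K m \<ge> 0 \<and>
        (\<forall>i f g a b. f \<in> LpS \<nu> p \<longrightarrow> g \<in> LpS \<nu> p \<longrightarrow> l m i (\<lambda>x. a * f x + b * g x) = a * l m i f + b * l m i g) \<and>
        (\<forall>i f. f \<in> LpS \<nu> p \<longrightarrow> \<bar>l m i f\<bar> \<le> K m * nu_n f) \<and>
        (\<forall>(u, g)\<in>E. mu_n u \<le> (1 / Suc m) * nu_n g + K m * (\<Sum>i<d m. \<bar>l m i u\<bar>))"
    by (simp only: choice_iff) (elim exE, rule that)
  have K: "K m \<ge> 0" and lin: "f \<in> LpS \<nu> p \<Longrightarrow> g \<in> LpS \<nu> p \<Longrightarrow> l m i (\<lambda>x. a * f x + b * g x) = a * l m i f + b * l m i g"
    and bd: "f \<in> LpS \<nu> p \<Longrightarrow> \<bar>l m i f\<bar> \<le> K m * nu_n f"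
    and fr: "(v, h) \<in> E \<Longrightarrow> mu_n v \<le> (1 / Suc m) * nu_n h + K m * (\<Sum>i<d m. \<bar>l m i v\<bar>)"
    for m f g i a b v h using dKl by blast+
  \<comment> \<open>Pairs of accuracy and functional are packed into one index, so that sequential
    compactness of a single product of intervals replaces a diagonal argument.\<close>
  define s where "s n j = l (fst (prod_decode j)) (snd (prod_decode j)) (u n)" for n j
  define b where "b j = K (fst (prod_decode j)) * (CP * R)" for j
  have sb: "s n \<in> PiE UNIV (\<lambda>j. {- b j..b j})" for n
  proof -
    have "\<bar>s n j\<bar> \<le> b j" for j
    proof -
      have "\<bar>s n j\<bar> \<le> K (fst (prod_decode j)) * nu_n (u n)" unfolding s_def by (rule bd[OF E_D(1)[OF z]])
      also have "nu_n (u n) \<le> CP * nu_n (g n)" by (rule E_poincare[OF z])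
      also have "\<dots> \<le> CP * R" using R CP by simp
      finally show ?thesis using K by (simp add: b_def mult_left_mono)
    qed
    then show ?thesis by (auto simp: abs_le_iff minus_le_iff)
  qed
  have "compactin (product_topology (\<lambda>i. euclidean) UNIV) (PiE UNIV (\<lambda>j. {- b j..b j}))"
    by (simp add: compactin_PiE)
  then have "compact (PiE UNIV (\<lambda>j. {- b j..b j}))" by (simp add: euclidean_product_topology)
  then have "seq_compact (PiE UNIV (\<lambda>j. {- b j..b j}))" by (simp add: compact_eq_seq_compact_metric)
  with sb obtain y r where r: "strict_mono r" and lim: "(s \<circ> r) \<longlonglongrightarrow> y" unfolding seq_compact_def by blast
  have limc: "(\<lambda>n. s (r n) j) \<longlonglongrightarrow> y j" for j
    using continuous_on_tendsto_compose[OF continuous_on_product_coordinates[of j] lim] by (simp add: o_def)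
  have Cau: "\<exists>N. \<forall>m\<ge>N. \<forall>n\<ge>N. mu_n (\<lambda>x. u (r m) x - u (r n) x) < e" if e: "e > 0" for e
  proof -
    \<comment> \<open>The gradients of differences are bounded by \<open>2 * \<bar>R\<bar>\<close>;
      this accuracy brings their contribution below \<open>e / 2\<close>, and the functionals supply
      the other half.\<close>
    obtain k where "2 * \<bar>R\<bar> / e * 2 < real k" using reals_Archimedean2 by blast
    then have k: "2 * \<bar>R\<bar> / e * 2 < real (Suc k)" by simp
    have k': "(1 / Suc k) * (2 * \<bar>R\<bar>) < e / 2" using k e by (simp add: field_simps)
    define c where "c = e / (4 * (K k + 1) * Suc (d k))"
    have c: "c > 0" using e K[of k] by (simp add: c_def)
    have nz: "K k + 1 \<noteq> 0" using K[of k] by linarith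
    have "K k * (d k * c) \<le> (K k + 1) * (Suc (d k) * c)" using K[of k] c by (intro mult_mono) auto
    also have "\<dots> = e / 4"
    proof -
      have "x * (y * (e / (4 * x * y))) = e / 4" if "x \<noteq> 0" "y \<noteq> 0" for x y :: real using that by simp
      from this[OF nz, of "Suc (d k)"] show ?thesis unfolding c_def by simp
    qed
    finally have cK: "K k * (d k * c) < e / 2" using e by simp
    have "\<forall>i. \<exists>N. \<forall>m\<ge>N. \<forall>n\<ge>N. \<bar>l k i (u (r m)) - l k i (u (r n))\<bar> < c"
    proof
      fix i
      have "Cauchy (\<lambda>n. s (r n) (prod_encode (k, i)))" by (rule LIMSEQ_imp_Cauchy[OF limc])
      then show "\<exists>N. \<forall>m\<ge>N. \<forall>n\<ge>N. \<bar>l k i (u (r m)) - l k i (u (r n))\<bar> < c"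
        using c by (simp add: Cauchy_def dist_real_def s_def)
    qed
    from choice[OF this] obtain N where "\<forall>i. \<forall>m\<ge>N i. \<forall>n\<ge>N i. \<bar>l k i (u (r m)) - l k i (u (r n))\<bar> < c" ..
    then have N: "m \<ge> N i \<Longrightarrow> n \<ge> N i \<Longrightarrow> \<bar>l k i (u (r m)) - l k i (u (r n))\<bar> < c" for i m n by simp
    have "mu_n (\<lambda>x. u (r m) x - u (r n) x) < e" if m: "m \<ge> (\<Sum>i<d k. N i)" and n: "n \<ge> (\<Sum>i<d k. N i)" for m n
    proof -
      have l: "\<bar>l k i (\<lambda>x. u (r m) x - u (r n) x)\<bar> \<le> c" if "i < d k" for i
      proof -
        have "N i \<le> (\<Sum>i<d k. N i)" using that by (intro member_le_sum) auto
        then have "\<bar>l k i (u (r m)) - l k i (u (r n))\<bar> < c" using m n by (intro N) auto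
        moreover have "l k i (\<lambda>x. 1 * u (r m) x + (-1) * u (r n) x) = 1 * l k i (u (r m)) + (-1) * l k i (u (r n))"
          by (rule lin[OF E_D(1)[OF z] E_D(1)[OF z]])
        ultimately show ?thesis by simp
      qed
      have "mu_n (\<lambda>x. u (r m) x - u (r n) x) \<le> (1 / Suc k) * nu_n (\<lambda>x. g (r m) x - g (r n) x) + K k * (\<Sum>i<d k. \<bar>l k i (\<lambda>x. u (r m) x - u (r n) x)\<bar>)"
        by (rule fr[OF E_diff[OF z z]])
      also have "\<dots> \<le> (1 / Suc k) * (2 * \<bar>R\<bar>) + K k * (\<Sum>i<d k. c)"
      proof (intro add_mono mult_left_mono sum_mono l)
        show "nu_n (\<lambda>x. g (r m) x - g (r n) x) \<le> 2 * \<bar>R\<bar>"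
          using Lpn_lincomb_le[OF E_D(2)[OF z[of "r m"]] E_D(2)[OF z[of "r n"]], of 1 "-1"] R[of "r m"] R[of "r n"] by simp
      qed (use K in auto)
      also have "\<dots> < e" using k' cK by simp
      finally show ?thesis .
    qed
    then show ?thesis by blast
  qed
  have "\<exists>v. v \<in> LpS \<mu> p \<and> (\<lambda>n. mu_n (\<lambda>x. u (r n) x - v x)) \<longlonglongrightarrow> 0"
    by (rule Lpn_complete[OF p], rule E_D(3)[OF z], rule Cau)
  then obtain v where "v \<in> LpS \<mu> p" "(\<lambda>n. mu_n (\<lambda>x. u (r n) x - v x)) \<longlonglongrightarrow> 0" by (elim exE conjE)
  with r show ?thesis by blast
qed

section \<open>The pairings \<open>A\<close> and \<open>B\<close>\<close>

lemma A_bound: "g \<in> LpS \<nu> p \<Longrightarrow> h \<in> LpS \<nu> p \<Longrightarrow> \<bar>A g h\<bar> \<le> nu_n g powr (p - 1) * nu_n h"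
  unfolding A_def by (rule Hoelder_dual(2)[OF p])

lemma B_bound: "g \<in> LpS \<mu> p \<Longrightarrow> h \<in> LpS \<mu> p \<Longrightarrow> \<bar>B g h\<bar> \<le> mu_n g powr (p - 1) * mu_n h"
  unfolding B_def by (rule Hoelder_dual(2)[OF p])

lemma A_lin:
  assumes "g \<in> LpS \<nu> p" "h \<in> LpS \<nu> p" "k \<in> LpS \<nu> p"
  shows "A g (\<lambda>x. a *\<^sub>R h x + b *\<^sub>R k x) = a * A g h + b * A g k"
  using Hoelder_dual(1)[OF p assms(1,2)] Hoelder_dual(1)[OF p assms(1,3)]
  by (simp add: A_def inner_add_right)

lemma B_lin:
  assumes "g \<in> LpS \<mu> p" "h \<in> LpS \<mu> p" "k \<in> LpS \<mu> p"
  shows "B g (\<lambda>x. a * h x + b * k x) = a * B g h + b * B g k"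
  using Hoelder_dual(1)[OF p assms(1,2)] Hoelder_dual(1)[OF p assms(1,3)]
  by (simp add: B_def distrib_left mult.left_commute)

lemma A_diff: "g \<in> LpS \<nu> p \<Longrightarrow> h \<in> LpS \<nu> p \<Longrightarrow> k \<in> LpS \<nu> p \<Longrightarrow> A g (\<lambda>x. h x - k x) = A g h - A g k"
  using A_lin[of g h k 1 "-1"] by simp

lemma B_diff: "g \<in> LpS \<mu> p \<Longrightarrow> h \<in> LpS \<mu> p \<Longrightarrow> k \<in> LpS \<mu> p \<Longrightarrow> B g (\<lambda>x. h x - k x) = B g h - B g k"
  using B_lin[of g h k 1 "-1"] by simp

lemma A_self: "A g g = nu_n g powr p"
  by (simp add: A_def dual_vec_inner_self Lpn_powr[OF p] Lpint_def)

lemma B_self: "B g g = mu_n g powr p"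
  using dual_vec_inner_self[of p "g _"] by (simp add: B_def Lpn_powr[OF p] Lpint_def)

lemma B_scale: "B (\<lambda>x. c * f x) h = \<bar>c\<bar> powr (p - 2) * c * B f h"
proof -
  have "dual_vec p (c * f x) = (\<bar>c\<bar> powr (p - 2) * c) * dual_vec p (f x)" for x
    using dual_vec_scale[of p c "f x"] by simp
  then show ?thesis by (simp add: B_def mult.assoc)
qed

lemma A_scale: "A (\<lambda>x. c *\<^sub>R f x) h = \<bar>c\<bar> powr (p - 2) * c * A f h"
  by (simp add: A_def dual_vec_scale mult.assoc)

text \<open>The p-Laplace equation with right-hand side \<open>dual_vec p f\<close>, in weak form:
  one step of the inverse iteration.\<close>

definition sol :: "('a \<Rightarrow> real) \<Rightarrow> ('a \<Rightarrow> real) \<Rightarrow> ('a \<Rightarrow> 'b) \<Rightarrow> bool" where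
  "sol f u g \<longleftrightarrow> (u, g) \<in> E \<and> (\<forall>\<phi>\<in>V. A g (D \<phi>) = B f \<phi>)"

text \<open>Both sides are continuous in the pair, by Hoelder's inequality and \<open>mu_le\<close>,
  so the equation extends from test functions to the closure. This admits the solutions themselves
  as test functions.\<close>

lemma sol_E:
  assumes f: "f \<in> LpS \<mu> p" and s: "sol f u g" and w: "(v, h) \<in> E"
  shows "A g h = B f v"
proof -
  have z: "(u, g) \<in> E" using s by (simp add: sol_def)
  define c where "c = nu_n g powr (p - 1) + mu_n f powr (p - 1) * Cm"
  have c0: "c \<ge> 0" using Cm by (simp add: c_def)
  have le: "\<bar>A g h - B f v\<bar> \<le> 0 + e" if e: "e > 0" for e
  proof -
    define r where "r = e / (c + 1)"
    have r: "r > 0" using e c0 by (simp add: r_def)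
    have rc: "r * (c + 1) = e" using c0 by (simp add: r_def)
    obtain \<phi> where \<phi>: "\<phi> \<in> V" "nu_n (\<lambda>x. v x - \<phi> x) < r" "nu_n (\<lambda>x. h x - D \<phi> x) < r" by (rule E_approx[OF w r])
    note L = E_D[OF z] E_D[OF w] V_LpS[OF \<phi>(1)] mu_LpS[OF V_LpS[OF \<phi>(1)]] D_LpS[OF \<phi>(1)]
    have "A g h - B f v = A g (\<lambda>x. h x - D \<phi> x) - B f (\<lambda>x. v x - \<phi> x)"
      using s \<phi>(1) L f by (simp add: A_diff B_diff sol_def)
    also have "\<bar>\<dots>\<bar> \<le> \<bar>A g (\<lambda>x. h x - D \<phi> x)\<bar> + \<bar>B f (\<lambda>x. v x - \<phi> x)\<bar>" by simp
    also have "\<dots> \<le> nu_n g powr (p - 1) * nu_n (\<lambda>x. h x - D \<phi> x) + mu_n f powr (p - 1) * mu_n (\<lambda>x. v x - \<phi> x)"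
      using L f by (intro add_mono A_bound B_bound LpS_diff[OF p]) auto
    also have "mu_n (\<lambda>x. v x - \<phi> x) \<le> Cm * nu_n (\<lambda>x. v x - \<phi> x)"
      using L by (intro mu_le LpS_diff[OF p]) auto
    also have "nu_n g powr (p - 1) * nu_n (\<lambda>x. h x - D \<phi> x) + mu_n f powr (p - 1) * (Cm * nu_n (\<lambda>x. v x - \<phi> x))
      \<le> nu_n g powr (p - 1) * r + mu_n f powr (p - 1) * (Cm * r)"
      using \<phi> Cm by (intro add_mono mult_left_mono) auto
    also have "\<dots> = r * c" by (simp add: c_def algebra_simps)
    also have "\<dots> \<le> e" using rc r by (simp add: algebra_simps)
    finally show ?thesis by (simp add: mult_left_mono)
  qed
  have "\<bar>A g h - B f v\<bar> \<le> 0" by (rule field_le_epsilon) (rule le)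
  then show ?thesis by simp
qed

text \<open>Direct method: the energy \<open>\<Phi>\<close> is bounded below on \<open>E\<close>,
  Clarkson's inequality makes a minimizing sequence Cauchy in the gradient, and the minimizer
  satisfies the Euler-Lagrange equation.\<close>

lemma sol_exists:
  assumes f: "f \<in> LpS \<mu> p"
  shows "\<exists>u g. sol f u g"
proof -
  define b where "b = mu_n f powr (p - 1) * (Cm * CP)"
  have b0: "b \<ge> 0" using Cm CP by (simp add: b_def)
  define \<Phi> where "\<Phi> = (\<lambda>(u, g :: 'a \<Rightarrow> 'b). Lpint \<nu> p g / p - B f u)"
  have Bb: "\<bar>B f u\<bar> \<le> b * nu_n g" if z: "(u, g) \<in> E" for u g
  proof -
    have "\<bar>B f u\<bar> \<le> mu_n f powr (p - 1) * mu_n u" by (rule B_bound[OF f E_D(3)[OF z]])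
    also have "\<dots> \<le> mu_n f powr (p - 1) * (Cm * CP * nu_n g)" using E_mu_le[OF z] by (intro mult_left_mono) auto
    finally show ?thesis by (simp add: b_def mult.assoc)
  qed
  \<comment> \<open>Once the gradient norm exceeds the radius
    \<open>(b * p) powr (1 / (p - 1))\<close>, the power term outweighs the linear one; below it the
    linear term is at least \<open>- b\<close> times the radius.\<close>
  have lower: "\<Phi> z \<ge> - (b * (b * p) powr (1 / (p - 1)))" if z: "z \<in> E" for z
  proof -
    obtain u g where ug: "z = (u, g)" by (cases z)
    have zE: "(u, g) \<in> E" using z ug by simp
    let ?N = "nu_n g" and ?R = "(b * p) powr (1 / (p - 1))"
    have 1: "\<Phi> z \<ge> ?N powr p / p - b * ?N"
      using Bb[OF zE] by (simp add: ug \<Phi>_def Lpn_powr[OF p])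
    show ?thesis
    proof (cases "?N \<le> ?R")
      case True
      have "0 \<le> ?N powr p / p" using p by simp
      then show ?thesis using 1 mult_left_mono[OF True b0] by linarith
    next
      case False
      then have "?R powr (p - 1) \<le> ?N powr (p - 1)" using p by (intro powr_mono2) auto
      then have "b * p \<le> ?N powr (p - 1)" using p b0 by (simp add: powr_powr)
      then have "?N * (b * p) \<le> ?N * ?N powr (p - 1)" by (intro mult_left_mono Lpn_nonneg)
      also have "\<dots> = ?N powr p" using powr_mult_base[OF Lpn_nonneg, of \<nu> p g "p - 1"] by simp
      finally have "b * ?N \<le> ?N powr p / p" using p by (simp add: le_divide_eq mult_ac)
      moreover have "0 \<le> b * ?R" using b0 by simp
      ultimately show ?thesis using 1 by linarith
    qed
  qed
  have ne: "E \<noteq> {}" using infinite_dim[of 0] V_in_E by blast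
  define m where "m = Inf (\<Phi> ` E)"
  have bdd: "bdd_below (\<Phi> ` E)" using lower by (intro bdd_belowI2)
  have m_le: "m \<le> \<Phi> z" if "z \<in> E" for z unfolding m_def by (rule cINF_lower[OF bdd that])
  have "\<forall>n::nat. \<exists>z. z \<in> E \<and> \<Phi> z < m + 1 / Suc n"
  proof
    fix n :: nat
    have "Inf (\<Phi> ` E) < m + 1 / Suc n" by (simp add: m_def)
    then show "\<exists>z. z \<in> E \<and> \<Phi> z < m + 1 / Suc n"
      using cInf_lessD[of "\<Phi> ` E"] ne by blast
  qed
  from choice[OF this] obtain z where z': "\<forall>n. z n \<in> E \<and> \<Phi> (z n) < m + 1 / Suc n" ..
  define u where "u n = fst (z n)" for n
  define g where "g n = snd (z n)" for n
  have z: "(u n, g n) \<in> E" "\<Phi> (u n, g n) < m + 1 / Suc n" for n using z' by (auto simp: u_def g_def)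
  \<comment> \<open>The midpoint has energy at least the infimum. As \<open>B f\<close> is linear,
    Clarkson's inequality bounds the energy of half the gradient difference by the excess of the two
    energies.\<close>
  have close: "Lpint \<nu> p (\<lambda>x. (1/2) *\<^sub>R (g i x - g j x)) \<le> p * (1 / Suc (min i j))" for i j
  proof -
    have mid: "((\<lambda>x. (1/2) * u i x + (1/2) * u j x), (\<lambda>x. (1/2) *\<^sub>R g i x + (1/2) *\<^sub>R g j x)) \<in> E"
      by (rule E_lin[OF z(1) z(1)])
    have "m \<le> Lpint \<nu> p (\<lambda>x. (1/2) *\<^sub>R (g i x + g j x)) / p - (B f (u i) / 2 + B f (u j) / 2)"
      using m_le[OF mid] B_lin[OF f E_D(3)[OF z(1)[of i]] E_D(3)[OF z(1)[of j]], of "1/2" "1/2"]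
      by (simp add: \<Phi>_def scaleR_right_distrib)
    moreover have "(Lpint \<nu> p (\<lambda>x. (1/2) *\<^sub>R (g i x + g j x)) + Lpint \<nu> p (\<lambda>x. (1/2) *\<^sub>R (g i x - g j x))) / p
        \<le> (Lpint \<nu> p (g i) + Lpint \<nu> p (g j)) / 2 / p"
      using Clarkson[OF p E_D(2)[OF z(1)[of i]] E_D(2)[OF z(1)[of j]]] p by (intro divide_right_mono) auto
    moreover have "Lpint \<nu> p (g k) / p - B f (u k) \<le> m + 1 / Suc (min i j)" if "k = i \<or> k = j" for k
    proof -
      have "1 / real (Suc k) \<le> 1 / Suc (min i j)" using that by (intro divide_left_mono) auto
      then show ?thesis using z(2)[of k] by (simp add: \<Phi>_def)
    qed
    note this[of i] this[of j]
    ultimately have "Lpint \<nu> p (\<lambda>x. (1/2) *\<^sub>R (g i x - g j x)) / p \<le> 1 / Suc (min i j)"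
      by (simp add: add_divide_distrib del: of_nat_Suc)
    then show ?thesis using p by (simp add: divide_le_eq mult.commute del: of_nat_Suc)
  qed
  have Cau: "\<exists>N. \<forall>i\<ge>N. \<forall>j\<ge>N. nu_n (\<lambda>x. g i x - g j x) < e" if e: "e > 0" for e
  proof -
    have ep: "(e/4) powr p > 0" using e by simp
    obtain N where N: "p / (e/4) powr p < real N" using reals_Archimedean2 by blast
    have "nu_n (\<lambda>x. g i x - g j x) < e" if ij: "i \<ge> N" "j \<ge> N" for i j
    proof -
      have "real N \<le> real (Suc (min i j))" using ij by simp
      then have "p / (e/4) powr p < real (Suc (min i j))" using N by linarith
      then have "p * (1 / Suc (min i j)) \<le> (e/4) powr p"
        using ep by (simp add: divide_less_eq divide_le_eq mult.commute del: of_nat_Suc)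
      then have "Lpint \<nu> p (\<lambda>x. (1/2) *\<^sub>R (g i x - g j x)) \<le> (e/4) powr p" using close[of i j] by linarith
      then have "nu_n (\<lambda>x. (1/2) *\<^sub>R (g i x - g j x)) \<le> e/4" using e by (simp add: Lpint_le_iff[OF p])
      then have "(1/2) * nu_n (\<lambda>x. g i x - g j x) \<le> e/4" by (simp only: Lpn_scaleR[OF p])
      then show ?thesis using e by simp
    qed
    then show ?thesis by blast
  qed
  have "\<exists>v h. (v, h) \<in> E \<and> (\<lambda>n. nu_n (\<lambda>x. u n x - v x)) \<longlonglongrightarrow> 0 \<and> (\<lambda>n. nu_n (\<lambda>x. g n x - h x)) \<longlonglongrightarrow> 0"
    by (rule E_complete, rule z(1), rule Cau)
  then obtain v h where vh: "(v, h) \<in> E" "(\<lambda>n. nu_n (\<lambda>x. g n x - h x)) \<longlonglongrightarrow> 0" by (elim exE conjE)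
  have lim1: "(\<lambda>n. nu_n (g n)) \<longlonglongrightarrow> nu_n h"
  proof (rule LIM_zero_cancel, rule Lim_null_comparison[OF _ vh(2)])
    show "\<forall>\<^sub>F n in sequentially. norm (nu_n (g n) - nu_n h) \<le> nu_n (\<lambda>x. g n x - h x)"
      using Minkowski_diff[OF p E_D(2)[OF z(1)] E_D(2)[OF vh(1)]] by simp
  qed
  have lim2: "(\<lambda>n. B f (u n)) \<longlonglongrightarrow> B f v"
  proof (rule LIM_zero_cancel, rule Lim_null_comparison)
    show "\<forall>\<^sub>F n in sequentially. norm (B f (u n) - B f v) \<le> b * nu_n (\<lambda>x. g n x - h x)"
      using Bb[OF E_diff[OF z(1) vh(1)]] B_diff[OF f E_D(3)[OF z(1)] E_D(3)[OF vh(1)]] by simp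
    show "(\<lambda>n. b * nu_n (\<lambda>x. g n x - h x)) \<longlonglongrightarrow> 0" using tendsto_mult_left[OF vh(2), of b] by simp
  qed
  have "(\<lambda>n. nu_n (g n) powr p / p - B f (u n)) \<longlonglongrightarrow> nu_n h powr p / p - B f v"
    using p by (intro tendsto_intros lim2 tendsto_powr' lim1) (auto simp: Lpn_nonneg)
  then have lim3: "(\<lambda>n. \<Phi> (u n, g n)) \<longlonglongrightarrow> \<Phi> (v, h)" by (simp add: \<Phi>_def Lpn_powr[OF p])
  have "(\<lambda>n. m + 1 / Suc n) \<longlonglongrightarrow> m + 0" by (intro tendsto_intros LIMSEQ_Suc[OF lim_1_over_n])
  then have "\<Phi> (v, h) \<le> m + 0"
    by (rule LIMSEQ_le[OF lim3]) (use z(2) less_imp_le in blast)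
  then have min: "\<Phi> (v, h) \<le> \<Phi> w" if "w \<in> E" for w using m_le[OF that] by simp
  have "A h (D \<phi>) = B f \<phi>" if \<phi>: "\<phi> \<in> V" for \<phi>
  proof -
    note L = E_D[OF vh(1)] V_LpS[OF \<phi>] mu_LpS[OF V_LpS[OF \<phi>]] D_LpS[OF \<phi>]
    let ?h = "\<lambda>t x. h x + t *\<^sub>R D \<phi> x"
    have ht: "?h t \<in> LpS \<nu> p" for t using L by (intro LpS_add[OF p] LpS_scaleR[OF p])
    \<comment> \<open>Minimality bounds the increment of the energy from below, and the tangent
      inequality at the perturbed gradient bounds it from above. This replaces differentiation under
      the integral; the sign of \<open>t\<close> decides which side of the equation results.\<close>
    have key: "t * B f \<phi> \<le> t * A (?h t) (D \<phi>)" for t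
    proof -
      have "((\<lambda>x. 1 * v x + t * \<phi> x), (\<lambda>x. 1 *\<^sub>R h x + t *\<^sub>R D \<phi> x)) \<in> E" by (rule E_lin[OF vh(1) V_in_E[OF \<phi>]])
      from min[OF this] have "Lpint \<nu> p h / p - B f v \<le> Lpint \<nu> p (?h t) / p - (B f v + t * B f \<phi>)"
        using B_lin[OF f L(3) L(5), of 1 t] by (simp add: \<Phi>_def)
      then have 1: "t * B f \<phi> \<le> (Lpint \<nu> p (?h t) - Lpint \<nu> p h) / p" by (simp add: diff_divide_distrib)
      have "Lpint \<nu> p h \<ge> Lpint \<nu> p (?h t) + p * A (?h t) (\<lambda>x. h x - ?h t x)"
        unfolding A_def by (rule Lpint_tangent[OF p ht L(2)])
      also have "A (?h t) (\<lambda>x. h x - ?h t x) = - t * A (?h t) (D \<phi>)"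
        using A_lin[OF ht L(6) L(6), of t "-t" 0] by simp
      finally have "Lpint \<nu> p (?h t) - Lpint \<nu> p h \<le> p * (t * A (?h t) (D \<phi>))" by simp
      then have "(Lpint \<nu> p (?h t) - Lpint \<nu> p h) / p \<le> t * A (?h t) (D \<phi>)" using p by (simp add: divide_le_eq mult.commute)
      with 1 show ?thesis by linarith
    qed
    \<comment> \<open>A bound for the rate at which \<open>A (?h t) (D \<phi>)\<close> departs from
      its value at \<open>t = 0\<close>, uniform over \<open>\<bar>t\<bar> \<le> 1\<close>; it lets
      the two one-sided inequalities close up as \<open>t\<close> tends to 0.\<close>
    define K where "K = p * (2 * nu_n h + nu_n (D \<phi>)) powr (p - 2) * nu_n (D \<phi>) * nu_n (D \<phi>)"
    have K0: "K \<ge> 0" unfolding K_def using p by (intro mult_nonneg_nonneg Lpn_nonneg) auto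
    have Ad: "\<bar>A (?h t) (D \<phi>) - A h (D \<phi>)\<bar> \<le> \<bar>t\<bar> * K" if t: "\<bar>t\<bar> \<le> 1" for t
    proof -
      have "\<bar>A (?h t) (D \<phi>) - A h (D \<phi>)\<bar> \<le> p * (nu_n (?h t) + nu_n h) powr (p - 2) * nu_n (\<lambda>x. ?h t x - h x) * nu_n (D \<phi>)"
        unfolding A_def by (rule dual_diff_bound[OF p ht L(2) L(6)])
      also have "nu_n (\<lambda>x. ?h t x - h x) = \<bar>t\<bar> * nu_n (D \<phi>)" by (simp add: Lpn_scaleR[OF p])
      also have "p * (nu_n (?h t) + nu_n h) powr (p - 2) * (\<bar>t\<bar> * nu_n (D \<phi>)) * nu_n (D \<phi>)
        \<le> p * (2 * nu_n h + nu_n (D \<phi>)) powr (p - 2) * (\<bar>t\<bar> * nu_n (D \<phi>)) * nu_n (D \<phi>)"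
      proof (intro mult_right_mono mult_left_mono powr_mono2)
        have "nu_n (?h t) \<le> nu_n h + \<bar>t\<bar> * nu_n (D \<phi>)"
          using Lpn_lincomb_le[OF L(2) L(6), of 1 t] by simp
        also have "\<bar>t\<bar> * nu_n (D \<phi>) \<le> 1 * nu_n (D \<phi>)" using t by (intro mult_right_mono Lpn_nonneg)
        finally show "nu_n (?h t) + nu_n h \<le> 2 * nu_n h + nu_n (D \<phi>)" by simp
      qed (use p in auto)
      finally show ?thesis by (simp add: K_def mult_ac)
    qed
    have "B f \<phi> \<le> A h (D \<phi>) + e" if e: "e > 0" for e
    proof -
      define t where "t = min 1 (e / (K + 1))"
      have t: "t > 0" "t \<le> 1" "t * K \<le> e"
      proof -
        show "t > 0" "t \<le> 1" using e K0 by (auto simp: t_def)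
        have "t * K \<le> e / (K + 1) * (K + 1)" using e K0 \<open>t > 0\<close> by (intro mult_mono) (auto simp: t_def)
        then show "t * K \<le> e" using K0 by simp
      qed
      have "B f \<phi> \<le> A (?h t) (D \<phi>)" using key[of t] t by simp
      then show ?thesis using Ad[of t] t by simp
    qed
    moreover have "A h (D \<phi>) \<le> B f \<phi> + e" if e: "e > 0" for e
    proof -
      define t where "t = min 1 (e / (K + 1))"
      have t: "t > 0" "t \<le> 1" "t * K \<le> e"
      proof -
        show "t > 0" "t \<le> 1" using e K0 by (auto simp: t_def)
        have "t * K \<le> e / (K + 1) * (K + 1)" using e K0 \<open>t > 0\<close> by (intro mult_mono) (auto simp: t_def)
        then show "t * K \<le> e" using K0 by simp
      qed
      have "A (?h (- t)) (D \<phi>) \<le> B f \<phi>" using key[of "- t"] t by simp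
      then show ?thesis using Ad[of "- t"] t by simp
    qed
    ultimately show ?thesis by (meson antisym field_le_epsilon)
  qed
  then show ?thesis using vh(1) by (auto simp: sol_def)
qed

lemma powr_le_imp_le: "x powr s \<le> y powr s \<Longrightarrow> s > 0 \<Longrightarrow> 0 \<le> y \<Longrightarrow> x \<le> (y::real)"
  by (meson not_le powr_less_mono2)

text \<open>Subtract the two equations and test with the difference of the solutions: strong
  monotonicity bounds it from below by the \<open>p\<close>-th power of the gradient norm, Hoelder's
  inequality from above by one factor of that norm, which cancels.\<close>

lemma sol_continuity:
  assumes f: "f \<in> LpS \<mu> p" "sol f u g" and f': "f' \<in> LpS \<mu> p" "sol f' u' g'"
  shows "nu_n (\<lambda>x. g x - g' x) powr (p - 1)
    \<le> 2 powr (p - 1) * (p * (mu_n f + mu_n f') powr (p - 2) * mu_n (\<lambda>x. f x - f' x) * (Cm * CP))"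
proof -
  have z: "(u, g) \<in> E" "(u', g') \<in> E" using f f' by (auto simp: sol_def)
  note L = E_D[OF z(1)] E_D[OF z(2)]
  note d = E_diff[OF z]
  let ?N = "nu_n (\<lambda>x. g x - g' x)"
  let ?K = "p * (mu_n f + mu_n f') powr (p - 2) * mu_n (\<lambda>x. f x - f' x)"
  have K: "?K \<ge> 0" using p by (intro mult_nonneg_nonneg Lpn_nonneg) auto
  have "2 powr (1 - p) * ?N powr p \<le> A g (\<lambda>x. g x - g' x) - A g' (\<lambda>x. g x - g' x)"
    using dual_monotone[OF p L(2) L(5)] by (simp add: A_def Lpn_powr[OF p])
  also have "\<dots> = B f (\<lambda>x. u x - u' x) - B f' (\<lambda>x. u x - u' x)"
    using sol_E[OF f d] sol_E[OF f' d] by simp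
  also have "\<dots> \<le> ?K * mu_n (\<lambda>x. u x - u' x)"
    using dual_diff_bound[OF p f(1) f'(1) E_D(3)[OF d]] by (simp add: B_def)
  also have "\<dots> \<le> ?K * (Cm * CP * ?N)" using E_mu_le[OF d] K by (intro mult_left_mono)
  finally have le: "2 powr (1 - p) * ?N powr p \<le> ?K * (Cm * CP * ?N)" .
  show ?thesis
  proof (cases "?N = 0")
    case True
    then show ?thesis using K p Cm CP Lpn_nonneg by simp
  next
    case False
    then have N: "?N > 0" using Lpn_nonneg[of \<nu> p] by (metis order_le_less)
    have "?N powr p = ?N * ?N powr (p - 1)" using powr_mult_base[of ?N "p - 1"] N by simp
    with le have "?N * (2 powr (1 - p) * ?N powr (p - 1)) \<le> ?N * (?K * (Cm * CP))" by (simp add: mult_ac)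
    then have "2 powr (1 - p) * ?N powr (p - 1) \<le> ?K * (Cm * CP)" using N by (simp only: mult_le_cancel_left_pos)
    then have "2 powr (p - 1) * (2 powr (1 - p) * ?N powr (p - 1)) \<le> 2 powr (p - 1) * (?K * (Cm * CP))"
      by (intro mult_left_mono) auto
    moreover have "2 powr (p - 1) * (2 powr (1 - p) * ?N powr (p - 1)) = ?N powr (p - 1)"
      by (simp flip: mult.assoc powr_add)
    ultimately show ?thesis by simp
  qed
qed

text \<open>The equation tested with its own solution; the third estimate cancels one factor of the
  gradient norm after the embedding inequality.\<close>

lemma sol_energy:
  assumes f: "f \<in> LpS \<mu> p" "sol f u g"
  shows "nu_n g powr p = B f u" "nu_n g powr p \<le> mu_n f powr (p - 1) * mu_n u"
    "nu_n g powr (p - 1) \<le> Cm * CP * mu_n f powr (p - 1)"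
proof -
  have z: "(u, g) \<in> E" using f by (simp add: sol_def)
  show 1: "nu_n g powr p = B f u" using sol_E[OF f z] A_self by simp
  show 2: "nu_n g powr p \<le> mu_n f powr (p - 1) * mu_n u"
    using B_bound[OF f(1) E_D(3)[OF z]] 1 by simp
  show "nu_n g powr (p - 1) \<le> Cm * CP * mu_n f powr (p - 1)"
  proof (cases "nu_n g = 0")
    case True
    then show ?thesis using p Cm CP by simp
  next
    case False
    then have N: "nu_n g > 0" using Lpn_nonneg[of \<nu> p g] by linarith
    have "nu_n g * nu_n g powr (p - 1) \<le> mu_n f powr (p - 1) * (Cm * CP * nu_n g)"
      using 2 mult_left_mono[OF E_mu_le[OF z], of "mu_n f powr (p - 1)"] powr_mult_base[of "nu_n g" "p - 1"] N by simp
    then have "nu_n g * nu_n g powr (p - 1) \<le> nu_n g * (Cm * CP * mu_n f powr (p - 1))" by (simp add: mult_ac)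
    then show ?thesis using N by (simp only: mult_le_cancel_left_pos)
  qed
qed

text \<open>Testing with \<open>f\<close> itself gives the positive value
  \<open>mu_n f powr p\<close>, so the gradient of the solution cannot vanish. This is why
  iterations start inside the energy space.\<close>

lemma sol_pos:
  assumes f: "f \<in> LpS \<mu> p" "sol f u g" and v: "(f, h) \<in> E" and pos: "mu_n f > 0"
  shows "mu_n u > 0"
proof -
  have z: "(u, g) \<in> E" using f by (simp add: sol_def)
  have "0 < mu_n f powr p" using pos by simp
  also have "\<dots> = A g h" using sol_E[OF f v] B_self by simp
  also have "\<dots> \<le> nu_n g powr (p - 1) * nu_n h" using A_bound[OF E_D(2)[OF z] E_D(2)[OF v]] by simp
  finally have "nu_n g \<noteq> 0" using p by auto
  then have "0 < nu_n g powr p" by simp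
  also have "\<dots> \<le> mu_n f powr (p - 1) * mu_n u" by (rule sol_energy(2)[OF f])
  finally show ?thesis using Lpn_nonneg[of \<mu> p u] by (metis less_le mult_zero_right)
qed

text \<open>With norms \<open>a\<close>, \<open>b\<close>, \<open>c\<close> of three consecutive
  iterates and gradient norms \<open>G\<close>, \<open>K\<close>: testing the second equation with
  \<open>u\<close> gives \<open>b\<^sup>p \<le> K\<^sup>p\<^sup>-\<^sup>1 G\<close>, while the
  energy estimates bound \<open>G\<^sup>p\<close> by \<open>a\<^sup>p\<^sup>-\<^sup>1 b\<close> and
  \<open>K\<^sup>p\<close> by \<open>b\<^sup>p\<^sup>-\<^sup>1 c\<close>. Elimination leaves the
  exponent \<open>p * p - (p - 1) * (p - 1) - 1 = 2 * (p - 1)\<close> on \<open>b\<close>.\<close>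

lemma sol_log_convex:
  assumes f: "f \<in> LpS \<mu> p" "sol f u g" and w: "sol u w k" and pos: "mu_n u > 0"
  shows "mu_n u ^ 2 \<le> mu_n f * mu_n w"
proof -
  have z: "(u, g) \<in> E" "(w, k) \<in> E" using f w by (auto simp: sol_def)
  note u = E_D(3)[OF z(1)]
  let ?a = "mu_n f" and ?b = "mu_n u" and ?c = "mu_n w" and ?G = "nu_n g" and ?K = "nu_n k"
  note nn = Lpn_nonneg[of \<mu> p f] Lpn_nonneg[of \<mu> p w] Lpn_nonneg[of \<nu> p g] Lpn_nonneg[of \<nu> p k]
  have "?b powr p = A k g" using sol_E[OF u w z(1)] B_self by simp
  also have "\<dots> \<le> ?K powr (p - 1) * ?G" using A_bound[OF E_D(2)[OF z(2)] E_D(2)[OF z(1)]] by simp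
  finally have "(?b powr p) powr p \<le> (?K powr (p - 1) * ?G) powr p" using p by (intro powr_mono2) auto
  also have "\<dots> = (?K powr p) powr (p - 1) * ?G powr p" using nn by (simp add: powr_mult powr_powr mult.commute)
  also have "\<dots> \<le> (?b powr (p - 1) * ?c) powr (p - 1) * (?a powr (p - 1) * ?b)"
    using p nn pos sol_energy(2)[OF u w] sol_energy(2)[OF f]
    by (intro mult_mono powr_mono2) auto
  also have "\<dots> = (?b powr ((p - 1) * (p - 1)) * ?b) * (?a * ?c) powr (p - 1)"
    using nn pos by (simp add: powr_mult powr_powr mult_ac)
  finally have "?b powr (p * p) \<le> (?b powr ((p - 1) * (p - 1)) * ?b powr 1) * (?a * ?c) powr (p - 1)"
    using pos by (simp add: powr_powr)
  then have "?b powr ((p - 1) * (p - 1) + 1) * ?b powr (2 * (p - 1)) \<le> ?b powr ((p - 1) * (p - 1) + 1) * (?a * ?c) powr (p - 1)"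
    unfolding powr_add[symmetric] by (simp add: algebra_simps)
  then have "?b powr (2 * (p - 1)) \<le> (?a * ?c) powr (p - 1)"
    using pos by (simp only: mult_le_cancel_left_pos powr_gt_zero)
  then have "(?b powr 2) powr (p - 1) \<le> (?a * ?c) powr (p - 1)" by (simp only: powr_powr)
  then have "?b powr 2 \<le> ?a * ?c" by (rule powr_le_imp_le) (use p nn in auto)
  then show ?thesis using pos by simp
qed

text \<open>Norms \<open>1\<close>, \<open>t\<close>, and at most \<open>t ^ 2\<close> are the
  equality case of log-convexity. Equality must then hold in Hoelder's inequality for
  \<open>B f u\<close>, which forces \<open>f = u / t\<close>; inserting this into the equation for
  \<open>u\<close> gives the eigenvalue \<open>t powr (1 - p)\<close>.\<close>

lemma sol_equality_case:
  assumes f: "f \<in> LpS \<mu> p" "sol f u g" and w: "sol u w k" and f1: "mu_n f = 1"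
    and t: "t > 0" "mu_n u = t" "mu_n w \<le> t ^ 2"
  shows "\<forall>\<phi>\<in>V. A g (D \<phi>) = t powr (1 - p) * B u \<phi>"
proof -
  have z: "(u, g) \<in> E" "(w, k) \<in> E" using f w by (auto simp: sol_def)
  note u = E_D(3)[OF z(1)]
  let ?G = "nu_n g" and ?K = "nu_n k"
  note nn = Lpn_nonneg[of \<mu> p w] Lpn_nonneg[of \<nu> p g] Lpn_nonneg[of \<nu> p k]
  have Kp: "?K powr p \<le> t powr (p + 1)"
  proof -
    have "?K powr p \<le> t powr (p - 1) * mu_n w" using sol_energy(2)[OF u w] t by simp
    also have "\<dots> \<le> t powr (p - 1) * t powr 2" using t by (intro mult_left_mono) auto
    also have "\<dots> = t powr (p + 1)" by (simp add: add.commute flip: powr_add)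
    finally show ?thesis .
  qed
  have "t powr p = A k g" using sol_E[OF u w z(1)] B_self t by simp
  also have "\<dots> \<le> ?K powr (p - 1) * ?G" using A_bound[OF E_D(2)[OF z(2)] E_D(2)[OF z(1)]] by simp
  finally have "(t powr p) powr p \<le> (?K powr (p - 1) * ?G) powr p" using p by (intro powr_mono2) auto
  also have "\<dots> = (?K powr p) powr (p - 1) * ?G powr p" using nn by (simp add: powr_mult powr_powr mult.commute)
  also have "\<dots> \<le> (t powr (p + 1)) powr (p - 1) * ?G powr p"
    using p Kp by (intro mult_right_mono powr_mono2) auto
  finally have "t powr (p * p) \<le> t powr ((p + 1) * (p - 1)) * ?G powr p" by (simp add: powr_powr)
  then have "t powr ((p + 1) * (p - 1)) * t powr 1 \<le> t powr ((p + 1) * (p - 1)) * ?G powr p"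
    unfolding powr_add[symmetric] by (simp add: algebra_simps)
  then have "t powr 1 \<le> ?G powr p" using t by (simp only: mult_le_cancel_left_pos powr_gt_zero)
  then have Bt: "B f u \<ge> t" using sol_energy(1)[OF f] t by simp
  \<comment> \<open>Both \<open>f\<close> and \<open>?v\<close> have norm 1 and
    \<open>B f ?v \<ge> 1\<close>, so their midpoint has norm at least 1; Clarkson's inequality then
    leaves nothing for the difference.\<close>
  let ?v = "\<lambda>x. (1/t) * u x"
  have v: "?v \<in> LpS \<mu> p" by (rule LpS_mult[OF p u])
  have vn: "mu_n ?v = 1" using Lpn_scaleR[OF p, of \<mu> "1/t" u] t by simp
  have "B f ?v \<ge> 1" using B_lin[OF f(1) u u, of "1/t" 0] Bt t by simp
  then have "1 \<le> B f (\<lambda>x. (1/2) * f x + (1/2) * ?v x)"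
    using B_lin[OF f(1) f(1) v, of "1/2" "1/2"] B_self[of f] f1 by simp
  also have "\<dots> \<le> mu_n f powr (p - 1) * mu_n (\<lambda>x. (1/2) * f x + (1/2) * ?v x)"
    using B_bound[OF f(1) LpS_add[OF p LpS_mult[OF p f(1), of "1/2"] LpS_mult[OF p v, of "1/2"]]] by simp
  also have "\<dots> = mu_n (\<lambda>x. (1/2) *\<^sub>R (f x + ?v x))" by (simp add: f1 distrib_left)
  finally have "1 powr p \<le> mu_n (\<lambda>x. (1/2) *\<^sub>R (f x + ?v x)) powr p" using p by (intro powr_mono2) auto
  then have "1 \<le> Lpint \<mu> p (\<lambda>x. (1/2) *\<^sub>R (f x + ?v x))" by (simp only: Lpn_powr[OF p] powr_one_eq_one)
  moreover have "Lpint \<mu> p (\<lambda>x. (1/2) *\<^sub>R (f x + ?v x)) + Lpint \<mu> p (\<lambda>x. (1/2) *\<^sub>R (f x - ?v x)) \<le> 1"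
    using Clarkson[OF p f(1) v] f1 vn Lpn_powr[OF p, of \<mu> f] Lpn_powr[OF p, of \<mu> ?v] by simp
  ultimately have "Lpint \<mu> p (\<lambda>x. (1/2) *\<^sub>R (f x - ?v x)) = 0" using Lpint_nonneg[of \<mu> p "\<lambda>x. (1/2) *\<^sub>R (f x - ?v x)"] by linarith
  then have "mu_n (\<lambda>x. (1/2) *\<^sub>R (f x - ?v x)) = 0" using p by (simp add: Lpn_def)
  then have "mu_n (\<lambda>x. f x - ?v x) = 0" by (simp only: Lpn_scaleR[OF p])
  then have ae: "AE x in \<mu>. f x = ?v x" using Lpn_eq_0_iff[OF p LpS_diff[OF p f(1) v]] by simp
  show ?thesis
  proof
    fix \<phi> assume \<phi>: "\<phi> \<in> V"
    have "A g (D \<phi>) = B f \<phi>" using f \<phi> by (simp add: sol_def)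
    also have "\<dots> = B ?v \<phi>" unfolding B_def
    proof (rule integral_cong_AE)
      note [measurable] = LpS_measurable[OF f(1)] LpS_measurable[OF v] LpS_measurable[OF mu_LpS[OF V_LpS[OF \<phi>]]]
      show "(\<lambda>x. dual_vec p (f x) \<bullet> \<phi> x) \<in> borel_measurable \<mu>" "(\<lambda>x. dual_vec p (?v x) \<bullet> \<phi> x) \<in> borel_measurable \<mu>"
        unfolding dual_vec_def by measurable
      show "AE x in \<mu>. dual_vec p (f x) \<bullet> \<phi> x = dual_vec p (?v x) \<bullet> \<phi> x" using ae by eventually_elim simp
    qed
    also have "\<dots> = \<bar>1/t\<bar> powr (p - 2) * (1/t) * B u \<phi>" by (rule B_scale)
    also have "\<bar>1/t\<bar> powr (p - 2) * (1/t) = t powr (1 - p)"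
      using t by (simp add: powr_divide powr_diff field_simps power2_eq_square)
    finally show "A g (D \<phi>) = t powr (1 - p) * B u \<phi>" .
  qed
qed

text \<open>A chosen solution. Solutions agree only up to null functions, so continuity and oddness
  of the iteration are stated through norms of differences.\<close>

definition Gu :: "('a \<Rightarrow> real) \<Rightarrow> 'a \<Rightarrow> real" where
  "Gu f = fst (SOME z. sol f (fst z) (snd z))"

definition Gg :: "('a \<Rightarrow> real) \<Rightarrow> 'a \<Rightarrow> 'b" where
  "Gg f = snd (SOME z. sol f (fst z) (snd z))"

section \<open>Inverse iteration\<close>

lemma G_sol: "f \<in> LpS \<mu> p \<Longrightarrow> sol f (Gu f) (Gg f)"
proof -
  assume "f \<in> LpS \<mu> p"
  then obtain u g where "sol f u g" using sol_exists by blast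
  then have "\<exists>z. sol f (fst z) (snd z)" by (intro exI[of _ "(u, g)"]) simp
  from someI_ex[OF this] show ?thesis by (simp add: Gu_def Gg_def)
qed

lemma G_E: "f \<in> LpS \<mu> p \<Longrightarrow> (Gu f, Gg f) \<in> E"
  using G_sol by (simp add: sol_def)

lemma iter_LpS: "f \<in> LpS \<mu> p \<Longrightarrow> (Gu ^^ k) f \<in> LpS \<mu> p"
  by (induction k) (auto intro: E_D(3)[OF G_E])

lemma sol_scale:
  assumes "sol f u g" "c > 0"
  shows "sol (\<lambda>x. c * f x) (\<lambda>x. c * u x) (\<lambda>x. c *\<^sub>R g x)"
  using assms by (auto simp: sol_def E_scale A_scale B_scale)

text \<open>The filter is arbitrary: it serves for subsequences, for points approaching on the
  sphere, and, with constant families, for uniqueness of solutions up to norm zero.\<close>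

lemma sol_tendsto:
  assumes f: "\<And>y. fy y \<in> LpS \<mu> p" "\<And>y. sol (fy y) (uy y) (gy y)" and f0: "f \<in> LpS \<mu> p" "sol f u g"
    and lim: "((\<lambda>y. mu_n (\<lambda>x. fy y x - f x)) \<longlongrightarrow> 0) F"
  shows "((\<lambda>y. nu_n (\<lambda>x. uy y x - u x)) \<longlongrightarrow> 0) F" and "((\<lambda>y. mu_n (\<lambda>x. uy y x - u x)) \<longlongrightarrow> 0) F"
proof -
  have z: "(uy y, gy y) \<in> E" "(u, g) \<in> E" for y using f f0 by (auto simp: sol_def)
  let ?N = "\<lambda>y. nu_n (\<lambda>x. gy y x - g x)" and ?d = "\<lambda>y. mu_n (\<lambda>x. fy y x - f x)"
  let ?C = "2 powr (p - 1) * p * (Cm * CP)"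
  have le: "?N y powr (p - 1) \<le> ?C * (2 * mu_n f + ?d y) powr (p - 2) * ?d y" for y
  proof -
    have "?N y powr (p - 1) \<le> 2 powr (p - 1) * (p * (mu_n (fy y) + mu_n f) powr (p - 2) * ?d y * (Cm * CP))"
      by (rule sol_continuity[OF f(1) f(2) f0])
    also have "\<dots> \<le> 2 powr (p - 1) * (p * (2 * mu_n f + ?d y) powr (p - 2) * ?d y * (Cm * CP))"
      using Lpn_diff_le2[OF f(1)[of y] f0(1)] p Cm CP
      by (intro mult_left_mono mult_right_mono powr_mono2) auto
    finally show ?thesis by (simp add: mult_ac)
  qed
  have "((\<lambda>y. ?C * (2 * mu_n f + ?d y) powr (p - 2) * ?d y) \<longlongrightarrow> ?C * (2 * mu_n f + 0) powr (p - 2) * 0) F"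
    using p by (intro tendsto_intros tendsto_powr' lim) auto
  then have "((\<lambda>y. ?C * (2 * mu_n f + ?d y) powr (p - 2) * ?d y) \<longlongrightarrow> 0) F" by simp
  then have "((\<lambda>y. ?N y powr (p - 1)) \<longlongrightarrow> 0) F"
    by (rule Lim_null_comparison[rotated]) (use le in auto)
  then have "((\<lambda>y. (?N y powr (p - 1)) powr (1 / (p - 1))) \<longlongrightarrow> 0 powr (1 / (p - 1))) F"
    using p by (intro tendsto_powr' tendsto_intros) auto
  then have N: "(?N \<longlongrightarrow> 0) F" using p by (simp add: powr_powr)
  have "((\<lambda>y. CP * ?N y) \<longlongrightarrow> 0) F" using tendsto_mult_left[OF N, of CP] by simp
  then show "((\<lambda>y. nu_n (\<lambda>x. uy y x - u x)) \<longlongrightarrow> 0) F"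
    by (rule Lim_null_comparison[rotated]) (use E_poincare[OF E_diff[OF z]] in auto)
  have "((\<lambda>y. Cm * CP * ?N y) \<longlongrightarrow> 0) F" using tendsto_mult_left[OF N, of "Cm * CP"] by simp
  then show "((\<lambda>y. mu_n (\<lambda>x. uy y x - u x)) \<longlongrightarrow> 0) F"
    by (rule Lim_null_comparison[rotated]) (use E_mu_le[OF E_diff[OF z]] in auto)
qed

lemma mu_n_tendsto:
  assumes "\<And>y. fy y \<in> LpS \<mu> p" "f \<in> LpS \<mu> p" "((\<lambda>y. mu_n (\<lambda>x. fy y x - f x)) \<longlongrightarrow> 0) F"
  shows "((\<lambda>y. mu_n (fy y)) \<longlongrightarrow> mu_n f) F"
proof (rule LIM_zero_cancel, rule Lim_null_comparison[OF _ assms(3)])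
  show "\<forall>\<^sub>F y in F. norm (mu_n (fy y) - mu_n f) \<le> mu_n (\<lambda>x. fy y x - f x)"
    using Minkowski_diff[OF p assms(1,2)] by simp
qed

lemma iter_pos:
  assumes f: "(f, h) \<in> E" "mu_n f > 0"
  shows "mu_n ((Gu ^^ k) f) > 0"
proof -
  have "mu_n ((Gu ^^ k) f) > 0 \<and> (\<exists>h. ((Gu ^^ k) f, h) \<in> E)"
  proof (induction k)
    case 0
    then show ?case using f by auto
  next
    case (Suc k)
    then obtain h where h: "((Gu ^^ k) f, h) \<in> E" "mu_n ((Gu ^^ k) f) > 0" by blast
    note L = E_D(3)[OF h(1)]
    have "mu_n (Gu ((Gu ^^ k) f)) > 0" by (rule sol_pos[OF L G_sol[OF L] h])
    then show ?case using G_E[OF L] by auto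
  qed
  then show ?thesis by simp
qed

lemma iter_ratio_mono:
  assumes f: "(f, h) \<in> E" "mu_n f > 0"
  defines "a \<equiv> \<lambda>k. mu_n ((Gu ^^ k) f)"
  shows "a (Suc k) / a k \<le> a (Suc (Suc k)) / a (Suc k)"
proof -
  have L: "(Gu ^^ k) f \<in> LpS \<mu> p" for k using E_D(3)[OF f(1)] by (rule iter_LpS)
  have pos: "a k > 0" for k unfolding a_def by (rule iter_pos[OF f])
  have "a (Suc k) ^ 2 \<le> a k * a (Suc (Suc k))"
    unfolding a_def using sol_log_convex[OF L G_sol[OF L] _ pos[of "Suc k", unfolded a_def, simplified]] G_sol[OF L, of "Suc k"] by simp
  then show ?thesis using pos[of k] pos[of "Suc k"] by (simp add: divide_simps power2_eq_square mult.commute)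
qed

text \<open>The increasing bounded ratios converge to some \<open>\<theta>\<close>. A limit
  \<open>v\<close> of normalized iterates then has norms \<open>1\<close>, \<open>\<theta>\<close>,
  \<open>\<theta> * \<theta>\<close> for itself and its next two iterates, which is the equality
  case of log-convexity.\<close>

lemma eigenpair_from_iterates:
  assumes f: "(f, h) \<in> E" "mu_n f > 0"
    and bound: "\<And>k. mu_n ((Gu ^^ Suc k) f) \<le> \<theta>\<^sub>0 * mu_n ((Gu ^^ k) f)"
  shows "\<exists>\<theta> u g. 0 < \<theta> \<and> \<theta> \<le> \<theta>\<^sub>0 \<and> (u, g) \<in> E \<and> mu_n u > 0 \<and> (\<forall>\<phi>\<in>V. A g (D \<phi>) = \<theta> powr (1 - p) * B u \<phi>)"
proof -
  define U where "U k = (Gu ^^ k) f" for k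
  define a where "a k = mu_n (U k)" for k
  define \<Theta> where "\<Theta> k = a (Suc k) / a k" for k
  have USuc: "U (Suc k) = Gu (U k)" for k by (simp add: U_def)
  have L: "U k \<in> LpS \<mu> p" for k unfolding U_def using E_D(3)[OF f(1)] by (rule iter_LpS)
  have pos: "a k > 0" for k unfolding a_def U_def by (rule iter_pos[OF f])
  have \<Theta>pos: "\<Theta> k > 0" for k using pos by (simp add: \<Theta>_def)
  have \<Theta>mono: "incseq \<Theta>" using iter_ratio_mono[OF f] by (intro incseq_SucI) (simp add: \<Theta>_def a_def U_def)
  have \<Theta>le: "\<Theta> k \<le> \<theta>\<^sub>0" for k using bound[of k] pos[of k] by (simp add: \<Theta>_def a_def U_def divide_le_eq)
  obtain \<theta> where \<theta>: "\<Theta> \<longlonglongrightarrow> \<theta>" "\<And>k. \<Theta> k \<le> \<theta>"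
    using incseq_convergent[OF \<Theta>mono, of \<theta>\<^sub>0] \<Theta>le by auto
  have \<theta>pos: "\<theta> > 0" using \<Theta>pos[of 0] \<theta>(2)[of 0] by linarith
  have \<theta>le: "\<theta> \<le> \<theta>\<^sub>0" by (rule LIMSEQ_le_const2[OF \<theta>(1)]) (use \<Theta>le in auto)
  define H where "H k = (\<lambda>x. (1 / a (Suc k)) * U (Suc k) x)" for k
  define HH where "HH k = (\<lambda>x. (1 / a (Suc k)) *\<^sub>R Gg (U k) x)" for k
  have HE: "(H k, HH k) \<in> E" for k
    unfolding H_def HH_def USuc by (rule E_scale[OF G_E[OF L]])
  \<comment> \<open>The energy estimate bounds the normalized gradients by
    \<open>(Cm * CP) powr (1 / (p - 1)) / \<Theta> k\<close>; as the ratios increase, the index 0 is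
    the worst.\<close>
  define R where "R = (Cm * CP) powr (1 / (p - 1)) / \<Theta> 0"
  have HR: "nu_n (HH k) \<le> R" for k
  proof -
    have "nu_n (Gg (U k)) powr (p - 1) \<le> Cm * CP * a k powr (p - 1)"
      unfolding a_def by (rule sol_energy(3)[OF L G_sol[OF L]])
    also have "\<dots> = ((Cm * CP) powr (1 / (p - 1)) * a k) powr (p - 1)"
      using p Cm CP pos[of k] by (simp add: powr_mult powr_powr)
    finally have "nu_n (Gg (U k)) \<le> (Cm * CP) powr (1 / (p - 1)) * a k"
      by (rule powr_le_imp_le) (use p pos[of k] in auto)
    then have "nu_n (HH k) \<le> (1 / a (Suc k)) * ((Cm * CP) powr (1 / (p - 1)) * a k)"
      using pos[of "Suc k"] unfolding HH_def Lpn_scaleR[OF p] by (simp add: divide_right_mono)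
    also have "\<dots> = (Cm * CP) powr (1 / (p - 1)) / \<Theta> k" by (simp add: \<Theta>_def)
    also have "\<dots> \<le> R" unfolding R_def using \<Theta>pos incseqD[OF \<Theta>mono, of 0 k] by (intro divide_left_mono) auto
    finally show ?thesis .
  qed
  have "\<exists>r v. strict_mono r \<and> v \<in> LpS \<mu> p \<and> (\<lambda>n. mu_n (\<lambda>x. H (r n) x - v x)) \<longlonglongrightarrow> 0"
    by (rule E_compact, rule HE, rule HR)
  then obtain r v where r: "strict_mono (r :: nat \<Rightarrow> nat)" and v: "v \<in> LpS \<mu> p"
    and lim: "(\<lambda>n. mu_n (\<lambda>x. H (r n) x - v x)) \<longlonglongrightarrow> 0" by (elim exE conjE)
  have HL: "H k \<in> LpS \<mu> p" for k by (rule E_D(3)[OF HE])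
  have scale: "mu_n (\<lambda>x. (1 / a (Suc k)) * U m x) = a m / a (Suc k)" for k m
    using Lpn_scaleR[OF p, of \<mu> "1 / a (Suc k)" "U m"] pos[of "Suc k"] by (simp add: a_def)
  have Hn: "mu_n (H k) = 1" for k using scale[of k "Suc k"] pos[of "Suc k"] by (simp add: H_def)
  have v1: "mu_n v = 1"
    using LIMSEQ_unique[OF mu_n_tendsto[OF HL v lim]] Hn by simp
  \<comment> \<open>The next two iterates carry the same scaling factor as \<open>H k\<close>; by
    homogeneity they solve the equations started at \<open>H k\<close>, so their norms are products
    of consecutive ratios.\<close>
  define H1 where "H1 k = (\<lambda>x. (1 / a (Suc k)) * U (Suc (Suc k)) x)" for k
  define H2 where "H2 k = (\<lambda>x. (1 / a (Suc k)) * U (Suc (Suc (Suc k))) x)" for k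
  have s1: "sol (H k) (H1 k) (\<lambda>x. (1 / a (Suc k)) *\<^sub>R Gg (U (Suc k)) x)" for k
    unfolding H_def H1_def USuc[of "Suc k"] using pos by (intro sol_scale G_sol L) auto
  have s2: "sol (H1 k) (H2 k) (\<lambda>x. (1 / a (Suc k)) *\<^sub>R Gg (U (Suc (Suc k))) x)" for k
    unfolding H1_def H2_def USuc[of "Suc (Suc k)"] using pos by (intro sol_scale G_sol L) auto
  have H1L: "H1 k \<in> LpS \<mu> p" "H2 k \<in> LpS \<mu> p" for k unfolding H1_def H2_def by (rule LpS_mult[OF p L])+
  note gv = G_sol[OF v]
  have uL: "Gu v \<in> LpS \<mu> p" by (rule E_D(3)[OF G_E[OF v]])
  have wL: "Gu (Gu v) \<in> LpS \<mu> p" by (rule E_D(3)[OF G_E[OF uL]])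
  have lim1: "(\<lambda>n. mu_n (\<lambda>x. H1 (r n) x - Gu v x)) \<longlonglongrightarrow> 0"
    by (rule sol_tendsto(2)[OF HL s1 v gv lim])
  have lim2: "(\<lambda>n. mu_n (\<lambda>x. H2 (r n) x - Gu (Gu v) x)) \<longlonglongrightarrow> 0"
    by (rule sol_tendsto(2)[OF H1L(1) s2 uL G_sol[OF uL] lim1])
  have n1: "mu_n (H1 k) = \<Theta> (Suc k)" for k unfolding H1_def by (simp only: scale \<Theta>_def)
  have n2: "mu_n (H2 k) = \<Theta> (Suc (Suc k)) * \<Theta> (Suc k)" for k
    unfolding H2_def scale using pos[of "Suc (Suc k)"] by (simp add: \<Theta>_def)
  have \<Theta>1: "(\<lambda>n. \<Theta> (Suc (r n))) \<longlonglongrightarrow> \<theta>" "(\<lambda>n. \<Theta> (Suc (Suc (r n)))) \<longlonglongrightarrow> \<theta>"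
    using LIMSEQ_subseq_LIMSEQ[OF LIMSEQ_Suc[OF \<theta>(1)] r] LIMSEQ_subseq_LIMSEQ[OF LIMSEQ_Suc[OF LIMSEQ_Suc[OF \<theta>(1)]] r]
    by (simp_all add: o_def)
  have e1: "mu_n (Gu v) = \<theta>"
    using LIMSEQ_unique[OF mu_n_tendsto[OF H1L(1) uL lim1] \<Theta>1(1)[folded n1]] .
  have e2: "mu_n (Gu (Gu v)) = \<theta> * \<theta>"
    using LIMSEQ_unique[OF mu_n_tendsto[OF H1L(2) wL lim2] tendsto_mult[OF \<Theta>1(2,1), folded n2]] .
  have "\<forall>\<phi>\<in>V. A (Gg v) (D \<phi>) = \<theta> powr (1 - p) * B (Gu v) \<phi>"
    by (rule sol_equality_case[OF v gv G_sol[OF uL] v1 \<theta>pos e1]) (simp add: e2 power2_eq_square)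
  then show ?thesis using \<theta>pos \<theta>le G_E[OF v] e1
    by (intro exI[of _ \<theta>] exI[of _ "Gu v"] exI[of _ "Gg v"]) auto
qed

section \<open>Unboundedness of the eigenvalues\<close>

lemma V_sum: "finite I \<Longrightarrow> I \<noteq> {} \<Longrightarrow> (\<And>i. i \<in> I \<Longrightarrow> \<psi> i \<in> V) \<Longrightarrow> (\<lambda>x. \<Sum>i\<in>I. c i *\<^sub>R \<psi> i x) \<in> V"
proof (induction I rule: finite_ne_induct)
  case (singleton i)
  then show ?case using V_lin[of "\<psi> i" "\<psi> i" "c i" 0] by simp
next
  case (insert i I)
  then show ?case using V_lin[of "\<psi> i" "\<lambda>x. \<Sum>i\<in>I. c i *\<^sub>R \<psi> i x" "c i" 1] by simp
qed

theorem eigenpairs: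
  assumes eps: "\<epsilon> > 0"
  shows "\<exists>u g lam. (u, g) \<in> E \<and> mu_n u > 0 \<and> lam \<ge> 1 / \<epsilon> \<and> (\<forall>\<phi>\<in>V. A g (D \<phi>) = lam * B u \<phi>)"
proof (rule ccontr)
  assume neg: "\<not> ?thesis"
  define \<theta>\<^sub>0 where "\<theta>\<^sub>0 = \<epsilon> powr (1 / (p - 1))"
  have \<theta>\<^sub>0: "\<theta>\<^sub>0 > 0" "\<theta>\<^sub>0 powr (p - 1) = \<epsilon>" using eps p by (auto simp: \<theta>\<^sub>0_def powr_powr)
  \<comment> \<open>A starting point whose ratios never exceed \<open>\<theta>\<^sub>0\<close> would
    produce an eigenvalue \<open>\<theta> powr (1 - p)\<close> with
    \<open>\<theta> \<le> \<theta>\<^sub>0\<close>, which is at least \<open>1 / \<epsilon>\<close>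
    since \<open>\<theta>\<^sub>0 powr (p - 1) = \<epsilon>\<close>.\<close>
  have grow: "\<exists>k. \<theta>\<^sub>0 * mu_n ((Gu ^^ k) f) < mu_n ((Gu ^^ Suc k) f)" if f: "(f, h) \<in> E" "mu_n f > 0" for f h
  proof (rule ccontr)
    assume "\<not> ?thesis"
    then have "mu_n ((Gu ^^ Suc k) f) \<le> \<theta>\<^sub>0 * mu_n ((Gu ^^ k) f)" for k by (simp add: not_less del: funpow.simps)
    from eigenpair_from_iterates[OF f this] obtain \<theta> u g where
      *: "0 < \<theta>" "\<theta> \<le> \<theta>\<^sub>0" "(u, g) \<in> E" "mu_n u > 0" "\<forall>\<phi>\<in>V. A g (D \<phi>) = \<theta> powr (1 - p) * B u \<phi>"
      by (elim exE conjE)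
    have "\<theta> powr (p - 1) \<le> \<epsilon>" using powr_mono2[of "p - 1" \<theta> \<theta>\<^sub>0] * p \<theta>\<^sub>0 by simp
    then have "1 / \<epsilon> \<le> 1 / \<theta> powr (p - 1)" using * eps by (intro divide_left_mono) auto
    also have "\<dots> = \<theta> powr (1 - p)" using * by (simp add: powr_minus_divide[symmetric])
    finally show False using neg * by blast
  qed
  \<comment> \<open>This tolerance turns into the factor \<open>\<epsilon>\<close> when the estimate
    is raised to the power \<open>p\<close> and compared with the energy.\<close>
  have "\<epsilon> powr (1 / p) > 0" using eps by simp
  from E_finite_rank[OF this] obtain d :: nat and K and l :: "nat \<Rightarrow> ('a \<Rightarrow> real) \<Rightarrow> real" where
    K: "K \<ge> 0"
    and lin: "\<forall>i f g a b. f \<in> LpS \<nu> p \<longrightarrow> g \<in> LpS \<nu> p \<longrightarrow> l i (\<lambda>x. a * f x + b * g x) = a * l i f + b * l i g"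
    and bd: "\<forall>i f. f \<in> LpS \<nu> p \<longrightarrow> \<bar>l i f\<bar> \<le> K * nu_n f"
    and fr: "\<forall>(u, g)\<in>E. mu_n u \<le> \<epsilon> powr (1 / p) * nu_n g + K * (\<Sum>i<d. \<bar>l i u\<bar>)"
    by (elim exE conjE) (rule that)
  from infinite_dim[of d] obtain \<psi> :: "nat \<Rightarrow> 'a \<Rightarrow> real" where \<psi>: "\<And>i. \<psi> i \<in> V"
    and ind: "\<And>c. \<exists>i\<le>d. c i \<noteq> 0 \<Longrightarrow> mu_n (\<lambda>x. \<Sum>i\<le>d. c i *\<^sub>R \<psi> i x) > 0" by auto
  define f where "f x = (\<lambda>y. \<Sum>i\<le>d. x i *\<^sub>R \<psi> i y)" for x :: "nat \<Rightarrow> real"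
  have fV: "f x \<in> V" for x unfolding f_def using \<psi> by (intro V_sum) auto
  have fE: "(f x, D (f x)) \<in> E" for x by (rule V_in_E[OF fV])
  have fpos: "mu_n (f x) > 0" if xS: "x \<in> Sph d" for x
  proof -
    obtain i where "i \<le> d" "(x i)\<^sup>2 \<ge> 1 / Suc d" using Sph_coord_ge[OF xS] by blast
    then have "x i \<noteq> 0" by (auto simp: not_le)
    then show ?thesis unfolding f_def using \<open>i \<le> d\<close> by (intro ind) auto
  qed
  define U where "U k x = (Gu ^^ k) (f x)" for k x
  have USuc: "U (Suc k) x = Gu (U k x)" for k x by (simp add: U_def)
  have L: "U k x \<in> LpS \<mu> p" for k x unfolding U_def using E_D(3)[OF fE] by (rule iter_LpS)
  have UE: "(U (Suc k) x, Gg (U k x)) \<in> E" for k x unfolding USuc by (rule G_E[OF L])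
  have cont: "((\<lambda>y. mu_n (\<lambda>t. U k y t - U k x t)) \<longlongrightarrow> 0) (at x within Sph d)" for k x
  proof (induction k)
    case 0
    have le: "mu_n (\<lambda>t. U 0 y t - U 0 x t) \<le> (\<Sum>i\<le>d. \<bar>y i - x i\<bar> * mu_n (\<psi> i))" for y
    proof -
      have "(\<lambda>t. U 0 y t - U 0 x t) = (\<lambda>t. \<Sum>i\<le>d. (y i - x i) *\<^sub>R \<psi> i t)"
        by (simp add: U_def f_def sum_subtractf left_diff_distrib)
      then show ?thesis
        using Lpn_sum_le[OF p, of "{..d}" \<psi> \<mu> "\<lambda>i. y i - x i"] \<psi> V_LpS mu_LpS by simp
    qed
    have "((\<lambda>y. \<Sum>i\<le>d. \<bar>y i - x i\<bar> * mu_n (\<psi> i)) \<longlongrightarrow> (\<Sum>i\<le>d. \<bar>x i - x i\<bar> * mu_n (\<psi> i))) (at x within Sph d)"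
    proof -
      have "((\<lambda>y. y i) \<longlongrightarrow> x i) (at x within Sph d)" for i
        using continuous_on_product_coordinates[of i] by (auto simp: continuous_on_def intro: tendsto_within_subset)
      then show ?thesis by (intro tendsto_intros)
    qed
    then have lim0: "((\<lambda>y. \<Sum>i\<le>d. \<bar>y i - x i\<bar> * mu_n (\<psi> i)) \<longlongrightarrow> 0) (at x within Sph d)" by simp
    show ?case by (rule Lim_null_comparison[OF _ lim0]) (use le in auto)
  next
    case (Suc k)
    show ?case unfolding USuc by (rule sol_tendsto(2)[OF L G_sol[OF L] L G_sol[OF L] Suc])
  qed
  have cont': "((\<lambda>y. nu_n (\<lambda>t. U (Suc k) y t - U (Suc k) x t)) \<longlongrightarrow> 0) (at x within Sph d)" for k x
    unfolding USuc by (rule sol_tendsto(1)[OF L G_sol[OF L] L G_sol[OF L] cont])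
  have acont: "continuous_on (Sph d) (\<lambda>x. mu_n (U k x))" for k
    unfolding continuous_on_def by (intro ballI mu_n_tendsto[OF L L cont])
  \<comment> \<open>Relatively open by continuity of the iterates and increasing in \<open>k\<close>
    by monotonicity of the ratios, so a finite subcover of the sphere collapses to a single
    step.\<close>
  define Ob where "Ob k = {x \<in> Sph d. \<theta>\<^sub>0 * mu_n (U k x) < mu_n (U (Suc k) x)}" for k
  have Obmono: "Ob k \<subseteq> Ob (Suc k)" for k
  proof
    fix x assume x: "x \<in> Ob k"
    then have xS: "x \<in> Sph d" by (simp add: Ob_def)
    have pos: "mu_n (U k x) > 0" for k unfolding U_def by (rule iter_pos[OF fE fpos[OF xS]])
    have "\<theta>\<^sub>0 < mu_n (U (Suc k) x) / mu_n (U k x)" using x pos[of k] by (simp add: Ob_def less_divide_eq)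
    also have "\<dots> \<le> mu_n (U (Suc (Suc k)) x) / mu_n (U (Suc k) x)"
      unfolding U_def by (rule iter_ratio_mono[OF fE fpos[OF xS]])
    finally show "x \<in> Ob (Suc k)" using xS pos[of "Suc k"] by (simp add: Ob_def less_divide_eq)
  qed
  have "\<exists>T. open T \<and> Ob k = T \<inter> Sph d" for k
  proof -
    have "continuous_on (Sph d) (\<lambda>x. mu_n (U (Suc k) x) - \<theta>\<^sub>0 * mu_n (U k x))"
      by (intro continuous_intros acont)
    then obtain T where "open T" "T \<inter> Sph d = (\<lambda>x. mu_n (U (Suc k) x) - \<theta>\<^sub>0 * mu_n (U k x)) -` {0<..} \<inter> Sph d"
      unfolding continuous_on_open_invariant using open_greaterThan by blast
    then show ?thesis by (intro exI[of _ T]) (auto simp: Ob_def)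
  qed
  then obtain T where T: "\<And>k. open (T k)" "\<And>k. Ob k = T k \<inter> Sph d" by metis
  have "Sph d \<subseteq> (\<Union>k\<in>UNIV. T k)"
  proof
    fix x assume x: "x \<in> Sph d"
    obtain k where "\<theta>\<^sub>0 * mu_n ((Gu ^^ k) (f x)) < mu_n ((Gu ^^ Suc k) (f x))" using grow[OF fE fpos[OF x]] ..
    then have "x \<in> Ob k" using x by (simp add: Ob_def U_def)
    then show "x \<in> (\<Union>k\<in>UNIV. T k)" using T(2) by auto
  qed
  then obtain C where C: "finite C" "Sph d \<subseteq> (\<Union>k\<in>C. T k)"
    by (rule compactE_image[OF compact_Sph T(1)])
  define n where "n = Max (insert 0 C)"
  have all: "x \<in> Ob n" if x: "x \<in> Sph d" for x
  proof -
    obtain k where k: "k \<in> C" "x \<in> T k" using C(2) x by blast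
    then have "k \<le> n" using C(1) by (simp add: n_def)
    moreover have "x \<in> Ob k" unfolding T(2) using k x by blast
    ultimately show ?thesis using lift_Suc_mono_le[of Ob, OF Obmono] by blast
  qed
  \<comment> \<open>The functionals act on functions, while oddness holds only up to norm zero;
    their boundedness makes them insensitive to such differences.\<close>
  have nu0: "l i g = l i h" if "g \<in> LpS \<nu> p" "h \<in> LpS \<nu> p" "nu_n (\<lambda>x. g x - h x) = 0" for i g h
  proof -
    have "l i (\<lambda>x. 1 * g x + (-1) * h x) = 1 * l i g + (-1) * l i h" using lin that by blast
    then have "\<bar>l i g - l i h\<bar> \<le> K * nu_n (\<lambda>x. g x - h x)" using bd[rule_format, OF LpS_diff[OF p that(1,2)], of i] by simp
    then show ?thesis using that by simp
  qed
  have solneg: "sol (\<lambda>x. - g x) (\<lambda>x. - u x) (\<lambda>x. - k x)" if "sol g u k" for g u k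
    using that E_scale[of u k "-1"] A_scale[of "-1" k] B_scale[of "-1" g] by (auto simp: sol_def)
  \<comment> \<open>The negated iterate solves the negated equation. Solutions are unique only up to
    null functions, which follows from \<open>sol_tendsto\<close> for constant sequences.\<close>
  have Uneg: "mu_n (\<lambda>t. U k (\<lambda>i. - x i) t + U k x t) = 0" for k x
  proof (induction k)
    case 0
    have "U 0 (\<lambda>i. - x i) t + U 0 x t = 0" for t by (simp add: U_def f_def sum_negf)
    then show ?case by (simp only:) (simp add: Lpn_def Lpint_def)
  next
    case (Suc k)
    have "((\<lambda>y::nat. mu_n (\<lambda>t. U (Suc k) (\<lambda>i. - x i) t - (- U (Suc k) x t))) \<longlongrightarrow> 0) sequentially"
      unfolding USuc using L[of k x] LpS_scaleR[OF p L[of k x], of "-1"]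
      by (intro sol_tendsto(2)[OF _ G_sol _ solneg[OF G_sol]]) (auto simp: L Suc)
    then show ?case by (simp add: LIMSEQ_const_iff)
  qed
  have Uneg': "nu_n (\<lambda>t. U (Suc k) (\<lambda>i. - x i) t - (- U (Suc k) x t)) = 0" for k x
  proof -
    have "((\<lambda>y::nat. nu_n (\<lambda>t. U (Suc k) (\<lambda>i. - x i) t - (- U (Suc k) x t))) \<longlongrightarrow> 0) sequentially"
      unfolding USuc using L[of k x] LpS_scaleR[OF p L[of k x], of "-1"]
      by (intro sol_tendsto(1)[OF _ G_sol _ solneg[OF G_sol]]) (auto simp: L Uneg)
    then show ?thesis by (simp add: LIMSEQ_const_iff)
  qed
  have Ul: "U (Suc n) x \<in> LpS \<nu> p" for x by (rule E_D(1)[OF UE])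
  \<comment> \<open>The functionals need continuity in \<open>L^p(\<nu>)\<close>, which the
    iteration provides only after one step; hence \<open>Suc n\<close>.\<close>
  have "\<exists>x\<in>Sph d. \<forall>i<d. l i (U (Suc n) x) = 0"
  proof (rule Borsuk_Ulam)
    fix i
    show "continuous_on (Sph d) (\<lambda>x. l i (U (Suc n) x))" unfolding continuous_on_def
    proof
      fix x assume "x \<in> Sph d"
      have le: "norm (l i (U (Suc n) y) - l i (U (Suc n) x)) \<le> K * nu_n (\<lambda>t. U (Suc n) y t - U (Suc n) x t)" for y
      proof -
        have "l i (\<lambda>t. 1 * U (Suc n) y t + (-1) * U (Suc n) x t) = 1 * l i (U (Suc n) y) + (-1) * l i (U (Suc n) x)"
          using lin Ul by blast
        then show ?thesis using bd[rule_format, OF LpS_diff[OF p Ul[of y] Ul[of x]], of i] by simp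
      qed
      have "((\<lambda>y. K * nu_n (\<lambda>t. U (Suc n) y t - U (Suc n) x t)) \<longlongrightarrow> 0) (at x within Sph d)"
        using tendsto_mult_left[OF cont', of K] by simp
      then have "((\<lambda>y. l i (U (Suc n) y) - l i (U (Suc n) x)) \<longlongrightarrow> 0) (at x within Sph d)"
        by (rule Lim_null_comparison[rotated]) (use le in auto)
      then show "((\<lambda>y. l i (U (Suc n) y)) \<longlongrightarrow> l i (U (Suc n) x)) (at x within Sph d)" by (rule LIM_zero_cancel)
    qed
    fix x
    have "l i (U (Suc n) (\<lambda>j. - x j)) = l i (\<lambda>t. - U (Suc n) x t)"
      using LpS_scaleR[OF p Ul, of "-1" x] by (intro nu0 Ul Uneg') simp
    also have "l i (\<lambda>t. (-1) * U (Suc n) x t + 0 * U (Suc n) x t) = (-1) * l i (U (Suc n) x) + 0 * l i (U (Suc n) x)"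
      using lin Ul by blast
    then have "l i (\<lambda>t. - U (Suc n) x t) = - l i (U (Suc n) x)" by simp
    finally show "l i (U (Suc n) (\<lambda>j. - x j)) = - l i (U (Suc n) x)" .
  qed
  then obtain x where x: "x \<in> Sph d" "\<And>i. i < d \<Longrightarrow> l i (U (Suc n) x) = 0" by blast
  \<comment> \<open>With all functionals zero, \<open>mu_n\<close> of step \<open>Suc n\<close> is
    at most \<open>\<epsilon> powr (1 / p)\<close> times its gradient norm. Combined with the energy
    estimate this bounds the ratio of steps \<open>n\<close> and \<open>Suc n\<close> by
    \<open>\<theta>\<^sub>0\<close>, although that step exceeds it everywhere.\<close>
  let ?u = "mu_n (U (Suc n) x)" and ?f = "mu_n (U n x)" and ?N = "nu_n (Gg (U n x))"
  have pos: "mu_n (U k x) > 0" for k unfolding U_def by (rule iter_pos[OF fE fpos[OF x(1)]])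
  have "?u \<le> \<epsilon> powr (1 / p) * ?N" using fr UE[of n x] x(2) by fastforce
  then have "?u powr p \<le> (\<epsilon> powr (1 / p) * ?N) powr p" using p by (intro powr_mono2) auto
  also have "\<dots> = \<epsilon> * ?N powr p" using p eps by (simp add: powr_mult powr_powr)
  also have "\<dots> \<le> \<epsilon> * (?f powr (p - 1) * ?u)"
    using sol_energy(2)[OF L G_sol[OF L]] eps by (intro mult_left_mono) (auto simp: USuc)
  finally have "?u * ?u powr (p - 1) \<le> ?u * (\<epsilon> * ?f powr (p - 1))"
    using powr_mult_base[of ?u "p - 1"] by (simp add: mult_ac)
  then have "?u powr (p - 1) \<le> \<epsilon> * ?f powr (p - 1)" using pos by (simp only: mult_le_cancel_left_pos)
  also have "\<dots> = (\<theta>\<^sub>0 * ?f) powr (p - 1)" using \<theta>\<^sub>0 by (simp add: powr_mult)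
  finally have "?u \<le> \<theta>\<^sub>0 * ?f" by (rule powr_le_imp_le) (use p \<theta>\<^sub>0 in auto)
  then show False using all[OF x(1)] by (simp add: Ob_def)
qed

text \<open>Approximating \<open>u\<close> by a test function within half its
  \<open>\<mu>\<close>-norm and using \<open>B u u = mu_n u powr p\<close> gives a contradiction
  unless the norm vanishes.\<close>

lemma E_dual_zero:
  assumes z: "(u, g) \<in> E" and 0: "\<And>\<phi>. \<phi> \<in> V \<Longrightarrow> B u \<phi> = 0"
  shows "mu_n u = 0"
proof (rule ccontr)
  assume "mu_n u \<noteq> 0"
  then have m: "mu_n u > 0" using Lpn_nonneg[of \<mu> p u] by linarith
  then have "mu_n u / (2 * Cm) > 0" using Cm by simp
  from E_approx[OF z this] obtain \<phi> where \<phi>: "\<phi> \<in> V" "nu_n (\<lambda>x. u x - \<phi> x) < mu_n u / (2 * Cm)" .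
  note L = E_D[OF z] V_LpS[OF \<phi>(1)]
  have "mu_n (\<lambda>x. u x - \<phi> x) \<le> Cm * nu_n (\<lambda>x. u x - \<phi> x)" by (rule mu_le[OF LpS_diff[OF p L(1,4)]])
  also have "\<dots> \<le> Cm * (mu_n u / (2 * Cm))" using \<phi>(2) Cm by (intro mult_left_mono) auto
  also have "\<dots> = mu_n u / 2" using Cm by simp
  finally have d: "mu_n (\<lambda>x. u x - \<phi> x) \<le> mu_n u / 2" .
  have "mu_n u powr p = B u (\<lambda>x. u x - \<phi> x)"
    using B_diff[OF L(3) L(3) mu_LpS[OF L(4)]] 0[OF \<phi>(1)] B_self[of u] by simp
  also have "\<dots> \<le> mu_n u powr (p - 1) * mu_n (\<lambda>x. u x - \<phi> x)"
    using B_bound[OF L(3) mu_LpS[OF LpS_diff[OF p L(1,4)]]] by linarith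
  also have "\<dots> \<le> mu_n u powr (p - 1) * (mu_n u / 2)" using d by (intro mult_left_mono) auto
  also have "\<dots> = mu_n u powr p / 2" using m by (simp add: powr_diff)
  finally show False using m by simp
qed

lemma A_cong_AE:
  assumes "g \<in> LpS \<nu> p" "h \<in> LpS \<nu> p" "k \<in> LpS \<nu> p" "AE x in \<nu>. g x = h x"
  shows "A g k = A h k"
  unfolding A_def
proof (rule integral_cong_AE)
  note [measurable] = assms(1-3)[THEN LpS_measurable]
  show "(\<lambda>x. dual_vec p (g x) \<bullet> k x) \<in> borel_measurable \<nu>" "(\<lambda>x. dual_vec p (h x) \<bullet> k x) \<in> borel_measurable \<nu>"
    unfolding dual_vec_def by measurable
  show "AE x in \<nu>. dual_vec p (g x) \<bullet> k x = dual_vec p (h x) \<bullet> k x" using assms(4) by eventually_elim simp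
qed

lemma B_cong_AE:
  assumes "g \<in> LpS \<mu> p" "h \<in> LpS \<mu> p" "k \<in> LpS \<mu> p" "AE x in \<mu>. g x = h x"
  shows "B g k = B h k"
  unfolding B_def
proof (rule integral_cong_AE)
  note [measurable] = assms(1-3)[THEN LpS_measurable]
  show "(\<lambda>x. dual_vec p (g x) \<bullet> k x) \<in> borel_measurable \<mu>" "(\<lambda>x. dual_vec p (h x) \<bullet> k x) \<in> borel_measurable \<mu>"
    unfolding dual_vec_def by measurable
  show "AE x in \<mu>. dual_vec p (g x) \<bullet> k x = dual_vec p (h x) \<bullet> k x" using assms(4) by eventually_elim simp
qed

text \<open>Both sides of the eigenvalue equation are homogeneous of the same degree, so a multiple
  has the same eigenvalue; two different ones would make \<open>B u\<close> vanish on all test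
  functions.\<close>

lemma eigenpairs_proportional:
  assumes z: "(u, g) \<in> E" "(v, h) \<in> E"
    and eu: "\<And>\<phi>. \<phi> \<in> V \<Longrightarrow> A g (D \<phi>) = lam * B u \<phi>" and ev: "\<And>\<phi>. \<phi> \<in> V \<Longrightarrow> A h (D \<phi>) = lam' * B v \<phi>"
    and u: "mu_n u > 0" and pr: "AE x in \<mu>. u x = c * v x" "AE x in \<nu>. g x = c *\<^sub>R h x"
  shows "lam = lam'"
proof (rule ccontr)
  assume ne: "lam \<noteq> lam'"
  have "B u \<phi> = 0" if \<phi>: "\<phi> \<in> V" for \<phi>
  proof -
    have a: "A g (D \<phi>) = \<bar>c\<bar> powr (p - 2) * c * A h (D \<phi>)"
      using A_cong_AE[OF E_D(2)[OF z(1)] LpS_scaleR[OF p E_D(2)[OF z(2)]] D_LpS[OF \<phi>] pr(2)] A_scale by simp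
    have b: "B u \<phi> = \<bar>c\<bar> powr (p - 2) * c * B v \<phi>"
      using B_cong_AE[OF E_D(3)[OF z(1)] LpS_mult[OF p E_D(3)[OF z(2)]] mu_LpS[OF V_LpS[OF \<phi>]] pr(1)] B_scale by simp
    have "lam * B u \<phi> = \<bar>c\<bar> powr (p - 2) * c * (lam' * B v \<phi>)"
      using eu[OF \<phi>] a unfolding ev[OF \<phi>] by (rule trans[OF sym])
    also have "\<dots> = lam' * B u \<phi>" unfolding b by (rule mult.left_commute)
    finally have "lam * B u \<phi> = lam' * B u \<phi>" .
    then show ?thesis using ne by simp
  qed
  from E_dual_zero[OF z(1) this] u show False by simp
qed

end

section \<open>Test functions and weak gradients\<close>

lemma Ck_continuous: "Ck k f \<Longrightarrow> continuous_on UNIV f"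
  by (cases k) (auto intro!: differentiable_imp_continuous_within simp: continuous_on_eq_continuous_within)

lemma Ck_Suc_imp: "Ck (Suc k) f \<Longrightarrow> Ck k f"
proof (induction k arbitrary: f)
  case 0
  then show ?case using Ck_continuous[OF 0] by simp
next
  case (Suc k)
  from Suc.prems have "\<forall>x. f differentiable (at x)"
    "\<And>i. i \<in> Basis \<Longrightarrow> Ck (Suc k) (\<lambda>x. frechet_derivative f (at x) i)"
    by (simp_all only: Ck.simps(2)[of "Suc k"]) blast
  then show ?case using Suc.IH by simp
qed

lemma Ck_const: "Ck k (\<lambda>x. c)"
  by (induction k arbitrary: c) (auto intro: continuous_on_const simp: frechet_derivative_const)

lemma Ck_cong_frechet:
  assumes "\<And>x. (f has_derivative f' x) (at x)" "\<And>i. i \<in> Basis \<Longrightarrow> Ck k (\<lambda>x. f' x i)"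
  shows "Ck (Suc k) f"
proof -
  have "frechet_derivative f (at x) = f' x" for x using frechet_derivative_at[OF assms(1)] by simp
  then show ?thesis using assms by (auto simp: differentiable_def)
qed

lemma Ck_SucD:
  assumes "Ck (Suc k) f"
  shows "(f has_derivative frechet_derivative f (at x)) (at x)" "i \<in> Basis \<Longrightarrow> Ck k (\<lambda>x. frechet_derivative f (at x) i)"
  using assms by (auto simp: frechet_derivative_works)

lemma Ck_inner: "Ck k (\<lambda>x. x \<bullet> v)"
proof (cases k)
  case 0
  then show ?thesis by (auto intro: continuous_intros)
next
  case (Suc k)
  have "Ck (Suc k) (\<lambda>x. x \<bullet> v)"
    by (rule Ck_cong_frechet[of _ "\<lambda>x h. h \<bullet> v"]) (auto intro!: derivative_eq_intros Ck_const)
  then show ?thesis using Suc by simp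
qed

lemma Ck_lincomb: "Ck k f \<Longrightarrow> Ck k g \<Longrightarrow> Ck k (\<lambda>x. a * f x + b * g x)"
proof (induction k arbitrary: f g)
  case 0
  then show ?case by (auto intro!: continuous_intros)
next
  case (Suc k)
  note f = Ck_SucD[OF Suc.prems(1)] and g = Ck_SucD[OF Suc.prems(2)]
  show ?case
    by (rule Ck_cong_frechet[of _ "\<lambda>x h. a * frechet_derivative f (at x) h + b * frechet_derivative g (at x) h"])
      (auto intro!: Suc.IH f(2) g(2) has_derivative_add has_derivative_mult_right f(1) g(1))
qed

lemma Ck_mult: "Ck k f \<Longrightarrow> Ck k g \<Longrightarrow> Ck k (\<lambda>x. f x * g x)"
proof (induction k arbitrary: f g)
  case 0
  then show ?case by (auto intro!: continuous_intros)
next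
  case (Suc k)
  note f = Ck_SucD[OF Suc.prems(1)] and g = Ck_SucD[OF Suc.prems(2)]
  show ?case
  proof (rule Ck_cong_frechet[of _ "\<lambda>x h. f x * frechet_derivative g (at x) h + frechet_derivative f (at x) h * g x"])
    show "((\<lambda>x. f x * g x) has_derivative (\<lambda>h. f x * frechet_derivative g (at x) h + frechet_derivative f (at x) h * g x)) (at x)" for x
      by (rule has_derivative_mult[OF f(1) g(1)])
    show "Ck k (\<lambda>x. f x * frechet_derivative g (at x) i + frechet_derivative f (at x) i * g x)" if i: "i \<in> Basis" for i
      using Ck_lincomb[OF Suc.IH[OF Ck_Suc_imp[OF Suc.prems(1)] g(2)[OF i]] Suc.IH[OF f(2)[OF i] Ck_Suc_imp[OF Suc.prems(2)]], of 1 1]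
      by simp
  qed
qed

lemma Ck_prod: "finite I \<Longrightarrow> (\<And>i. i \<in> I \<Longrightarrow> Ck k (f i)) \<Longrightarrow> Ck k (\<lambda>x. \<Prod>i\<in>I. f i x)"
  by (induction I rule: finite_induct) (auto intro: Ck_const Ck_mult)

text \<open>The outer function comes with the whole sequence of its derivatives, so that the
  induction on \<open>k\<close> can move from \<open>e j\<close> to
  \<open>e (Suc j)\<close>.\<close>

lemma Ck_compose:
  fixes e :: "nat \<Rightarrow> real \<Rightarrow> real"
  assumes e: "\<And>j t. (e j has_real_derivative e (Suc j) t) (at t)"
  shows "Ck k f \<Longrightarrow> Ck k (\<lambda>x. e j (f x))"
proof (induction k arbitrary: f j)
  case 0
  have "continuous_on UNIV (e j)"
    by (rule DERIV_continuous_on) (use e has_field_derivative_at_within in blast)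
  with 0 show ?case by (auto intro: continuous_on_compose2)
next
  case (Suc k)
  note f = Ck_SucD[OF Suc.prems]
  show ?case
  proof (rule Ck_cong_frechet[of _ "\<lambda>x h. e (Suc j) (f x) * frechet_derivative f (at x) h"])
    show "((\<lambda>x. e j (f x)) has_derivative (\<lambda>h. e (Suc j) (f x) * frechet_derivative f (at x) h)) (at x)" for x
      using has_derivative_compose[OF f(1) e[of j, unfolded has_field_derivative_def]] by simp
    show "Ck k (\<lambda>x. e (Suc j) (f x) * frechet_derivative f (at x) i)" if "i \<in> Basis" for i
      by (intro Ck_mult Suc.IH Ck_Suc_imp[OF Suc.prems] f(2) that)
  qed
qed

text \<open>The derivative of \<open>P(1 / t) * exp (- 1 / t)\<close> is
  \<open>(P - P')(1 / t) / t^2 * exp (- 1 / t)\<close>, so each step multiplies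
  \<open>P - P'\<close> by the square of its variable.\<close>

fun bump_poly :: "nat \<Rightarrow> real poly" where
  "bump_poly 0 = 1"
| "bump_poly (Suc j) = [:0, 0, 1:] * (bump_poly j - pderiv (bump_poly j))"

text \<open>The \<open>j\<close>-th derivative of the flat function \<open>t \<mapsto> exp (- 1 / t)\<close>, extended by zero.\<close>

definition flat_exp :: "nat \<Rightarrow> real \<Rightarrow> real" where
  "flat_exp j t = (if t > 0 then poly (bump_poly j) (1 / t) * exp (- (1 / t)) else 0)"

lemma poly_mult_exp_tendsto_0: "((\<lambda>s. s ^ k * poly q s * exp (- s)) \<longlongrightarrow> 0) (at_top :: real filter)"
proof (induction q arbitrary: k)
  case 0
  then show ?case by simp
next
  case (pCons a q)
  have "((\<lambda>s. a * (s ^ k / exp s) + s ^ Suc k * poly q s * exp (- s)) \<longlongrightarrow> a * 0 + 0) at_top"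
    by (intro tendsto_intros tendsto_power_div_exp_0 pCons.IH)
  then show ?case by (simp add: exp_minus field_simps)
qed

lemma flat_exp_deriv: "(flat_exp j has_real_derivative flat_exp (Suc j) t) (at t)"
proof -
  consider "t > 0" | "t < 0" | "t = 0" by linarith
  then show ?thesis
  proof cases
    case 1
    have "((\<lambda>t. poly (bump_poly j) (1 / t) * exp (- (1 / t))) has_real_derivative flat_exp (Suc j) t) (at t)"
      using 1 by (auto intro!: derivative_eq_intros DERIV_chain'[OF _ poly_DERIV] simp: flat_exp_def field_simps power2_eq_square)
    then show ?thesis
      by (rule has_field_derivative_transform_within_open[of _ _ _ "{0<..}"]) (use 1 in \<open>auto simp: flat_exp_def\<close>)
  next
    case 2
    have "((\<lambda>t. 0) has_real_derivative flat_exp (Suc j) t) (at t)"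
      using 2 by (auto simp: flat_exp_def)
    then show ?thesis
      by (rule has_field_derivative_transform_within_open[of _ _ _ "{..<0}"]) (use 2 in \<open>auto simp: flat_exp_def\<close>)
  next
    case 3
    have "((\<lambda>h. (flat_exp j (0 + h) - flat_exp j 0) / h) \<longlongrightarrow> 0) (at 0)"
    proof (rule filterlim_split_at_real)
      have "((\<lambda>h. inverse h ^ 1 * poly (bump_poly j) (inverse h) * exp (- inverse h)) \<longlongrightarrow> 0) (at_right (0::real))"
        by (rule filterlim_compose[OF poly_mult_exp_tendsto_0 filterlim_inverse_at_top_right])
      then show "((\<lambda>h. (flat_exp j (0 + h) - flat_exp j 0) / h) \<longlongrightarrow> 0) (at_right 0)"
        by (rule Lim_transform_eventually)
          (use eventually_at_right_less[of "0::real"] in eventually_elim, simp add: flat_exp_def field_simps)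
      have "\<forall>\<^sub>F h in at_left (0::real). (flat_exp j (0 + h) - flat_exp j 0) / h = 0"
        by (auto simp: eventually_at_filter flat_exp_def)
      then show "((\<lambda>h. (flat_exp j (0 + h) - flat_exp j 0) / h) \<longlongrightarrow> 0) (at_left 0)"
        by (simp add: tendsto_eventually)
    qed
    then show ?thesis unfolding 3 by (simp add: DERIV_def flat_exp_def)
  qed
qed

definition box_bump :: "'a::euclidean_space \<Rightarrow> 'a \<Rightarrow> real \<Rightarrow> 'a \<Rightarrow> real" where
  "box_bump a b m x = 1 - exp (- m * (\<Prod>i\<in>Basis. flat_exp 0 (x \<bullet> i - a \<bullet> i) * flat_exp 0 (b \<bullet> i - x \<bullet> i)))"

lemma flat_exp_0: "flat_exp 0 t \<ge> 0" "flat_exp 0 t > 0 \<longleftrightarrow> t > 0" "flat_exp 0 t = 0 \<longleftrightarrow> t \<le> 0"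
  by (auto simp: flat_exp_def)

lemma box_bump_outside: "x \<notin> box a b \<Longrightarrow> box_bump a b m x = 0"
  by (auto simp: box_bump_def mem_box flat_exp_0 not_less)

lemma box_bump_limit: "x \<in> box a b \<Longrightarrow> (\<lambda>n. box_bump a b (real n) x) \<longlonglongrightarrow> 1"
proof -
  assume x: "x \<in> box a b"
  let ?c = "\<Prod>i\<in>Basis. flat_exp 0 (x \<bullet> i - a \<bullet> i) * flat_exp 0 (b \<bullet> i - x \<bullet> i)"
  have c: "?c > 0" using x by (auto intro!: prod_pos simp: mem_box flat_exp_0)
  have "(\<lambda>n. 1 - exp (- ?c) ^ n) \<longlonglongrightarrow> 1 - 0"
    using c by (intro tendsto_intros LIMSEQ_power_zero) auto
  then show ?thesis by (simp add: box_bump_def mult.commute flip: exp_of_nat_mult)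
qed

lemma box_bump_pos: "x \<in> box a b \<Longrightarrow> m > 0 \<Longrightarrow> box_bump a b m x > 0"
proof -
  assume x: "x \<in> box a b" and m: "m > 0"
  have "(\<Prod>i\<in>Basis. flat_exp 0 (x \<bullet> i - a \<bullet> i) * flat_exp 0 (b \<bullet> i - x \<bullet> i)) > 0"
    using x by (auto intro!: prod_pos simp: mem_box flat_exp_0)
  then show ?thesis using m by (simp add: box_bump_def)
qed

lemma box_bump_bounds: "m \<ge> 0 \<Longrightarrow> 0 \<le> box_bump a b m x \<and> box_bump a b m x \<le> 1"
proof -
  assume m: "m \<ge> 0"
  have "(\<Prod>i\<in>Basis. flat_exp 0 (x \<bullet> i - a \<bullet> i) * flat_exp 0 (b \<bullet> i - x \<bullet> i)) \<ge> 0"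
    by (intro prod_nonneg mult_nonneg_nonneg flat_exp_0 ballI)
  then show ?thesis using m by (simp add: box_bump_def)
qed

lemma Ck_box_bump: "Ck k (box_bump a b m)"
proof -
  have e: "((\<lambda>t. (- m) ^ j * exp (- m * t)) has_real_derivative (- m) ^ Suc j * exp (- m * t)) (at t)" for j t
    by (auto intro!: derivative_eq_intros)
  have "Ck k (\<lambda>x. x \<bullet> i - a \<bullet> i)" "Ck k (\<lambda>x. b \<bullet> i - x \<bullet> i)" for i
    using Ck_lincomb[OF Ck_inner[of k i] Ck_const[of k 1], of 1 "- (a \<bullet> i)"]
      Ck_lincomb[OF Ck_inner[of k i] Ck_const[of k 1], of "-1" "b \<bullet> i"] by simp_all
  then have "Ck k (\<lambda>x. \<Prod>i\<in>Basis. flat_exp 0 (x \<bullet> i - a \<bullet> i) * flat_exp 0 (b \<bullet> i - x \<bullet> i))"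
    by (intro Ck_prod Ck_mult Ck_compose[of flat_exp, OF flat_exp_deriv]) auto
  from Ck_lincomb[OF Ck_const[of k 1] Ck_compose[of "\<lambda>j t. (- m) ^ j * exp (- m * t)", OF e this, of 0], of 1 "-1"]
  show ?thesis unfolding box_bump_def by simp
qed

lemma box_bump_test:
  assumes "cbox a b \<subseteq> U"
  shows "box_bump a b m \<in> test_functions U"
proof -
  have s: "{x. box_bump a b m x \<noteq> 0} \<subseteq> cbox a b" using box_bump_outside box_subset_cbox by blast
  then have c: "closure {x. box_bump a b m x \<noteq> 0} \<subseteq> cbox a b" by (rule closure_minimal[OF _ closed_cbox])
  moreover have "compact (closure {x. box_bump a b m x \<noteq> 0})"
    using bounded_subset[OF bounded_cbox s] by (simp add: compact_closure)
  ultimately show ?thesis using assms Ck_box_bump by (auto simp: test_functions_def)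
qed

lemma test_functions_lincomb:
  assumes "\<phi> \<in> test_functions U" "\<psi> \<in> test_functions U"
  shows "(\<lambda>x. a * \<phi> x + b * \<psi> x) \<in> test_functions U"
proof -
  let ?S = "\<lambda>f. closure {x. f x \<noteq> (0::real)}"
  have "{x. a * \<phi> x + b * \<psi> x \<noteq> 0} \<subseteq> {x. \<phi> x \<noteq> 0} \<union> {x. \<psi> x \<noteq> 0}" by auto
  also have "\<dots> \<subseteq> ?S \<phi> \<union> ?S \<psi>" by (intro Un_mono closure_subset)
  finally have s: "{x. a * \<phi> x + b * \<psi> x \<noteq> 0} \<subseteq> ?S \<phi> \<union> ?S \<psi>" .
  then have c: "?S (\<lambda>x. a * \<phi> x + b * \<psi> x) \<subseteq> ?S \<phi> \<union> ?S \<psi>" by (intro closure_minimal) auto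
  have "compact (?S \<phi> \<union> ?S \<psi>)" using assms by (auto simp: test_functions_def)
  then have "compact (?S (\<lambda>x. a * \<phi> x + b * \<psi> x))"
    using bounded_subset[OF compact_imp_bounded s] by (simp add: compact_closure)
  with c assms show ?thesis by (auto simp: test_functions_def intro: Ck_lincomb)
qed

text \<open>Lebesgue differentiation along small cubes with corner \<open>x\<close> recovers
  \<open>g x\<close> almost everywhere from integrals that all vanish.\<close>

lemma integral_vanishing_boxes_AE:
  fixes g :: "'a::euclidean_space \<Rightarrow> real"
  assumes g: "integrable lebesgue (\<lambda>x. indicator (cbox c d) x *\<^sub>R g x)"
    and zero: "\<And>a b. cbox a b \<subseteq> box c d \<Longrightarrow> integral (cbox a b) g = 0"
  shows "negligible {x \<in> box c d. g x \<noteq> 0}"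
proof -
  let ?f = "\<lambda>x. indicator (cbox c d) x *\<^sub>R g x"
  have fi: "?f integrable_on cbox a b" for a b
    using integrable_on_subcbox[OF integrable_on_lebesgue[OF g]] by simp
  have "\<exists>N. negligible N \<and> (\<forall>x e. x \<notin> N \<longrightarrow> 0 < e \<longrightarrow>
      (\<exists>r>0. \<forall>h. 0 < h \<and> h < r \<longrightarrow> norm (integral (cbox x (x + h *\<^sub>R One)) ?f /\<^sub>R h ^ DIM('a) - ?f x) < e))"
    by (rule integrable_ccontinuous_explicit[OF fi]) blast
  then obtain N where N: "negligible N" "\<forall>x e. x \<notin> N \<longrightarrow> 0 < e \<longrightarrow>
      (\<exists>r>0. \<forall>h. 0 < h \<and> h < r \<longrightarrow> norm (integral (cbox x (x + h *\<^sub>R One)) ?f /\<^sub>R h ^ DIM('a) - ?f x) < e)"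
    by (elim exE conjE)
  have "{x \<in> box c d. g x \<noteq> 0} \<subseteq> N"
  proof (rule subsetI, rule ccontr)
    fix x assume x: "x \<in> {x \<in> box c d. g x \<noteq> 0}" and "x \<notin> N"
    then have "\<bar>g x\<bar> > 0" by simp
    from N(2)[rule_format, OF \<open>x \<notin> N\<close> this] obtain r where r: "r > 0"
      "\<And>h. 0 < h \<Longrightarrow> h < r \<Longrightarrow> norm (integral (cbox x (x + h *\<^sub>R One)) ?f /\<^sub>R h ^ DIM('a) - ?f x) < \<bar>g x\<bar>" by blast
    obtain e where e: "e > 0" "ball x e \<subseteq> box c d" using x open_box open_contains_ball by blast
    \<comment> \<open>The cube with corner \<open>x\<close> and edge \<open>h\<close> has diameter
      \<open>h * norm One\<close>, which must stay below \<open>e\<close> to remain in the ball;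
      \<open>r / 2\<close> keeps \<open>h\<close> in the range of the differentiation
      theorem.\<close>
    define h where "h = min (r / 2) (e / (2 * (norm (One::'a) + 1)))"
    have n1: "norm (One::'a) + 1 > 0" by (simp add: add_nonneg_pos)
    have h: "0 < h" "h < r" using r e n1 by (auto simp: h_def)
    have "h * (norm (One::'a) + 1) \<le> e / (2 * (norm (One::'a) + 1)) * (norm (One::'a) + 1)"
      using n1 by (intro mult_right_mono) (auto simp: h_def)
    also have "\<dots> = e / 2" using n1 by (simp add: field_simps)
    finally have hn: "h * norm (One::'a) < e" using h e by (simp add: algebra_simps)
    have sub: "cbox x (x + h *\<^sub>R One) \<subseteq> box c d"
    proof
      fix y assume y: "y \<in> cbox x (x + h *\<^sub>R One)"
      have "norm (y - x) \<le> norm (h *\<^sub>R (One::'a))"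
        using y h by (intro norm_le_componentwise) (auto simp: mem_box algebra_simps)
      then have "y \<in> ball x e" using hn h by (simp add: dist_norm norm_minus_commute)
      then show "y \<in> box c d" using e by blast
    qed
    have "integral (cbox x (x + h *\<^sub>R One)) ?f = integral (cbox x (x + h *\<^sub>R One)) g"
      using sub box_subset_cbox by (intro integral_cong) (auto simp: indicator_def)
    also have "\<dots> = 0" by (rule zero[OF sub])
    finally have "norm (?f x) < \<bar>g x\<bar>" using r(2)[OF h] by simp
    moreover have "?f x = g x" using x box_subset_cbox by (auto simp: indicator_def)
    ultimately show False by auto
  qed
  then show ?thesis using N(1) negligible_subset by blast
qed

section \<open>Integration by parts and the fundamental lemma\<close>

lemma test_functionsD:
  assumes "\<phi> \<in> test_functions U"
  shows "Ck k \<phi>" "compact (closure {x. \<phi> x \<noteq> 0})" "closure {x. \<phi> x \<noteq> 0} \<subseteq> U"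
    "continuous_on UNIV \<phi>" "(\<phi> has_derivative frechet_derivative \<phi> (at x)) (at x)"
    "i \<in> Basis \<Longrightarrow> Ck k (\<lambda>x. frechet_derivative \<phi> (at x) i)"
    "x \<notin> closure {x. \<phi> x \<noteq> 0} \<Longrightarrow> \<phi> x = 0"
proof -
  have C: "Ck k \<phi>" for k using assms by (simp add: test_functions_def)
  then show "Ck k \<phi>" .
  show "compact (closure {x. \<phi> x \<noteq> 0})" "closure {x. \<phi> x \<noteq> 0} \<subseteq> U"
    using assms by (auto simp: test_functions_def)
  show "continuous_on UNIV \<phi>" by (rule Ck_continuous[OF C])
  show "(\<phi> has_derivative frechet_derivative \<phi> (at x)) (at x)" by (rule Ck_SucD(1)[OF C])
  show "i \<in> Basis \<Longrightarrow> Ck k (\<lambda>x. frechet_derivative \<phi> (at x) i)" by (rule Ck_SucD(2)[OF C])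
  show "x \<notin> closure {x. \<phi> x \<noteq> 0} \<Longrightarrow> \<phi> x = 0" using closure_subset[of "{x. \<phi> x \<noteq> 0}"] by auto
qed

lemma frechet_derivative_outside_support:
  assumes "x \<notin> closure {x. f x \<noteq> (0::real)}"
  shows "frechet_derivative f (at x) i = 0"
proof -
  have "((\<lambda>x. 0) has_derivative (\<lambda>h. 0)) (at x)" by simp
  then have "(f has_derivative (\<lambda>h. 0)) (at x)"
    by (rule has_derivative_transform_within_open[of _ _ _ _ "- closure {x. f x \<noteq> 0}"])
      (use assms closure_subset[of "{x. f x \<noteq> 0}"] in auto)
  from frechet_derivative_at[OF this, symmetric] show ?thesis by simp
qed

lemma integral_lebesgue_on_support:
  fixes F :: "'a::euclidean_space \<Rightarrow> real"
  assumes "F \<in> borel_measurable borel" "U \<in> sets lebesgue" "\<And>x. x \<notin> U \<Longrightarrow> F x = 0"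
  shows "integral\<^sup>L (lebesgue_on U) F = integral\<^sup>L lborel F"
proof -
  have "integral\<^sup>L (lebesgue_on U) F = integral\<^sup>L lebesgue (\<lambda>x. indicator U x *\<^sub>R F x)"
    using assms(2) by (simp add: integral_restrict_space)
  also have "(\<lambda>x. indicator U x *\<^sub>R F x) = F" by (rule ext) (use assms(3) in \<open>auto simp: indicator_def\<close>)
  also have "integral\<^sup>L lebesgue F = integral\<^sup>L lborel F" using assms(1) by (intro integral_completion) simp
  finally show ?thesis .
qed

lemma integrable_lebesgue_on_support:
  fixes F :: "'a::euclidean_space \<Rightarrow> real"
  assumes "integrable lborel F" "U \<in> sets lebesgue"
  shows "integrable (lebesgue_on U) F"
proof -
  have "integrable lebesgue F" using assms(1) by (subst integrable_completion) auto
  from integrable_mult_indicator[OF assms(2) this] show ?thesis using assms(2) by (simp add: integrable_restrict_space)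
qed

lemma integrable_continuous_compact_support:
  fixes F :: "'a::euclidean_space \<Rightarrow> real"
  assumes "continuous_on UNIV F" "compact K" "\<And>x. x \<notin> K \<Longrightarrow> F x = 0"
  shows "integrable lborel F"
proof -
  have "(\<lambda>x. indicator K x *\<^sub>R F x) = F" by (rule ext) (use assms(3) in \<open>auto simp: indicator_def\<close>)
  then show ?thesis using borel_integrable_compact[OF assms(2) continuous_on_subset[OF assms(1)]] by simp
qed

lemma lborel_integral_translation:
  fixes F :: "'a::euclidean_space \<Rightarrow> real"
  assumes "F \<in> borel_measurable borel"
  shows "(\<integral>x. F (x + c) \<partial>lborel) = integral\<^sup>L lborel F"
proof -
  have "integral\<^sup>L lborel F = integral\<^sup>L (distr lborel borel ((+) c)) F" by (simp add: lborel_distr_plus)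
  also have "\<dots> = (\<integral>x. F (c + x) \<partial>lborel)" using assms by (intro integral_distr) auto
  finally show ?thesis by (simp add: add.commute)
qed

text \<open>Difference quotients in the direction \<open>i\<close> have integral zero by translation
  invariance; they converge to the derivative and are dominated through the mean value
  theorem.\<close>

lemma integral_partial_derivative_zero:
  fixes f :: "'a::euclidean_space \<Rightarrow> real"
  assumes C: "Ck (Suc 0) f" and K: "compact (closure {x. f x \<noteq> 0})" and i: "i \<in> Basis"
  shows "(\<integral>x. frechet_derivative f (at x) i \<partial>lborel) = 0"
proof -
  define K where "K = closure {x. f x \<noteq> 0}"
  define f' where "f' x = frechet_derivative f (at x) i" for x
  have f'c: "continuous_on UNIV f'" unfolding f'_def using Ck_SucD(2)[OF C i] by simp
  have fc: "continuous_on UNIV f" by (rule Ck_continuous[OF C])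
  have [measurable]: "f \<in> borel_measurable borel" "f' \<in> borel_measurable borel"
    using fc f'c borel_measurable_continuous_onI by auto
  have f0: "f x = 0" if "x \<notin> K" for x using that closure_subset[of "{x. f x \<noteq> 0}"] unfolding K_def by auto
  have f'0: "f' x = 0" if "x \<notin> K" for x unfolding f'_def using that unfolding K_def by (rule frechet_derivative_outside_support)
  have line: "((\<lambda>t. f (x + t *\<^sub>R i)) has_real_derivative f' (x + t *\<^sub>R i)) (at t)" for x t
  proof -
    have "((\<lambda>t. x + t *\<^sub>R i) has_derivative (\<lambda>h. h *\<^sub>R i)) (at t)" by (auto intro!: derivative_eq_intros)
    from has_derivative_compose[OF this Ck_SucD(1)[OF C]]
    have "((\<lambda>t. f (x + t *\<^sub>R i)) has_derivative (\<lambda>h. frechet_derivative f (at (x + t *\<^sub>R i)) (h *\<^sub>R i))) (at t)" .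
    moreover have "frechet_derivative f (at (x + t *\<^sub>R i)) (h *\<^sub>R i) = f' (x + t *\<^sub>R i) * h" for h
      using linear_scale[OF has_derivative_linear[OF Ck_SucD(1)[OF C, of "x + t *\<^sub>R i"]], of h i] by (simp add: f'_def)
    ultimately show ?thesis by (simp add: has_field_derivative_def)
  qed
  have "bounded (f' ` K)" using K f'c unfolding K_def[symmetric]
    by (intro compact_imp_bounded compact_continuous_image) (auto intro: continuous_on_subset)
  then obtain M where M: "\<And>x. x \<in> K \<Longrightarrow> \<bar>f' x\<bar> \<le> M" by (auto simp: bounded_iff)
  have M': "\<bar>f' x\<bar> \<le> \<bar>M\<bar>" for x using M[of x] f'0[of x] by (cases "x \<in> K") auto
  \<comment> \<open>The support swept backwards by steps of length at most 1: outside it no point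
    \<open>x + z *\<^sub>R i\<close> with \<open>0 \<le> z \<le> 1\<close> meets the support, so it
    carries all the difference quotients.\<close>
  define K' where "K' = (\<lambda>(t, x). x - t *\<^sub>R i) ` ({0..1} \<times> K)"
  have K'c: "compact K'" unfolding K'_def case_prod_beta using K unfolding K_def[symmetric]
    by (intro compact_continuous_image compact_Times continuous_intros) auto
  define h where "h n = 1 / real (Suc n)" for n
  have h: "0 < h n" "h n \<le> 1" for n by (auto simp: h_def)
  define q where "q n x = (f (x + h n *\<^sub>R i) - f x) / h n" for n x
  have [measurable]: "q n \<in> borel_measurable borel" for n unfolding q_def[abs_def] by measurable
  have "(\<lambda>n. integral\<^sup>L lborel (q n)) \<longlonglongrightarrow> integral\<^sup>L lborel f'"
  proof (rule integral_dominated_convergence)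
    show "integrable lborel (\<lambda>x. \<bar>M\<bar> * indicator K' x)"
      using emeasure_compact_finite[OF K'c] K'c
      by (intro integrable_mult_right integrable_real_indicator) (auto simp: compact_imp_closed borel_closed)
    show "AE x in lborel. (\<lambda>n. q n x) \<longlonglongrightarrow> f' x"
    proof (rule AE_I2)
      fix x
      have "((\<lambda>s. (f (x + (0 + s) *\<^sub>R i) - f (x + 0 *\<^sub>R i)) / s) \<longlongrightarrow> f' (x + 0 *\<^sub>R i)) (at 0)"
        using line[of x 0] unfolding DERIV_def .
      moreover have "filterlim h (at 0) sequentially"
        unfolding h_def using LIMSEQ_Suc[OF lim_1_over_n] by (auto simp: filterlim_at)
      ultimately have "(\<lambda>n. (f (x + (0 + h n) *\<^sub>R i) - f (x + 0 *\<^sub>R i)) / h n) \<longlonglongrightarrow> f' (x + 0 *\<^sub>R i)"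
        by (rule filterlim_compose)
      then show "(\<lambda>n. q n x) \<longlonglongrightarrow> f' x" by (simp add: q_def)
    qed
    show "AE x in lborel. norm (q n x) \<le> \<bar>M\<bar> * indicator K' x" for n
    proof (rule AE_I2)
      fix x
      obtain z where z: "0 < z" "z < h n" "f (x + h n *\<^sub>R i) - f (x + 0 *\<^sub>R i) = (h n - 0) * f' (x + z *\<^sub>R i)"
        using MVT2[of 0 "h n" "\<lambda>t. f (x + t *\<^sub>R i)" "\<lambda>t. f' (x + t *\<^sub>R i)"] h[of n] line by blast
      then have q: "q n x = f' (x + z *\<^sub>R i)" using h[of n] by (simp add: q_def)
      show "norm (q n x) \<le> \<bar>M\<bar> * indicator K' x"
      proof (cases "x \<in> K'")
        case True
        then show ?thesis using M' q by simp
      next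
        case False
        have "x + z *\<^sub>R i \<notin> K"
        proof
          assume "x + z *\<^sub>R i \<in> K"
          then have "(z, x + z *\<^sub>R i) \<in> {0..1} \<times> K" using z h[of n] by simp
          then have "(\<lambda>(t, x). x - t *\<^sub>R i) (z, x + z *\<^sub>R i) \<in> K'" unfolding K'_def by (rule imageI)
          then show False using False by simp
        qed
        then show ?thesis using q f'0 by simp
      qed
    qed
  qed simp_all
  moreover have "integral\<^sup>L lborel (q n) = 0" for n
  proof -
    have i1: "integrable lborel f" by (rule integrable_continuous_compact_support[OF fc K f0[unfolded K_def]])
    have i2: "integrable lborel (\<lambda>x. f (x + h n *\<^sub>R i))"
    proof (rule integrable_continuous_compact_support[OF _ compact_translation[OF K]])
      show "continuous_on UNIV (\<lambda>x. f (x + h n *\<^sub>R i))"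
        by (rule continuous_on_compose2[OF fc]) (auto intro!: continuous_intros)
      fix x assume x: "x \<notin> (+) (- (h n *\<^sub>R i)) ` closure {x. f x \<noteq> 0}"
      have "x + h n *\<^sub>R i \<notin> K"
      proof
        assume "x + h n *\<^sub>R i \<in> K"
        then have "(+) (- (h n *\<^sub>R i)) (x + h n *\<^sub>R i) \<in> (+) (- (h n *\<^sub>R i)) ` closure {x. f x \<noteq> 0}"
          unfolding K_def by (rule imageI)
        then show False using x by simp
      qed
      then show "f (x + h n *\<^sub>R i) = 0" by (rule f0)
    qed
    have "integral\<^sup>L lborel (q n) = ((\<integral>x. f (x + h n *\<^sub>R i) \<partial>lborel) - integral\<^sup>L lborel f) / h n"
      unfolding q_def using i1 i2 by simp
    also have "(\<integral>x. f (x + h n *\<^sub>R i) \<partial>lborel) = integral\<^sup>L lborel f" by (rule lborel_integral_translation) simp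
    finally show ?thesis by simp
  qed
  ultimately show ?thesis by (simp add: LIMSEQ_const_iff f'_def[abs_def])
qed

lemma classical_gradient_inner: "i \<in> Basis \<Longrightarrow> classical_gradient f x \<bullet> i = frechet_derivative f (at x) i"
  by (simp add: classical_gradient_def inner_sum_left inner_Basis if_distrib cong: if_cong)

lemma continuous_on_classical_gradient:
  assumes "\<phi> \<in> test_functions U"
  shows "continuous_on UNIV (classical_gradient \<phi>)"
  unfolding classical_gradient_def[abs_def]
  using Ck_continuous[OF test_functionsD(6)[OF assms]] by (intro continuous_intros) auto

lemma Lp_loc_continuous:
  fixes f :: "'a::euclidean_space \<Rightarrow> 'b::euclidean_space"
  assumes "continuous_on UNIV f" "U \<in> sets lebesgue" "p \<ge> 0"
  shows "f \<in> Lp_loc U p"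
proof -
  have [measurable]: "f \<in> borel_measurable borel" by (rule borel_measurable_continuous_onI[OF assms(1)])
  have "f \<in> borel_measurable (lebesgue_on U)" by (intro measurable_restrict_space1 measurable_completion) simp
  moreover have "integrable (lebesgue_on K) (\<lambda>x. norm (f x) powr p)" if K: "compact K" for K
  proof -
    have "bounded (f ` K)" using K assms(1) by (intro compact_imp_bounded compact_continuous_image) (auto intro: continuous_on_subset)
    then obtain M where M: "\<And>x. x \<in> K \<Longrightarrow> norm (f x) \<le> M" by (auto simp: bounded_iff)
    have Ks: "K \<in> sets lebesgue" using K by (simp add: compact_imp_closed borel_closed)
    show ?thesis
    proof (rule integrableI_bounded_set[of K _ _ "M powr p"])
      show "emeasure (lebesgue_on K) K < \<infinity>"
        using emeasure_compact_finite[OF K] Ks K by (simp add: emeasure_restrict_space compact_imp_closed borel_closed)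
      show "(\<lambda>x. norm (f x) powr p) \<in> borel_measurable (lebesgue_on K)"
        by (intro measurable_restrict_space1 measurable_completion) simp
      show "AE x in lebesgue_on K. x \<in> K \<longrightarrow> norm (norm (f x) powr p) \<le> M powr p"
        using M assms(3) by (auto intro!: AE_I2 powr_mono2)
    qed (use Ks in \<open>auto simp: sets_restrict_space\<close>)
  qed
  ultimately show ?thesis by (auto simp: Lp_loc_def)
qed

text \<open>The product rule and the vanishing integral of the derivative of
  \<open>\<phi> * \<psi>\<close>.\<close>

lemma test_weak_gradient:
  assumes U: "open U" and \<phi>: "\<phi> \<in> test_functions U"
  shows "is_weak_gradient U \<phi> (classical_gradient \<phi>)"
  unfolding is_weak_gradient_def
proof (intro conjI ballI)
  have Us: "U \<in> sets lebesgue" using U by simp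
  show "\<phi> \<in> Lp_loc U 1" by (rule Lp_loc_continuous[OF test_functionsD(4)[OF \<phi>] Us]) simp
  show "classical_gradient \<phi> \<in> Lp_loc U 1" by (rule Lp_loc_continuous[OF continuous_on_classical_gradient[OF \<phi>] Us]) simp
  fix \<psi> and i :: 'a assume \<psi>: "\<psi> \<in> test_functions U" and i: "i \<in> Basis"
  let ?K = "closure {x. \<phi> x \<noteq> 0}"
  let ?d = "\<lambda>f x. frechet_derivative f (at x) i"
  note c = test_functionsD(4)[OF \<phi>] test_functionsD(4)[OF \<psi>]
    Ck_continuous[OF test_functionsD(6)[OF \<phi> i]] Ck_continuous[OF test_functionsD(6)[OF \<psi> i]]
  have 1: "continuous_on UNIV (\<lambda>x. \<phi> x * ?d \<psi> x)" "continuous_on UNIV (\<lambda>x. ?d \<phi> x * \<psi> x)"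
    by (intro continuous_on_mult c)+
  have 0: "\<phi> x * ?d \<psi> x = 0" "?d \<phi> x * \<psi> x = 0" if "x \<notin> ?K" for x
    using test_functionsD(7)[OF \<phi> that] frechet_derivative_outside_support[OF that] by auto
  have KU: "?K \<subseteq> U" by (rule test_functionsD(3)[OF \<phi>])
  note ii = integrable_continuous_compact_support[OF 1(1) test_functionsD(2)[OF \<phi>] 0(1)]
    integrable_continuous_compact_support[OF 1(2) test_functionsD(2)[OF \<phi>] 0(2)]
  have "(\<integral>x. ?d (\<lambda>x. \<phi> x * \<psi> x) x \<partial>lborel) = 0"
  proof (rule integral_partial_derivative_zero[OF _ _ i])
    show "Ck (Suc 0) (\<lambda>x. \<phi> x * \<psi> x)" by (rule Ck_mult[OF test_functionsD(1)[OF \<phi>] test_functionsD(1)[OF \<psi>]])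
    have "{x. \<phi> x * \<psi> x \<noteq> 0} \<subseteq> ?K" using closure_subset[of "{x. \<phi> x \<noteq> 0}"] by auto
    then show "compact (closure {x. \<phi> x * \<psi> x \<noteq> 0})"
      using bounded_subset[OF compact_imp_bounded[OF test_functionsD(2)[OF \<phi>]]] by (simp add: compact_closure)
  qed
  moreover have "?d (\<lambda>x. \<phi> x * \<psi> x) x = \<phi> x * ?d \<psi> x + ?d \<phi> x * \<psi> x" for x
    using frechet_derivative_at[OF has_derivative_mult[OF test_functionsD(5)[OF \<phi>, of x] test_functionsD(5)[OF \<psi>, of x]], symmetric]
    by simp
  ultimately have "(\<integral>x. \<phi> x * ?d \<psi> x \<partial>lborel) = - (\<integral>x. ?d \<phi> x * \<psi> x \<partial>lborel)"
    using ii by simp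
  moreover have "(\<integral>x. \<phi> x * ?d \<psi> x \<partial>lebesgue_on U) = (\<integral>x. \<phi> x * ?d \<psi> x \<partial>lborel)"
    using 0 KU by (intro integral_lebesgue_on_support borel_measurable_continuous_onI 1 Us) auto
  moreover have "(\<integral>x. ?d \<phi> x * \<psi> x \<partial>lebesgue_on U) = (\<integral>x. ?d \<phi> x * \<psi> x \<partial>lborel)"
    using 0 KU by (intro integral_lebesgue_on_support borel_measurable_continuous_onI 1 Us) auto
  ultimately show "(\<integral>x. \<phi> x * frechet_derivative \<psi> (at x) i \<partial>lebesgue_on U) =
      - (\<integral>x. (classical_gradient \<phi> x \<bullet> i) * \<psi> x \<partial>lebesgue_on U)"
    using i by (simp add: classical_gradient_inner)
qed

lemma Lp_loc_1D:
  assumes f: "f \<in> Lp_loc U 1" and K: "compact K" "K \<subseteq> U"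
  shows "integrable (lebesgue_on K) f" "integrable lebesgue (\<lambda>x. indicator K x *\<^sub>R f x)"
proof -
  have Ks: "K \<in> sets lebesgue" using K(1) by (simp add: compact_imp_closed borel_closed)
  have "f \<in> borel_measurable (lebesgue_on K)"
    using f K(2) by (auto simp: Lp_loc_def intro: measurable_restrict_mono)
  moreover have "integrable (lebesgue_on K) (\<lambda>x. norm (f x))"
    using f K by (simp add: Lp_loc_def)
  ultimately show i: "integrable (lebesgue_on K) f" by (simp add: integrable_norm_iff)
  then show "integrable lebesgue (\<lambda>x. indicator K x *\<^sub>R f x)"
    using Ks by (simp add: integrable_restrict_space)
qed

lemma Lp_loc_times_test:
  fixes f :: "'a::euclidean_space \<Rightarrow> 'b::euclidean_space"
  assumes U: "U \<in> sets lebesgue" and f: "f \<in> Lp_loc U 1" and K: "compact K" "K \<subseteq> U"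
    and \<psi>: "continuous_on UNIV \<psi>" "\<And>x. x \<notin> K \<Longrightarrow> \<psi> x = 0" "\<And>x. \<bar>\<psi> x\<bar> \<le> M"
  shows "integrable (lebesgue_on U) (\<lambda>x. \<psi> x *\<^sub>R f x)"
    and "norm (\<integral>x. \<psi> x *\<^sub>R f x \<partial>lebesgue_on U) \<le> M * (\<integral>x. norm (f x) \<partial>lebesgue_on K)"
proof -
  have Ks: "K \<in> sets lebesgue" using K(1) by (simp add: compact_imp_closed borel_closed)
  note F = Lp_loc_1D[OF f K]
  let ?F = "\<lambda>x. indicator K x *\<^sub>R f x"
  have M: "M \<ge> 0" using \<psi>(3)[of undefined] by linarith
  have eq: "indicator U x *\<^sub>R (\<psi> x *\<^sub>R f x) = \<psi> x *\<^sub>R ?F x" for x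
    using \<psi>(2)[of x] K(2) by (auto simp: indicator_def)
  have [measurable]: "\<psi> \<in> borel_measurable lebesgue"
    by (rule measurable_completion) (use borel_measurable_continuous_onI[OF \<psi>(1)] in simp)
  have [measurable]: "?F \<in> borel_measurable lebesgue" by (rule borel_measurable_integrable[OF F(2)])
  have bd: "norm (\<psi> x *\<^sub>R ?F x) \<le> M * norm (?F x)" for x
    by (subst norm_scaleR) (intro mult_right_mono \<psi>(3) norm_ge_zero)
  have I: "integrable lebesgue (\<lambda>x. \<psi> x *\<^sub>R ?F x)"
  proof (rule Bochner_Integration.integrable_bound)
    show "integrable lebesgue (\<lambda>x. M * norm (?F x))" using F(2) by (intro integrable_mult_right integrable_norm)
    show "AE x in lebesgue. norm (\<psi> x *\<^sub>R ?F x) \<le> norm (M * norm (?F x))"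
      using bd M by (auto intro!: AE_I2 order_trans[OF bd])
  qed measurable
  then show "integrable (lebesgue_on U) (\<lambda>x. \<psi> x *\<^sub>R f x)"
    by (subst integrable_restrict_space) (use U in simp, simp only: eq)
  have "norm (\<integral>x. \<psi> x *\<^sub>R f x \<partial>lebesgue_on U) = norm (\<integral>x. \<psi> x *\<^sub>R ?F x \<partial>lebesgue)"
    by (subst integral_restrict_space) (use U in simp, simp only: eq)
  also have "\<dots> \<le> (\<integral>x. norm (\<psi> x *\<^sub>R ?F x) \<partial>lebesgue)" by (rule integral_norm_bound)
  also have "\<dots> \<le> (\<integral>x. M * norm (?F x) \<partial>lebesgue)"
    by (intro integral_mono integrable_norm I integrable_mult_right F(2) bd)
  also have "\<dots> = M * (\<integral>x. indicator K x *\<^sub>R norm (f x) \<partial>lebesgue)" by simp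
  also have "\<dots> = M * (\<integral>x. norm (f x) \<partial>lebesgue_on K)" using Ks by (simp add: integral_restrict_space)
  finally show "norm (\<integral>x. \<psi> x *\<^sub>R f x \<partial>lebesgue_on U) \<le> M * (\<integral>x. norm (f x) \<partial>lebesgue_on K)" .
qed

lemma continuous_compact_support_bounded:
  fixes \<psi> :: "'a::euclidean_space \<Rightarrow> real"
  assumes "continuous_on UNIV \<psi>" "compact K" "\<And>x. x \<notin> K \<Longrightarrow> \<psi> x = 0"
  obtains M where "M > 0" "\<And>x. \<bar>\<psi> x\<bar> \<le> M"
proof -
  have "bounded (\<psi> ` K)" using assms by (intro compact_imp_bounded compact_continuous_image) (auto intro: continuous_on_subset)
  then obtain M where M: "\<And>x. x \<in> K \<Longrightarrow> \<bar>\<psi> x\<bar> \<le> M" by (auto simp: bounded_iff)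
  have "\<bar>\<psi> x\<bar> \<le> \<bar>M\<bar> + 1" for x using M[of x] assms(3)[of x] by (cases "x \<in> K") auto
  then show ?thesis by (intro that[of "\<bar>M\<bar> + 1"]) auto
qed

lemma test_function_integrable:
  fixes f :: "'a::euclidean_space \<Rightarrow> real"
  assumes U: "open U" and f: "f \<in> Lp_loc U 1" and \<psi>: "\<psi> \<in> test_functions U"
  shows "integrable (lebesgue_on U) (\<lambda>x. f x * \<psi> x)"
    and "i \<in> Basis \<Longrightarrow> integrable (lebesgue_on U) (\<lambda>x. f x * frechet_derivative \<psi> (at x) i)"
proof -
  let ?K = "closure {x. \<psi> x \<noteq> 0}"
  note K = test_functionsD(2,3)[OF \<psi>]
  have Us: "U \<in> sets lebesgue" using U by simp
  obtain M where "\<And>x. \<bar>\<psi> x\<bar> \<le> M"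
    using continuous_compact_support_bounded[OF test_functionsD(4)[OF \<psi>] K(1) test_functionsD(7)[OF \<psi>]] by blast
  from Lp_loc_times_test(1)[OF Us f K test_functionsD(4)[OF \<psi>] test_functionsD(7)[OF \<psi>] this]
  show "integrable (lebesgue_on U) (\<lambda>x. f x * \<psi> x)" by (simp add: mult.commute)
  assume i: "i \<in> Basis"
  note c = Ck_continuous[OF test_functionsD(6)[OF \<psi> i]]
  obtain M where "\<And>x. \<bar>frechet_derivative \<psi> (at x) i\<bar> \<le> M"
    using continuous_compact_support_bounded[OF c K(1) frechet_derivative_outside_support] by blast
  from Lp_loc_times_test(1)[OF Us f K c frechet_derivative_outside_support this]
  show "integrable (lebesgue_on U) (\<lambda>x. f x * frechet_derivative \<psi> (at x) i)" by (simp add: mult.commute)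
qed

text \<open>Bumps tend to the indicator of a box under a fixed dominating function, so
  \<open>g\<close> has zero integral over every closed box in \<open>U\<close>; differentiation and
  a countable cover by boxes finish.\<close>

theorem fundamental_lemma_calculus_of_variations:
  fixes g :: "'a::euclidean_space \<Rightarrow> real"
  assumes U: "open U" and g: "g \<in> Lp_loc U 1"
    and zero: "\<And>\<phi>. \<phi> \<in> test_functions U \<Longrightarrow> (\<integral>x. g x * \<phi> x \<partial>lebesgue_on U) = 0"
  shows "AE x in lebesgue_on U. g x = 0"
proof -
  have Us: "U \<in> sets lebesgue" using U by simp
  have box0: "integral (cbox a b) g = 0" if ab: "cbox a b \<subseteq> U" for a b
  proof -
    have K: "compact (cbox a b)" by simp
    have bs: "box a b \<in> sets lebesgue" by simp
    let ?F = "\<lambda>x. indicator (cbox a b) x *\<^sub>R g x"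
    note F = Lp_loc_1D[OF g K ab]
    have gm: "g \<in> borel_measurable (lebesgue_on U)" using g by (simp add: Lp_loc_def)
    have "(\<lambda>n. \<integral>x. g x * box_bump a b (real n) x \<partial>lebesgue_on U) \<longlonglongrightarrow> (\<integral>x. g x * indicator (box a b) x \<partial>lebesgue_on U)"
    proof (rule integral_dominated_convergence)
      show "(\<lambda>x. g x * indicator (box a b) x) \<in> borel_measurable (lebesgue_on U)"
        using gm by (intro borel_measurable_times borel_measurable_indicator) (use ab box_subset_cbox[of a b] in \<open>auto simp: sets_restrict_space_iff Us\<close>)
      have "box_bump a b m \<in> borel_measurable (lebesgue_on U)" for m
        by (intro measurable_restrict_space1 measurable_completion)
          (use borel_measurable_continuous_onI[OF Ck_continuous[OF Ck_box_bump]] in simp)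
      then show "(\<lambda>x. g x * box_bump a b (real n) x) \<in> borel_measurable (lebesgue_on U)" for n
        using gm by (intro borel_measurable_times)
      show "integrable (lebesgue_on U) (\<lambda>x. norm (?F x))"
        using integrable_norm[OF integrable_mult_indicator[OF Us F(2)]] Us by (simp add: integrable_restrict_space abs_mult)
      show "AE x in lebesgue_on U. (\<lambda>n. g x * box_bump a b (real n) x) \<longlonglongrightarrow> g x * indicator (box a b) x"
      proof (rule AE_I2)
        fix x
        have "(\<lambda>n. box_bump a b (real n) x) \<longlonglongrightarrow> indicator (box a b) x"
          using box_bump_limit[of x a b] box_bump_outside[of x a b] by (cases "x \<in> box a b") auto
        then show "(\<lambda>n. g x * box_bump a b (real n) x) \<longlonglongrightarrow> g x * indicator (box a b) x" by (rule tendsto_mult_left)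
      qed
      show "AE x in lebesgue_on U. norm (g x * box_bump a b (real n) x) \<le> norm (?F x)" for n
      proof (rule AE_I2)
        fix x
        show "norm (g x * box_bump a b (real n) x) \<le> norm (?F x)"
        proof (cases "x \<in> cbox a b")
          case True
          then show ?thesis using box_bump_bounds[of "real n" a b x]
            by (simp add: abs_mult mult_left_le)
        next
          case False
          then have "x \<notin> box a b" using box_subset_cbox by blast
          then show ?thesis by (simp add: box_bump_outside)
        qed
      qed
    qed
    moreover have "(\<integral>x. g x * box_bump a b (real n) x \<partial>lebesgue_on U) = 0" for n
      by (rule zero[OF box_bump_test[OF ab]])
    ultimately have "(\<integral>x. g x * indicator (box a b) x \<partial>lebesgue_on U) = 0" by (simp add: LIMSEQ_const_iff)
    moreover have "(\<integral>x. g x * indicator (box a b) x \<partial>lebesgue_on U) = integral\<^sup>L lebesgue (\<lambda>x. indicator (box a b) x *\<^sub>R g x)"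
      using Us subsetD[OF order_trans[OF box_subset_cbox ab]]
      by (subst integral_restrict_space) (auto intro!: Bochner_Integration.integral_cong simp: indicator_def)
    moreover have "integral\<^sup>L lebesgue (\<lambda>x. indicator (box a b) x *\<^sub>R g x) = integral\<^sup>L (lebesgue_on (box a b)) g"
      by (simp add: integral_restrict_space)
    moreover have "integral\<^sup>L (lebesgue_on (box a b)) g = integral (box a b) g"
    proof (rule lebesgue_integral_eq_integral)
      have "(\<lambda>x. indicator (box a b) x *\<^sub>R ?F x) = (\<lambda>x. indicator (box a b) x *\<^sub>R g x)"
        by (rule ext) (use box_subset_cbox[of a b] in \<open>auto simp: indicator_def\<close>)
      with integrable_mult_indicator[OF bs F(2)] have "integrable lebesgue (\<lambda>x. indicator (box a b) x *\<^sub>R g x)" by simp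
      then show "integrable (lebesgue_on (box a b)) g" by (simp add: integrable_restrict_space)
    qed simp
    ultimately show ?thesis by (simp add: integral_open_interval)
  qed
  obtain \<D> where D: "countable \<D>" "\<And>X. X \<in> \<D> \<Longrightarrow> X \<subseteq> U" "\<And>X. X \<in> \<D> \<Longrightarrow> \<exists>a b. X = cbox a b" "\<Union>\<D> = U"
    by (rule open_countable_Union_open_cbox[OF U]) blast
  have "negligible {x \<in> X. g x \<noteq> 0}" if X: "X \<in> \<D>" for X
  proof -
    obtain a b where ab: "X = cbox a b" using D(3)[OF X] by blast
    have sub: "cbox a b \<subseteq> U" using D(2)[OF X] ab by simp
    have "negligible {x \<in> box a b. g x \<noteq> 0}"
    proof (rule integral_vanishing_boxes_AE)
      show "integrable lebesgue (\<lambda>x. indicator (cbox a b) x *\<^sub>R g x)" by (rule Lp_loc_1D(2)[OF g _ sub]) simp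
      show "integral (cbox c d) g = 0" if "cbox c d \<subseteq> box a b" for c d
        using that box_subset_cbox[of a b] sub by (intro box0) blast
    qed
    then have "negligible ({x \<in> box a b. g x \<noteq> 0} \<union> (cbox a b - box a b))"
      by (intro negligible_Un negligible_frontier_interval)
    then show ?thesis by (rule negligible_subset) (auto simp: ab)
  qed
  then have "negligible (\<Union>X\<in>\<D>. {x \<in> X. g x \<noteq> 0})"
    using D(1) by (intro negligible_countable_Union) auto
  moreover have "(\<Union>X\<in>\<D>. {x \<in> X. g x \<noteq> 0}) = {x \<in> U. g x \<noteq> 0}" using D(4) by blast
  ultimately have "{x \<in> U. g x \<noteq> 0} \<in> null_sets lebesgue" by (simp add: negligible_iff_null_sets)
  then have "AE x in lebesgue. x \<notin> {x \<in> U. g x \<noteq> 0}" by (rule AE_not_in)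
  then show ?thesis using Us by (subst AE_restrict_space_iff) (auto elim: eventually_mono)
qed

section \<open>Linearity, uniqueness and closedness of weak gradients\<close>

lemma Lp_loc_1_lincomb:
  fixes f g :: "'a::euclidean_space \<Rightarrow> 'b::euclidean_space"
  assumes "f \<in> Lp_loc U 1" "g \<in> Lp_loc U 1"
  shows "(\<lambda>x. a *\<^sub>R f x + b *\<^sub>R g x) \<in> Lp_loc U 1"
proof -
  have "integrable (lebesgue_on K) (\<lambda>x. norm (a *\<^sub>R f x + b *\<^sub>R g x))" if "compact K" "K \<subseteq> U" for K
    using Lp_loc_1D(1)[OF assms(1) that] Lp_loc_1D(1)[OF assms(2) that] by auto
  then show ?thesis using assms by (auto simp: Lp_loc_def)
qed

lemma Lp_loc_1_inner:
  assumes "f \<in> Lp_loc U 1"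
  shows "(\<lambda>x. f x \<bullet> i) \<in> Lp_loc U 1"
proof -
  have "integrable (lebesgue_on K) (\<lambda>x. norm (f x \<bullet> i))" if "compact K" "K \<subseteq> U" for K
    using Lp_loc_1D(1)[OF assms that] by (intro integrable_norm integrable_inner_left) auto
  then show ?thesis using assms by (auto simp: Lp_loc_def)
qed

lemma is_weak_gradientD:
  assumes "is_weak_gradient U u g"
  shows "u \<in> Lp_loc U 1" "g \<in> Lp_loc U 1"
    "\<phi> \<in> test_functions U \<Longrightarrow> i \<in> Basis \<Longrightarrow> (\<integral>x. u x * frechet_derivative \<phi> (at x) i \<partial>lebesgue_on U) =
        - (\<integral>x. (g x \<bullet> i) * \<phi> x \<partial>lebesgue_on U)"
  using assms by (auto simp: is_weak_gradient_def)

lemma is_weak_gradient_lincomb: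
  assumes U: "open U" and u: "is_weak_gradient U u g" and v: "is_weak_gradient U v h"
  shows "is_weak_gradient U (\<lambda>x. a * u x + b * v x) (\<lambda>x. a *\<^sub>R g x + b *\<^sub>R h x)"
  unfolding is_weak_gradient_def
proof (intro conjI ballI)
  note u = is_weak_gradientD[OF u] and v = is_weak_gradientD[OF v]
  show "(\<lambda>x. a * u x + b * v x) \<in> Lp_loc U 1" using Lp_loc_1_lincomb[OF u(1) v(1), of a b] by simp
  show "(\<lambda>x. a *\<^sub>R g x + b *\<^sub>R h x) \<in> Lp_loc U 1" by (rule Lp_loc_1_lincomb[OF u(2) v(2)])
  fix \<phi> and i :: 'a assume \<phi>: "\<phi> \<in> test_functions U" and i: "i \<in> Basis"
  note I = test_function_integrable(2)[OF U u(1) \<phi> i] test_function_integrable(2)[OF U v(1) \<phi> i]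
    test_function_integrable(1)[OF U Lp_loc_1_inner[OF u(2)] \<phi>, of i] test_function_integrable(1)[OF U Lp_loc_1_inner[OF v(2)] \<phi>, of i]
  have "(\<integral>x. (a * u x + b * v x) * frechet_derivative \<phi> (at x) i \<partial>lebesgue_on U) =
     a * (\<integral>x. u x * frechet_derivative \<phi> (at x) i \<partial>lebesgue_on U) + b * (\<integral>x. v x * frechet_derivative \<phi> (at x) i \<partial>lebesgue_on U)"
    using I by (simp add: distrib_right mult.assoc)
  also have "\<dots> = - (\<integral>x. ((a *\<^sub>R g x + b *\<^sub>R h x) \<bullet> i) * \<phi> x \<partial>lebesgue_on U)"
    using I u(3)[OF \<phi> i] v(3)[OF \<phi> i] by (simp add: distrib_right mult.assoc inner_add_left)
  finally show "(\<integral>x. (a * u x + b * v x) * frechet_derivative \<phi> (at x) i \<partial>lebesgue_on U) =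
     - (\<integral>x. ((a *\<^sub>R g x + b *\<^sub>R h x) \<bullet> i) * \<phi> x \<partial>lebesgue_on U)" .
qed

lemma is_weak_gradient_cong_AE:
  assumes u: "is_weak_gradient U u g" and v: "v \<in> Lp_loc U 1" "AE x in lebesgue_on U. v x = u x"
  shows "is_weak_gradient U v g"
  unfolding is_weak_gradient_def
proof (intro conjI ballI)
  note u = is_weak_gradientD[OF u]
  show "v \<in> Lp_loc U 1" "g \<in> Lp_loc U 1" by (rule v(1), rule u(2))
  fix \<phi> and i :: 'a assume \<phi>: "\<phi> \<in> test_functions U" and i: "i \<in> Basis"
  have [measurable]: "(\<lambda>x. frechet_derivative \<phi> (at x) i) \<in> borel_measurable (lebesgue_on U)"
    by (intro measurable_restrict_space1 measurable_completion)
      (use borel_measurable_continuous_onI[OF Ck_continuous[OF test_functionsD(6)[OF \<phi> i]]] in simp)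
  have [measurable]: "u \<in> borel_measurable (lebesgue_on U)" "v \<in> borel_measurable (lebesgue_on U)"
    using u(1) v(1) by (auto simp: Lp_loc_def)
  have "(\<integral>x. v x * frechet_derivative \<phi> (at x) i \<partial>lebesgue_on U) = (\<integral>x. u x * frechet_derivative \<phi> (at x) i \<partial>lebesgue_on U)"
    using v(2) by (intro integral_cong_AE) (measurable, auto)
  then show "(\<integral>x. v x * frechet_derivative \<phi> (at x) i \<partial>lebesgue_on U) = - (\<integral>x. (g x \<bullet> i) * \<phi> x \<partial>lebesgue_on U)"
    using u(3)[OF \<phi> i] by simp
qed

lemma weak_gradient_unique:
  assumes U: "open U" and g: "is_weak_gradient U u g" and h: "is_weak_gradient U u h"
  shows "AE x in lebesgue_on U. g x = h x"
proof -
  note w = is_weak_gradient_lincomb[OF U g h, of 1 "-1"]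
  have "AE x in lebesgue_on U. (g x - h x) \<bullet> i = 0" if i: "i \<in> Basis" for i
  proof (rule fundamental_lemma_calculus_of_variations[OF U])
    show "(\<lambda>x. (g x - h x) \<bullet> i) \<in> Lp_loc U 1" using Lp_loc_1_inner[OF is_weak_gradientD(2)[OF w]] by simp
    show "(\<integral>x. (g x - h x) \<bullet> i * \<phi> x \<partial>lebesgue_on U) = 0" if "\<phi> \<in> test_functions U" for \<phi>
      using is_weak_gradientD(3)[OF w that i] by simp
  qed
  then have "AE x in lebesgue_on U. \<forall>i\<in>Basis. (g x - h x) \<bullet> i = 0" by (intro AE_finite_allI) auto
  then show ?thesis by eventually_elim (simp add: euclidean_eq_iff[of "g _"] inner_diff_left)
qed

lemma weak_gradient_AE:
  assumes "open U" "is_weak_gradient U u g"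
  shows "AE x in lebesgue_on U. weak_gradient U u x = g x"
proof -
  have "is_weak_gradient U u (weak_gradient U u)" unfolding weak_gradient_def by (rule someI[of "is_weak_gradient U u", OF assms(2)])
  then show ?thesis using weak_gradient_unique[OF assms(1) _ assms(2)] by blast
qed

text \<open>A test function sees only its compact support, so approximation in \<open>L^1\<close> on
  each compact set suffices and the approximants may depend on it.\<close>

lemma is_weak_gradient_closed:
  assumes U: "open U" and u: "u \<in> Lp_loc U 1" and g: "g \<in> Lp_loc U 1"
    and approx: "\<And>K e. compact K \<Longrightarrow> K \<subseteq> U \<Longrightarrow> e > 0 \<Longrightarrow> \<exists>v h. is_weak_gradient U v h \<and>
        (\<integral>x. norm (u x - v x) \<partial>lebesgue_on K) < e \<and> (\<integral>x. norm (g x - h x) \<partial>lebesgue_on K) < e"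
  shows "is_weak_gradient U u g"
  unfolding is_weak_gradient_def
proof (intro conjI ballI u g)
  fix \<phi> and i :: 'a assume \<phi>: "\<phi> \<in> test_functions U" and i: "i \<in> Basis"
  have Us: "U \<in> sets lebesgue" using U by simp
  let ?K = "closure {x. \<phi> x \<noteq> 0}"
  let ?d = "\<lambda>x. frechet_derivative \<phi> (at x) i"
  note K = test_functionsD(2,3)[OF \<phi>]
  note c = test_functionsD(4)[OF \<phi>] Ck_continuous[OF test_functionsD(6)[OF \<phi> i]]
  obtain M where M: "M > 0" "\<And>x. \<bar>\<phi> x\<bar> \<le> M"
    by (rule continuous_compact_support_bounded[OF c(1) K(1) test_functionsD(7)[OF \<phi>]]) blast+
  obtain M' where M': "M' > 0" "\<And>x. \<bar>?d x\<bar> \<le> M'"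
    by (rule continuous_compact_support_bounded[OF c(2) K(1) frechet_derivative_outside_support]) blast+
  have "\<bar>(\<integral>x. u x * ?d x \<partial>lebesgue_on U) - (- (\<integral>x. (g x \<bullet> i) * \<phi> x \<partial>lebesgue_on U))\<bar> \<le> 0"
  proof (rule field_le_epsilon)
    fix e :: real assume e: "e > 0"
    define r where "r = e / (M + M')"
    have "(M + M') * r = e" using M(1) M'(1) by (simp add: r_def)
    then have "M' * r + M * r = e" by (simp add: algebra_simps)
    moreover have "r > 0" using e M(1) M'(1) by (simp add: r_def)
    ultimately have r: "r > 0" "M' * r + M * r = e" by auto
    obtain v h where v: "is_weak_gradient U v h" "(\<integral>x. norm (u x - v x) \<partial>lebesgue_on ?K) < r"
      "(\<integral>x. norm (g x - h x) \<partial>lebesgue_on ?K) < r" using approx[OF K r(1)] by blast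
    note w = is_weak_gradientD[OF v(1)]
    have L: "(\<lambda>x. u x - v x) \<in> Lp_loc U 1" "(\<lambda>x. g x - h x) \<in> Lp_loc U 1"
      using Lp_loc_1_lincomb[OF u w(1), of 1 "-1"] Lp_loc_1_lincomb[OF g w(2), of 1 "-1"] by auto
    note b1 = Lp_loc_times_test[OF Us L(1) K c(2) frechet_derivative_outside_support M'(2)]
    note b2 = Lp_loc_times_test[OF Us L(2) K c(1) test_functionsD(7)[OF \<phi>] M(2)]
    note I = test_function_integrable(2)[OF U u \<phi> i] test_function_integrable(2)[OF U w(1) \<phi> i]
      test_function_integrable(1)[OF U Lp_loc_1_inner[OF g] \<phi>, of i] test_function_integrable(1)[OF U Lp_loc_1_inner[OF w(2)] \<phi>, of i]
    have "(\<integral>x. u x * ?d x \<partial>lebesgue_on U) + (\<integral>x. (g x \<bullet> i) * \<phi> x \<partial>lebesgue_on U) =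
      (\<integral>x. ?d x *\<^sub>R (u x - v x) \<partial>lebesgue_on U) + (\<integral>x. (\<phi> x *\<^sub>R (g x - h x)) \<bullet> i \<partial>lebesgue_on U)"
      using I w(3)[OF \<phi> i] by (simp add: right_diff_distrib left_diff_distrib inner_diff_left mult.commute)
    also have "(\<integral>x. (\<phi> x *\<^sub>R (g x - h x)) \<bullet> i \<partial>lebesgue_on U) = (\<integral>x. \<phi> x *\<^sub>R (g x - h x) \<partial>lebesgue_on U) \<bullet> i"
      using b2(1) by (rule integral_inner_left)
    also have "\<bar>(\<integral>x. ?d x *\<^sub>R (u x - v x) \<partial>lebesgue_on U) + (\<integral>x. \<phi> x *\<^sub>R (g x - h x) \<partial>lebesgue_on U) \<bullet> i\<bar>
      \<le> norm (\<integral>x. ?d x *\<^sub>R (u x - v x) \<partial>lebesgue_on U) + norm (\<integral>x. \<phi> x *\<^sub>R (g x - h x) \<partial>lebesgue_on U)"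
      using Basis_le_norm[OF i, of "\<integral>x. \<phi> x *\<^sub>R (g x - h x) \<partial>lebesgue_on U"] by simp
    also have "\<dots> \<le> M' * r + M * r"
      using order_trans[OF b1(2) mult_left_mono[OF less_imp_le[OF v(2)] less_imp_le[OF M'(1)]]]
        order_trans[OF b2(2) mult_left_mono[OF less_imp_le[OF v(3)] less_imp_le[OF M(1)]]] by (rule add_mono)
    finally show "\<bar>(\<integral>x. u x * ?d x \<partial>lebesgue_on U) - (- (\<integral>x. (g x \<bullet> i) * \<phi> x \<partial>lebesgue_on U))\<bar> \<le> 0 + e"
      using r(2) by simp
  qed
  then show "(\<integral>x. u x * frechet_derivative \<phi> (at x) i \<partial>lebesgue_on U) = - (\<integral>x. (g x \<bullet> i) * \<phi> x \<partial>lebesgue_on U)" by simp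
qed

section \<open>The Poincare inequality on convex sets\<close>

lemma frechet_derivative_eq_gradient:
  assumes "(f has_derivative frechet_derivative f (at x)) (at x)"
  shows "frechet_derivative f (at x) h = classical_gradient f x \<bullet> h"
proof -
  have l: "linear (frechet_derivative f (at x))" by (rule has_derivative_linear[OF assms])
  have "frechet_derivative f (at x) h = frechet_derivative f (at x) (\<Sum>i\<in>Basis. (h \<bullet> i) *\<^sub>R i)"
    by (simp add: euclidean_representation)
  also have "\<dots> = (\<Sum>i\<in>Basis. (h \<bullet> i) *\<^sub>R frechet_derivative f (at x) i)"
    by (simp add: linear_sum[OF l] linear_scale[OF l])
  also have "\<dots> = classical_gradient f x \<bullet> h"
    by (simp add: classical_gradient_def inner_sum_left inner_sum_right inner_commute mult.commute)
  finally show ?thesis .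
qed

text \<open>Hoelder's inequality against the constant 1, which \<open>dual_vec\<close>
  fixes.\<close>

lemma finite_measure_mean_le:
  fixes h :: "'a \<Rightarrow> real"
  assumes p: "2 < p" and fin: "emeasure M (space M) < \<infinity>" and h: "h \<in> LpS M p"
  shows "\<bar>integral\<^sup>L M h\<bar> powr p \<le> measure M (space M) powr (p - 1) * Lpint M p h"
proof -
  have m: "emeasure M (space M) \<noteq> \<infinity>" using fin by simp
  interpret finite_measure M by standard (use m in simp)
  have one: "(\<lambda>x. 1::real) \<in> LpS M p" by (simp add: LpS_def)
  have n1: "Lpint M p (\<lambda>x. 1::real) = measure M (space M)" by (simp add: Lpint_def)
  have "\<bar>integral\<^sup>L M h\<bar> \<le> Lpn M p (\<lambda>x. 1::real) powr (p - 1) * Lpn M p h"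
    using Hoelder_dual(2)[OF p one h] by (simp add: dual_vec_def)
  then have "\<bar>integral\<^sup>L M h\<bar> powr p \<le> (Lpn M p (\<lambda>x. 1::real) powr (p - 1) * Lpn M p h) powr p"
    using p by (intro powr_mono2) auto
  also have "\<dots> = (Lpn M p (\<lambda>x. 1::real) powr p) powr (p - 1) * Lpn M p h powr p"
    using Lpn_nonneg[of M p h] by (simp add: powr_mult powr_powr mult.commute)
  also have "\<dots> = measure M (space M) powr (p - 1) * Lpint M p h"
    by (simp only: Lpn_powr[OF p] n1)
  finally show ?thesis .
qed

lemma nn_integral_lebesgue_on:
  assumes "f \<in> borel_measurable borel" "S \<in> sets borel"
  shows "(\<integral>\<^sup>+x. f x \<partial>lebesgue_on S) = (\<integral>\<^sup>+x. indicator S x * f x \<partial>lborel)"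
proof -
  have "(\<integral>\<^sup>+x. f x \<partial>lebesgue_on S) = (\<integral>\<^sup>+x. f x * indicator S x \<partial>lebesgue)"
    using assms(2) by (intro nn_integral_restrict_space) simp
  also have "\<dots> = (\<integral>\<^sup>+x. f x * indicator S x \<partial>lborel)"
    using assms by (intro nn_integral_completion)
  finally show ?thesis by (simp add: mult.commute)
qed

lemma nn_integral_lborel_translation:
  fixes f :: "'a::euclidean_space \<Rightarrow> ennreal"
  assumes "f \<in> borel_measurable borel"
  shows "(\<integral>\<^sup>+x. f (x + c) \<partial>lborel) = (\<integral>\<^sup>+x. f x \<partial>lborel)"
proof -
  have "(\<integral>\<^sup>+x. f x \<partial>lborel) = (\<integral>\<^sup>+x. f x \<partial>distr lborel borel ((+) c))" by (simp add: lborel_distr_plus)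
  also have "\<dots> = (\<integral>\<^sup>+x. f (c + x) \<partial>lborel)" using assms by (intro nn_integral_distr) auto
  finally show ?thesis by (simp add: add.commute)
qed

text \<open>The substitution contributes \<open>c\<close> to the power \<open>- DIM('a)\<close>, at
  most \<open>2 ^ DIM('a)\<close> for \<open>c \<ge> 1/2\<close>.\<close>

lemma nn_integral_lborel_affine_le:
  fixes f :: "'a::euclidean_space \<Rightarrow> ennreal"
  assumes f: "f \<in> borel_measurable borel" and c: "1/2 \<le> c"
  shows "(\<integral>\<^sup>+x. f (t + c *\<^sub>R x) \<partial>lborel) \<le> 2 ^ DIM('a) * (\<integral>\<^sup>+x. f x \<partial>lborel)"
proof -
  have [measurable]: "(\<lambda>x. f (t + c *\<^sub>R x)) \<in> borel_measurable borel" using f by measurable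
  have "(\<integral>\<^sup>+x. f x \<partial>lborel) = (\<integral>\<^sup>+x. f x \<partial>density (distr lborel borel (\<lambda>x. t + c *\<^sub>R x)) (\<lambda>_. \<bar>c\<bar> ^ DIM('a)))"
    using lborel_affine[of c t] c by simp
  also have "\<dots> = (\<integral>\<^sup>+x. ennreal (\<bar>c\<bar> ^ DIM('a)) * f x \<partial>distr lborel borel (\<lambda>x. t + c *\<^sub>R x))"
    using f by (intro nn_integral_density) auto
  also have "\<dots> = (\<integral>\<^sup>+x. ennreal (\<bar>c\<bar> ^ DIM('a)) * f (t + c *\<^sub>R x) \<partial>lborel)"
    using f by (intro nn_integral_distr) auto
  also have "\<dots> = ennreal (\<bar>c\<bar> ^ DIM('a)) * (\<integral>\<^sup>+x. f (t + c *\<^sub>R x) \<partial>lborel)"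
    by (intro nn_integral_cmult) simp
  finally have eq: "(\<integral>\<^sup>+x. f x \<partial>lborel) = ennreal (c ^ DIM('a)) * (\<integral>\<^sup>+x. f (t + c *\<^sub>R x) \<partial>lborel)" using c by simp
  have "1 \<le> (2 * c) ^ DIM('a)" using c by (intro one_le_power) simp
  then have "ennreal 1 \<le> ennreal (2 ^ DIM('a) * c ^ DIM('a))" by (intro ennreal_leI) (simp add: power_mult_distrib)
  then have "1 * (\<integral>\<^sup>+x. f (t + c *\<^sub>R x) \<partial>lborel) \<le> ennreal (2 ^ DIM('a) * c ^ DIM('a)) * (\<integral>\<^sup>+x. f (t + c *\<^sub>R x) \<partial>lborel)"
    by (intro mult_right_mono) auto
  also have "ennreal (2 ^ DIM('a) * c ^ DIM('a)) = 2 ^ DIM('a) * ennreal (c ^ DIM('a))"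
    using c by (simp add: ennreal_mult flip: ennreal_power)
  finally show ?thesis by (simp add: eq mult.assoc)
qed

section \<open>Increments of a function along segments\<close>

context
  fixes p :: real and \<phi> :: "'a::euclidean_space \<Rightarrow> real"
  assumes p: "2 < p" and C1: "Ck (Suc 0) \<phi>"
begin

lemma gradient_continuous: "continuous_on UNIV (classical_gradient \<phi>)"
  unfolding classical_gradient_def[abs_def] using Ck_SucD(2)[OF C1] by (intro continuous_intros) auto

lemma gradient_measurable[measurable]: "classical_gradient \<phi> \<in> borel_measurable borel"
  by (rule borel_measurable_continuous_onI[OF gradient_continuous])

lemma phi_measurable[measurable]: "\<phi> \<in> borel_measurable borel"
  by (rule borel_measurable_continuous_onI[OF Ck_continuous[OF C1]])

text \<open>The fundamental theorem of calculus on the segment, followed by the mean inequality on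
  an interval of length 1, where the measure factor is 1.\<close>

lemma segment_Jensen:
  "ennreal (\<bar>\<phi> y - \<phi> x\<bar> powr p) \<le>
    (\<integral>\<^sup>+t. indicator {0..1} t * ennreal (\<bar>classical_gradient \<phi> (x + t *\<^sub>R (y - x)) \<bullet> (y - x)\<bar> powr p) \<partial>lborel)"
proof -
  let ?g = "\<lambda>t. classical_gradient \<phi> (x + t *\<^sub>R (y - x)) \<bullet> (y - x)"
  let ?M = "lebesgue_on {0..1::real}"
  have gc: "continuous_on UNIV ?g"
    by (intro continuous_intros continuous_on_compose2[OF gradient_continuous]) auto
  have [measurable]: "?g \<in> borel_measurable borel" by (rule borel_measurable_continuous_onI[OF gc])
  have d: "((\<lambda>t. \<phi> (x + t *\<^sub>R (y - x))) has_vector_derivative ?g t) (at t within {0..1})" for t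
  proof -
    have "((\<lambda>t. x + t *\<^sub>R (y - x)) has_derivative (\<lambda>h. h *\<^sub>R (y - x))) (at t)" by (auto intro!: derivative_eq_intros)
    from has_derivative_compose[OF this Ck_SucD(1)[OF C1]]
    have "((\<lambda>t. \<phi> (x + t *\<^sub>R (y - x))) has_derivative (\<lambda>h. h *\<^sub>R ?g t)) (at t)"
      by (simp add: frechet_derivative_eq_gradient[OF Ck_SucD(1)[OF C1]])
    then show ?thesis unfolding has_vector_derivative_def by (rule has_derivative_at_withinI)
  qed
  have "(?g has_integral (\<phi> (x + 1 *\<^sub>R (y - x)) - \<phi> (x + 0 *\<^sub>R (y - x)))) {0..1}"
    by (rule fundamental_theorem_of_calculus) (use d in auto)
  then have FTC: "integral {0..1} ?g = \<phi> y - \<phi> x" by (simp add: integral_unique)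
  have I: "integrable ?M ?g" by (rule continuous_imp_integrable_real) (rule continuous_on_subset[OF gc], simp)
  have gL: "?g \<in> LpS ?M p"
  proof -
    have "integrable ?M (\<lambda>t. norm (?g t) powr p)"
      using p by (intro continuous_imp_integrable_real continuous_on_powr' continuous_on_norm continuous_on_subset[OF gc] continuous_on_const) auto
    then show ?thesis using I by (simp add: LpS_def borel_measurable_integrable)
  qed
  have "integral\<^sup>L ?M ?g = \<phi> y - \<phi> x" using lebesgue_integral_eq_integral[OF I] FTC by simp
  moreover have sp: "space ?M = {0..1}" by simp
  moreover have em: "emeasure ?M {0..1} = 1" by (simp add: emeasure_restrict_space)
  ultimately have "\<bar>\<phi> y - \<phi> x\<bar> powr p \<le> Lpint ?M p ?g"
    using finite_measure_mean_le[OF p _ gL] by (simp add: measure_def)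
  then have "ennreal (\<bar>\<phi> y - \<phi> x\<bar> powr p) \<le> ennreal (\<integral>t. norm (?g t) powr p \<partial>?M)"
    unfolding Lpint_def by (rule ennreal_leI)
  also have "\<dots> = (\<integral>\<^sup>+t. ennreal (norm (?g t) powr p) \<partial>?M)"
    by (rule nn_integral_eq_integral[symmetric, OF LpS_integrable[OF gL]]) auto
  also have "\<dots> = (\<integral>\<^sup>+t. indicator {0..1} t * ennreal (norm (?g t) powr p) \<partial>lborel)"
    by (rule nn_integral_lebesgue_on) auto
  finally show ?thesis by simp
qed

text \<open>Integrate the segment estimate and exchange integrals: for fixed \<open>t\<close> the
  shift by \<open>t *\<^sub>R v\<close> preserves Lebesgue measure and the weight. Nonnegative
  integrals spare all integrability questions.\<close>

lemma translation_estimate: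
  fixes w :: "'a \<Rightarrow> ennreal"
  assumes w[measurable]: "w \<in> borel_measurable borel" and inv: "\<And>x t. w (x + t *\<^sub>R v) = w x"
  shows "(\<integral>\<^sup>+x. w x * ennreal (\<bar>\<phi> (x + v) - \<phi> x\<bar> powr p) \<partial>lborel)
    \<le> (\<integral>\<^sup>+x. w x * ennreal (\<bar>classical_gradient \<phi> x \<bullet> v\<bar> powr p) \<partial>lborel)" (is "_ \<le> ?R")
proof -
  let ?k = "\<lambda>x. w x * ennreal (\<bar>classical_gradient \<phi> x \<bullet> v\<bar> powr p)"
  have k[measurable]: "?k \<in> borel_measurable borel" by measurable
  have "(\<integral>\<^sup>+x. w x * ennreal (\<bar>\<phi> (x + v) - \<phi> x\<bar> powr p) \<partial>lborel)
    \<le> (\<integral>\<^sup>+x. (\<integral>\<^sup>+t. indicator {0..1} t * ?k (x + t *\<^sub>R v) \<partial>lborel) \<partial>lborel)"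
  proof (rule nn_integral_mono)
    fix x
    have "w x * ennreal (\<bar>\<phi> (x + v) - \<phi> x\<bar> powr p)
      \<le> w x * (\<integral>\<^sup>+t. indicator {0..1} t * ennreal (\<bar>classical_gradient \<phi> (x + t *\<^sub>R v) \<bullet> v\<bar> powr p) \<partial>lborel)"
      using segment_Jensen[of "x + v" x] by (intro mult_left_mono) auto
    also have "\<dots> = (\<integral>\<^sup>+t. w x * (indicator {0..1} t * ennreal (\<bar>classical_gradient \<phi> (x + t *\<^sub>R v) \<bullet> v\<bar> powr p)) \<partial>lborel)"
      by (rule nn_integral_cmult[symmetric]) measurable
    also have "\<dots> = (\<integral>\<^sup>+t. indicator {0..1} t * ?k (x + t *\<^sub>R v) \<partial>lborel)" by (simp add: inv mult_ac)
    finally show "w x * ennreal (\<bar>\<phi> (x + v) - \<phi> x\<bar> powr p) \<le> (\<integral>\<^sup>+t. indicator {0..1} t * ?k (x + t *\<^sub>R v) \<partial>lborel)" .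
  qed
  also have "\<dots> = (\<integral>\<^sup>+t. (\<integral>\<^sup>+x. indicator {0..1} t * ?k (x + t *\<^sub>R v) \<partial>lborel) \<partial>lborel)"
    by (rule lborel_pair.Fubini') measurable
  also have "\<dots> = (\<integral>\<^sup>+t. indicator {0..1::real} t * ?R \<partial>lborel)"
  proof (rule nn_integral_cong)
    fix t :: real
    have "(\<integral>\<^sup>+x. indicator {0..1} t * ?k (x + t *\<^sub>R v) \<partial>lborel) = indicator {0..1} t * (\<integral>\<^sup>+x. ?k (x + t *\<^sub>R v) \<partial>lborel)"
      by (rule nn_integral_cmult) measurable
    also have "(\<integral>\<^sup>+x. ?k (x + t *\<^sub>R v) \<partial>lborel) = ?R" by (rule nn_integral_lborel_translation[OF k])
    finally show "(\<integral>\<^sup>+x. indicator {0..1} t * ?k (x + t *\<^sub>R v) \<partial>lborel) = indicator {0..1} t * ?R" .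
  qed
  also have "\<dots> = (\<integral>\<^sup>+t. indicator {0..1::real} t \<partial>lborel) * ?R" by (rule nn_integral_multc) simp
  also have "\<dots> = ?R" by simp
  finally show ?thesis .
qed

text \<open>At each \<open>t\<close> the larger of the coefficients \<open>1 - t\<close> and \<open>t\<close> is at least \<open>1 / 2\<close>, so that the affine
  substitution in the corresponding variable costs a factor of at most \<open>2 ^ DIM('a)\<close>.\<close>

lemma convex_double_integral:
  assumes Q: "convex Q" "Q \<in> sets borel" and d: "\<And>x y. x \<in> Q \<Longrightarrow> y \<in> Q \<Longrightarrow> norm (x - y) \<le> d"
  shows "(\<integral>\<^sup>+x. indicator Q x * (\<integral>\<^sup>+y. indicator Q y * ennreal (\<bar>\<phi> x - \<phi> y\<bar> powr p) \<partial>lborel) \<partial>lborel)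
    \<le> emeasure lborel Q * 2 ^ DIM('a) * ennreal (d powr p) * (\<integral>\<^sup>+x. indicator Q x * ennreal (norm (classical_gradient \<phi> x) powr p) \<partial>lborel)"
proof -
  have [measurable]: "Q \<in> sets borel" by (rule Q(2))
  define G where "G z = indicator Q z * ennreal (d powr p * norm (classical_gradient \<phi> z) powr p)" for z
  have G[measurable]: "G \<in> borel_measurable borel" unfolding G_def[abs_def] by measurable
  define I where "I = (\<integral>\<^sup>+x. G x \<partial>lborel)"
  let ?m = "emeasure lborel Q"
  let ?H = "\<lambda>t x y. indicator Q x * (indicator Q y * (indicator {0..1::real} t * G (x + t *\<^sub>R (y - x))))"
  have mQ: "(\<integral>\<^sup>+x. indicator Q x * c \<partial>lborel) = ?m * c" for c by (simp add: nn_integral_multc)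
  have pt: "indicator Q x * (indicator Q y * ennreal (\<bar>\<phi> x - \<phi> y\<bar> powr p)) \<le> (\<integral>\<^sup>+t. ?H t x y \<partial>lborel)" for x y
  proof (cases "x \<in> Q \<and> y \<in> Q")
    case True
    have "ennreal (\<bar>\<phi> x - \<phi> y\<bar> powr p) = ennreal (\<bar>\<phi> y - \<phi> x\<bar> powr p)" by (simp add: abs_minus_commute)
    also have "\<dots> \<le> (\<integral>\<^sup>+t. indicator {0..1} t * ennreal (\<bar>classical_gradient \<phi> (x + t *\<^sub>R (y - x)) \<bullet> (y - x)\<bar> powr p) \<partial>lborel)"
      by (rule segment_Jensen)
    also have "\<dots> \<le> (\<integral>\<^sup>+t. ?H t x y \<partial>lborel)"
    proof (rule nn_integral_mono)
      fix t :: real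
      show "indicator {0..1} t * ennreal (\<bar>classical_gradient \<phi> (x + t *\<^sub>R (y - x)) \<bullet> (y - x)\<bar> powr p) \<le> ?H t x y"
      proof (cases "t \<in> {0..1}")
        case t: True
        let ?z = "x + t *\<^sub>R (y - x)"
        have "?z = (1 - t) *\<^sub>R x + t *\<^sub>R y" by (simp add: algebra_simps)
        then have z: "?z \<in> Q" using True t convexD[OF Q(1), of x y "1 - t" t] by simp
        have "\<bar>classical_gradient \<phi> ?z \<bullet> (y - x)\<bar> \<le> norm (classical_gradient \<phi> ?z) * norm (y - x)" by (rule Cauchy_Schwarz_ineq2)
        also have "\<dots> \<le> norm (classical_gradient \<phi> ?z) * d" using d[of y x] True by (intro mult_left_mono) auto
        finally have "\<bar>classical_gradient \<phi> ?z \<bullet> (y - x)\<bar> powr p \<le> (d * norm (classical_gradient \<phi> ?z)) powr p"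
          using p by (intro powr_mono2) (auto simp: mult.commute)
        then show ?thesis using True t z by (simp add: G_def powr_mult ennreal_leI)
      qed simp
    qed
    finally show ?thesis using True by simp
  qed auto
  have Hm[measurable]: "(\<lambda>t. ?H t x y) \<in> borel_measurable borel" "(\<lambda>y. ?H t x y) \<in> borel_measurable borel"
     "(\<lambda>x. ?H t x y) \<in> borel_measurable borel" for t x y by measurable
  have half: "(\<integral>\<^sup>+x. (\<integral>\<^sup>+y. ?H t x y \<partial>lborel) \<partial>lborel) \<le> indicator {0..1} t * (?m * (2 ^ DIM('a) * I))" for t
  proof (cases "t \<in> {0..1}")
    case True
    have a: "x + t *\<^sub>R (y - x) = (1 - t) *\<^sub>R x + t *\<^sub>R y" "x + t *\<^sub>R (y - x) = t *\<^sub>R y + (1 - t) *\<^sub>R x" for x y :: 'a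
      by (simp_all add: algebra_simps)
    show ?thesis
    proof (cases "1/2 \<le> t")
      case t: True
      have "(\<integral>\<^sup>+y. ?H t x y \<partial>lborel) \<le> indicator Q x * (2 ^ DIM('a) * I)" for x
      proof -
        have "(\<integral>\<^sup>+y. ?H t x y \<partial>lborel) \<le> (\<integral>\<^sup>+y. indicator Q x * G ((1 - t) *\<^sub>R x + t *\<^sub>R y) \<partial>lborel)"
          by (intro nn_integral_mono) (auto simp: a(1) indicator_def)
        also have "\<dots> = indicator Q x * (\<integral>\<^sup>+y. G ((1 - t) *\<^sub>R x + t *\<^sub>R y) \<partial>lborel)" by (rule nn_integral_cmult) measurable
        also have "\<dots> \<le> indicator Q x * (2 ^ DIM('a) * I)"
          unfolding I_def by (intro mult_left_mono nn_integral_lborel_affine_le G t) auto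
        finally show ?thesis .
      qed
      then have "(\<integral>\<^sup>+x. (\<integral>\<^sup>+y. ?H t x y \<partial>lborel) \<partial>lborel) \<le> (\<integral>\<^sup>+x. indicator Q x * (2 ^ DIM('a) * I) \<partial>lborel)"
        by (intro nn_integral_mono)
      then show ?thesis using True by (simp add: mQ)
    next
      case t: False
      have "(\<integral>\<^sup>+x. (\<integral>\<^sup>+y. ?H t x y \<partial>lborel) \<partial>lborel) = (\<integral>\<^sup>+y. (\<integral>\<^sup>+x. ?H t x y \<partial>lborel) \<partial>lborel)"
        by (rule lborel_pair.Fubini') measurable
      moreover have "(\<integral>\<^sup>+x. ?H t x y \<partial>lborel) \<le> indicator Q y * (2 ^ DIM('a) * I)" for y
      proof -
        have "(\<integral>\<^sup>+x. ?H t x y \<partial>lborel) \<le> (\<integral>\<^sup>+x. indicator Q y * G (t *\<^sub>R y + (1 - t) *\<^sub>R x) \<partial>lborel)"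
          by (intro nn_integral_mono) (auto simp: a(2) indicator_def)
        also have "\<dots> = indicator Q y * (\<integral>\<^sup>+x. G (t *\<^sub>R y + (1 - t) *\<^sub>R x) \<partial>lborel)" by (rule nn_integral_cmult) measurable
        also have "\<dots> \<le> indicator Q y * (2 ^ DIM('a) * I)"
          unfolding I_def using t by (intro mult_left_mono nn_integral_lborel_affine_le G) auto
        finally show ?thesis .
      qed
      then have "(\<integral>\<^sup>+y. (\<integral>\<^sup>+x. ?H t x y \<partial>lborel) \<partial>lborel) \<le> (\<integral>\<^sup>+y. indicator Q y * (2 ^ DIM('a) * I) \<partial>lborel)"
        by (intro nn_integral_mono)
      ultimately show ?thesis using True by (simp add: mQ)
    qed
  qed simp
  have "(\<integral>\<^sup>+x. indicator Q x * (\<integral>\<^sup>+y. indicator Q y * ennreal (\<bar>\<phi> x - \<phi> y\<bar> powr p) \<partial>lborel) \<partial>lborel)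
     = (\<integral>\<^sup>+x. (\<integral>\<^sup>+y. indicator Q x * (indicator Q y * ennreal (\<bar>\<phi> x - \<phi> y\<bar> powr p)) \<partial>lborel) \<partial>lborel)"
    by (intro nn_integral_cong nn_integral_cmult[symmetric]) measurable
  also have "\<dots> \<le> (\<integral>\<^sup>+x. (\<integral>\<^sup>+y. (\<integral>\<^sup>+t. ?H t x y \<partial>lborel) \<partial>lborel) \<partial>lborel)"
    by (intro nn_integral_mono pt)
  also have "\<dots> = (\<integral>\<^sup>+x. (\<integral>\<^sup>+t. (\<integral>\<^sup>+y. ?H t x y \<partial>lborel) \<partial>lborel) \<partial>lborel)"
    by (intro nn_integral_cong lborel_pair.Fubini') measurable
  also have "\<dots> = (\<integral>\<^sup>+t. (\<integral>\<^sup>+x. (\<integral>\<^sup>+y. ?H t x y \<partial>lborel) \<partial>lborel) \<partial>lborel)"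
    by (rule lborel_pair.Fubini') measurable
  also have "\<dots> \<le> (\<integral>\<^sup>+t. indicator {0..1::real} t * (?m * (2 ^ DIM('a) * I)) \<partial>lborel)"
    by (intro nn_integral_mono half)
  also have "\<dots> = ?m * (2 ^ DIM('a) * I)" by (simp add: nn_integral_multc)
  also have "I = ennreal (d powr p) * (\<integral>\<^sup>+x. indicator Q x * ennreal (norm (classical_gradient \<phi> x) powr p) \<partial>lborel)"
    unfolding I_def G_def by (subst nn_integral_cmult[symmetric]) (auto simp: ennreal_mult mult_ac)
  finally show ?thesis by (simp add: mult_ac)
qed

text \<open>Integrating over \<open>y\<close> writes \<open>measure lborel Q * \<phi> x\<close> as
  the integral of the differences \<open>\<phi> x - \<phi> y\<close> plus the integral of
  \<open>\<phi>\<close>. The differences are bounded by the double integral; the integral of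
  \<open>\<phi>\<close> is kept, since it becomes one of the controlling functionals.\<close>

lemma convex_Poincare:
  assumes Q: "convex Q" "Q \<in> sets borel" "bounded Q" and d: "\<And>x y. x \<in> Q \<Longrightarrow> y \<in> Q \<Longrightarrow> norm (x - y) \<le> d"
    and bdd: "\<And>x. \<bar>\<phi> x\<bar> \<le> M"
  shows "(\<integral>\<^sup>+x. indicator Q x * ennreal (\<bar>\<phi> x\<bar> powr p) \<partial>lborel) \<le>
      ennreal (2 powr p) * 2 ^ DIM('a) * ennreal (d powr p) * (\<integral>\<^sup>+x. indicator Q x * ennreal (norm (classical_gradient \<phi> x) powr p) \<partial>lborel)
      + ennreal (measure lborel Q * (2 powr p * measure lborel Q powr (- p)) * \<bar>\<integral>x. \<phi> x \<partial>lebesgue_on Q\<bar> powr p)"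
proof -
  let ?m = "measure lborel Q" and ?M = "lebesgue_on Q"
  let ?J = "\<integral>\<^sup>+x. indicator Q x * ennreal (norm (classical_gradient \<phi> x) powr p) \<partial>lborel"
  have [measurable]: "Q \<in> sets borel" by (rule Q(2))
  have fin: "emeasure lborel Q < \<infinity>" by (rule emeasure_bounded_finite[OF Q(3)])
  then have em: "emeasure lborel Q = ennreal ?m" by (simp add: emeasure_eq_ennreal_measure)
  show ?thesis
  \<comment> \<open>For a null set \<open>measure lborel Q powr (- p)\<close> is 0 by convention,
    and the left side vanishes too.\<close>
  proof (cases "?m = 0")
    case True
    then have "Q \<in> null_sets lborel" using em by (intro null_setsI) auto
    then have "AE x in lborel. x \<notin> Q" by (rule AE_not_in)
    then have "AE x in lborel. indicator Q x * ennreal (\<bar>\<phi> x\<bar> powr p) = 0" by eventually_elim simp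
    then have "(\<integral>\<^sup>+x. indicator Q x * ennreal (\<bar>\<phi> x\<bar> powr p) \<partial>lborel) = 0"
      by (subst nn_integral_0_iff_AE) auto
    then show ?thesis by simp
  next
    case False
    then have m: "?m > 0" using measure_nonneg[of lborel Q] by linarith
    have Ms: "emeasure ?M (space ?M) = ennreal ?m" "measure ?M (space ?M) = ?m"
      by (simp_all add: emeasure_restrict_space em measure_restrict_space)
    interpret M: finite_measure ?M by standard (simp only: Ms(1), simp)
    have phiM: "\<phi> \<in> borel_measurable ?M" by (intro measurable_restrict_space1 measurable_completion) simp
    have phiI: "integrable ?M \<phi>"
      by (rule M.integrable_const_bound[of _ M]) (use bdd phiM in auto)
    define a where "a = \<bar>\<integral>x. \<phi> x \<partial>?M\<bar> powr p"
    have pt: "ennreal (\<bar>\<phi> x\<bar> powr p) \<le> ennreal (2 powr p / ?m) * (\<integral>\<^sup>+y. indicator Q y * ennreal (\<bar>\<phi> x - \<phi> y\<bar> powr p) \<partial>lborel) + ennreal (2 powr p * ?m powr (- p) * a)" for x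
    proof -
      let ?h = "\<lambda>y. \<phi> x - \<phi> y"
      have hL: "?h \<in> LpS ?M p"
      proof -
        have "integrable ?M (\<lambda>y. norm (?h y) powr p)"
        proof (rule M.integrable_const_bound[of _ "(2 * M) powr p"])
          have "\<bar>\<phi> x - \<phi> y\<bar> \<le> 2 * M" for y using bdd[of x] bdd[of y] by (simp add: abs_le_iff)
          then show "AE y in ?M. norm (norm (?h y) powr p) \<le> (2 * M) powr p"
            using p by (auto intro!: AE_I2 powr_mono2)
          show "(\<lambda>y. norm (?h y) powr p) \<in> borel_measurable ?M" using phiM by measurable
        qed
        then show ?thesis using phiM by (simp add: LpS_def)
      qed
      have "?m * \<phi> x = (\<integral>y. ?h y \<partial>?M) + (\<integral>y. \<phi> y \<partial>?M)" using phiI Ms(2) by simp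
      then have "(?m * \<bar>\<phi> x\<bar>) powr p = norm ((\<integral>y. ?h y \<partial>?M) + (\<integral>y. \<phi> y \<partial>?M)) powr p"
        using m by (metis abs_mult abs_of_pos real_norm_def)
      also have "\<dots> \<le> 2 powr p * (norm (\<integral>y. ?h y \<partial>?M) powr p + norm (\<integral>y. \<phi> y \<partial>?M) powr p)"
        using p by (intro norm_add_powr_le) simp
      also have "\<dots> \<le> 2 powr p * (?m powr (p - 1) * Lpint ?M p ?h + a)"
        using finite_measure_mean_le[OF p _ hL] Ms by (intro mult_left_mono add_mono) (auto simp: a_def)
      finally have "?m powr p * \<bar>\<phi> x\<bar> powr p \<le> 2 powr p * (?m powr (p - 1) * Lpint ?M p ?h + a)"
        using m by (simp add: powr_mult)
      then have "?m powr (- p) * (?m powr p * \<bar>\<phi> x\<bar> powr p) \<le> ?m powr (- p) * (2 powr p * (?m powr (p - 1) * Lpint ?M p ?h + a))"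
        by (intro mult_left_mono) auto
      moreover have "?m powr (- p) * (?m powr p * \<bar>\<phi> x\<bar> powr p) = \<bar>\<phi> x\<bar> powr p"
        using m by (simp flip: mult.assoc powr_add)
      moreover have "?m powr (- p) * (2 powr p * (?m powr (p - 1) * Lpint ?M p ?h + a)) = 2 powr p / ?m * Lpint ?M p ?h + 2 powr p * ?m powr (- p) * a"
      proof -
        have "?m powr (- p) * ?m powr (p - 1) = ?m powr (- 1)" unfolding powr_add[symmetric] by simp
        also have "\<dots> = 1 / ?m" using m by (simp add: powr_minus_divide)
        finally have c: "?m powr (- p) * ?m powr (p - 1) = 1 / ?m" .
        have "x * (t * (y * L)) = t * (x * y) * L" for x t y L :: real by simp
        from this[of "?m powr (- p)" "2 powr p" "?m powr (p - 1)"]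
        have "?m powr (- p) * (2 powr p * (?m powr (p - 1) * L)) = 2 powr p / ?m * L" for L
          unfolding c by simp
        from this[of "Lpint ?M p ?h"] show ?thesis by (simp only: distrib_left) (simp only: mult.assoc mult.left_commute)
      qed
      ultimately have "\<bar>\<phi> x\<bar> powr p \<le> 2 powr p / ?m * Lpint ?M p ?h + 2 powr p * ?m powr (- p) * a" by simp
      then have "ennreal (\<bar>\<phi> x\<bar> powr p) \<le> ennreal (2 powr p / ?m * Lpint ?M p ?h + 2 powr p * ?m powr (- p) * a)"
        by (rule ennreal_leI)
      also have "\<dots> = ennreal (2 powr p / ?m) * ennreal (Lpint ?M p ?h) + ennreal (2 powr p * ?m powr (- p) * a)"
      proof -
        have gen: "ennreal (x * L + y) = ennreal x * ennreal L + ennreal y" if "0 \<le> x" "0 \<le> L" "0 \<le> y" for x L y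
          using that by (simp add: ennreal_mult)
        show ?thesis by (rule gen) (use m in \<open>auto simp: Lpint_nonneg a_def\<close>)
      qed
      also have "ennreal (Lpint ?M p ?h) = (\<integral>\<^sup>+y. ennreal (norm (?h y) powr p) \<partial>?M)"
        unfolding Lpint_def by (rule nn_integral_eq_integral[symmetric, OF LpS_integrable[OF hL]]) auto
      also have "\<dots> = (\<integral>\<^sup>+y. indicator Q y * ennreal (norm (?h y) powr p) \<partial>lborel)"
        by (rule nn_integral_lebesgue_on) auto
      finally show ?thesis by simp
    qed
    let ?D = "\<lambda>x. \<integral>\<^sup>+y. indicator Q y * ennreal (\<bar>\<phi> x - \<phi> y\<bar> powr p) \<partial>lborel"
    have [measurable]: "?D \<in> borel_measurable borel" by measurable
    have "(\<integral>\<^sup>+x. indicator Q x * ennreal (\<bar>\<phi> x\<bar> powr p) \<partial>lborel)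
      \<le> (\<integral>\<^sup>+x. ennreal (2 powr p / ?m) * (indicator Q x * ?D x) + indicator Q x * ennreal (2 powr p * ?m powr (- p) * a) \<partial>lborel)"
    proof (rule nn_integral_mono)
      fix x
      show "indicator Q x * ennreal (\<bar>\<phi> x\<bar> powr p) \<le> ennreal (2 powr p / ?m) * (indicator Q x * ?D x) + indicator Q x * ennreal (2 powr p * ?m powr (- p) * a)"
        using pt[of x] by (cases "x \<in> Q") auto
    qed
    also have "\<dots> = ennreal (2 powr p / ?m) * (\<integral>\<^sup>+x. indicator Q x * ?D x \<partial>lborel) + emeasure lborel Q * ennreal (2 powr p * ?m powr (- p) * a)"
      by (subst nn_integral_add) (auto simp: nn_integral_cmult nn_integral_multc)
    also have "\<dots> \<le> ennreal (2 powr p / ?m) * (emeasure lborel Q * 2 ^ DIM('a) * ennreal (d powr p) * ?J) + emeasure lborel Q * ennreal (2 powr p * ?m powr (- p) * a)"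
      by (intro add_right_mono mult_left_mono convex_double_integral Q d) auto
    also have "ennreal (2 powr p / ?m) * (emeasure lborel Q * 2 ^ DIM('a) * ennreal (d powr p) * ?J) = ennreal (2 powr p) * 2 ^ DIM('a) * ennreal (d powr p) * ?J"
    proof -
      have e: "ennreal (2 powr p / ?m) * ennreal ?m = ennreal (2 powr p)"
        using m by (simp add: ennreal_mult[symmetric])
      show ?thesis by (simp only: em mult.assoc[symmetric] e)
    qed
    also have "emeasure lborel Q * ennreal (2 powr p * ?m powr (- p) * a) = ennreal (?m * (2 powr p * ?m powr (- p)) * a)"
      unfolding em using m by (simp add: ennreal_mult[symmetric] a_def mult.assoc)
    finally show ?thesis by (simp only: a_def)
  qed
qed

end

text \<open>Cells are the fibres of rounding all coordinates down, hence disjoint, and intersections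
  of half-spaces, hence convex. Only cells that meet the bounded set are kept, so they are finitely
  many.\<close>

lemma bounded_grid_partition:
  fixes S :: "'a::euclidean_space set"
  assumes S: "bounded S" and h: "h > 0"
  shows "\<exists>(d::nat) Q. (\<forall>i<d. convex (Q i) \<and> Q i \<in> sets borel \<and> bounded (Q i) \<and> Q i \<inter> S \<noteq> {} \<and>
      (\<forall>x\<in>Q i. \<forall>y\<in>Q i. norm (x - y) \<le> h)) \<and> disjoint_family_on Q {..<d} \<and> S \<subseteq> (\<Union>i<d. Q i)"
proof -
  \<comment> \<open>The diameter is estimated by the sum of coordinate differences, each at most
    \<open>c\<close>.\<close>
  define c where "c = h / real DIM('a)"
  have c: "c > 0" using h by (simp add: c_def)
  define key where "key x = restrict (\<lambda>i. \<lfloor>x \<bullet> i / c\<rfloor>) Basis" for x :: 'a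
  define cell where "cell k = {x. key x = k}" for k
  obtain B where B: "\<And>x. x \<in> S \<Longrightarrow> norm x \<le> B" using S by (auto simp: bounded_iff)
  have "key ` S \<subseteq> PiE Basis (\<lambda>_. {\<lfloor>- B / c\<rfloor>..\<lfloor>B / c\<rfloor>})"
  proof
    fix k assume "k \<in> key ` S"
    then obtain x where x: "x \<in> S" "k = key x" by blast
    have "\<lfloor>- B / c\<rfloor> \<le> \<lfloor>x \<bullet> i / c\<rfloor> \<and> \<lfloor>x \<bullet> i / c\<rfloor> \<le> \<lfloor>B / c\<rfloor>" if "i \<in> Basis" for i
    proof -
      have "\<bar>x \<bullet> i\<bar> \<le> B" using Basis_le_norm[OF that, of x] B[OF x(1)] by linarith
      then have "- B \<le> x \<bullet> i" "x \<bullet> i \<le> B" by linarith+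
      then show ?thesis using c by (intro conjI floor_mono divide_right_mono) auto
    qed
    then show "k \<in> PiE Basis (\<lambda>_. {\<lfloor>- B / c\<rfloor>..\<lfloor>B / c\<rfloor>})" by (auto simp: x(2) key_def)
  qed
  then have fin: "finite (key ` S)" by (rule finite_subset) (auto intro: finite_PiE)
  obtain q where q: "bij_betw q {..<card (key ` S)} (key ` S)"
    using ex_bij_betw_nat_finite[OF fin] by (auto simp: atLeast0LessThan)
  define Q where "Q i = cell (q i)" for i
  have cell_eq: "cell k = (\<Inter>i\<in>Basis. {x. i \<bullet> x \<ge> of_int (k i) * c} \<inter> {x. i \<bullet> x < (of_int (k i) + 1) * c})"
    if k: "k \<in> key ` S" for k
  proof -
    obtain y where y: "k = key y" using k by blast
    have "x \<in> cell k \<longleftrightarrow> (\<forall>i\<in>Basis. \<lfloor>x \<bullet> i / c\<rfloor> = k i)" for x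
      unfolding y cell_def key_def by (auto simp: fun_eq_iff restrict_def split: if_splits)
    moreover have "\<lfloor>x \<bullet> i / c\<rfloor> = k i \<longleftrightarrow> of_int (k i) * c \<le> i \<bullet> x \<and> i \<bullet> x < (of_int (k i) + 1) * c" for x i
      using c by (simp add: floor_eq_iff le_divide_eq divide_less_eq inner_commute)
    ultimately show ?thesis by auto
  qed
  have diam: "norm (x - y) \<le> h" if "x \<in> cell k" "y \<in> cell k" for x y k
  proof -
    have "key x = key y" using that by (simp add: cell_def)
    then have f: "\<lfloor>x \<bullet> i / c\<rfloor> = \<lfloor>y \<bullet> i / c\<rfloor>" if "i \<in> Basis" for i
      using that by (metis key_def restrict_apply')
    have "\<bar>(x - y) \<bullet> i\<bar> \<le> c" if i: "i \<in> Basis" for i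
    proof -
      have "\<bar>x \<bullet> i / c - y \<bullet> i / c\<bar> \<le> 1" using f[OF i] by linarith
      then show ?thesis using c by (simp add: abs_divide inner_diff_left flip: diff_divide_distrib)
    qed
    then have "(\<Sum>i\<in>Basis. \<bar>(x - y) \<bullet> i\<bar>) \<le> real DIM('a) * c" by (rule sum_bounded_above)
    then show ?thesis using norm_le_l1[of "x - y"] by (simp add: c_def)
  qed
  have qS: "q i \<in> key ` S" if "i < card (key ` S)" for i using q that by (auto simp: bij_betw_def)
  have "convex (Q i) \<and> Q i \<in> sets borel \<and> bounded (Q i) \<and> Q i \<inter> S \<noteq> {} \<and> (\<forall>x\<in>Q i. \<forall>y\<in>Q i. norm (x - y) \<le> h)"
    if i: "i < card (key ` S)" for i
  proof (intro conjI)
    note e = cell_eq[OF qS[OF i]]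
    show "convex (Q i)" unfolding Q_def e
      by (intro convex_INT convex_Int convex_halfspace_ge convex_halfspace_lt)
    show "Q i \<in> sets borel" unfolding Q_def e
      by (intro sets.finite_INT sets.Int borel_closed borel_open closed_halfspace_ge open_halfspace_lt) auto
    show ne: "Q i \<inter> S \<noteq> {}" using qS[OF i] by (auto simp: Q_def cell_def)
    show d: "\<forall>x\<in>Q i. \<forall>y\<in>Q i. norm (x - y) \<le> h" using diam by (auto simp: Q_def)
    obtain z where "z \<in> Q i" using ne by blast
    then have "Q i \<subseteq> cball z h" using d by (auto simp: dist_norm norm_minus_commute)
    then show "bounded (Q i)" using bounded_cball bounded_subset by blast
  qed
  moreover have "disjoint_family_on Q {..<card (key ` S)}"
    using q by (auto simp: disjoint_family_on_def Q_def cell_def bij_betw_def inj_on_def)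
  moreover have "S \<subseteq> (\<Union>i<card (key ` S). Q i)"
  proof
    fix x assume "x \<in> S"
    then obtain i where "i < card (key ` S)" "q i = key x" using q by (metis (no_types, lifting) bij_betw_def imageE image_eqI lessThan_iff)
    then show "x \<in> (\<Union>i<card (key ` S). Q i)" by (intro UN_I[of i]) (auto simp: Q_def cell_def)
  qed
  ultimately show ?thesis by (intro exI[of _ "card (key ` S)"] exI[of _ Q]) simp
qed

lemma powr_sum_superadditive:
  fixes b :: "'i \<Rightarrow> real"
  assumes "1 \<le> p" "finite I" "\<And>i. i \<in> I \<Longrightarrow> 0 \<le> b i"
  shows "(\<Sum>i\<in>I. b i powr p) \<le> (\<Sum>i\<in>I. b i) powr p"
  using assms(2,3)
proof (induction I)
  case (insert i I)
  have "(\<Sum>i\<in>insert i I. b i powr p) \<le> b i powr p + (\<Sum>i\<in>I. b i) powr p" using insert by simp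
  also have "\<dots> \<le> (b i + (\<Sum>i\<in>I. b i)) powr p"
    using insert assms(1) by (intro powr_superadditive sum_nonneg) auto
  finally show ?case using insert by simp
qed simp

section \<open>The corner domain\<close>

text \<open>The density of \<open>d\<sigma>\<close> is \<open>1 / (x1^2 * x2)\<close>; the weight
  \<open>x1\<close> of the problem cancels one power.\<close>

definition corner_wt :: "'n::finite pt \<Rightarrow> real" where
  "corner_wt x = 1 / (fst x * fst (snd x))"

definition nuM :: "real \<Rightarrow> (real ^ 'n) set \<Rightarrow> 'n::finite pt measure" where
  "nuM \<delta> X = density (lebesgue_on (MM \<delta> X)) (\<lambda>x. ennreal (corner_wt x))"

definition muM :: "real \<Rightarrow> (real ^ 'n) set \<Rightarrow> real \<Rightarrow> 'n::finite pt measure" where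
  "muM \<delta> X p = density (nuM \<delta> X) (\<lambda>x. ennreal ((fst x * fst (snd x)) powr p))"

lemma pt_coord_measurable:
  "(\<lambda>x::'n::finite pt. fst x) \<in> borel_measurable borel" "(\<lambda>x::'n pt. fst (snd x)) \<in> borel_measurable borel"
  by (auto intro!: borel_measurable_continuous_onI continuous_intros)

lemma corner_wt_measurable[measurable]: "corner_wt \<in> borel_measurable borel"
  unfolding corner_wt_def[abs_def]
  by (intro borel_measurable_divide borel_measurable_times borel_measurable_const pt_coord_measurable)

lemma lebesgue_on_borelI:
  assumes "f \<in> borel_measurable borel"
  shows "f \<in> borel_measurable (lebesgue_on S)"
  by (intro measurable_restrict_space1 measurable_completion) (use assms in simp)

locale corner_domain =
  fixes \<delta> p :: real and X :: "(real ^ 'n::finite) set"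
  assumes \<delta>: "\<delta> > 0" and X: "open X" "bounded X" "X \<noteq> {}" and p: "2 < p"
begin

abbreviation "M \<equiv> MM \<delta> X"
abbreviation "\<nu> \<equiv> nuM \<delta> X"
abbreviation "\<mu> \<equiv> muM \<delta> X p"

section \<open>The measures \<nu> and \<mu> on the domain\<close>

lemma M_mem: "x \<in> M \<longleftrightarrow> 0 < fst x \<and> fst x < \<delta> \<and> 0 < fst (snd x) \<and> fst (snd x) < \<delta> \<and> snd (snd x) \<in> X"
  by (cases x) (auto simp: MM_def)

lemma M_open: "open M"
  unfolding MM_def using X by (intro open_Times) auto

lemma M_borel[measurable]: "M \<in> sets borel" using M_open by simp

lemma M_lebesgue: "M \<in> sets lebesgue" using M_open by simp

lemma M_bounded: "bounded M"
  unfolding MM_def using X bounded_subset[OF bounded_closed_interval, of "{0<..<\<delta>}" 0 \<delta>] by (intro bounded_Times) auto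

lemma space_nu[simp]: "space \<nu> = M" by (simp add: nuM_def)

lemma sets_nu[simp]: "sets \<nu> = sets (lebesgue_on M)" by (simp add: nuM_def)

lemma sets_mu[simp]: "sets \<mu> = sets (lebesgue_on M)" by (simp add: muM_def)

lemma measurable_nu: "borel_measurable \<nu> = borel_measurable (lebesgue_on M)"
  by (rule measurable_cong_sets) simp_all

lemma measurable_mu: "borel_measurable \<mu> = borel_measurable (lebesgue_on M)"
  by (rule measurable_cong_sets) simp_all

lemma wt_pos: "x \<in> M \<Longrightarrow> corner_wt x > 0" by (simp add: M_mem corner_wt_def)

lemma wt_measurable[measurable]: "corner_wt \<in> borel_measurable (lebesgue_on M)"
  by (rule lebesgue_on_borelI) simp

lemma scale_measurable[measurable]: "(\<lambda>x::'n pt. (fst x * fst (snd x)) powr p) \<in> borel_measurable (lebesgue_on M)"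
  by (intro lebesgue_on_borelI powr_real_measurable borel_measurable_times borel_measurable_const pt_coord_measurable)

text \<open>Lebesgue measure on the domain is at most \<open>\<delta>\<^sup>2\<close> times \<nu>,
  so \<open>L^p(\<nu>)\<close> functions are integrable in the ordinary sense.\<close>

lemma wt_lower: "x \<in> M \<Longrightarrow> 1 \<le> \<delta>\<^sup>2 * corner_wt x"
proof -
  assume x: "x \<in> M"
  have "fst x * fst (snd x) \<le> \<delta> * \<delta>" using x by (intro mult_mono) (auto simp: M_mem)
  moreover have "fst x * fst (snd x) > 0" using x by (simp add: M_mem)
  ultimately show ?thesis by (simp add: corner_wt_def power2_eq_square le_divide_eq)
qed

lemma AE_nu: "(AE x in \<nu>. P x) \<longleftrightarrow> (AE x in lebesgue_on M. P x)"
proof -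
  have "(AE x in \<nu>. P x) \<longleftrightarrow> (AE x in lebesgue_on M. 0 < ennreal (corner_wt x) \<longrightarrow> P x)"
    unfolding nuM_def by (rule AE_density) simp
  also have "\<dots> \<longleftrightarrow> (AE x in lebesgue_on M. P x)"
    by (rule AE_cong) (simp add: wt_pos)
  finally show ?thesis .
qed

lemma AE_mu: "(AE x in \<mu>. P x) \<longleftrightarrow> (AE x in lebesgue_on M. P x)"
proof -
  have "(AE x in \<mu>. P x) \<longleftrightarrow> (AE x in \<nu>. 0 < ennreal ((fst x * fst (snd x)) powr p) \<longrightarrow> P x)"
    unfolding muM_def by (rule AE_density) (simp add: measurable_nu)
  also have "\<dots> \<longleftrightarrow> (AE x in \<nu>. P x)"
    by (rule AE_cong) (simp add: M_mem)
  finally show ?thesis by (simp add: AE_nu)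
qed

lemma integrable_nu:
  fixes f :: "'n pt \<Rightarrow> real"
  assumes "f \<in> borel_measurable (lebesgue_on M)"
  shows "integrable \<nu> f \<longleftrightarrow> integrable (lebesgue_on M) (\<lambda>x. corner_wt x * f x)"
    and "integral\<^sup>L \<nu> f = (\<integral>x. corner_wt x * f x \<partial>lebesgue_on M)"
proof -
  have nn: "AE x in lebesgue_on M. 0 \<le> corner_wt x" by (rule AE_I2) (simp add: less_imp_le wt_pos)
  show "integrable \<nu> f \<longleftrightarrow> integrable (lebesgue_on M) (\<lambda>x. corner_wt x * f x)"
    unfolding nuM_def using integrable_density[OF assms wt_measurable nn] by simp
  show "integral\<^sup>L \<nu> f = (\<integral>x. corner_wt x * f x \<partial>lebesgue_on M)"
    unfolding nuM_def using integral_density[OF assms wt_measurable nn] by simp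
qed

lemma integrable_mu:
  fixes f :: "'n pt \<Rightarrow> real"
  assumes "f \<in> borel_measurable (lebesgue_on M)"
  shows "integrable \<mu> f \<longleftrightarrow> integrable \<nu> (\<lambda>x. (fst x * fst (snd x)) powr p * f x)"
    and "integral\<^sup>L \<mu> f = (\<integral>x. (fst x * fst (snd x)) powr p * f x \<partial>\<nu>)"
proof -
  have nn: "AE x in \<nu>. 0 \<le> (fst x * fst (snd x)) powr p" by simp
  have m: "f \<in> borel_measurable \<nu>" "(\<lambda>x::'n pt. (fst x * fst (snd x)) powr p) \<in> borel_measurable \<nu>"
    unfolding measurable_nu by (rule assms, rule scale_measurable)
  show "integrable \<mu> f \<longleftrightarrow> integrable \<nu> (\<lambda>x. (fst x * fst (snd x)) powr p * f x)"
    unfolding muM_def using integrable_density[OF m nn] by simp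
  show "integral\<^sup>L \<mu> f = (\<integral>x. (fst x * fst (snd x)) powr p * f x \<partial>\<nu>)"
    unfolding muM_def using integral_density[OF m nn] by simp
qed

lemma nn_integral_nu:
  assumes [measurable]: "f \<in> borel_measurable borel"
  shows "(\<integral>\<^sup>+x. f x \<partial>\<nu>) = (\<integral>\<^sup>+x. indicator M x * (ennreal (corner_wt x) * f x) \<partial>lborel)"
proof -
  have "(\<integral>\<^sup>+x. f x \<partial>\<nu>) = (\<integral>\<^sup>+x. ennreal (corner_wt x) * f x \<partial>lebesgue_on M)"
    unfolding nuM_def by (rule nn_integral_density) (auto intro: lebesgue_on_borelI)
  also have "\<dots> = (\<integral>\<^sup>+x. indicator M x * (ennreal (corner_wt x) * f x) \<partial>lborel)"
    by (rule nn_integral_lebesgue_on) measurable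
  finally show ?thesis .
qed

section \<open>Test functions and their Poincare inequality\<close>

lemma LpS_nu_continuous:
  fixes f :: "'n pt \<Rightarrow> 'b::euclidean_space"
  assumes f: "continuous_on UNIV f" and K: "compact K" "K \<subseteq> M" "\<And>x. x \<notin> K \<Longrightarrow> f x = 0"
  shows "f \<in> LpS \<nu> p"
proof -
  have fm: "f \<in> borel_measurable (lebesgue_on M)" by (rule lebesgue_on_borelI[OF borel_measurable_continuous_onI[OF f]])
  have "continuous_on K corner_wt"
    unfolding corner_wt_def[abs_def] using K(2) by (intro continuous_intros) (auto simp: M_mem subset_eq)
  then have "continuous_on K (\<lambda>x. corner_wt x * norm (f x) powr p)"
    using p by (intro continuous_on_mult continuous_on_powr' continuous_on_norm continuous_on_subset[OF f] continuous_on_const) auto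
  from borel_integrable_compact[OF K(1) this]
  have "integrable lborel (\<lambda>x. indicator K x *\<^sub>R (corner_wt x * norm (f x) powr p))" .
  also have "(\<lambda>x. indicator K x *\<^sub>R (corner_wt x * norm (f x) powr p)) = (\<lambda>x. corner_wt x * norm (f x) powr p)"
    by (rule ext) (use K(3) in \<open>auto simp: indicator_def\<close>)
  finally have "integrable (lebesgue_on M) (\<lambda>x. corner_wt x * norm (f x) powr p)"
    by (rule integrable_lebesgue_on_support[OF _ M_lebesgue])
  then show ?thesis using fm by (simp add: LpS_def integrable_nu measurable_nu)
qed

lemma gradient_outside: "x \<notin> closure {x. \<phi> x \<noteq> (0::real)} \<Longrightarrow> classical_gradient \<phi> x = 0"
  by (simp add: classical_gradient_def frechet_derivative_outside_support)

lemma corner_scale_simp: "corner_scale x g = (fst x * fst g, fst x * fst (snd x) * fst (snd g), snd (snd g))"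
  by (cases x; cases g) (auto simp: corner_scale_def)

lemma continuous_nabla:
  fixes \<phi> :: "'n pt \<Rightarrow> real"
  assumes "\<phi> \<in> test_functions U"
  shows "continuous_on UNIV (nabla_M_classical \<phi>)"
  unfolding nabla_M_classical_def[abs_def] corner_scale_simp
  by (intro continuous_intros continuous_on_classical_gradient[OF assms])

lemma nabla_outside: "x \<notin> closure {x. \<phi> x \<noteq> 0} \<Longrightarrow> nabla_M_classical \<phi> x = 0"
  unfolding nabla_M_classical_def by (simp add: gradient_outside corner_scale_simp zero_prod_def)

lemma test_LpS: "\<phi> \<in> test_functions M \<Longrightarrow> \<phi> \<in> LpS \<nu> p"
  using test_functionsD by (intro LpS_nu_continuous[of _ "closure {x. \<phi> x \<noteq> 0}"]) blast+

lemma nabla_LpS: "\<phi> \<in> test_functions M \<Longrightarrow> nabla_M_classical \<phi> \<in> LpS \<nu> p"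
  using test_functionsD(2,3) by (intro LpS_nu_continuous[of _ "closure {x. \<phi> x \<noteq> 0}"] continuous_nabla nabla_outside)

lemma classical_gradient_lincomb:
  fixes \<phi> \<psi> :: "'n pt \<Rightarrow> real"
  assumes "\<phi> \<in> test_functions U" "\<psi> \<in> test_functions U"
  shows "classical_gradient (\<lambda>x. a * \<phi> x + b * \<psi> x) x = a *\<^sub>R classical_gradient \<phi> x + b *\<^sub>R classical_gradient \<psi> x"
proof -
  have "((\<lambda>x. a * \<phi> x + b * \<psi> x) has_derivative (\<lambda>h. a * frechet_derivative \<phi> (at x) h + b * frechet_derivative \<psi> (at x) h)) (at x)"
    by (intro has_derivative_add has_derivative_mult_right test_functionsD(5)[OF assms(1)] test_functionsD(5)[OF assms(2)])
  from frechet_derivative_at[OF this, symmetric] show ?thesis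
    by (simp add: classical_gradient_def scaleR_sum_right sum.distrib scaleR_left_distrib)
qed

lemma nabla_lincomb:
  fixes \<phi> \<psi> :: "'n pt \<Rightarrow> real"
  assumes "\<phi> \<in> test_functions U" "\<psi> \<in> test_functions U"
  shows "nabla_M_classical (\<lambda>x. a * \<phi> x + b * \<psi> x) x = a *\<^sub>R nabla_M_classical \<phi> x + b *\<^sub>R nabla_M_classical \<psi> x"
  unfolding nabla_M_classical_def classical_gradient_lincomb[OF assms]
  by (simp add: corner_scale_simp algebra_simps)

lemma ennreal_Lpint:
  fixes f :: "'n pt \<Rightarrow> 'b::euclidean_space"
  assumes "f \<in> LpS N p"
  shows "ennreal (Lpint N p f) = (\<integral>\<^sup>+x. ennreal (norm (f x) powr p) \<partial>N)"
  unfolding Lpint_def by (rule nn_integral_eq_integral[symmetric, OF LpS_integrable[OF assms]]) auto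

definition radius :: real where
  "radius = (SOME R. R > 0 \<and> (\<forall>x\<in>X. norm x < R))"

lemma radius: "radius > 0" "x \<in> X \<Longrightarrow> norm x < radius"
proof -
  obtain B where B: "\<forall>x\<in>X. norm x \<le> B" using X(2) by (auto simp: bounded_iff)
  have "\<bar>B\<bar> + 1 > 0 \<and> (\<forall>x\<in>X. norm x < \<bar>B\<bar> + 1)" using B by force
  from someI[of "\<lambda>R. R > 0 \<and> (\<forall>x\<in>X. norm x < R)", OF this]
  show "radius > 0" "x \<in> X \<Longrightarrow> norm x < radius" by (auto simp: radius_def)
qed

text \<open>The translation by \<open>2 * radius\<close> along \<open>x'\<close> moves the domain off itself and leaves the weight
  of \<open>\<nu>\<close> unchanged.\<close>

lemma Poincare_M:
  assumes \<phi>: "\<phi> \<in> test_functions M"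
  shows "Lpn \<nu> p \<phi> \<le> 2 * radius * Lpn \<nu> p (nabla_M_classical \<phi>)"
proof -
  obtain k :: 'n where True by simp
  define e :: "real ^ 'n" where "e = axis k 1"
  have e: "norm e = 1" "e \<bullet> e = 1" by (simp_all add: e_def norm_axis_1 inner_axis_axis)
  let ?R = "2 * radius"
  define v :: "'n pt" where "v = (0, 0, ?R *\<^sub>R e)"
  \<comment> \<open>The strip drops the condition on \<open>x'\<close>, so that \<open>w\<close> is
    invariant under translation along \<open>v\<close>; on the domain it agrees with the weight of
    \<nu>.\<close>
  let ?strip = "{x::'n pt. 0 < fst x \<and> fst x < \<delta> \<and> 0 < fst (snd x) \<and> fst (snd x) < \<delta>}"
  define w where "w x = indicator ?strip x * ennreal (corner_wt x)" for x :: "'n pt"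
  have "open ?strip" by (intro open_Collect_conj open_Collect_less continuous_intros)
  then have [measurable]: "?strip \<in> sets borel" by simp
  have w[measurable]: "w \<in> borel_measurable borel" unfolding w_def[abs_def] by measurable
  have inv: "w (x + t *\<^sub>R v) = w x" for x t by (simp add: w_def v_def corner_wt_def indicator_def)
  have C1: "Ck (Suc 0) \<phi>" by (rule test_functionsD(1)[OF \<phi>])
  have phim[measurable]: "\<phi> \<in> borel_measurable borel" by (rule borel_measurable_continuous_onI[OF test_functionsD(4)[OF \<phi>]])
  have nabm[measurable]: "nabla_M_classical \<phi> \<in> borel_measurable borel" by (rule borel_measurable_continuous_onI[OF continuous_nabla[OF \<phi>]])
  \<comment> \<open>On the domain the component of \<open>x'\<close> along \<open>e\<close> exceeds
    \<open>- radius\<close>; after the shift by \<open>2 * radius\<close> it exceeds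
    \<open>radius\<close>, which no point of \<open>X\<close> attains.\<close>
  have shift: "\<phi> (x + v) = 0" if "x \<in> M" for x
  proof -
    have "norm (snd (snd x)) < radius" using that radius(2) by (simp add: M_mem)
    then have "\<bar>snd (snd x) \<bullet> e\<bar> < radius" using Cauchy_Schwarz_ineq2[of "snd (snd x)" e] e by simp
    then have "snd (snd (x + v)) \<bullet> e > radius" using e by (simp add: v_def inner_add_left)
    then have "norm (snd (snd (x + v))) > radius" using Cauchy_Schwarz_ineq2[of "snd (snd (x + v))" e] e by simp
    then have "x + v \<notin> M" using radius(2)[of "snd (snd (x + v))"] by (auto simp: M_mem)
    then show ?thesis using test_functionsD(3,7)[OF \<phi>] by blast
  qed
  have "ennreal (Lpint \<nu> p \<phi>) = (\<integral>\<^sup>+x. ennreal (\<bar>\<phi> x\<bar> powr p) \<partial>\<nu>)" using ennreal_Lpint[OF test_LpS[OF \<phi>]] by simp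
  also have "\<dots> = (\<integral>\<^sup>+x. indicator M x * (ennreal (corner_wt x) * ennreal (\<bar>\<phi> x\<bar> powr p)) \<partial>lborel)"
    by (rule nn_integral_nu) measurable
  also have "\<dots> \<le> (\<integral>\<^sup>+x. w x * ennreal (\<bar>\<phi> (x + v) - \<phi> x\<bar> powr p) \<partial>lborel)"
  proof (rule nn_integral_mono)
    fix x
    show "indicator M x * (ennreal (corner_wt x) * ennreal (\<bar>\<phi> x\<bar> powr p)) \<le> w x * ennreal (\<bar>\<phi> (x + v) - \<phi> x\<bar> powr p)"
      using shift[of x] by (cases "x \<in> M") (auto simp: w_def M_mem)
  qed
  also have "\<dots> \<le> (\<integral>\<^sup>+x. w x * ennreal (\<bar>classical_gradient \<phi> x \<bullet> v\<bar> powr p) \<partial>lborel)"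
    by (rule translation_estimate[OF p C1 w inv])
  also have "\<dots> \<le> (\<integral>\<^sup>+x. ennreal (?R powr p) * (indicator M x * (ennreal (corner_wt x) * ennreal (norm (nabla_M_classical \<phi> x) powr p))) \<partial>lborel)"
  proof (rule nn_integral_mono)
    fix x
    show "w x * ennreal (\<bar>classical_gradient \<phi> x \<bullet> v\<bar> powr p) \<le> ennreal (?R powr p) * (indicator M x * (ennreal (corner_wt x) * ennreal (norm (nabla_M_classical \<phi> x) powr p)))"
    proof (cases "x \<in> M")
      case True
      have "\<bar>classical_gradient \<phi> x \<bullet> v\<bar> = ?R * \<bar>snd (snd (classical_gradient \<phi> x)) \<bullet> e\<bar>"
        using radius(1) by (simp add: v_def inner_prod_def abs_mult)
      also have "\<dots> \<le> ?R * norm (snd (snd (classical_gradient \<phi> x)))"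
        using Cauchy_Schwarz_ineq2[of "snd (snd (classical_gradient \<phi> x))" e] e radius(1) by simp
      also have "norm (snd (snd (classical_gradient \<phi> x))) = norm (snd (snd (nabla_M_classical \<phi> x)))"
        by (simp add: nabla_M_classical_def corner_scale_simp)
      also have "\<dots> \<le> norm (nabla_M_classical \<phi> x)"
        using norm_snd_le[of "snd (nabla_M_classical \<phi> x)" "fst (nabla_M_classical \<phi> x)"]
          norm_snd_le[of "snd (snd (nabla_M_classical \<phi> x))" "fst (snd (nabla_M_classical \<phi> x))"] by simp
      finally have "\<bar>classical_gradient \<phi> x \<bullet> v\<bar> \<le> ?R * norm (nabla_M_classical \<phi> x)" using radius(1) by simp
      then have "\<bar>classical_gradient \<phi> x \<bullet> v\<bar> powr p \<le> ?R powr p * norm (nabla_M_classical \<phi> x) powr p"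
        using p powr_mono2[of p _ "?R * norm (nabla_M_classical \<phi> x)"] by (simp add: powr_mult)
      then have "ennreal (\<bar>classical_gradient \<phi> x \<bullet> v\<bar> powr p) \<le> ennreal (?R powr p) * ennreal (norm (nabla_M_classical \<phi> x) powr p)"
        by (simp add: ennreal_mult[symmetric] ennreal_leI)
      then have "ennreal (corner_wt x) * ennreal (\<bar>classical_gradient \<phi> x \<bullet> v\<bar> powr p) \<le> ennreal (corner_wt x) * (ennreal (?R powr p) * ennreal (norm (nabla_M_classical \<phi> x) powr p))"
        by (intro mult_left_mono) auto
      then show ?thesis using True by (simp add: w_def M_mem mult_ac)
    next
      case False
      then have "x \<notin> closure {x. \<phi> x \<noteq> 0}" using test_functionsD(3)[OF \<phi>] by blast
      then show ?thesis using p by (simp add: gradient_outside)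
    qed
  qed
  also have "\<dots> = ennreal (?R powr p) * (\<integral>\<^sup>+x. indicator M x * (ennreal (corner_wt x) * ennreal (norm (nabla_M_classical \<phi> x) powr p)) \<partial>lborel)"
    by (rule nn_integral_cmult) measurable
  also have "(\<integral>\<^sup>+x. indicator M x * (ennreal (corner_wt x) * ennreal (norm (nabla_M_classical \<phi> x) powr p)) \<partial>lborel) = (\<integral>\<^sup>+x. ennreal (norm (nabla_M_classical \<phi> x) powr p) \<partial>\<nu>)"
    by (rule nn_integral_nu[symmetric]) measurable
  also have "\<dots> = ennreal (Lpint \<nu> p (nabla_M_classical \<phi>))" by (rule ennreal_Lpint[OF nabla_LpS[OF \<phi>], symmetric])
  also have "ennreal (?R powr p) * \<dots> = ennreal (?R powr p * Lpint \<nu> p (nabla_M_classical \<phi>))"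
    by (simp add: ennreal_mult Lpint_nonneg)
  finally have "Lpint \<nu> p \<phi> \<le> ?R powr p * Lpint \<nu> p (nabla_M_classical \<phi>)"
    by (subst (asm) ennreal_le_iff) (simp add: Lpint_nonneg)
  also have "\<dots> = (?R * Lpn \<nu> p (nabla_M_classical \<phi>)) powr p"
    by (simp add: powr_mult Lpn_powr[OF p])
  finally show ?thesis using radius(1) by (subst (asm) Lpint_le_iff[OF p]) (auto intro: Lpn_nonneg)
qed

lemma mu_from_nu:
  fixes f :: "'n pt \<Rightarrow> real"
  assumes f: "f \<in> LpS \<nu> p"
  shows "f \<in> LpS \<mu> p" "Lpn \<mu> p f \<le> \<delta>\<^sup>2 * Lpn \<nu> p f"
proof -
  let ?s = "\<lambda>x::'n pt. (fst x * fst (snd x)) powr p"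
  have fm[measurable]: "f \<in> borel_measurable (lebesgue_on M)" using f by (simp add: LpS_def measurable_nu)
  have sle: "?s x \<le> (\<delta>\<^sup>2) powr p" if "x \<in> M" for x
  proof -
    have "fst x * fst (snd x) \<le> \<delta> * \<delta>" using that by (intro mult_mono) (auto simp: M_mem)
    then show ?thesis using that p by (intro powr_mono2) (auto simp: M_mem power2_eq_square)
  qed
  note i = LpS_integrable[OF f]
  have I: "integrable \<nu> (\<lambda>x. ?s x * norm (f x) powr p)"
  proof (rule Bochner_Integration.integrable_bound)
    show "integrable \<nu> (\<lambda>x. (\<delta>\<^sup>2) powr p * norm (f x) powr p)" using i by simp
    show "(\<lambda>x. ?s x * norm (f x) powr p) \<in> borel_measurable \<nu>" unfolding measurable_nu by measurable
    show "AE x in \<nu>. norm (?s x * norm (f x) powr p) \<le> norm ((\<delta>\<^sup>2) powr p * norm (f x) powr p)"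
      using sle by (auto intro!: AE_I2 mult_right_mono simp: abs_mult)
  qed
  have fp: "(\<lambda>x. norm (f x) powr p) \<in> borel_measurable (lebesgue_on M)" by measurable
  show L: "f \<in> LpS \<mu> p" using I integrable_mu(1)[OF fp] by (simp add: LpS_def measurable_mu)
  have "Lpint \<mu> p f = (\<integral>x. ?s x * norm (f x) powr p \<partial>\<nu>)" unfolding Lpint_def by (rule integrable_mu(2)[OF fp])
  also have "\<dots> \<le> (\<integral>x. (\<delta>\<^sup>2) powr p * norm (f x) powr p \<partial>\<nu>)"
    using sle i by (intro integral_mono I) (auto intro!: mult_right_mono)
  also have "\<dots> = (\<delta>\<^sup>2 * Lpn \<nu> p f) powr p" by (simp add: powr_mult Lpn_powr[OF p] Lpint_def)
  finally show "Lpn \<mu> p f \<le> \<delta>\<^sup>2 * Lpn \<nu> p f" by (subst (asm) Lpint_le_iff[OF p]) (auto intro: Lpn_nonneg)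
qed

section \<open>Ordinary integrability on subsets, and independent test functions\<close>

lemma LpS_lebesgue_on_subset:
  fixes f :: "'n pt \<Rightarrow> 'b::euclidean_space"
  assumes f: "f \<in> LpS \<nu> p" and T: "T \<in> sets borel" "T \<subseteq> M"
  shows "f \<in> LpS (lebesgue_on T) p" "Lpint (lebesgue_on T) p f \<le> \<delta>\<^sup>2 * Lpint \<nu> p f"
proof -
  have fm[measurable]: "f \<in> borel_measurable (lebesgue_on M)" using f by (simp add: LpS_def measurable_nu)
  let ?h = "\<lambda>x. norm (f x) powr p"
  have hm: "?h \<in> borel_measurable (lebesgue_on M)" by measurable
  have I: "integrable (lebesgue_on M) (\<lambda>x. corner_wt x * ?h x)"
    using LpS_integrable[OF f] integrable_nu(1)[OF hm] by simp
  have le: "?h x \<le> \<delta>\<^sup>2 * (corner_wt x * ?h x)" if "x \<in> M" for x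
    using mult_right_mono[OF wt_lower[OF that], of "?h x"] by (simp add: mult.assoc)
  have IM: "integrable (lebesgue_on M) ?h"
  proof (rule Bochner_Integration.integrable_bound[OF integrable_mult_right[OF I, of "\<delta>\<^sup>2"] hm])
    show "AE x in lebesgue_on M. norm (?h x) \<le> norm (\<delta>\<^sup>2 * (corner_wt x * ?h x))"
      using le by (auto intro!: AE_I2 order_trans[OF le])
  qed
  have Ts: "T \<in> sets lebesgue" using T(1) by simp
  have IL: "integrable lebesgue (\<lambda>x. indicator M x *\<^sub>R ?h x)" using IM M_lebesgue by (simp add: integrable_restrict_space)
  have eq: "(\<lambda>x. indicator T x *\<^sub>R (indicator M x *\<^sub>R ?h x)) = (\<lambda>x. indicator T x *\<^sub>R ?h x)"
    by (rule ext) (use T(2) in \<open>auto simp: indicator_def\<close>)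
  have IT: "integrable lebesgue (\<lambda>x. indicator T x *\<^sub>R ?h x)"
    using integrable_mult_indicator[OF Ts IL] unfolding eq .
  then have "integrable (lebesgue_on T) ?h" using Ts by (simp add: integrable_restrict_space)
  moreover have "f \<in> borel_measurable (lebesgue_on T)" by (rule measurable_restrict_mono[OF fm T(2)])
  ultimately show "f \<in> LpS (lebesgue_on T) p" by (simp add: LpS_def)
  have "Lpint (lebesgue_on T) p f = (\<integral>x. indicator T x *\<^sub>R ?h x \<partial>lebesgue)"
    unfolding Lpint_def using Ts by (subst integral_restrict_space) auto
  also have "\<dots> \<le> (\<integral>x. indicator M x *\<^sub>R ?h x \<partial>lebesgue)"
    using T(2) by (intro integral_mono IT IL) (auto simp: indicator_def)
  also have "\<dots> = (\<integral>x. ?h x \<partial>lebesgue_on M)" using M_lebesgue by (subst integral_restrict_space) auto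
  also have "\<dots> \<le> (\<integral>x. \<delta>\<^sup>2 * (corner_wt x * ?h x) \<partial>lebesgue_on M)"
    using le by (intro integral_mono IM integrable_mult_right I) auto
  also have "\<dots> = \<delta>\<^sup>2 * Lpint \<nu> p f" using integrable_nu(2)[OF hm] by (simp add: Lpint_def)
  finally show "Lpint (lebesgue_on T) p f \<le> \<delta>\<^sup>2 * Lpint \<nu> p f" .
qed

lemma finite_measure_on_subset:
  assumes "T \<in> sets borel" "T \<subseteq> M"
  shows "finite_measure (lebesgue_on T)" "measure (lebesgue_on T) (space (lebesgue_on T)) = measure lborel T"
proof -
  have "emeasure lborel T < \<infinity>" by (rule emeasure_bounded_finite[OF bounded_subset[OF M_bounded assms(2)]])
  then show "finite_measure (lebesgue_on T)" using assms(1)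
    by (intro finite_measureI) (simp add: emeasure_restrict_space)
  show "measure (lebesgue_on T) (space (lebesgue_on T)) = measure lborel T"
    using assms(1) by (simp add: measure_restrict_space)
qed

lemma LpS_integrable_subset:
  fixes f :: "'n pt \<Rightarrow> 'b::euclidean_space"
  assumes f: "f \<in> LpS \<nu> p" and T: "T \<in> sets borel" "T \<subseteq> M"
  shows "integrable (lebesgue_on T) f"
    and "(\<integral>x. norm (f x) \<partial>lebesgue_on T) \<le> (measure lborel T powr (p - 1) * \<delta>\<^sup>2) powr (1 / p) * Lpn \<nu> p f"
proof -
  interpret T: finite_measure "lebesgue_on T" by (rule finite_measure_on_subset[OF T])
  note L = LpS_lebesgue_on_subset[OF f T]
  have N: "(\<lambda>x. norm (f x)) \<in> LpS (lebesgue_on T) p"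
    using L(1) by (auto simp: LpS_def intro: borel_measurable_norm)
  have one: "(\<lambda>x. 1::real) \<in> LpS (lebesgue_on T) p" by (simp add: LpS_def)
  have "integrable (lebesgue_on T) (\<lambda>x. norm (f x))"
    using Hoelder_dual(1)[OF p one N] by (simp add: dual_vec_def)
  then show "integrable (lebesgue_on T) f"
    using LpS_measurable[OF L(1)] integrable_norm_iff by blast
  have "\<bar>\<integral>x. norm (f x) \<partial>lebesgue_on T\<bar> powr p \<le> measure lborel T powr (p - 1) * Lpint (lebesgue_on T) p (\<lambda>x. norm (f x))"
    using finite_measure_mean_le[OF p _ N] T.finite_emeasure_space
    unfolding finite_measure_on_subset(2)[OF T] by (simp only: less_top infinity_ennreal_def not_False_eq_True)
  also have "Lpint (lebesgue_on T) p (\<lambda>x. norm (f x)) = Lpint (lebesgue_on T) p f" by (simp add: Lpint_def)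
  also have "measure lborel T powr (p - 1) * Lpint (lebesgue_on T) p f \<le> measure lborel T powr (p - 1) * (\<delta>\<^sup>2 * Lpint \<nu> p f)"
    by (intro mult_left_mono L) auto
  finally have "(\<bar>\<integral>x. norm (f x) \<partial>lebesgue_on T\<bar> powr p) powr (1/p) \<le> (measure lborel T powr (p - 1) * (\<delta>\<^sup>2 * Lpint \<nu> p f)) powr (1/p)"
    using p by (intro powr_mono2) auto
  moreover have "(\<bar>\<integral>x. norm (f x) \<partial>lebesgue_on T\<bar> powr p) powr (1/p) = (\<integral>x. norm (f x) \<partial>lebesgue_on T)"
    using p by (simp add: powr_powr)
  moreover have "(measure lborel T powr (p - 1) * (\<delta>\<^sup>2 * Lpint \<nu> p f)) powr (1/p) = (measure lborel T powr (p - 1) * \<delta>\<^sup>2) powr (1 / p) * Lpn \<nu> p f"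
    unfolding Lpn_def by (subst powr_mult[symmetric]) (auto simp: mult.assoc Lpint_nonneg)
  ultimately show "(\<integral>x. norm (f x) \<partial>lebesgue_on T) \<le> (measure lborel T powr (p - 1) * \<delta>\<^sup>2) powr (1 / p) * Lpn \<nu> p f" by simp
qed

text \<open>Bumps on \<open>d + 1\<close> disjoint boxes lined up in the \<open>x1\<close>
  direction: a vanishing combination would have every coefficient zero, as each box has positive
  measure.\<close>

lemma infinite_dim_M:
  "\<exists>\<psi> :: nat \<Rightarrow> 'n pt \<Rightarrow> real. (\<forall>i. \<psi> i \<in> test_functions M) \<and>
     (\<forall>c. (\<exists>i\<le>d. c i \<noteq> 0) \<longrightarrow> Lpn \<mu> p (\<lambda>x. \<Sum>i\<le>d. c i *\<^sub>R \<psi> i x) > 0)"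
proof -
  obtain x' where "x' \<in> X" using X(3) by blast
  then have "(\<delta>/2, \<delta>/2, x') \<in> M" using \<delta> by (simp add: M_mem)
  then obtain z r where z: "r > 0" "cball z r \<subseteq> M" using M_open open_contains_cball[of M] by blast
  \<comment> \<open>With spacing \<open>s = r / n1\<close>, the farthest centre is at distance
    \<open>d * s\<close> and each box lies within \<open>s * norm One\<close> of its centre, so all
    fit into the ball of radius \<open>r\<close>. Half-widths \<open>s / 3\<close> keep neighbours
    apart.\<close>
  define n1 where "n1 = norm (One :: 'n pt) + real d + 1"
  have n1: "n1 > 0" by (simp add: n1_def add_nonneg_pos)
  define s where "s = r / n1"
  have s: "s > 0" using z n1 by (simp add: s_def)
  define u :: "'n pt" where "u = (1, 0, 0)"
  define a where "a i = z + (real i * s) *\<^sub>R u - (s / 3) *\<^sub>R One" for i :: nat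
  define b where "b i = z + (real i * s) *\<^sub>R u + (s / 3) *\<^sub>R One" for i :: nat
  have uB: "u \<in> Basis" by (simp add: u_def Basis_prod_def zero_prod_def)
  then have nu: "norm u = 1" by simp
  have sub: "cbox (a i) (b i) \<subseteq> M" if "i \<le> d" for i
  proof
    fix y assume y: "y \<in> cbox (a i) (b i)"
    have "norm (y - (z + (real i * s) *\<^sub>R u)) \<le> norm ((s / 3) *\<^sub>R (One :: 'n pt))"
    proof (rule norm_le_componentwise)
      fix j :: "'n pt" assume j: "j \<in> Basis"
      then have "a i \<bullet> j \<le> y \<bullet> j" "y \<bullet> j \<le> b i \<bullet> j" using y by (auto simp: mem_box)
      then have "z \<bullet> j + real i * s * (u \<bullet> j) - s / 3 \<le> y \<bullet> j" "y \<bullet> j \<le> z \<bullet> j + real i * s * (u \<bullet> j) + s / 3"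
        using j by (simp_all add: a_def b_def inner_add_left inner_diff_left)
      then have "\<bar>y \<bullet> j - (z \<bullet> j + real i * s * (u \<bullet> j))\<bar> \<le> s / 3"
        by linarith
      then show "\<bar>(y - (z + (real i * s) *\<^sub>R u)) \<bullet> j\<bar> \<le> \<bar>((s / 3) *\<^sub>R One) \<bullet> j\<bar>"
        using j s by (simp add: inner_simps)
    qed
    also have "\<dots> \<le> s * norm (One :: 'n pt)" using s by simp
    finally have 1: "norm (y - (z + (real i * s) *\<^sub>R u)) \<le> s * norm (One :: 'n pt)" .
    have "norm (y - z) \<le> norm (y - (z + (real i * s) *\<^sub>R u)) + norm ((real i * s) *\<^sub>R u)"
      using norm_triangle_ineq[of "y - (z + (real i * s) *\<^sub>R u)" "(real i * s) *\<^sub>R u"] by simp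
    also have "\<dots> \<le> s * norm (One :: 'n pt) + real d * s" using 1 that s nu by (intro add_mono) auto
    also have "\<dots> \<le> s * n1" using s by (simp add: n1_def algebra_simps)
    also have "\<dots> = r" using n1 by (simp add: s_def)
    finally show "y \<in> M" using z by (auto simp: dist_norm norm_minus_commute)
  qed
  have ab: "box (a i) (b i) \<noteq> {}" for i
    using s by (auto simp: box_ne_empty a_def b_def inner_simps)
  have disj: "x \<notin> box (a j) (b j)" if "x \<in> box (a i) (b i)" "i \<noteq> j" for x i j
  proof
    assume "x \<in> box (a j) (b j)"
    then have "a j \<bullet> u < x \<bullet> u" "x \<bullet> u < b j \<bullet> u" "a i \<bullet> u < x \<bullet> u" "x \<bullet> u < b i \<bullet> u"
      using that uB by (auto simp: mem_box)
    then have "\<bar>real i * s - real j * s\<bar> < s"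
      using uB s by (simp add: a_def b_def inner_simps)
    then have "\<bar>real i - real j\<bar> * s < 1 * s" using s by (simp add: abs_mult flip: left_diff_distrib)
    then have "\<bar>real i - real j\<bar> < 1" using s mult_less_cancel_right_pos by blast
    then show False using that(2) by linarith
  qed
  \<comment> \<open>Indices beyond \<open>d\<close> only need some test function; the bump of the
    first box serves.\<close>
  define \<psi> where "\<psi> i = (if i \<le> d then box_bump (a i) (b i) 1 else box_bump (a 0) (b 0) 1)" for i
  have \<psi>t: "\<psi> i \<in> test_functions M" for i
    unfolding \<psi>_def using sub by (auto intro: box_bump_test)
  have "Lpn \<mu> p (\<lambda>x. \<Sum>i\<le>d. c i *\<^sub>R \<psi> i x) > 0" if c: "\<exists>i\<le>d. c i \<noteq> 0" for c :: "nat \<Rightarrow> real"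
  proof (rule ccontr)
    assume "\<not> ?thesis"
    then have 0: "Lpn \<mu> p (\<lambda>x. \<Sum>i\<le>d. c i *\<^sub>R \<psi> i x) = 0"
      using Lpn_nonneg[of \<mu> p "\<lambda>x. \<Sum>i\<le>d. c i *\<^sub>R \<psi> i x"] by linarith
    have L: "(\<lambda>x. \<Sum>i\<le>d. c i *\<^sub>R \<psi> i x) \<in> LpS \<mu> p"
      using Lpn_sum_le[OF p, of "{..d}" \<psi> \<mu> c] mu_from_nu(1)[OF test_LpS[OF \<psi>t]] by auto
    have ae: "AE x in lebesgue_on M. (\<Sum>i\<le>d. c i *\<^sub>R \<psi> i x) = 0"
      using Lpn_eq_0_iff[OF p L] 0 by (simp add: AE_mu)
    obtain i where i: "i \<le> d" "c i \<noteq> 0" using c by blast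
    have bM: "box (a i) (b i) \<subseteq> M" using sub[OF i(1)] box_subset_cbox by blast
    have nz: "(\<Sum>j\<le>d. c j *\<^sub>R \<psi> j x) \<noteq> 0" if x: "x \<in> box (a i) (b i)" for x
    proof -
      have "(\<Sum>j\<le>d. c j *\<^sub>R \<psi> j x) = (\<Sum>j\<le>d. if j = i then c i * \<psi> i x else 0)"
        using disj[OF x] by (intro sum.cong) (auto simp: \<psi>_def box_bump_outside)
      also have "\<dots> = c i * \<psi> i x" using i by simp
      finally show ?thesis using i box_bump_pos[OF x, of 1] by (simp add: \<psi>_def)
    qed
    have "AE x in lebesgue. x \<in> M \<longrightarrow> (\<Sum>i\<le>d. c i *\<^sub>R \<psi> i x) = 0"
      using ae M_lebesgue by (simp add: AE_restrict_space_iff)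
    then have "AE x in lebesgue. x \<notin> box (a i) (b i)"
      by eventually_elim (use nz bM in auto)
    then have "box (a i) (b i) \<in> null_sets lebesgue"
      by (subst AE_iff_null_sets) simp_all
    then show False
      using open_not_negligible[OF open_box ab[of i]] by (simp add: negligible_iff_null_sets)
  qed
  then show ?thesis using \<psi>t by blast
qed

text \<open>The degenerate components are multiplied by \<open>x1 > a / 2\<close> and by
  \<open>x1 * x2 > a^2 / 4\<close>; inverting these factors gives the summands \<open>2 / a\<close>
  and \<open>4 / a\<^sup>2\<close>.\<close>

lemma gradient_le_nabla:
  assumes a: "a > 0" and x: "a / 2 < fst x" "a / 2 < fst (snd x)"
  shows "norm g \<le> (2 / a + (4 / a\<^sup>2 + 1)) * norm (corner_scale x g)"
proof -
  let ?c = "corner_scale x g"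
  have 1: "\<bar>fst x * fst g\<bar> \<le> norm ?c"
    using norm_fst_le[of "fst x * fst g" "(fst x * fst (snd x) * fst (snd g), snd (snd g))"] by (simp add: corner_scale_simp)
  have s: "norm (fst x * fst (snd x) * fst (snd g), snd (snd g)) \<le> norm ?c"
    using norm_snd_le[of "(fst x * fst (snd x) * fst (snd g), snd (snd g))" "fst x * fst g"] by (simp add: corner_scale_simp)
  have 2: "\<bar>fst x * fst (snd x) * fst (snd g)\<bar> \<le> norm ?c"
    using norm_fst_le[of "fst x * fst (snd x) * fst (snd g)" "snd (snd g)"] s by simp
  have 3: "norm (snd (snd g)) \<le> norm ?c"
    using norm_snd_le[of "snd (snd g)" "fst x * fst (snd x) * fst (snd g)"] s by linarith
  have "(a / 2) * \<bar>fst g\<bar> \<le> fst x * \<bar>fst g\<bar>" using x by (intro mult_right_mono) auto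
  also have "\<dots> \<le> norm ?c" using 1 x a by (simp add: abs_mult)
  finally have 1: "\<bar>fst g\<bar> \<le> 2 / a * norm ?c" using a by (simp add: field_simps)
  have "(a / 2 * (a / 2)) * \<bar>fst (snd g)\<bar> \<le> (fst x * fst (snd x)) * \<bar>fst (snd g)\<bar>"
    using x a by (intro mult_right_mono mult_mono) auto
  also have "\<dots> \<le> norm ?c" using 2 x a by (simp add: abs_mult)
  finally have 2: "\<bar>fst (snd g)\<bar> \<le> 4 / a\<^sup>2 * norm ?c" using a by (simp add: field_simps power2_eq_square)
  have "norm g \<le> norm (fst g) + (norm (fst (snd g)) + norm (snd (snd g)))"
    using norm_Pair_le[of "fst g" "snd g"] norm_Pair_le[of "fst (snd g)" "snd (snd g)"] by simp
  also have "\<dots> \<le> 2 / a * norm ?c + (4 / a\<^sup>2 * norm ?c + 1 * norm ?c)"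
    using 1 2 3 by simp
  finally show ?thesis by (simp only: distrib_right)
qed

text \<open>\<open>B\<close> bounds the Lebesgue density of \<open>\<mu>\<close> away from the corner, \<open>G\<close> is the constant of the Poincare
  inequality on a cell of diameter \<open>h\<close>, and \<open>H\<close> compares gradients on the cells with \<open>\<nu>\<close>; near the corner
  \<open>\<mu>\<close> has density at most \<open>(a * \<delta>) powr p\<close> with respect to \<open>\<nu>\<close>.\<close>

lemma partition_estimate:
  fixes Q :: "nat \<Rightarrow> 'n pt set"
  assumes a: "a > 0" and h: "h > 0" "h \<le> a / 2"
    and Q: "\<And>i. i < d \<Longrightarrow> convex (Q i)" "\<And>i. i < d \<Longrightarrow> Q i \<in> sets borel" "\<And>i. i < d \<Longrightarrow> bounded (Q i)"
      "\<And>i. i < d \<Longrightarrow> Q i \<inter> {x \<in> M. a < fst x \<and> a < fst (snd x)} \<noteq> {}"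
      "\<And>i x y. i < d \<Longrightarrow> x \<in> Q i \<Longrightarrow> y \<in> Q i \<Longrightarrow> norm (x - y) \<le> h"
    and disj: "disjoint_family_on Q {..<d}"
    and cov: "{x \<in> M. a < fst x \<and> a < fst (snd x)} \<subseteq> (\<Union>i<d. Q i)"
    and \<phi>: "\<phi> \<in> test_functions M"
    and B: "B = (\<delta>\<^sup>2) powr p / a\<^sup>2" and G: "G = 2 powr p * 2 ^ DIM('n pt) * h powr p"
    and H: "H = (2 / a + (4 / a\<^sup>2 + 1)) powr p * \<delta>\<^sup>2"
    and c: "\<And>i. c i = measure lborel (Q i) * (2 powr p * measure lborel (Q i) powr (- p))"
  shows "Lpint \<mu> p \<phi> \<le> (a * \<delta>) powr p * Lpint \<nu> p \<phi> + B * G * H * Lpint \<nu> p (nabla_M_classical \<phi>)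
     + (\<Sum>i<d. B * c i * \<bar>\<integral>x. \<phi> x \<partial>lebesgue_on (Q i)\<bar> powr p)"
proof -
  have C1: "Ck (Suc 0) \<phi>" by (rule test_functionsD(1)[OF \<phi>])
  have phim[measurable]: "\<phi> \<in> borel_measurable borel" by (rule borel_measurable_continuous_onI[OF test_functionsD(4)[OF \<phi>]])
  have nabm[measurable]: "nabla_M_classical \<phi> \<in> borel_measurable borel" by (rule borel_measurable_continuous_onI[OF continuous_nabla[OF \<phi>]])
  have gradm[measurable]: "classical_gradient \<phi> \<in> borel_measurable borel" by (rule gradient_measurable[OF p C1])
  have Qm[measurable]: "Q i \<in> sets borel" if "i \<in> {..<d}" for i using Q(2) that by simp
  have nn: "B \<ge> 0" "G \<ge> 0" "H \<ge> 0" "c i \<ge> 0" for i using a by (simp_all add: B G H c)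
  obtain L where L: "\<And>x. \<bar>\<phi> x\<bar> \<le> L"
  proof -
    have "bounded (\<phi> ` closure {x. \<phi> x \<noteq> 0})"
      using test_functionsD(2)[OF \<phi>] continuous_on_subset[OF test_functionsD(4)[OF \<phi>]]
      by (intro compact_imp_bounded compact_continuous_image) auto
    then obtain L where L: "\<And>x. x \<in> closure {x. \<phi> x \<noteq> 0} \<Longrightarrow> \<bar>\<phi> x\<bar> \<le> L" by (auto simp: bounded_iff)
    have "\<bar>\<phi> x\<bar> \<le> max L 0" for x
      using L[of x] closure_subset[of "{x. \<phi> x \<noteq> 0}"] by (cases "\<phi> x = 0") (auto simp: max_def)
    then show thesis by (rule that)
  qed
  \<comment> \<open>Each cell contains a point with \<open>x1\<close> and \<open>x2\<close> above
    \<open>a\<close> and has diameter at most \<open>a / 2\<close>, so it keeps away from the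
    corner, even where it sticks out of the domain.\<close>
  have cell: "a / 2 < fst x \<and> a / 2 < fst (snd x)" if i: "i < d" and x: "x \<in> Q i" for i x
  proof -
    obtain y where y: "y \<in> Q i" "a < fst y" "a < fst (snd y)" using Q(4)[OF i] by auto
    have n: "norm (x - y) \<le> a / 2" using Q(5)[OF i x y(1)] h by simp
    have le: "\<bar>fst z\<bar> \<le> norm z" "\<bar>fst (snd z)\<bar> \<le> norm z" for z :: "'n pt"
      using norm_fst_le[of "fst z" "snd z"] norm_snd_le[of "snd z" "fst z"] norm_fst_le[of "fst (snd z)" "snd (snd z)"]
      by simp_all
    show ?thesis using y le[of "x - y"] n by (auto simp: abs_le_iff)
  qed
  let ?D = "nabla_M_classical \<phi>" and ?g = "classical_gradient \<phi>"
  let ?u = "\<lambda>x. ennreal (\<bar>\<phi> x\<bar> powr p)"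
  have 1: "ennreal (Lpint \<mu> p \<phi>) \<le> ennreal ((a * \<delta>) powr p * Lpint \<nu> p \<phi>) + ennreal B * (\<Sum>i<d. \<integral>\<^sup>+x. indicator (Q i) x * ?u x \<partial>lborel)"
  proof -
    \<comment> \<open>Away from the corner the density of \<open>\<mu>\<close> is at most
      \<open>B\<close>; otherwise one of \<open>x1\<close>, \<open>x2\<close> is at most
      \<open>a\<close> and the other below \<open>\<delta>\<close>, so the factor
      \<open>(x1 x2)^p\<close> is at most \<open>(a * \<delta>) powr p\<close>.\<close>
    have pw: "(fst x * fst (snd x)) powr p * (corner_wt x * \<bar>\<phi> x\<bar> powr p) \<le> (a * \<delta>) powr p * (corner_wt x * \<bar>\<phi> x\<bar> powr p) + B * (\<Sum>i<d. indicator (Q i) x * \<bar>\<phi> x\<bar> powr p)"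
      if x: "x \<in> M" for x
    proof (cases "a < fst x \<and> a < fst (snd x)")
      case True
      then obtain i where i: "i < d" "x \<in> Q i" using cov x by blast
      have le: "fst x * fst (snd x) \<le> \<delta>\<^sup>2" using x by (auto simp: M_mem power2_eq_square intro!: mult_mono)
      have ge: "a\<^sup>2 \<le> fst x * fst (snd x)" using True a by (auto simp: power2_eq_square intro!: mult_mono)
      have "(fst x * fst (snd x)) powr p * corner_wt x \<le> (\<delta>\<^sup>2) powr p * (1 / a\<^sup>2)"
        unfolding corner_wt_def using le ge a p x by (intro mult_mono powr_mono2 divide_left_mono) (auto simp: M_mem)
      then have "(fst x * fst (snd x)) powr p * corner_wt x * \<bar>\<phi> x\<bar> powr p \<le> B * \<bar>\<phi> x\<bar> powr p"
        unfolding B by (intro mult_right_mono) auto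
      also have "\<dots> \<le> B * (\<Sum>i<d. indicator (Q i) x * \<bar>\<phi> x\<bar> powr p)"
      proof (rule mult_left_mono[OF _ nn(1)])
        have "indicator (Q i) x * \<bar>\<phi> x\<bar> powr p \<le> (\<Sum>i<d. indicator (Q i) x * \<bar>\<phi> x\<bar> powr p)"
          using i by (intro member_le_sum) auto
        then show "\<bar>\<phi> x\<bar> powr p \<le> (\<Sum>i<d. indicator (Q i) x * \<bar>\<phi> x\<bar> powr p)" using i by simp
      qed
      moreover have "0 \<le> (a * \<delta>) powr p * (corner_wt x * \<bar>\<phi> x\<bar> powr p)"
        using wt_pos[OF x] by simp
      ultimately show ?thesis by (simp add: mult.assoc)
    next
      case False
      have "fst x * fst (snd x) \<le> a * \<delta>"
      proof (cases "fst x \<le> a")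
        case True
        then show ?thesis using x a by (intro mult_mono) (auto simp: M_mem)
      next
        case False
        then have "fst x * fst (snd x) \<le> \<delta> * a" using x a \<open>\<not> (a < fst x \<and> a < fst (snd x))\<close> by (intro mult_mono) (auto simp: M_mem)
        then show ?thesis by (simp add: mult.commute)
      qed
      then have "(fst x * fst (snd x)) powr p * (corner_wt x * \<bar>\<phi> x\<bar> powr p) \<le> (a * \<delta>) powr p * (corner_wt x * \<bar>\<phi> x\<bar> powr p)"
        using x p wt_pos[OF x] by (intro mult_right_mono powr_mono2) (auto simp: M_mem)
      moreover have "0 \<le> B * (\<Sum>i<d. indicator (Q i) x * \<bar>\<phi> x\<bar> powr p)"
        by (intro mult_nonneg_nonneg nn sum_nonneg) auto
      ultimately show ?thesis by linarith
    qed
    have pm: "(\<lambda>x. \<bar>\<phi> x\<bar> powr p) \<in> borel_measurable borel" by measurable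
    have scm[measurable]: "(\<lambda>x::'n pt. (fst x * fst (snd x)) powr p) \<in> borel_measurable borel"
      by (intro powr_real_measurable borel_measurable_times borel_measurable_const pt_coord_measurable)
    have "ennreal (Lpint \<mu> p \<phi>) = (\<integral>\<^sup>+x. ?u x \<partial>\<mu>)" using ennreal_Lpint[OF mu_from_nu(1)[OF test_LpS[OF \<phi>]]] by simp
    also have "\<dots> = (\<integral>\<^sup>+x. ennreal ((fst x * fst (snd x)) powr p) * ?u x \<partial>\<nu>)"
      unfolding muM_def by (rule nn_integral_density) (simp_all add: measurable_nu lebesgue_on_borelI)
    also have "\<dots> = (\<integral>\<^sup>+x. indicator M x * (ennreal (corner_wt x) * (ennreal ((fst x * fst (snd x)) powr p) * ?u x)) \<partial>lborel)"
      by (rule nn_integral_nu) measurable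
    also have "\<dots> \<le> (\<integral>\<^sup>+x. ennreal ((a * \<delta>) powr p) * (indicator M x * (ennreal (corner_wt x) * ?u x)) + ennreal B * (\<Sum>i<d. indicator (Q i) x * ?u x) \<partial>lborel)"
    proof (rule nn_integral_mono)
      fix x
      show "indicator M x * (ennreal (corner_wt x) * (ennreal ((fst x * fst (snd x)) powr p) * ?u x)) \<le>
        ennreal ((a * \<delta>) powr p) * (indicator M x * (ennreal (corner_wt x) * ?u x)) + ennreal B * (\<Sum>i<d. indicator (Q i) x * ?u x)"
      proof (cases "x \<in> M")
        case True
        have w: "0 \<le> corner_wt x" using wt_pos[OF True] by simp
        have ie: "indicator (Q i) x * ?u x = ennreal (indicator (Q i) x * \<bar>\<phi> x\<bar> powr p)" for i
          by (simp add: indicator_def)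
        have "indicator M x * (ennreal (corner_wt x) * (ennreal ((fst x * fst (snd x)) powr p) * ?u x)) = ennreal ((fst x * fst (snd x)) powr p * (corner_wt x * \<bar>\<phi> x\<bar> powr p))"
          using True w by (simp add: ennreal_mult'' mult.left_commute)
        also have "\<dots> \<le> ennreal ((a * \<delta>) powr p * (corner_wt x * \<bar>\<phi> x\<bar> powr p) + B * (\<Sum>i<d. indicator (Q i) x * \<bar>\<phi> x\<bar> powr p))"
          by (rule ennreal_leI[OF pw[OF True]])
        also have "\<dots> = ennreal ((a * \<delta>) powr p * (corner_wt x * \<bar>\<phi> x\<bar> powr p)) + ennreal (B * (\<Sum>i<d. indicator (Q i) x * \<bar>\<phi> x\<bar> powr p))"
          using w by (intro ennreal_plus mult_nonneg_nonneg nn sum_nonneg) auto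
        also have "ennreal ((a * \<delta>) powr p * (corner_wt x * \<bar>\<phi> x\<bar> powr p)) = ennreal ((a * \<delta>) powr p) * (indicator M x * (ennreal (corner_wt x) * ?u x))"
          using True w by (simp add: ennreal_mult'')
        also have "ennreal (B * (\<Sum>i<d. indicator (Q i) x * \<bar>\<phi> x\<bar> powr p)) = ennreal B * (\<Sum>i<d. indicator (Q i) x * ?u x)"
          unfolding ie by (subst ennreal_mult) (auto simp: sum_ennreal intro!: nn sum_nonneg)
        finally show ?thesis .
      qed simp
    qed
    also have "\<dots> = ennreal ((a * \<delta>) powr p) * (\<integral>\<^sup>+x. indicator M x * (ennreal (corner_wt x) * ?u x) \<partial>lborel) + ennreal B * (\<Sum>i<d. \<integral>\<^sup>+x. indicator (Q i) x * ?u x \<partial>lborel)"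
      by (subst nn_integral_add, measurable, subst nn_integral_cmult, measurable, subst nn_integral_cmult, measurable, subst nn_integral_sum, measurable)
    also have "(\<integral>\<^sup>+x. indicator M x * (ennreal (corner_wt x) * ?u x) \<partial>lborel) = (\<integral>\<^sup>+x. ?u x \<partial>\<nu>)"
      by (rule nn_integral_nu[symmetric]) measurable
    also have "\<dots> = ennreal (Lpint \<nu> p \<phi>)" using ennreal_Lpint[OF test_LpS[OF \<phi>]] by simp
    also have "ennreal ((a * \<delta>) powr p) * ennreal (Lpint \<nu> p \<phi>) = ennreal ((a * \<delta>) powr p * Lpint \<nu> p \<phi>)"
      by (simp add: ennreal_mult Lpint_nonneg)
    finally show ?thesis .
  qed
  have "(\<Sum>i<d. \<integral>\<^sup>+x. indicator (Q i) x * ?u x \<partial>lborel) \<le>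
      (\<Sum>i<d. ennreal G * (\<integral>\<^sup>+x. indicator (Q i) x * ennreal (norm (?g x) powr p) \<partial>lborel) + ennreal (c i * \<bar>\<integral>x. \<phi> x \<partial>lebesgue_on (Q i)\<bar> powr p))"
  proof (rule sum_mono)
    fix i assume "i \<in> {..<d}"
    then have i: "i < d" by simp
    have G': "ennreal (2 powr p) * 2 ^ DIM('n pt) * ennreal (h powr p) = ennreal G"
      unfolding G by (simp add: ennreal_mult flip: ennreal_power)
    show "(\<integral>\<^sup>+x. indicator (Q i) x * ?u x \<partial>lborel) \<le>
      ennreal G * (\<integral>\<^sup>+x. indicator (Q i) x * ennreal (norm (?g x) powr p) \<partial>lborel) + ennreal (c i * \<bar>\<integral>x. \<phi> x \<partial>lebesgue_on (Q i)\<bar> powr p)"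
      using convex_Poincare[OF p C1 Q(1)[OF i] Q(2)[OF i] Q(3)[OF i] Q(5)[OF i] L] unfolding G' c .
  qed
  also have "\<dots> = ennreal G * (\<integral>\<^sup>+x. (\<Sum>i<d. indicator (Q i) x * ennreal (norm (?g x) powr p)) \<partial>lborel) + ennreal (\<Sum>i<d. c i * \<bar>\<integral>x. \<phi> x \<partial>lebesgue_on (Q i)\<bar> powr p)"
    by (subst nn_integral_sum, measurable) (simp add: sum.distrib sum_distrib_left sum_ennreal nn)
  also have "\<dots> \<le> ennreal G * (ennreal H * ennreal (Lpint \<nu> p ?D)) + ennreal (\<Sum>i<d. c i * \<bar>\<integral>x. \<phi> x \<partial>lebesgue_on (Q i)\<bar> powr p)"
  proof (intro add_right_mono mult_left_mono)
    have "(\<integral>\<^sup>+x. (\<Sum>i<d. indicator (Q i) x * ennreal (norm (?g x) powr p)) \<partial>lborel) \<le> (\<integral>\<^sup>+x. ennreal H * (indicator M x * (ennreal (corner_wt x) * ennreal (norm (?D x) powr p))) \<partial>lborel)"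
    proof (rule nn_integral_mono)
      fix x
      let ?r = "ennreal H * (indicator M x * (ennreal (corner_wt x) * ennreal (norm (?D x) powr p)))"
      have eq: "(\<Sum>i<d. indicator (Q i) x * ennreal (norm (?g x) powr p)) = indicator (\<Union>i<d. Q i) x * ennreal (norm (?g x) powr p)"
        by (subst indicator_UN_disjoint[OF finite_lessThan disj]) (rule sum_distrib_right[symmetric])
      show "(\<Sum>i<d. indicator (Q i) x * ennreal (norm (?g x) powr p)) \<le> ?r"
      proof (cases "x \<in> (\<Union>i<d. Q i) \<and> x \<in> M")
        case True
        then obtain i where i: "i < d" "x \<in> Q i" by blast
        have x: "x \<in> M" using True by simp
        have "norm (?g x) \<le> (2 / a + (4 / a\<^sup>2 + 1)) * norm (?D x)"
          unfolding nabla_M_classical_def using gradient_le_nabla[OF a] cell[OF i] by blast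
        then have "norm (?g x) powr p \<le> ((2 / a + (4 / a\<^sup>2 + 1)) * norm (?D x)) powr p"
          using p by (intro powr_mono2) auto
        also have "\<dots> = (2 / a + (4 / a\<^sup>2 + 1)) powr p * 1 * norm (?D x) powr p"
          using a by (subst powr_mult) auto
        also have "\<dots> \<le> (2 / a + (4 / a\<^sup>2 + 1)) powr p * (\<delta>\<^sup>2 * corner_wt x) * norm (?D x) powr p"
          using wt_lower[OF x] by (intro mult_right_mono mult_left_mono) auto
        finally have "norm (?g x) powr p \<le> H * (corner_wt x * norm (?D x) powr p)" by (simp add: H mult.assoc)
        then have "ennreal (norm (?g x) powr p) \<le> ennreal (H * (corner_wt x * norm (?D x) powr p))" by (rule ennreal_leI)
        also have "\<dots> = ?r" using x wt_pos[OF x] nn by (simp add: ennreal_mult)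
        finally show ?thesis using True unfolding eq by simp
      next
        case False
        \<comment> \<open>The part of a cell outside the domain contributes nothing, since the
          gradient vanishes off the support of \<open>\<phi>\<close>.\<close>
        have "x \<in> M" if "x \<in> closure {x. \<phi> x \<noteq> 0}" using that test_functionsD(3)[OF \<phi>] by blast
        then have "?g x = 0" if "x \<notin> M" using that gradient_outside by blast
        then show ?thesis using False unfolding eq by (cases "x \<in> M") auto
      qed
    qed
    also have "\<dots> = ennreal H * (\<integral>\<^sup>+x. indicator M x * (ennreal (corner_wt x) * ennreal (norm (?D x) powr p)) \<partial>lborel)"
      by (rule nn_integral_cmult) measurable
    also have "(\<integral>\<^sup>+x. indicator M x * (ennreal (corner_wt x) * ennreal (norm (?D x) powr p)) \<partial>lborel) = (\<integral>\<^sup>+x. ennreal (norm (?D x) powr p) \<partial>\<nu>)"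
      by (rule nn_integral_nu[symmetric]) measurable
    also have "\<dots> = ennreal (Lpint \<nu> p ?D)" by (rule ennreal_Lpint[OF nabla_LpS[OF \<phi>], symmetric])
    finally show "(\<integral>\<^sup>+x. (\<Sum>i<d. indicator (Q i) x * ennreal (norm (?g x) powr p)) \<partial>lborel) \<le> ennreal H * ennreal (Lpint \<nu> p ?D)" .
  qed simp
  also have "\<dots> = ennreal (G * (H * Lpint \<nu> p ?D) + (\<Sum>i<d. c i * \<bar>\<integral>x. \<phi> x \<partial>lebesgue_on (Q i)\<bar> powr p))"
    using nn Lpint_nonneg[of \<nu> p ?D] by (subst ennreal_plus) (auto simp: ennreal_mult intro!: sum_nonneg)
  finally have 2: "(\<Sum>i<d. \<integral>\<^sup>+x. indicator (Q i) x * ?u x \<partial>lborel) \<le> \<dots>" .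
  have "ennreal (Lpint \<mu> p \<phi>) \<le> ennreal ((a * \<delta>) powr p * Lpint \<nu> p \<phi>) + ennreal B * ennreal (G * (H * Lpint \<nu> p ?D) + (\<Sum>i<d. c i * \<bar>\<integral>x. \<phi> x \<partial>lebesgue_on (Q i)\<bar> powr p))"
    by (rule order_trans[OF 1 add_left_mono[OF mult_left_mono[OF 2]]]) simp
  also have "\<dots> = ennreal ((a * \<delta>) powr p * Lpint \<nu> p \<phi> + B * (G * (H * Lpint \<nu> p ?D) + (\<Sum>i<d. c i * \<bar>\<integral>x. \<phi> x \<partial>lebesgue_on (Q i)\<bar> powr p)))"
  proof -
    have s: "0 \<le> G * (H * Lpint \<nu> p ?D) + (\<Sum>i<d. c i * \<bar>\<integral>x. \<phi> x \<partial>lebesgue_on (Q i)\<bar> powr p)"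
      using nn Lpint_nonneg[of \<nu> p ?D] by (intro add_nonneg_nonneg mult_nonneg_nonneg sum_nonneg) auto
    then show ?thesis using nn(1) Lpint_nonneg[of \<nu> p \<phi>] by (simp add: ennreal_mult ennreal_plus)
  qed
  finally have "Lpint \<mu> p \<phi> \<le> (a * \<delta>) powr p * Lpint \<nu> p \<phi> + B * (G * (H * Lpint \<nu> p ?D) + (\<Sum>i<d. c i * \<bar>\<integral>x. \<phi> x \<partial>lebesgue_on (Q i)\<bar> powr p))"
    by (subst (asm) ennreal_le_iff) (auto intro!: add_nonneg_nonneg mult_nonneg_nonneg sum_nonneg nn simp: Lpint_nonneg)
  then show ?thesis by (simp add: distrib_left sum_distrib_left mult.assoc)
qed

text \<open>In the partition estimate the corner term is made small by \<open>a\<close>, then the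
  oscillation term by the cell size \<open>h\<close>; what remains are finitely many cell integrals,
  the functionals.\<close>

lemma finite_rank_M:
  assumes e: "e > 0"
  shows "\<exists>(d::nat) K (l :: nat \<Rightarrow> ('n pt \<Rightarrow> real) \<Rightarrow> real). K \<ge> 0 \<and>
        (\<forall>i f g a b. f \<in> LpS \<nu> p \<longrightarrow> g \<in> LpS \<nu> p \<longrightarrow> l i (\<lambda>x. a * f x + b * g x) = a * l i f + b * l i g) \<and>
        (\<forall>i f. f \<in> LpS \<nu> p \<longrightarrow> \<bar>l i f\<bar> \<le> K * Lpn \<nu> p f) \<and>
        (\<forall>\<phi>\<in>test_functions M. Lpn \<mu> p \<phi> \<le> e * Lpn \<nu> p (nabla_M_classical \<phi>) + K * (\<Sum>i<d. \<bar>l i \<phi>\<bar>))"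
proof -
  \<comment> \<open>Makes \<open>a * \<delta>\<close> times the Poincare constant
    \<open>2 * radius\<close> equal to \<open>e / 2\<close>.\<close>
  define a where "a = e / (4 * radius * \<delta>)"
  have a: "a > 0" using e \<delta> radius(1) by (simp add: a_def)
  define S where "S = {x \<in> M. a < fst x \<and> a < fst (snd x)}"
  define B where "B = (\<delta>\<^sup>2) powr p / a\<^sup>2"
  define H where "H = (2 / a + (4 / a\<^sup>2 + 1)) powr p * \<delta>\<^sup>2"
  define Z where "Z = B * (2 powr p * 2 ^ DIM('n pt)) * H"
  have B: "B > 0" using a \<delta> by (simp add: B_def)
  have "2 / a + (4 / a\<^sup>2 + 1) > 0" using a by (simp add: add_pos_pos)
  then have H: "H > 0" using \<delta> by (simp add: H_def)
  have Z: "Z > 0" using B H by (simp add: Z_def)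
  \<comment> \<open>\<open>Z\<close> collects everything in \<open>B * G * H\<close> except
    \<open>h powr p\<close>, and depends on \<open>a\<close> only; this choice brings the product
    below \<open>(e / 2) powr p\<close>.\<close>
  define h where "h = min (a / 2) ((e / 2) / Z powr (1 / p))"
  have h: "h > 0" "h \<le> a / 2" using a e Z by (auto simp: h_def)
  define G where "G = 2 powr p * 2 ^ DIM('n pt) * h powr p"
  have "h powr p \<le> ((e / 2) / Z powr (1 / p)) powr p"
    using h p by (intro powr_mono2) (auto simp: h_def)
  also have "\<dots> = (e / 2) powr p / Z" using p e Z by (simp add: powr_divide powr_mult powr_powr)
  finally have "Z * h powr p \<le> (e / 2) powr p" using Z by (simp add: field_simps)
  then have BGH: "B * G * H \<le> (e / 2) powr p" by (simp add: Z_def G_def mult.assoc mult.left_commute mult.commute)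
  have Sb: "bounded S" by (rule bounded_subset[OF M_bounded]) (auto simp: S_def)
  from bounded_grid_partition[OF Sb h(1)] obtain d :: nat and Q where
    Q: "\<And>i. i < d \<Longrightarrow> convex (Q i)" "\<And>i. i < d \<Longrightarrow> Q i \<in> sets borel" "\<And>i. i < d \<Longrightarrow> bounded (Q i)"
      "\<And>i. i < d \<Longrightarrow> Q i \<inter> S \<noteq> {}"
      "\<And>i x y. i < d \<Longrightarrow> x \<in> Q i \<Longrightarrow> y \<in> Q i \<Longrightarrow> norm (x - y) \<le> h"
    and disj: "disjoint_family_on Q {..<d}" and cov: "S \<subseteq> (\<Union>i<d. Q i)"
    by (elim exE conjE) blast
  define c where "c i = measure lborel (Q i) * (2 powr p * measure lborel (Q i) powr (- p))" for i
  have c: "c i \<ge> 0" for i by (simp add: c_def)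
  \<comment> \<open>Cells may leave the domain, but the functionals must be bounded on all of
    \<open>L^p(\<nu>)\<close>, hence the intersection. For test functions the integral is the
    same.\<close>
  define l where "l i f = (if i < d then \<integral>x. f x \<partial>lebesgue_on (Q i \<inter> M) else 0)" for i and f :: "'n pt \<Rightarrow> real"
  define b where "b i = (B * c i) powr (1 / p)" for i
  define k where "k i = (measure lborel (Q i \<inter> M) powr (p - 1) * \<delta>\<^sup>2) powr (1 / p)" for i
  define K where "K = (\<Sum>i<d. b i) + (\<Sum>i<d. k i)"
  have bk: "b i \<ge> 0" "k i \<ge> 0" for i by (simp_all add: b_def k_def)
  have K: "K \<ge> 0" unfolding K_def by (intro add_nonneg_nonneg sum_nonneg bk)
  have bK: "b i \<le> K" "k i \<le> K" if "i < d" for i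
    using that member_le_sum[of i "{..<d}" b] member_le_sum[of i "{..<d}" k] bk sum_nonneg[of "{..<d}" b] sum_nonneg[of "{..<d}" k]
    by (auto simp: K_def)
  have QM: "Q i \<inter> M \<in> sets borel" "Q i \<inter> M \<subseteq> M" if "i < d" for i using Q(2)[OF that] by auto
  have lin: "l i (\<lambda>x. s * f x + t * g x) = s * l i f + t * l i g" if "f \<in> LpS \<nu> p" "g \<in> LpS \<nu> p" for i f g s t
    using LpS_integrable_subset(1)[OF that(1) QM] LpS_integrable_subset(1)[OF that(2) QM] by (auto simp: l_def)
  have bdd: "\<bar>l i f\<bar> \<le> K * Lpn \<nu> p f" if f: "f \<in> LpS \<nu> p" for i f
  proof (cases "i < d")
    case True
    have "\<bar>l i f\<bar> \<le> (\<integral>x. norm (f x) \<partial>lebesgue_on (Q i \<inter> M))" using True integral_norm_bound[of "lebesgue_on (Q i \<inter> M)" f] by (simp add: l_def)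
    also have "\<dots> \<le> k i * Lpn \<nu> p f" unfolding k_def by (rule LpS_integrable_subset(2)[OF f QM[OF True]])
    also have "\<dots> \<le> K * Lpn \<nu> p f" using bK[OF True] by (intro mult_right_mono) auto
    finally show ?thesis .
  next
    case False
    then show ?thesis using K by (simp add: l_def)
  qed
  have main: "Lpn \<mu> p \<phi> \<le> e * Lpn \<nu> p (nabla_M_classical \<phi>) + K * (\<Sum>i<d. \<bar>l i \<phi>\<bar>)" if \<phi>: "\<phi> \<in> test_functions M" for \<phi>
  proof -
    define n where "n = Lpn \<nu> p (nabla_M_classical \<phi>)"
    have n: "n \<ge> 0" by (simp add: n_def)
    have z: "\<phi> x = 0" if "x \<notin> M" for x
    proof -
      have "x \<notin> closure {x. \<phi> x \<noteq> 0}" using test_functionsD(3)[OF \<phi>] that by blast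
      then show ?thesis by (rule test_functionsD(7)[OF \<phi>])
    qed
    have l: "(\<integral>x. \<phi> x \<partial>lebesgue_on (Q i)) = l i \<phi>" if "i < d" for i
    proof -
      have "(\<integral>x. \<phi> x \<partial>lebesgue_on (Q i)) = (\<integral>x. indicator (Q i) x *\<^sub>R \<phi> x \<partial>lebesgue)"
        using Q(2)[OF that] by (subst integral_restrict_space) auto
      also have "\<dots> = (\<integral>x. indicator (Q i \<inter> M) x *\<^sub>R \<phi> x \<partial>lebesgue)"
      proof (rule Bochner_Integration.integral_cong[OF refl])
        show "indicator (Q i) x *\<^sub>R \<phi> x = indicator (Q i \<inter> M) x *\<^sub>R \<phi> x" for x
          using z[of x] by (auto simp: indicator_def)
      qed
      also have "\<dots> = l i \<phi>" unfolding l_def using that QM(1)[OF that] by (subst integral_restrict_space) auto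
      finally show ?thesis .
    qed
    have "Lpint \<mu> p \<phi> \<le> (a * \<delta>) powr p * Lpint \<nu> p \<phi> + B * G * H * Lpint \<nu> p (nabla_M_classical \<phi>)
     + (\<Sum>i<d. B * c i * \<bar>\<integral>x. \<phi> x \<partial>lebesgue_on (Q i)\<bar> powr p)"
      by (rule partition_estimate[OF a h Q(1-3) Q(4)[unfolded S_def] Q(5) disj cov[unfolded S_def] \<phi> B_def G_def H_def c_def])
    moreover have "(\<Sum>i<d. B * c i * \<bar>\<integral>x. \<phi> x \<partial>lebesgue_on (Q i)\<bar> powr p) = (\<Sum>i<d. (b i * \<bar>l i \<phi>\<bar>) powr p)"
      using p B c by (intro sum.cong) (auto simp: l b_def powr_mult powr_powr)
    moreover have "(a * \<delta>) powr p * Lpint \<nu> p \<phi> \<le> (e / 2 * n) powr p"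
    proof -
      have "(a * \<delta>) powr p * Lpint \<nu> p \<phi> = (a * \<delta> * Lpn \<nu> p \<phi>) powr p"
        using a \<delta> by (simp add: powr_mult Lpn_powr[OF p])
      also have "\<dots> \<le> (a * \<delta> * (2 * radius * n)) powr p"
        using a \<delta> p Poincare_M[OF \<phi>] by (intro powr_mono2 mult_left_mono) (auto simp: n_def)
      also have "a * \<delta> * (2 * radius * n) = e / 2 * n" using \<delta> radius(1) by (simp add: a_def)
      finally show ?thesis .
    qed
    moreover have "B * G * H * Lpint \<nu> p (nabla_M_classical \<phi>) \<le> (e / 2 * n) powr p"
    proof -
      have "B * G * H * Lpint \<nu> p (nabla_M_classical \<phi>) \<le> (e / 2) powr p * Lpint \<nu> p (nabla_M_classical \<phi>)"
        by (rule mult_right_mono[OF BGH Lpint_nonneg])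
      also have "\<dots> = (e / 2 * n) powr p" unfolding n_def using e by (subst powr_mult) (auto simp: Lpn_powr[OF p])
      finally show ?thesis .
    qed
    \<comment> \<open>Superadditivity of the \<open>p\<close>-th power collects all terms under a
      single power, so that the \<open>p\<close>-th root can be taken.\<close>
    moreover have "(\<Sum>i<d. (b i * \<bar>l i \<phi>\<bar>) powr p) \<le> (\<Sum>i<d. b i * \<bar>l i \<phi>\<bar>) powr p"
      using p bk by (intro powr_sum_superadditive) auto
    ultimately have "Lpint \<mu> p \<phi> \<le> (e / 2 * n) powr p + (e / 2 * n) powr p + (\<Sum>i<d. b i * \<bar>l i \<phi>\<bar>) powr p"
      by linarith
    also have "\<dots> \<le> (e / 2 * n + e / 2 * n) powr p + (\<Sum>i<d. b i * \<bar>l i \<phi>\<bar>) powr p"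
      using p e n by (intro add_right_mono powr_superadditive) auto
    also have "\<dots> \<le> (e / 2 * n + e / 2 * n + (\<Sum>i<d. b i * \<bar>l i \<phi>\<bar>)) powr p"
      using p e n bk by (intro powr_superadditive sum_nonneg) auto
    finally have "Lpint \<mu> p \<phi> \<le> (e / 2 * n + e / 2 * n + (\<Sum>i<d. b i * \<bar>l i \<phi>\<bar>)) powr p" .
    then have "Lpn \<mu> p \<phi> \<le> e / 2 * n + e / 2 * n + (\<Sum>i<d. b i * \<bar>l i \<phi>\<bar>)"
      using e n bk by (subst (asm) Lpint_le_iff[OF p]) (auto intro!: add_nonneg_nonneg sum_nonneg)
    moreover have "(\<Sum>i<d. b i * \<bar>l i \<phi>\<bar>) \<le> (\<Sum>i<d. K * \<bar>l i \<phi>\<bar>)"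
      using bK by (intro sum_mono mult_right_mono) auto
    ultimately show ?thesis by (simp add: n_def sum_distrib_left)
  qed
  show ?thesis by (rule exI[of _ d], rule exI[of _ K], rule exI[of _ l]) (use K lin bdd main in blast)
qed

lemma lp_variational_M: "lp_variational p \<nu> \<mu> (test_functions M) nabla_M_classical (2 * radius) (\<delta>\<^sup>2)"
proof
  show "2 < p" by (rule p)
  show "(\<lambda>x. a * \<phi> x + b * \<psi> x) \<in> test_functions M" if "\<phi> \<in> test_functions M" "\<psi> \<in> test_functions M" for \<phi> \<psi> a b
    by (rule test_functions_lincomb[OF that])
  show "nabla_M_classical (\<lambda>x. a * \<phi> x + b * \<psi> x) x = a *\<^sub>R nabla_M_classical \<phi> x + b *\<^sub>R nabla_M_classical \<psi> x"
    if "\<phi> \<in> test_functions M" "\<psi> \<in> test_functions M" for \<phi> \<psi> a b x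
    by (rule nabla_lincomb[OF that])
  show "2 * radius > 0" "\<delta>\<^sup>2 > 0" using radius(1) \<delta> by auto
qed (rule test_LpS nabla_LpS Poincare_M mu_from_nu finite_rank_M infinite_dim_M; assumption)+

section \<open>From energy pairs to weak gradients\<close>

interpretation lp: lp_variational p \<nu> \<mu> "test_functions M" nabla_M_classical "2 * radius" "\<delta>\<^sup>2"
  by (rule lp_variational_M)

text \<open>Inverse of \<open>corner_scale x\<close> on the domain: it turns a limit of corner
  gradients into an ordinary gradient.\<close>

definition corner_unscale :: "'n pt \<Rightarrow> 'n pt \<Rightarrow> 'n pt" where
  "corner_unscale x g = (fst g / fst x, fst (snd g) / (fst x * fst (snd x)), snd (snd g))"

lemma corner_scale_unscale: "x \<in> M \<Longrightarrow> corner_scale x (corner_unscale x g) = g"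
  by (simp add: corner_scale_simp corner_unscale_def M_mem)

lemma corner_scale_diff: "corner_scale x (g - h) = corner_scale x g - corner_scale x h" for x g h :: "'n pt"
  by (simp add: corner_scale_simp algebra_simps)

lemma corner_scale_scaleR: "corner_scale x (c *\<^sub>R g) = c *\<^sub>R corner_scale x g" for x g :: "'n pt"
  by (simp add: corner_scale_simp algebra_simps)

lemma compact_corner_bound:
  assumes K: "compact K" "K \<subseteq> M"
  obtains C where "C \<ge> 0" "\<And>x g. x \<in> K \<Longrightarrow> norm g \<le> C * norm (corner_scale x g)"
proof (cases "K = {}")
  case True
  show thesis by (rule that[of 0]) (use True in auto)
next
  case False
  have "continuous_on K (\<lambda>x::'n pt. min (fst x) (fst (snd x)))" by (intro continuous_intros)
  from continuous_attains_inf[OF K(1) False this] obtain y where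
    y: "y \<in> K" "\<forall>x\<in>K. min (fst y) (fst (snd y)) \<le> min (fst x) (fst (snd x))" by blast
  define a where "a = min (fst y) (fst (snd y))"
  have "y \<in> M" using y(1) K(2) by blast
  then have a: "a > 0" by (simp add: a_def M_mem)
  show thesis
  proof (rule that)
    show "0 \<le> 2 / a + (4 / a\<^sup>2 + 1)" using a by simp
    fix x g assume "x \<in> K"
    then have "a \<le> min (fst x) (fst (snd x))" using y(2) by (simp add: a_def)
    then show "norm g \<le> (2 / a + (4 / a\<^sup>2 + 1)) * norm (corner_scale x g)"
      using a by (intro gradient_le_nabla) auto
  qed
qed

lemma compact_borel: "compact K \<Longrightarrow> K \<in> sets borel" for K :: "'n pt set"
  by (simp add: borel_closed compact_imp_closed)

lemma LpS_Lp_loc: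
  fixes f :: "'n pt \<Rightarrow> 'b::euclidean_space"
  assumes f: "f \<in> LpS \<nu> p"
  shows "f \<in> Lp_loc M p" "f \<in> Lp_loc M 1"
proof -
  have m: "f \<in> borel_measurable (lebesgue_on M)" using f by (simp add: LpS_def measurable_nu)
  show "f \<in> Lp_loc M p"
    using m LpS_lebesgue_on_subset(1)[OF f compact_borel] by (auto simp: Lp_loc_def LpS_def)
  have "integrable (lebesgue_on K) (\<lambda>x. norm (f x))" if "compact K" "K \<subseteq> M" for K
    using LpS_integrable_subset(1)[OF f compact_borel] that by (intro integrable_norm) auto
  then show "f \<in> Lp_loc M 1" using m by (simp add: Lp_loc_def)
qed

lemma unscale_Lp_loc:
  assumes g: "g \<in> Lp_loc M q" and q: "q \<ge> 0"
  shows "(\<lambda>x. corner_unscale x (g x)) \<in> Lp_loc M q"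
proof -
  have gm: "g \<in> borel_measurable (lebesgue_on M)" using g by (simp add: Lp_loc_def)
  have c: "(\<lambda>x::'n pt. fst x) \<in> borel_measurable (lebesgue_on M)" "(\<lambda>x::'n pt. fst (snd x)) \<in> borel_measurable (lebesgue_on M)"
    by (rule lebesgue_on_borelI[OF pt_coord_measurable(1)], rule lebesgue_on_borelI[OF pt_coord_measurable(2)])
  have s: "(\<lambda>x::'n pt. snd (snd x)) \<in> borel_measurable borel" by (intro borel_measurable_continuous_onI continuous_intros)
  note gc = measurable_compose[OF gm pt_coord_measurable(1)] measurable_compose[OF gm pt_coord_measurable(2)] measurable_compose[OF gm s]
  have m: "(\<lambda>x. corner_unscale x (g x)) \<in> borel_measurable (lebesgue_on M)"
    unfolding corner_unscale_def by (intro borel_measurable_Pair borel_measurable_divide borel_measurable_times gc c)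
  have "integrable (lebesgue_on K) (\<lambda>x. norm (corner_unscale x (g x)) powr q)" if K: "compact K" "K \<subseteq> M" for K
  proof -
    obtain C where C: "C \<ge> 0" "\<And>x g. x \<in> K \<Longrightarrow> norm g \<le> C * norm (corner_scale x g)" using compact_corner_bound[OF K] by blast
    have le: "norm (corner_unscale x (g x)) \<le> C * norm (g x)" if "x \<in> K" for x
      using C(2)[OF that, of "corner_unscale x (g x)"] unfolding corner_scale_unscale[OF subsetD[OF K(2) that]] .
    have i: "integrable (lebesgue_on K) (\<lambda>x. norm (g x) powr q)" using g K by (simp add: Lp_loc_def)
    show ?thesis
    proof (rule Bochner_Integration.integrable_bound[OF integrable_mult_right[OF i, of "C powr q"]])
      have "(\<lambda>x. corner_unscale x (g x)) \<in> borel_measurable (lebesgue_on K)" by (rule measurable_restrict_mono[OF m K(2)])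
      then show "(\<lambda>x. norm (corner_unscale x (g x)) powr q) \<in> borel_measurable (lebesgue_on K)" by measurable
      show "AE x in lebesgue_on K. norm (norm (corner_unscale x (g x)) powr q) \<le> norm (C powr q * norm (g x) powr q)"
      proof (rule AE_I2)
        fix x assume "x \<in> space (lebesgue_on K)"
        then have "norm (corner_unscale x (g x)) powr q \<le> (C * norm (g x)) powr q"
          using le q by (intro powr_mono2) auto
        then show "norm (norm (corner_unscale x (g x)) powr q) \<le> norm (C powr q * norm (g x) powr q)"
          using C(1) by (simp add: powr_mult)
      qed
    qed
  qed
  then show ?thesis using m by (simp add: Lp_loc_def)
qed

text \<open>On a compact subset the unscaling is bounded, so convergence of corner gradients in
  \<open>L^p(\<nu>)\<close> implies convergence of ordinary gradients in \<open>L^1\<close> there,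
  and weak gradients are closed under this.\<close>

lemma E_weak_gradient:
  assumes z: "(u, g) \<in> lp.E"
  shows "is_weak_gradient M u (\<lambda>x. corner_unscale x (g x))"
proof (rule is_weak_gradient_closed[OF M_open])
  note L = lp.E_D[OF z]
  show "u \<in> Lp_loc M 1" by (rule LpS_Lp_loc(2)[OF L(1)])
  show "(\<lambda>x. corner_unscale x (g x)) \<in> Lp_loc M 1" by (rule unscale_Lp_loc[OF LpS_Lp_loc(2)[OF L(2)]]) simp
  fix K and e :: real assume K: "compact K" "K \<subseteq> M" and e: "e > 0"
  obtain C where C: "C \<ge> 0" "\<And>x g. x \<in> K \<Longrightarrow> norm g \<le> C * norm (corner_scale x g)" using compact_corner_bound[OF K] by blast
  define k where "k = (measure lborel K powr (p - 1) * \<delta>\<^sup>2) powr (1 / p)"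
  have k: "k \<ge> 0" by (simp add: k_def)
  \<comment> \<open>The added ones keep the denominator positive when \<open>C\<close> or
    \<open>k\<close> is 0.\<close>
  define r where "r = e / (2 * ((C + 1) * (k + 1)))"
  have r: "r > 0" using e C k by (simp add: r_def)
  have "(C + 1) * (k + 1) \<noteq> 0" using C k by simp
  then have r2: "(C + 1) * ((k + 1) * r) = e / 2" unfolding r_def mult.assoc[symmetric] by (simp add: field_simps del: mult_eq_0_iff)
  have kr: "(k + 1) * r \<le> e / 2"
    using mult_right_mono[of 1 "C + 1" "(k + 1) * r"] C k r r2 by simp
  obtain \<phi> where \<phi>: "\<phi> \<in> test_functions M" "Lpn \<nu> p (\<lambda>x. u x - \<phi> x) < r" "Lpn \<nu> p (\<lambda>x. g x - nabla_M_classical \<phi> x) < r"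
    by (rule lp.E_approx[OF z r])
  note Ld = LpS_diff[OF p L(1) test_LpS[OF \<phi>(1)]] LpS_diff[OF p L(2) nabla_LpS[OF \<phi>(1)]]
  note I = LpS_integrable_subset[OF Ld(1) compact_borel[OF K(1)] K(2), folded k_def]
    LpS_integrable_subset[OF Ld(2) compact_borel[OF K(1)] K(2), folded k_def]
  have small: "k * t < e / 2" if "t < r" "0 \<le> t" for t
  proof -
    have "k * t \<le> k * r" using that k by (intro mult_left_mono) auto
    also have "\<dots> < (k + 1) * r" using r by simp
    finally show ?thesis using kr by simp
  qed
  have 1: "(\<integral>x. norm (u x - \<phi> x) \<partial>lebesgue_on K) < e"
    using I(2) small[OF \<phi>(2)] e by simp
  have le: "norm (corner_unscale x (g x) - classical_gradient \<phi> x) \<le> C * norm (g x - nabla_M_classical \<phi> x)" if "x \<in> K" for x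
  proof -
    have "x \<in> M" using that K(2) by blast
    then show ?thesis
      using C(2)[OF that, of "corner_unscale x (g x) - classical_gradient \<phi> x"]
      by (simp add: corner_scale_diff corner_scale_unscale nabla_M_classical_def)
  qed
  have "(\<integral>x. norm (corner_unscale x (g x) - classical_gradient \<phi> x) \<partial>lebesgue_on K) \<le> (\<integral>x. C * norm (g x - nabla_M_classical \<phi> x) \<partial>lebesgue_on K)"
  proof (rule integral_mono')
    show "integrable (lebesgue_on K) (\<lambda>x. C * norm (g x - nabla_M_classical \<phi> x))"
      using integrable_norm[OF I(3)] by simp
  qed (use le C in auto)
  also have "\<dots> = C * (\<integral>x. norm (g x - nabla_M_classical \<phi> x) \<partial>lebesgue_on K)" by simp
  also have "\<dots> \<le> C * (k * Lpn \<nu> p (\<lambda>x. g x - nabla_M_classical \<phi> x))" by (rule mult_left_mono[OF I(4) C(1)])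
  also have "\<dots> \<le> C * (k * r)" using \<phi>(3) C k by (intro mult_left_mono) auto
  also have "\<dots> \<le> (C + 1) * ((k + 1) * r)" using C k r by (intro mult_mono) auto
  also have "\<dots> < e" using r2 e by simp
  finally have 2: "(\<integral>x. norm (corner_unscale x (g x) - classical_gradient \<phi> x) \<partial>lebesgue_on K) < e" .
  show "\<exists>v h. is_weak_gradient M v h \<and> (\<integral>x. norm (u x - v x) \<partial>lebesgue_on K) < e \<and>
      (\<integral>x. norm (corner_unscale x (g x) - h x) \<partial>lebesgue_on K) < e"
    by (rule exI[of _ \<phi>], rule exI[of _ "classical_gradient \<phi>"]) (use test_weak_gradient[OF M_open \<phi>(1)] 1 2 in simp)
qed

text \<open>\<open>weak_gradient\<close> is an arbitrary choice; uniqueness up to null sets ties it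
  to the second component of the pair.\<close>

lemma E_nabla_M:
  assumes z: "(u, g) \<in> lp.E"
  shows "AE x in lebesgue_on M. nabla_M \<delta> X u x = g x" "nabla_M \<delta> X u \<in> LpS \<nu> p"
proof -
  note w = E_weak_gradient[OF z]
  have wg: "is_weak_gradient M u (weak_gradient M u)"
    unfolding weak_gradient_def by (rule someI[of "is_weak_gradient M u", OF w])
  have "AE x in lebesgue_on M. weak_gradient M u x = corner_unscale x (g x)" by (rule weak_gradient_AE[OF M_open w])
  moreover have "AE x in lebesgue_on M. x \<in> M" by (rule AE_I2) simp
  ultimately show ae: "AE x in lebesgue_on M. nabla_M \<delta> X u x = g x"
    by eventually_elim (simp add: nabla_M_def corner_scale_unscale)
  have gm: "weak_gradient M u \<in> borel_measurable (lebesgue_on M)" using is_weak_gradientD(2)[OF wg] by (simp add: Lp_loc_def)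
  have c: "(\<lambda>x::'n pt. fst x) \<in> borel_measurable (lebesgue_on M)" "(\<lambda>x::'n pt. fst (snd x)) \<in> borel_measurable (lebesgue_on M)"
    by (rule lebesgue_on_borelI[OF pt_coord_measurable(1)], rule lebesgue_on_borelI[OF pt_coord_measurable(2)])
  have s: "(\<lambda>x::'n pt. snd (snd x)) \<in> borel_measurable borel" by (intro borel_measurable_continuous_onI continuous_intros)
  note gc = measurable_compose[OF gm pt_coord_measurable(1)] measurable_compose[OF gm pt_coord_measurable(2)] measurable_compose[OF gm s]
  have m: "nabla_M \<delta> X u \<in> borel_measurable (lebesgue_on M)"
    unfolding nabla_M_def[abs_def] corner_scale_simp by (intro borel_measurable_Pair borel_measurable_times gc c)
  show "nabla_M \<delta> X u \<in> LpS \<nu> p"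
  proof (rule LpS_cong_AE[OF lp.E_D(2)[OF z]])
    show "nabla_M \<delta> X u \<in> borel_measurable \<nu>" using m by (simp add: measurable_nu)
    show "AE x in \<nu>. g x = nabla_M \<delta> X u x" unfolding AE_nu using ae by eventually_elim simp
  qed
qed

text \<open>The factor \<open>x1\<close> split off from the integrand is absorbed by the measure,
  turning \<sigma> into \<nu>.\<close>

lemma sigma_M_integral:
  fixes k h :: "'n pt \<Rightarrow> real"
  assumes h: "h \<in> borel_measurable (lebesgue_on M)" and k: "\<And>x. x \<in> M \<Longrightarrow> k x = fst x * h x"
  shows "integrable (sigma_M \<delta> X) k \<longleftrightarrow> integrable \<nu> h" "integral\<^sup>L (sigma_M \<delta> X) k = integral\<^sup>L \<nu> h"
proof -
  define s where "s x = 1 / fst x * corner_wt x" for x :: "'n pt"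
  have seq: "sigma_M \<delta> X = density (lebesgue_on M) (\<lambda>x. ennreal (s x))"
    unfolding sigma_M_def
    by (rule arg_cong[of _ _ "density (lebesgue_on M)"]) (auto simp: s_def corner_wt_def)
  have c: "(\<lambda>x::'n pt. fst x) \<in> borel_measurable (lebesgue_on M)" by (rule lebesgue_on_borelI[OF pt_coord_measurable(1)])
  have sm: "s \<in> borel_measurable (lebesgue_on M)"
    unfolding s_def[abs_def] by (intro borel_measurable_times borel_measurable_divide borel_measurable_const c wt_measurable)
  have s0: "AE x in lebesgue_on M. 0 \<le> s x"
    by (rule AE_I2) (use wt_pos in \<open>auto simp: s_def M_mem intro!: mult_nonneg_nonneg less_imp_le\<close>)
  have km: "k \<in> borel_measurable (lebesgue_on M)"
  proof (subst measurable_cong)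
    show "k x = fst x * h x" if "x \<in> space (lebesgue_on M)" for x using k that by simp
    show "(\<lambda>x. fst x * h x) \<in> borel_measurable (lebesgue_on M)" by (intro borel_measurable_times c h)
  qed
  have eq: "s x * k x = corner_wt x * h x" if "x \<in> space (lebesgue_on M)" for x
    using k[of x] that by (simp add: s_def M_mem)
  have "integrable (sigma_M \<delta> X) k \<longleftrightarrow> integrable (lebesgue_on M) (\<lambda>x. s x * k x)"
    unfolding seq using integrable_density[OF km sm s0] by simp
  also have "\<dots> \<longleftrightarrow> integrable (lebesgue_on M) (\<lambda>x. corner_wt x * h x)"
    by (rule Bochner_Integration.integrable_cong[OF refl eq])
  also have "\<dots> \<longleftrightarrow> integrable \<nu> h" using integrable_nu(1)[OF h] by simp
  finally show "integrable (sigma_M \<delta> X) k \<longleftrightarrow> integrable \<nu> h" .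
  have "integral\<^sup>L (sigma_M \<delta> X) k = (\<integral>x. s x * k x \<partial>lebesgue_on M)"
    unfolding seq using integral_density[OF km sm s0] by simp
  also have "\<dots> = (\<integral>x. corner_wt x * h x \<partial>lebesgue_on M)"
    by (rule Bochner_Integration.integral_cong[OF refl eq])
  also have "\<dots> = integral\<^sup>L \<nu> h" using integrable_nu(2)[OF h] by simp
  finally show "integral\<^sup>L (sigma_M \<delta> X) k = integral\<^sup>L \<nu> h" .
qed

section \<open>Comparison with the weighted Sobolev spaces\<close>

abbreviation "\<gamma>1 \<equiv> (dimN X - 1) / p"
abbreviation "\<gamma>2 \<equiv> dimN X / p"

text \<open>With these indices the exponents of the weight are \<open>1 / p\<close> on
  \<open>x1\<close> and 0 on \<open>x2\<close>, so its \<open>p\<close>-th power is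
  \<open>x1\<close>: the weighted norm is that of \<open>L^p(\<nu>)\<close>.\<close>

lemma weighted_pow_eq:
  assumes "x \<in> M"
  shows "weighted_pow X p \<gamma>1 \<gamma>2 f x = fst x * norm (f x) powr p"
proof -
  obtain x1 x2 x' where x: "x = (x1, x2, x')" by (cases x) auto
  have pos: "x1 > 0" "x2 > 0" using assms by (auto simp: x M_mem)
  have e: "dimN X / p - \<gamma>1 = 1 / p" by (simp add: diff_divide_distrib)
  have "weighted_pow X p \<gamma>1 \<gamma>2 f x = \<bar>x1 powr (1 / p) * f x\<bar> powr p"
    unfolding weighted_pow_def x e using pos by simp
  also have "\<dots> = x1 * norm (f x) powr p" using pos p by (simp add: abs_mult powr_mult powr_powr)
  finally show ?thesis by (simp add: x)
qed

lemma LpS_Lp_M: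
  assumes f: "f \<in> LpS \<nu> p"
  shows "f \<in> Lp_M \<delta> X p \<gamma>1 \<gamma>2" "Lp_M_norm \<delta> X p \<gamma>1 \<gamma>2 f = Lpn \<nu> p f"
proof -
  have fm[measurable]: "f \<in> borel_measurable (lebesgue_on M)" using f by (simp add: LpS_def measurable_nu)
  have m: "(\<lambda>x. norm (f x) powr p) \<in> borel_measurable (lebesgue_on M)" by measurable
  note s = sigma_M_integral[OF m weighted_pow_eq[of _ f]]
  show "f \<in> Lp_M \<delta> X p \<gamma>1 \<gamma>2" using s(1) fm LpS_integrable[OF f] by (simp add: Lp_M_def)
  show "Lp_M_norm \<delta> X p \<gamma>1 \<gamma>2 f = Lpn \<nu> p f" using s(2) by (simp add: Lp_M_norm_def Lpn_def Lpint_def)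
qed

lemma LpS_component:
  fixes f :: "'n pt \<Rightarrow> 'n pt"
  assumes f: "f \<in> LpS \<nu> p" and i: "i \<in> Basis"
  shows "(\<lambda>x. f x \<bullet> i) \<in> LpS \<nu> p" "Lpn \<nu> p (\<lambda>x. f x \<bullet> i) \<le> Lpn \<nu> p f"
proof -
  note [measurable] = LpS_measurable[OF f]
  have le: "norm (f x \<bullet> i) \<le> norm (f x)" for x using Basis_le_norm[OF i, of "f x"] by simp
  have m: "(\<lambda>x. f x \<bullet> i) \<in> borel_measurable \<nu>" by measurable
  show L: "(\<lambda>x. f x \<bullet> i) \<in> LpS \<nu> p"
    by (rule LpS_bound[OF f _ m, of 1]) (use p le in auto)
  have "Lpint \<nu> p (\<lambda>x. f x \<bullet> i) \<le> Lpint \<nu> p f"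
    unfolding Lpint_def using le p
    by (intro integral_mono LpS_integrable[OF L] LpS_integrable[OF f] powr_mono2) auto
  then show "Lpn \<nu> p (\<lambda>x. f x \<bullet> i) \<le> Lpn \<nu> p f"
    using Lpint_le_iff[OF p, of "Lpn \<nu> p f" \<nu> "\<lambda>x. f x \<bullet> i"] by (simp add: Lpn_powr[OF p])
qed

text \<open>The Sobolev norm sums over gradient components, each bounded by the full gradient; this
  costs the factor \<open>(1 + DIM) powr (1 / p)\<close>.\<close>

lemma E_H1_M:
  assumes z: "(u, g) \<in> lp.E"
  shows "u \<in> H1_M \<delta> X p \<gamma>1 \<gamma>2"
    and "0 \<le> r \<Longrightarrow> Lpn \<nu> p u \<le> r \<Longrightarrow> Lpn \<nu> p g \<le> r \<Longrightarrow> H1_M_norm \<delta> X p \<gamma>1 \<gamma>2 u \<le> r * (1 + real DIM('n pt)) powr (1 / p)"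
proof -
  note L = lp.E_D(1)[OF z] and n = E_nabla_M[OF z]
  note c = LpS_component[OF n(2)]
  have "is_weak_gradient M u (\<lambda>x. corner_unscale x (g x))" "(\<lambda>x. corner_unscale x (g x)) \<in> Lp_loc M p"
    using E_weak_gradient[OF z] unscale_Lp_loc[OF LpS_Lp_loc(1)[OF lp.E_D(2)[OF z]]] p by auto
  then have "u \<in> W1p_loc M p" using LpS_Lp_loc(1)[OF L] unfolding W1p_loc_def by blast
  then show "u \<in> H1_M \<delta> X p \<gamma>1 \<gamma>2"
    using LpS_Lp_M(1)[OF L] LpS_Lp_M(1)[OF c(1)] by (simp add: H1_M_def)
  assume r: "0 \<le> r" "Lpn \<nu> p u \<le> r" "Lpn \<nu> p g \<le> r"
  have "Lpint \<nu> p (nabla_M \<delta> X u) = Lpint \<nu> p g"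
    by (rule Lpint_cong_AE[OF LpS_measurable[OF n(2)] LpS_measurable[OF lp.E_D(2)[OF z]]]) (use n(1) in \<open>simp add: AE_nu\<close>)
  then have ng: "Lpn \<nu> p (nabla_M \<delta> X u) \<le> r" using r by (simp add: Lpn_def)
  have "H1_M_norm \<delta> X p \<gamma>1 \<gamma>2 u = (Lpn \<nu> p u powr p + (\<Sum>i\<in>Basis. Lpn \<nu> p (\<lambda>x. nabla_M \<delta> X u x \<bullet> i) powr p)) powr (1 / p)"
    using LpS_Lp_M(2)[OF L] LpS_Lp_M(2)[OF c(1)] by (simp add: H1_M_norm_def)
  also have "\<dots> \<le> (r powr p + (\<Sum>i\<in>(Basis::'n pt set). r powr p)) powr (1 / p)"
  proof (intro powr_mono2 add_mono sum_mono)
    show "Lpn \<nu> p (\<lambda>x. nabla_M \<delta> X u x \<bullet> i) \<le> r" if "i \<in> Basis" for i using c(2)[OF that] ng by linarith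
  qed (use r p in \<open>auto intro!: add_nonneg_nonneg sum_nonneg\<close>)
  also have "r powr p + (\<Sum>i\<in>(Basis::'n pt set). r powr p) = r powr p * (1 + real DIM('n pt))"
    by (simp add: distrib_left mult.commute)
  also have "\<dots> powr (1 / p) = r * (1 + real DIM('n pt)) powr (1 / p)"
    using r(1) p by (simp only: powr_mult powr_powr) simp
  finally show "H1_M_norm \<delta> X p \<gamma>1 \<gamma>2 u \<le> r * (1 + real DIM('n pt)) powr (1 / p)" .
qed

lemma E_H10_M:
  assumes z: "(u, g) \<in> lp.E"
  shows "u \<in> H10_M \<delta> X p \<gamma>1 \<gamma>2"
proof -
  let ?d = "(1 + real DIM('n pt)) powr (1 / p)"
  have d: "?d > 0" by simp
  have "\<exists>\<phi>\<in>test_functions M. H1_M_norm \<delta> X p \<gamma>1 \<gamma>2 (\<lambda>x. u x - \<phi> x) < e" if e: "e > 0" for e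
  proof -
    define r where "r = e / (2 * ?d)"
    have r: "r > 0" "r * ?d = e / 2" using e d by (simp_all add: r_def)
    obtain \<phi> where \<phi>: "\<phi> \<in> test_functions M" "Lpn \<nu> p (\<lambda>x. u x - \<phi> x) < r" "Lpn \<nu> p (\<lambda>x. g x - nabla_M_classical \<phi> x) < r"
      by (rule lp.E_approx[OF z r(1)])
    have "H1_M_norm \<delta> X p \<gamma>1 \<gamma>2 (\<lambda>x. u x - \<phi> x) \<le> r * ?d"
      using r \<phi> by (intro E_H1_M(2)[OF lp.E_diff[OF z lp.V_in_E[OF \<phi>(1)]]]) auto
    then show ?thesis using r e \<phi>(1) by (intro bexI[of _ \<phi>]) auto
  qed
  then show ?thesis using E_H1_M(1)[OF z] by (simp add: H10_M_def)
qed

lemma E_weak_eigensolution: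
  assumes z: "(u, g) \<in> lp.E" and eig: "\<And>\<phi>. \<phi> \<in> test_functions M \<Longrightarrow> lp.A g (nabla_M_classical \<phi>) = lam * lp.B u \<phi>"
  shows "weak_eigensolution \<delta> X p u lam"
  unfolding weak_eigensolution_def
proof
  fix \<phi> assume \<phi>: "\<phi> \<in> test_functions M"
  let ?D = "nabla_M_classical \<phi>" and ?n = "nabla_M \<delta> X u"
  note n = E_nabla_M[OF z]
  have um[measurable]: "u \<in> borel_measurable (lebesgue_on M)" using lp.E_D(1)[OF z] by (simp add: LpS_def measurable_nu)
  have pm[measurable]: "\<phi> \<in> borel_measurable (lebesgue_on M)" using test_LpS[OF \<phi>] by (simp add: LpS_def measurable_nu)
  have nm[measurable]: "?n \<in> borel_measurable (lebesgue_on M)" using n(2) by (simp add: LpS_def measurable_nu)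
  have dm[measurable]: "?D \<in> borel_measurable (lebesgue_on M)" using nabla_LpS[OF \<phi>] by (simp add: LpS_def measurable_nu)
  have m1: "(\<lambda>x. dual_vec p (?n x) \<bullet> ?D x) \<in> borel_measurable (lebesgue_on M)" unfolding dual_vec_def by measurable
  have m2: "(\<lambda>x. dual_vec p (u x) \<bullet> \<phi> x) \<in> borel_measurable (lebesgue_on M)" unfolding dual_vec_def by measurable
  have m3: "(\<lambda>x. (fst x * fst (snd x)) powr p * (dual_vec p (u x) \<bullet> \<phi> x)) \<in> borel_measurable (lebesgue_on M)"
    by (intro borel_measurable_times scale_measurable m2)
  have "(\<integral>x. fst x * norm (?n x) powr (p - 2) * (?n x \<bullet> ?D x) \<partial>sigma_M \<delta> X) = lp.A ?n ?D"
    unfolding lp.A_def by (rule sigma_M_integral(2)[OF m1]) (simp add: dual_vec_def)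
  also have "\<dots> = lp.A g ?D"
    by (rule lp.A_cong_AE[OF n(2) lp.E_D(2)[OF z] nabla_LpS[OF \<phi>]]) (use n(1) in \<open>simp add: AE_nu\<close>)
  also have "\<dots> = lam * lp.B u \<phi>" by (rule eig[OF \<phi>])
  also have "lp.B u \<phi> = (\<integral>x. (fst x * fst (snd x)) powr p * (dual_vec p (u x) \<bullet> \<phi> x) \<partial>\<nu>)"
    unfolding lp.B_def by (rule integrable_mu(2)[OF m2])
  also have "\<dots> = (\<integral>x. fst x * (fst x * fst (snd x)) powr p * \<bar>u x\<bar> powr (p - 2) * u x * \<phi> x \<partial>sigma_M \<delta> X)"
    by (rule sigma_M_integral(2)[OF m3, symmetric]) (simp add: dual_vec_def mult.assoc)
  finally show "(\<integral>x. fst x * norm (?n x) powr (p - 2) * (?n x \<bullet> ?D x) \<partial>sigma_M \<delta> X) =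
     lam * (\<integral>x. fst x * (fst x * fst (snd x)) powr p * \<bar>u x\<bar> powr (p - 2) * u x * \<phi> x \<partial>sigma_M \<delta> X)" .
qed

text \<open>The abstract comparison of eigenvalues asks for proportional gradients as well;
  uniqueness of weak gradients supplies them.\<close>

lemma E_proportional_gradients:
  assumes z: "(u, g) \<in> lp.E" "(v, h) \<in> lp.E" and pr: "AE x in lebesgue_on M. u x = c * v x"
  shows "AE x in lebesgue_on M. g x = c *\<^sub>R h x"
proof -
  note w = E_weak_gradient[OF z(1)] E_weak_gradient[OF z(2)]
  have "is_weak_gradient M (\<lambda>x. c * v x) (\<lambda>x. c *\<^sub>R corner_unscale x (h x))"
    using is_weak_gradient_lincomb[OF M_open w(2) w(2), of c 0] by simp
  from is_weak_gradient_cong_AE[OF this is_weak_gradientD(1)[OF w(1)] pr]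
  have "is_weak_gradient M u (\<lambda>x. c *\<^sub>R corner_unscale x (h x))" .
  from weak_gradient_unique[OF M_open w(1) this]
  have "AE x in lebesgue_on M. corner_unscale x (g x) = c *\<^sub>R corner_unscale x (h x)" .
  moreover have "AE x in lebesgue_on M. x \<in> M" by (rule AE_I2) simp
  ultimately show ?thesis
  proof eventually_elim
    case (elim x)
    from elim(1) have "corner_scale x (corner_unscale x (g x)) = corner_scale x (c *\<^sub>R corner_unscale x (h x))" by simp
    then show ?case unfolding corner_scale_scaleR corner_scale_unscale[OF elim(2)] .
  qed
qed

theorem infinitely_many_eigensolutions:
  "\<exists>(u :: nat \<Rightarrow> 'n pt \<Rightarrow> real) (lam :: nat \<Rightarrow> real).
    (\<forall>k. u k \<in> H10_M \<delta> X p \<gamma>1 \<gamma>2 \<and> lam k > 0 \<and>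
         \<not> (AE x in lebesgue_on M. u k x = 0) \<and> weak_eigensolution \<delta> X p (u k) (lam k)) \<and>
    (\<forall>j k. j \<noteq> k \<longrightarrow> \<not> (\<exists>c::real. AE x in lebesgue_on M. u j x = c * u k x))"
proof -
  define P where "P w \<longleftrightarrow> (case w of (u, g, lam) \<Rightarrow> (u, g) \<in> lp.E \<and> Lpn \<mu> p u > 0 \<and> lam > 0 \<and>
      (\<forall>\<phi>\<in>test_functions M. lp.A g (nabla_M_classical \<phi>) = lam * lp.B u \<phi>))"
    for w :: "('n pt \<Rightarrow> real) \<times> ('n pt \<Rightarrow> 'n pt) \<times> real"
  \<comment> \<open>The bound \<open>1 / \<epsilon>\<close> with
    \<open>\<epsilon> = 1 / (s + 1)\<close> yields an eigenvalue above \<open>s\<close>; iterating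
    makes the eigenvalues strictly increasing, hence distinct.\<close>
  have ex: "\<exists>w. P w \<and> snd (snd w) > s" if s: "s \<ge> 0" for s
  proof -
    have "1 / (s + 1) > 0" using s by simp
    from lp.eigenpairs[OF this] obtain u g lam where
      w: "(u, g) \<in> lp.E" "Lpn \<mu> p u > 0" "1 / (1 / (s + 1)) \<le> lam" "\<forall>\<phi>\<in>test_functions M. lp.A g (nabla_M_classical \<phi>) = lam * lp.B u \<phi>"
      by (elim exE conjE)
    have "lam \<ge> s + 1" using w(3) by simp
    then have "lam > s" "lam > 0" using s by auto
    then show ?thesis using w by (intro exI[of _ "(u, g, lam)"]) (simp add: P_def)
  qed
  have "\<exists>f. \<forall>k. P (f k) \<and> snd (snd (f (Suc k))) > snd (snd (f k))"
  proof (rule dependent_nat_choice)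
    show "\<exists>w. P w" using ex[of 0] by (auto simp del: split_paired_Ex)
    show "\<exists>y. P y \<and> snd (snd y) > snd (snd x)" if "P x" for x k
      using that by (intro ex) (auto simp: P_def split: prod.splits)
  qed
  then obtain f where f: "\<forall>k. P (f k) \<and> snd (snd (f (Suc k))) > snd (snd (f k))" ..
  define u where "u k = fst (f k)" for k
  define g where "g k = fst (snd (f k))" for k
  define lam where "lam k = snd (snd (f k))" for k
  have P: "(u k, g k) \<in> lp.E" "Lpn \<mu> p (u k) > 0" "lam k > 0"
    "\<And>\<phi>. \<phi> \<in> test_functions M \<Longrightarrow> lp.A (g k) (nabla_M_classical \<phi>) = lam k * lp.B (u k) \<phi>" for k
    using f[rule_format, of k] by (auto simp: P_def u_def g_def lam_def split: prod.splits)
  have "strict_mono lam" using f by (auto simp: strict_mono_Suc_iff lam_def)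
  then have inj: "lam j \<noteq> lam k" if "j \<noteq> k" for j k using that by (simp add: strict_mono_eq)
  have nz: "\<not> (AE x in lebesgue_on M. u k x = 0)" for k
    using Lpn_eq_0_iff[OF p lp.E_D(3)[OF P(1)[of k]]] P(2)[of k] by (simp add: AE_mu)
  have np: "\<not> (\<exists>c::real. AE x in lebesgue_on M. u j x = c * u k x)" if "j \<noteq> k" for j k
  proof
    assume "\<exists>c::real. AE x in lebesgue_on M. u j x = c * u k x"
    then obtain c where c: "AE x in lebesgue_on M. u j x = c * u k x" ..
    have "lam j = lam k"
      using lp.eigenpairs_proportional[OF P(1)[of j] P(1)[of k] P(4)[of _ j] P(4)[of _ k] P(2)[of j], of c]
        c E_proportional_gradients[OF P(1)[of j] P(1)[of k] c] by (simp add: AE_mu AE_nu)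
    then show False using inj[OF that] by simp
  qed
  show ?thesis
    by (rule exI[of _ u], rule exI[of _ lam])
      (use E_H10_M[OF P(1)] P(3) nz np E_weak_eigensolution[OF P(1) P(4)] in simp)
qed

end

theorem theorem1p3:
  fixes X :: "(real ^ 'n::finite) set" and \<delta> p :: real
  assumes "\<delta> > 0"
    and "open X" and "bounded X" and "X \<noteq> {}"
    and "2 < p" and "p < dimN X"
  shows "\<exists>(u :: nat \<Rightarrow> 'n pt \<Rightarrow> real) (lam :: nat \<Rightarrow> real).
    (\<forall>k. u k \<in> H10_M \<delta> X p ((dimN X - 1) / p) (dimN X / p) \<and>
         lam k > 0 \<and>
         \<not> (AE x in lebesgue_on (MM \<delta> X). u k x = 0) \<and>
         weak_eigensolution \<delta> X p (u k) (lam k)) \<and>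
    (\<forall>j k. j \<noteq> k \<longrightarrow>
         \<not> (\<exists>c::real. AE x in lebesgue_on (MM \<delta> X). u j x = c * u k x))"
proof -
  interpret corner_domain \<delta> p X by standard (use assms in auto)
  show ?thesis by (rule infinitely_many_eigensolutions)
qed

end
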